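(* Consider the planar $13$-body problem and the two-parameter family of rosette central configurations $w:(0,\infty)^2\to\Omega$ with masses $m(m_0,m_1)$, and the associated $SO(2)$-invariant potential $\varphi(q,(m_0,m_1))=U(q,m(m_0,m_1))+\lambda(m_0,m_1)I(q,m(m_0,m_1))$, together with the polynomials $C_1,C_2,C_3$ appearing in the factorization of the coefficient $a_{25}$ of the characteristic polynomial of the Hessian along $w$, all as defined in the context. Let $(m_0,m_1)\in(0,\infty)^2$. Then: (1) for any $i\in\{1,2,3\}$, if $C_i(m_0,m_1)=0$, then $(m_0,m_1)\in\mathcal{BIF}$; (2) if $C_2(m_0,m_1)=0$, then $(m_0,m_1)\in\mathcal{GLOB}$.
   Context: $\Omega=\{q=(q_1,\dots,q_{13})\in(\mathbb{R}^2)^{13}:q_i\neq q_j\text{ for }i\neq j\}$, with $SO(2)$ acting diagonally. For masses $\mu\in(0,\infty)^{13}$: $U(q,\mu)=\sum_{i<j}\frac{\mu_i\mu_j}{|q_i-q_j|}$, $I(q,\mu)=\frac12\sum_j\mu_j|q_j|^2$. Family. Let $\Phi(s)$ be the rotation of $\mathbb{R}^2$ by angle $s$. Put $\hat q_{k+1}=\Phi(\frac{2\pi}{6}k)(\cos\frac\pi3,0)$, $\hat q_{7+k}=\Phi(\frac\pi6+\frac{2\pi}6k)(\sin\frac\pi3,0)$ for $k=0,\dots,5$, $\hat q_{13}=(0,0)$, and $w(m_0,m_1)=(\hat q_1,\dots,\hat q_{13})$ for all $(m_0,m_1)\in(0,\infty)^2$ (a constant map). Let $$m_2(m_0,m_1)=\frac{-7644\,m_0+6(81\sqrt7-441\sqrt3+9\sqrt3\sqrt7-147)\,m_1}{-1862\sqrt3-7203+810\sqrt7+90\sqrt7\sqrt3}$$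 and $m(m_0,m_1)=(m_1,\dots,m_1,m_2(m_0,m_1),\dots,m_2(m_0,m_1),m_0)$ (six entries $m_1$, six entries $m_2(m_0,m_1)$, one entry $m_0$); with these masses $w(m_0,m_1)$ is a central configuration. Let $\lambda(m_0,m_1)=\frac{U(w,m(m_0,m_1))}{2I(w,m(m_0,m_1))}$. Then $\nabla_q\varphi(w(m_0,m_1),(m_0,m_1))=0$ for all $(m_0,m_1)$. Polynomials. Write the characteristic polynomial of the $26\times26$ matrix $\nabla_q^2\varphi(w(m_0,m_1),(m_0,m_1))$ as $x^{26}-a_1x^{25}+\cdots-a_{25}x+a_{26}$ with $a_i=a_i(m_0,m_1)$. Here $a_{26}=0$ and $a_{25}=C\,C_1^2\,C_2\,C_3^2$, where $C$ has no zeros in $(0,\infty)^2$ and $C_1,C_2,C_3$ are the polynomials in $(m_0,m_1)$ collecting the factors of $a_{25}$ that vanish on curves in $(0,\infty)^2$: $C_2$ is the factor of multiplicity one, and $C_1,C_3$ are the factors of multiplicity two. Across the zero curve of $C_2$ the Morse index (number of negative eigenvalues) of $\nabla_q^2\varphi$ along $w$ changes between $3$ and $2$. Bifurcation. For a one-parameter family obtained by restricting the parameters to a straight segment $\rho\mapsto\sigma(\rho)\in(0,\infty)^2$ (nonconstant affine, $\rho$ in an open interval $J$), let $\varphi_\sigma(q,\rho)=\varphi(q,\sigma(\rho))$, $\mathcal{F}_X=\bigcup_{\rho\in X}SO(2)(w(\sigma(\rho)))\times\{\rho\}$ for $X\subset J$, $\mathcal{F}=\mathcal{F}_J$, $\mathcal{N}=\{(q,\rho)\in(\Omega\times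 J)\setminus\mathcal{F}:\nabla_q\varphi_\sigma(q,\rho)=0\}$. A parameter $\rho_0\in J$ is one of local bifurcation if $(w(\sigma(\rho_0)),\rho_0)$ is an accumulation point of $\mathcal{N}$. It is one of global bifurcation, relative to a segment $[\rho^-,\rho^+]\subset J$ with $\rho^-<\rho_0<\rho^+$ and $\rho^\pm$ not parameters of local bifurcation, if the connected component $C(\rho_0)$ of $\mathrm{cl}(\mathcal{N})\cup\mathcal{F}_{\{\rho_0\}}$ (closure in $\Omega\times J$) containing $\mathcal{F}_{\{\rho_0\}}$ is not compact or $(C(\rho_0)\setminus\mathcal{F}_{[\rho^-,\rho^+]})\cap\mathcal{F}\neq\emptyset$. A point $p\in(0,\infty)^2$ belongs to $\mathcal{BIF}$ (resp. $\mathcal{GLOB}$) if $p=\sigma(\rho_0)$ for some such $\sigma$ and some parameter $\rho_0$ of local (resp. global) bifurcation of the restricted family. *)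

theory Defs
  imports "HOL-Analysis.Analysis"
    "HOL-Computational_Algebra.Squarefree"
    "Jordan_Normal_Form.Char_Poly"
begin

no_notation vec_index (infixl \<open>$\<close> 100)

section \<open>The planar 13-body problem\<close>

(* The bodies 1, ..., 13 are the elements of the numeral type 13, in which 13 = 0; the library
   function vector fills the components 1, 2, ..., 13 in this order. *)
type_synonym config = "(real ^ 2) ^ 13"

definition Omega :: "config set" where
  "Omega = {q. \<forall>i j. i \<noteq> j \<longrightarrow> q $ i \<noteq> q $ j}"

definition newton_U :: "config \<Rightarrow> real ^ 13 \<Rightarrow> real" where
  "newton_U q \<mu> = (\<Sum>(i, j) \<in> {(i, j). i < j}. \<mu> $ i * \<mu> $ j / norm (q $ i - q $ j))"

definition inertia :: "config \<Rightarrow> real ^ 13 \<Rightarrow> real" where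
  "inertia q \<mu> = (1 / 2) * (\<Sum>j\<in>UNIV. \<mu> $ j * (norm (q $ j))\<^sup>2)"

definition SO2_orbit :: "config \<Rightarrow> config set" where
  "SO2_orbit q = {(\<chi> j. A *v (q $ j)) | A :: real ^ 2 ^ 2. rotation_matrix A}"

section \<open>The rosette family\<close>

(* A parameter is a pair p = (m0, m1). *)
definition quadrant :: "(real \<times> real) set" where
  "quadrant = {0<..} \<times> {0<..}"

definition Phi :: "real \<Rightarrow> real ^ 2 ^ 2" where
  "Phi s = vector [vector [cos s, - sin s], vector [sin s, cos s]]"

definition rosette :: "real \<times> real \<Rightarrow> config" where
  "rosette p = vector
     (map (\<lambda>k. Phi (2 * pi / 6 * real k) *v vector [cos (pi / 3), 0]) [0..<6] @
      map (\<lambda>k. Phi (pi / 6 + 2 * pi / 6 * real k) *v vector [sin (pi / 3), 0]) [0..<6] @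
      [0])"

definition m2 :: "real \<times> real \<Rightarrow> real" where
  "m2 = (\<lambda>(m0, m1).
     (- 7644 * m0 + 6 * (81 * sqrt 7 - 441 * sqrt 3 + 9 * sqrt 3 * sqrt 7 - 147) * m1) /
     (- 1862 * sqrt 3 - 7203 + 810 * sqrt 7 + 90 * sqrt 7 * sqrt 3))"

definition rosette_mass :: "real \<times> real \<Rightarrow> real ^ 13" where
  "rosette_mass p = vector (replicate 6 (snd p) @ replicate 6 (m2 p) @ [fst p])"

definition lam :: "real \<times> real \<Rightarrow> real" where
  "lam p = newton_U (rosette p) (rosette_mass p) / (2 * inertia (rosette p) (rosette_mass p))"

definition phi :: "config \<Rightarrow> real \<times> real \<Rightarrow> real" where
  "phi q p = newton_U q (rosette_mass p) + lam p * inertia q (rosette_mass p)"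

section \<open>Gradient, Hessian and its characteristic polynomial\<close>

definition grad :: "('a::real_inner \<Rightarrow> real) \<Rightarrow> 'a \<Rightarrow> 'a" where
  "grad f x = (THE D. GDERIV f x :> D)"

(* The 26 standard unit vectors: k = 2 j + c with j < 13 and c < 2 belongs to body j and
   component c (taken in the types 13 and 2). *)
definition unit_config :: "nat \<Rightarrow> config" where
  "unit_config k = axis (of_nat (k div 2)) (axis (of_nat (k mod 2)) 1)"

definition hessian :: "(config \<Rightarrow> real) \<Rightarrow> config \<Rightarrow> real mat" where
  "hessian f q = Matrix.mat 26 26 (\<lambda>(i, j).
     inner (unit_config i) (frechet_derivative (grad f) (at q) (unit_config j)))"

(* char_poly = x^26 - a_1 x^25 + a_2 x^24 - ... - a_25 x + a_26 with a_i = cp_coeff i *)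
definition cp_coeff :: "nat \<Rightarrow> real \<times> real \<Rightarrow> real" where
  "cp_coeff i p = (- 1) ^ i * coeff (char_poly (hessian (\<lambda>q. phi q p) (rosette p))) (26 - i)"

(* Polynomials in (m0, m1) are elements of R[m0][m1]. *)
definition bipoly :: "real poly poly \<Rightarrow> real \<times> real \<Rightarrow> real" where
  "bipoly F = (\<lambda>(m0, m1). poly (poly F [:m1:]) m0)"

(* C0 is the cofactor without zeros (so every factor of a_25 that vanishes in the quadrant
   divides one of C 1, C 2, C 3), and squarefreeness says that the factors collected in C 2 have
   multiplicity exactly one in a_25, and those collected in C 1 and C 3 multiplicity two.
   Constant multiples, and the way the double factors are distributed over C 1 and C 3, are
   left free. *)
definition a25_factorization :: "real poly poly \<Rightarrow> (nat \<Rightarrow> real poly poly) \<Rightarrow> bool" where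
  "a25_factorization C0 C \<longleftrightarrow>
     (\<forall>p\<in>quadrant. cp_coeff 25 p =
        bipoly C0 p * (bipoly (C 1) p)\<^sup>2 * bipoly (C 2) p * (bipoly (C 3) p)\<^sup>2) \<and>
     (\<forall>p\<in>quadrant. bipoly C0 p \<noteq> 0) \<and>
     squarefree (C 1 * C 2 * C 3)"

section \<open>Bifurcation along segments\<close>

definition segment_family :: "(real \<Rightarrow> real \<times> real) \<Rightarrow> real set \<Rightarrow> bool" where
  "segment_family \<sigma> J \<longleftrightarrow>
     open J \<and> is_interval J \<and> (\<exists>b d. d \<noteq> 0 \<and> (\<forall>\<rho>. \<sigma> \<rho> = b + \<rho> *\<^sub>R d)) \<and> \<sigma> ` J \<subseteq> quadrant"

definition trivial_set :: "(real \<Rightarrow> real \<times> real) \<Rightarrow> real set \<Rightarrow> (config \<times> real) set" where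
  "trivial_set \<sigma> X = (\<Union>\<rho>\<in>X. SO2_orbit (rosette (\<sigma> \<rho>)) \<times> {\<rho>})"

definition nontrivial_set :: "(real \<Rightarrow> real \<times> real) \<Rightarrow> real set \<Rightarrow> (config \<times> real) set" where
  "nontrivial_set \<sigma> J =
     {(q, \<rho>). (q, \<rho>) \<in> (Omega \<times> J) - trivial_set \<sigma> J \<and> grad (\<lambda>q. phi q (\<sigma> \<rho>)) q = 0}"

definition local_bif :: "(real \<Rightarrow> real \<times> real) \<Rightarrow> real set \<Rightarrow> real \<Rightarrow> bool" where
  "local_bif \<sigma> J \<rho>0 \<longleftrightarrow> \<rho>0 \<in> J \<and> (rosette (\<sigma> \<rho>0), \<rho>0) islimpt nontrivial_set \<sigma> J"

definition global_bif ::
  "(real \<Rightarrow> real \<times> real) \<Rightarrow> real set \<Rightarrow> real \<Rightarrow> real \<Rightarrow> real \<Rightarrow> bool" where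
  "global_bif \<sigma> J \<rho>1 \<rho>2 \<rho>0 \<longleftrightarrow>
     \<rho>1 < \<rho>0 \<and> \<rho>0 < \<rho>2 \<and> {\<rho>1..\<rho>2} \<subseteq> J \<and> \<not> local_bif \<sigma> J \<rho>1 \<and> \<not> local_bif \<sigma> J \<rho>2 \<and>
     (\<exists>K \<in> components
            (closure (nontrivial_set \<sigma> J) \<inter> (Omega \<times> J) \<union> trivial_set \<sigma> {\<rho>0}).
        trivial_set \<sigma> {\<rho>0} \<subseteq> K \<and>
        (\<not> compact K \<or> (K - trivial_set \<sigma> {\<rho>1..\<rho>2}) \<inter> trivial_set \<sigma> J \<noteq> {}))"

definition BIF :: "(real \<times> real) set" where
  "BIF = {p \<in> quadrant. \<exists>\<sigma> J \<rho>0. segment_family \<sigma> J \<and> p = \<sigma> \<rho>0 \<and> local_bif \<sigma> J \<rho>0}"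

definition GLOB :: "(real \<times> real) set" where
  "GLOB = {p \<in> quadrant. \<exists>\<sigma> J \<rho>0 \<rho>1 \<rho>2.
     segment_family \<sigma> J \<and> p = \<sigma> \<rho>0 \<and> global_bif \<sigma> J \<rho>1 \<rho>2 \<rho>0}"

end

theory Submission
  imports Defs "HOL-Real_Asymp.Real_Asymp"
begin

text \<open>The Hessian along the family commutes with the symmetries of the rosette. In an adapted basis
  \<open>a\<^sub>2\<^sub>5\<close> is a factor without zeros times \<open>b1_det\<close> times the square of \<open>free_det\<close>: the former comes from a
  \<open>2 \<times> 2\<close> block of displacements invariant under the rotation by \<open>2\<pi>/3\<close> and a reflection, the latter from
  the two-dimensional irreducible representations. Everything is homogeneous in \<open>(m\<^sub>0, m\<^sub>1)\<close>, so the zero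
  set is a union of rays, and squarefreeness of \<open>C\<^sub>1 C\<^sub>2 C\<^sub>3\<close> makes \<open>b1_det\<close> or \<open>free_det\<close> vanish to first
  order on the ray under consideration; on the zeros of \<open>C\<^sub>2\<close> it is \<open>b1_det\<close>.

  Restricting to reflection symmetric configurations removes the rotational degeneracy and leaves a
  one-dimensional kernel that is crossed transversally when \<open>m\<^sub>0\<close> varies, so a branch bifurcates from
  the trivial one. On the zeros of \<open>C\<^sub>2\<close> the expansion of the force to third order along the kernel shows
  that \<open>m\<^sub>0\<close> is not constant along the branch. Hence on a sufficiently short segment the branch runs into
  the end of the parameter interval, and its component is not compact.\<close>

section \<open>Bifurcation at a simple zero\<close>

text \<open>The polynomials \<open>C i\<close> are known only through
  \<open>a25_factorization\<close> and are not assumed homogeneous, and the determinant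
  \<open>free_det\<close> is never evaluated. Only its order of vanishing along a ray is used. It is
  found by counting: \<open>free_det\<close> enters \<open>a_25\<close> squared, so an odd order can
  only come from \<open>b1_det\<close>, whose single zero ray is simple. The gradient of
  \<open>phi\<close> is divided by the masses. What remains is a force that depends linearly on
  \<open>(m0, m1)\<close> once \<open>lam\<close> is replaced by the linear form
  \<open>lamf\<close>, so a shift of \<open>m0\<close> adds a multiple of one fixed field and the
  problem reads A + \<tau> B = 0 with A and B vanishing at the rosette. The price is a derivative
  that is self-adjoint only for the mass-weighted inner product. By homogeneity the zero ray of
  \<open>b1_det\<close> is one ratio \<open>m0/m1\<close>, enclosed between 1.787 and 1.7875; the
  bounds there are interval arithmetic over sqrt 3 and sqrt 7, the only roots among the mutual
  distances. The parameter interval in the global statement is chosen after the branch: its end is a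
  value that \<tau> attains.\<close>

definition strict_deriv :: "('a::real_normed_vector \<Rightarrow> 'b::real_normed_vector) \<Rightarrow> ('a \<Rightarrow> 'b) \<Rightarrow> 'a \<Rightarrow> bool"
  where "strict_deriv f f' w \<longleftrightarrow> linear f' \<and>
    (\<forall>\<epsilon>>0. \<exists>\<delta>>0. \<forall>x\<in>ball w \<delta>. \<forall>y\<in>ball w \<delta>. norm (f x - f y - f' (x - y)) \<le> \<epsilon> * norm (x - y))"

lemma strict_derivD:
  assumes "strict_deriv f f' w" "\<epsilon> > 0"
  obtains \<delta> where "\<delta> > 0" "\<And>x y. x \<in> ball w \<delta> \<Longrightarrow> y \<in> ball w \<delta> \<Longrightarrow>
    norm (f x - f y - f' (x - y)) \<le> \<epsilon> * norm (x - y)"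
  using assms unfolding strict_deriv_def by metis

lemma orthogonal_projection_exists:
  fixes V :: "'a::euclidean_space set"
  assumes "subspace V"
  obtains P where "linear P" "\<And>x. P x \<in> V" "\<And>x y. y \<in> V \<Longrightarrow> inner (x - P x) y = 0"
    "\<And>x. x \<in> V \<Longrightarrow> P x = x"
proof -
  obtain B where B: "B \<subseteq> V" "pairwise real_inner_class.orthogonal B" "\<And>x. x \<in> B \<Longrightarrow> norm x = 1"
      "independent B" "span B = V"
    using orthonormal_basis_subspace[OF assms] by metis
  have fin: "finite B" using B(4) independent_imp_finite by blast
  define P where "P x = (\<Sum>b\<in>B. inner x b *\<^sub>R b)" for x
  have lin: "linear P"
    unfolding P_def by (rule linearI)
      (simp_all add: inner_add_left scaleR_add_left sum.distrib scaleR_right.sum)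
  have inV: "P x \<in> V" for x
    unfolding P_def using B(1) assms by (intro subspace_sum) (auto intro: subspace_scale)
  have orthB: "inner (x - P x) b = 0" if "b \<in> B" for x b
  proof -
    have "inner (P x) b = (\<Sum>c\<in>B. inner x c * inner c b)"
      unfolding P_def by (simp add: inner_sum_left)
    also have "\<dots> = (\<Sum>c\<in>B. if c = b then inner x b else 0)"
    proof (rule sum.cong)
      fix c assume c: "c \<in> B"
      show "inner x c * inner c b = (if c = b then inner x b else 0)"
      proof (cases "c = b")
        case True
        then show ?thesis using B(3)[OF c] by (simp add: dot_square_norm)
      next
        case False
        then have "inner c b = 0" using B(2) c that by (auto simp: pairwise_def real_inner_class.orthogonal_def)
        then show ?thesis using False by simp
      qed
    qed simp
    also have "\<dots> = inner x b" using fin that by simp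
    finally show ?thesis by (simp add: inner_diff_left)
  qed
  have orth: "inner (x - P x) y = 0" if "y \<in> V" for x y
  proof -
    have "y \<in> span B" using that B(5) by simp
    moreover have "real_inner_class.orthogonal (x - P x) b" if "b \<in> B" for b
      using orthB[OF that] by (simp add: real_inner_class.orthogonal_def)
    ultimately have "real_inner_class.orthogonal (x - P x) y" using orthogonal_to_span by blast
    then show ?thesis by (simp add: real_inner_class.orthogonal_def)
  qed
  have "P x = x" if "x \<in> V" for x
  proof -
    have "x - P x \<in> V" using that inV assms by (simp add: subspace_diff)
    then have "inner (x - P x) (x - P x) = 0" by (rule orth)
    then show ?thesis by simp
  qed
  with lin inV orth show thesis using that by blast
qed

text \<open>Dividing the equation at \<open>w + x (e + \<eta>)\<close> by \<open>x\<close> makes it uniformly close, for small \<open>x\<close>, to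
  its linearization in \<open>(\<eta>, t)\<close>, which is invertible; the solutions are then fixed points of
  contractions depending continuously on \<open>x\<close>.\<close>

theorem bifurcation_from_simple_zero:
  fixes A B :: "'a::euclidean_space \<Rightarrow> 'a"
  assumes A: "strict_deriv A A' w" and B: "strict_deriv B B' w"
    and Aw: "A w = 0" and Bw: "B w = 0"
    and V: "subspace V" and eV: "e \<in> V" and e0: "A' e = 0"
    and AV: "\<And>v. v \<in> V \<Longrightarrow> A (w + v) \<in> V" and BV: "\<And>v. v \<in> V \<Longrightarrow> B (w + v) \<in> V"
    and AV': "\<And>v. v \<in> V \<Longrightarrow> A' v \<in> V" and BV': "\<And>v. v \<in> V \<Longrightarrow> B' v \<in> V"
    and inj: "\<And>\<eta> s. \<eta> \<in> V \<Longrightarrow> inner e \<eta> = 0 \<Longrightarrow> A' \<eta> + s *\<^sub>R B' e = 0 \<Longrightarrow> \<eta> = 0 \<and> s = 0"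
  obtains a :: real and h \<tau> where "a > 0" "continuous_on {0..a} h" "continuous_on {0..a} \<tau>"
    "h 0 = 0" "\<tau> 0 = (0::real)"
    "\<And>x. x \<in> {0..a} \<Longrightarrow> h x \<in> V \<and> inner e (h x) = 0 \<and>
       A (w + x *\<^sub>R (e + h x)) + \<tau> x *\<^sub>R B (w + x *\<^sub>R (e + h x)) = 0"
proof -
  obtain P where P: "linear P" and PV: "\<And>x. P x \<in> V" and Porth: "\<And>x y. y \<in> V \<Longrightarrow> inner (x - P x) y = 0"
    and Pid: "\<And>x. x \<in> V \<Longrightarrow> P x = x"
    using orthogonal_projection_exists[OF V] by metis
  have lA: "linear A'" and lB: "linear B'" using A B by (auto simp: strict_deriv_def)
  \<comment> \<open>The linearization in \<open>(\<eta>, t)\<close>, extended by the identity on the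
    orthogonal complement of V. It then maps the whole product space to itself, so injectivity
    already gives an inverse.\<close>
  define T where "T y = (A' (P (fst y)) + snd y *\<^sub>R B' e + (fst y - P (fst y)), inner e (fst y))" for y
  have linT: "linear T"
    unfolding T_def
    by (rule linearI) (simp_all add: linear_add[OF lA] linear_add[OF P] linear_scale[OF lA]
        linear_scale[OF P] algebra_simps)
  have split0: "u = 0 \<and> v - P v = 0" if "u \<in> V" "u + (v - P v) = 0" for u v
  proof -
    have "inner (v - P v) u = 0" using that Porth by blast
    moreover have "v - P v = - u" using that(2) by (simp add: eq_neg_iff_add_eq_0 add.commute)
    ultimately have "inner u u = 0" by simp
    then show ?thesis using that by simp
  qed
  have T0: "y = 0" if "T y = 0" for y
  proof -
    have 1: "A' (P (fst y)) + snd y *\<^sub>R B' e + (fst y - P (fst y)) = 0" and 2: "inner e (fst y) = 0"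
      using that by (auto simp: T_def zero_prod_def)
    have "A' (P (fst y)) + snd y *\<^sub>R B' e \<in> V"
      using AV' BV' PV eV V by (intro subspace_add subspace_scale) auto
    from split0[OF this 1] have a: "A' (P (fst y)) + snd y *\<^sub>R B' e = 0" and b: "fst y - P (fst y) = 0"
      by auto
    then have "inner e (P (fst y)) = 0" using 2 by simp
    from inj[OF PV this a] b show ?thesis by (simp add: prod_eq_iff)
  qed
  have "inj T"
  proof (rule injI)
    fix x y assume "T x = T y"
    then have "T (x - y) = 0" using linear_diff[OF linT] by simp
    then show "x = y" using T0 by fastforce
  qed
  then obtain G where linG: "linear G" and GT: "\<And>x. G (T x) = x" and TG: "\<And>x. T (G x) = x"
    using linear_injective_isomorphism[OF linT] by blast
  obtain Kg where Kg: "Kg > 0" "\<And>x. norm (G x) \<le> Kg * norm x"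
    using linear_bounded_pos[OF linG] by blast
  obtain Ka where Ka: "Ka > 0" "\<And>x. norm (A' x) \<le> Ka * norm x"
    using linear_bounded_pos[OF lA] by blast
  obtain Kb where Kb: "Kb > 0" "\<And>x. norm (B' x) \<le> Kb * norm x"
    using linear_bounded_pos[OF lB] by blast
  obtain Kp where Kp: "Kp > 0" "\<And>x. norm (P x) \<le> Kp * norm x"
    using linear_bounded_pos[OF P] by blast
  define N where "N = norm e + 1"
  have N: "N > 0" by (simp add: N_def add_nonneg_pos)
  \<comment> \<open>Both \<open>\<epsilon>1\<close> and \<open>\<rho>\<close> are sized to
    contribute at most 1/(4 Kg) each to the Lipschitz constant of \<open>Gh x - T\<close>; with the
    bound Kg for the inverse G this leaves the contraction constant 1/2.\<close>
  define \<epsilon>1 where "\<epsilon>1 = 1 / (2 * Kg) / (2 * (Kp + Kp * N) + 1)"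
  have e1: "\<epsilon>1 > 0" unfolding \<epsilon>1_def using Kg Kp N
    by (intro divide_pos_pos) (auto intro: add_pos_pos add_nonneg_pos)
  obtain d where d: "d > 0"
    "\<And>x y. x \<in> ball w d \<Longrightarrow> y \<in> ball w d \<Longrightarrow> norm (A x - A y - A' (x - y)) \<le> \<epsilon>1 * norm (x - y)"
    "\<And>x y. x \<in> ball w d \<Longrightarrow> y \<in> ball w d \<Longrightarrow> norm (B x - B y - B' (x - y)) \<le> \<epsilon>1 * norm (x - y)"
  proof -
    obtain d1 where d1: "d1 > 0" "\<And>x y. x \<in> ball w d1 \<Longrightarrow> y \<in> ball w d1 \<Longrightarrow> norm (A x - A y - A' (x - y)) \<le> \<epsilon>1 * norm (x - y)"
      using strict_derivD[OF A e1] by metis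
    obtain d2 where d2: "d2 > 0" "\<And>x y. x \<in> ball w d2 \<Longrightarrow> y \<in> ball w d2 \<Longrightarrow> norm (B x - B y - B' (x - y)) \<le> \<epsilon>1 * norm (x - y)"
      using strict_derivD[OF B e1] by metis
    show thesis using d1 d2 by (intro that[of "min d1 d2"]) auto
  qed
  define \<rho> where "\<rho> = min 1 (1 / (4 * Kg) / ((\<epsilon>1 + Kb) * Kp + Kb * Kp + 1))"
  have rho0: "\<rho> > 0" unfolding \<rho>_def using Kg Kp Kb e1
    by (auto intro!: divide_pos_pos add_pos_pos mult_pos_pos add_nonneg_pos)
  have rho1: "\<rho> \<le> 1" by (simp add: \<rho>_def)
  have rho2: "\<rho> * ((\<epsilon>1 + Kb) * Kp + Kb * Kp) \<le> 1 / (4 * Kg)"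
  proof -
    define Z where "Z = (\<epsilon>1 + Kb) * Kp + Kb * Kp"
    have Z: "Z > 0" unfolding Z_def using Kb Kp e1 by (auto intro!: add_pos_pos mult_pos_pos)
    have "\<rho> \<le> 1 / (4 * Kg) / (Z + 1)" by (simp add: \<rho>_def Z_def)
    then have "\<rho> * Z \<le> 1 / (4 * Kg) / (Z + 1) * Z" using Z by (intro mult_right_mono) auto
    also have "\<dots> \<le> 1 / (4 * Kg)"
    proof -
      have "Z / (Z + 1) \<le> 1" using Z by simp
      then have "1 / (4 * Kg) * (Z / (Z + 1)) \<le> 1 / (4 * Kg) * 1" using Kg by (intro mult_left_mono) auto
      then show ?thesis by simp
    qed
    finally show ?thesis by (simp add: Z_def)
  qed
  \<comment> \<open>Projecting \<open>e + \<eta>\<close> keeps the point in w + V, where the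
    invariance hypotheses on A and B apply, although \<open>\<eta>\<close> ranges over the whole
    space.\<close>
  define pt where "pt x \<eta> = w + x *\<^sub>R P (e + \<eta>)" for x :: real and \<eta>
  define Gh where "Gh x y = ((1/x) *\<^sub>R (A (pt x (fst y)) + snd y *\<^sub>R B (pt x (fst y))) + (fst y - P (fst y)), inner e (fst y))"
    for x :: real and y
  \<comment> \<open>A Newton step with the fixed inverse G of T in place of the inverse derivative
    at y; its fixed points are the zeros of \<open>Gh x\<close>.\<close>
  define Ph where "Ph x y = y - G (Gh x y)" for x y
  define a0 where "a0 = d / (Kp * N + 1)"
  have KN: "Kp * N + 1 > 0" using Kp(1) N by (simp add: add_pos_pos)
  have a0: "a0 > 0" unfolding a0_def using d(1) KN by simp
  have Pn: "norm (P (e + fst y)) \<le> Kp * N" if "y \<in> cball 0 \<rho>" for y :: "'a \<times> real"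
  proof -
    have "norm (fst y) \<le> 1" using that rho1 norm_fst_le[of "fst y" "snd y"] by (simp only: prod.collapse mem_cball dist_0_norm)
    then have "norm (e + fst y) \<le> N" unfolding N_def using norm_triangle_ineq[of e "fst y"] by linarith
    then show ?thesis using Kp order_trans[OF Kp(2) mult_left_mono] by (simp add: less_imp_le)
  qed
  have ptb: "pt x (fst y) \<in> ball w d" if "y \<in> cball 0 \<rho>" "0 < x" "x < a0" for x and y :: "'a \<times> real"
  proof -
    have "norm (x *\<^sub>R P (e + fst y)) \<le> x * (Kp * N)"
      using Pn[OF that(1)] that(2) by (simp add: mult_left_mono)
    also have "\<dots> < x * (Kp * N + 1)" using that(2) by simp
    also have "\<dots> < d" using that KN unfolding a0_def by (simp add: field_simps)
    finally show ?thesis by (simp add: pt_def dist_norm)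
  qed
  have wb: "w \<in> ball w d" using d(1) by simp
  \<comment> \<open>The increments \<open>p - q\<close> and \<open>q - w\<close> carry a factor x
    that cancels the division by x, so the bound is uniform in x. E1 and E3 are the linearization
    errors of A and B, and E2 is the increment of B; this is where differences at two points near w,
    that is strict differentiability, are needed.\<close>
  have estimate: "norm (Gh x y - Gh x z - T (y - z)) \<le> 1 / (2 * Kg) * norm (y - z)"
    if y: "y \<in> cball 0 \<rho>" and z: "z \<in> cball 0 \<rho>" and x: "0 < x" "x < a0" for x y z
  proof -
    define u where "u = fst y - fst z"
    define s where "s = snd y - snd z"
    have un: "norm u \<le> norm (y - z)" unfolding u_def by (metis fst_diff norm_fst_le prod.collapse)
    have sn: "\<bar>s\<bar> \<le> norm (y - z)" unfolding s_def
      by (metis snd_diff norm_snd_le prod.collapse real_norm_def)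
    have zn: "\<bar>snd y\<bar> \<le> \<rho>" using y norm_snd_le[of "snd y" "fst y"] by simp
    have fzn: "norm (fst z) \<le> \<rho>" using z norm_fst_le[of "fst z" "snd z"] by simp
    define p where "p = pt x (fst y)"
    define q where "q = pt x (fst z)"
    have pb: "p \<in> ball w d" "q \<in> ball w d" using ptb y z x by (auto simp: p_def q_def)
    have pq: "p - q = x *\<^sub>R P u"
      unfolding p_def q_def pt_def u_def by (simp add: linear_add[OF P] linear_diff[OF P] algebra_simps)
    have qw: "q - w = x *\<^sub>R P (e + fst z)" by (simp add: q_def pt_def)
    have npq: "norm (p - q) \<le> x * (Kp * norm (y - z))"
      unfolding pq using Kp(2)[of u] un x(1) Kp(1)
      by simp (meson mult_left_mono order_trans less_imp_le)
    define E1 where "E1 = A p - A q - A' (p - q)"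
    define E2 where "E2 = B p - B q"
    define E3 where "E3 = B q - B w - B' (q - w)"
    have n1: "norm E1 \<le> \<epsilon>1 * (x * (Kp * norm (y - z)))"
      unfolding E1_def using d(2)[OF pb] npq e1 by (meson mult_left_mono order_trans less_imp_le)
    have n2: "norm E2 \<le> (\<epsilon>1 + Kb) * (x * (Kp * norm (y - z)))"
    proof -
      have "norm E2 \<le> norm (B p - B q - B' (p - q)) + norm (B' (p - q))"
        unfolding E2_def using norm_triangle_ineq[of "B p - B q - B' (p - q)" "B' (p - q)"] by simp
      also have "\<dots> \<le> \<epsilon>1 * norm (p - q) + Kb * norm (p - q)"
        using d(3)[OF pb] Kb(2)[of "p - q"] by linarith
      also have "\<dots> = (\<epsilon>1 + Kb) * norm (p - q)" by (simp add: algebra_simps)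
      also have "\<dots> \<le> (\<epsilon>1 + Kb) * (x * (Kp * norm (y - z)))"
        using npq e1 Kb(1) by (intro mult_left_mono) auto
      finally show ?thesis .
    qed
    have n3: "norm E3 \<le> \<epsilon>1 * (x * (Kp * N))"
    proof -
      have "norm E3 \<le> \<epsilon>1 * norm (q - w)" unfolding E3_def by (rule d(3)[OF pb(2) wb])
      also have "\<dots> \<le> \<epsilon>1 * (x * (Kp * N))"
        unfolding qw using Pn[OF z] x(1) e1 by (intro mult_left_mono) auto
      finally show ?thesis .
    qed
    have n4: "norm (B' (P (fst z))) \<le> Kb * (Kp * \<rho>)"
      using Kb(2)[of "P (fst z)"] Kp(2)[of "fst z"] fzn Kb(1) Kp(1)
      by (meson mult_left_mono order_trans less_imp_le)
    have Bq: "B q = E3 + x *\<^sub>R B' e + x *\<^sub>R B' (P (fst z))"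
      unfolding E3_def Bw qw by (simp add: linear_add[OF P] linear_add[OF lB] linear_scale[OF lB] Pid[OF eV] algebra_simps)
    have "x *\<^sub>R fst (Gh x y - Gh x z - T (y - z)) =
        (A p + snd y *\<^sub>R B p) - (A q + snd z *\<^sub>R B q) - x *\<^sub>R A' (P u) - x *\<^sub>R (s *\<^sub>R B' e)"
      using x(1) unfolding Gh_def T_def p_def[symmetric] q_def[symmetric] u_def s_def
      by (simp add: algebra_simps linear_diff[OF P])
    also have "\<dots> = E1 + snd y *\<^sub>R E2 + s *\<^sub>R (E3 + x *\<^sub>R B' (P (fst z)))"
    proof -
      have a: "A' (p - q) = x *\<^sub>R A' (P u)" unfolding pq by (rule linear_scale[OF lA])
      have "(A p + snd y *\<^sub>R B p) - (A q + snd z *\<^sub>R B q) - x *\<^sub>R A' (P u) - x *\<^sub>R (s *\<^sub>R B' e)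
         = E1 + snd y *\<^sub>R E2 + s *\<^sub>R B q - s *\<^sub>R (x *\<^sub>R B' e)"
        unfolding E1_def E2_def a s_def by (simp add: algebra_simps)
      moreover have "s *\<^sub>R B q - s *\<^sub>R (x *\<^sub>R B' e) = s *\<^sub>R (E3 + x *\<^sub>R B' (P (fst z)))"
        unfolding Bq by (simp add: algebra_simps)
      ultimately show ?thesis by (simp add: algebra_simps)
    qed
    finally have id: "x *\<^sub>R fst (Gh x y - Gh x z - T (y - z)) = E1 + snd y *\<^sub>R E2 + s *\<^sub>R (E3 + x *\<^sub>R B' (P (fst z)))" .
    have "x * norm (fst (Gh x y - Gh x z - T (y - z))) = norm (E1 + snd y *\<^sub>R E2 + s *\<^sub>R (E3 + x *\<^sub>R B' (P (fst z))))"
      using id x(1) by (metis abs_of_pos norm_scaleR)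
    also have "\<dots> \<le> norm E1 + \<bar>snd y\<bar> * norm E2 + \<bar>s\<bar> * (norm E3 + x * norm (B' (P (fst z))))"
      using norm_triangle_ineq[of "E1 + snd y *\<^sub>R E2" "s *\<^sub>R (E3 + x *\<^sub>R B' (P (fst z)))"]
        norm_triangle_ineq[of E1 "snd y *\<^sub>R E2"] norm_triangle_ineq[of E3 "x *\<^sub>R B' (P (fst z))"] x(1)
        mult_left_mono[OF norm_triangle_ineq[of E3 "x *\<^sub>R B' (P (fst z))"], of "\<bar>s\<bar>"] by simp
    also have "\<dots> \<le> \<epsilon>1 * (x * (Kp * norm (y - z))) + \<rho> * ((\<epsilon>1 + Kb) * (x * (Kp * norm (y - z))))
        + norm (y - z) * (\<epsilon>1 * (x * (Kp * N)) + x * (Kb * (Kp * \<rho>)))"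
      using n1 n2 n3 n4 zn sn x(1) rho0 by (intro add_mono mult_mono mult_left_mono) auto
    also have "\<dots> = x * (norm (y - z) * (\<epsilon>1 * (Kp + Kp * N) + \<rho> * ((\<epsilon>1 + Kb) * Kp + Kb * Kp)))"
      by (simp add: algebra_simps)
    also have "\<dots> \<le> x * (norm (y - z) * (1 / (2 * Kg)))"
    proof -
      have "\<epsilon>1 * (Kp + Kp * N) \<le> 1 / (4 * Kg)"
      proof -
        define Z where "Z = Kp + Kp * N"
        have Z: "Z > 0" unfolding Z_def using Kp N by (simp add: add_pos_pos)
        have "\<epsilon>1 * Z = 1 / (4 * Kg) * (2 * Z / (2 * Z + 1))" using Z Kg by (simp add: \<epsilon>1_def Z_def[symmetric])
        also have "\<dots> \<le> 1 / (4 * Kg) * 1" using Z Kg by (intro mult_left_mono) auto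
        finally show ?thesis by (simp add: Z_def)
      qed
      then have "\<epsilon>1 * (Kp + Kp * N) + \<rho> * ((\<epsilon>1 + Kb) * Kp + Kb * Kp) \<le> 1 / (4 * Kg) + 1 / (4 * Kg)"
        using rho2 by linarith
      also have "\<dots> = 1 / (2 * Kg)" by simp
      finally show ?thesis using x(1) by (intro mult_left_mono) auto
    qed
    finally have "norm (fst (Gh x y - Gh x z - T (y - z))) \<le> norm (y - z) * (1 / (2 * Kg))"
      using x(1) by (rule mult_left_le_imp_le)
    then have "norm (fst (Gh x y - Gh x z - T (y - z))) \<le> 1 / (2 * Kg) * norm (y - z)"
      by (simp only: mult.commute)
    moreover have "snd (Gh x y - Gh x z - T (y - z)) = 0"
      by (simp add: Gh_def T_def inner_diff_right)
    ultimately show ?thesis by (simp add: norm_prod_def)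
  qed
  have contr: "norm (Ph x y - Ph x z) \<le> 1/2 * norm (y - z)"
    if "y \<in> cball 0 \<rho>" "z \<in> cball 0 \<rho>" "0 < x" "x < a0" for x y z
  proof -
    have "Ph x y - Ph x z = - G (Gh x y - Gh x z - T (y - z))"
      by (simp add: Ph_def linear_diff[OF linG] GT)
    then have "norm (Ph x y - Ph x z) \<le> Kg * norm (Gh x y - Gh x z - T (y - z))"
      using Kg(2) by simp
    also have "\<dots> \<le> Kg * (1 / (2 * Kg) * norm (y - z))"
      using estimate[OF that] Kg(1) by (intro mult_left_mono) auto
    finally show ?thesis using Kg(1) by simp
  qed
  \<comment> \<open>At \<open>y = 0\<close> the residual is A (w + x e) / x, which is small because
    A w = 0 and \<open>A' e = 0\<close>.\<close>
  have Gh0: "norm (Gh x 0) \<le> \<epsilon> * norm e"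
    if "0 < x" "norm (A (w + x *\<^sub>R e) - A w - A' (x *\<^sub>R e)) \<le> \<epsilon> * norm (x *\<^sub>R e)" for x \<epsilon>
  proof -
    have "Gh x 0 = ((1/x) *\<^sub>R A (w + x *\<^sub>R e), 0)"
      by (simp add: Gh_def pt_def Pid[OF eV] linear_0[OF P])
    then have "norm (Gh x 0) = 1/x * norm (A (w + x *\<^sub>R e))" using that(1) by (simp add: norm_prod_def)
    also have "\<dots> \<le> 1/x * (\<epsilon> * norm (x *\<^sub>R e))"
      using that by (intro mult_left_mono) (auto simp: Aw e0 linear_scale[OF lA])
    also have "\<dots> = \<epsilon> * norm e" using that(1) by simp
    finally show ?thesis .
  qed
  have small: "\<exists>a>0. \<forall>x. 0 < x \<longrightarrow> x < a \<longrightarrow> norm (G (Gh x 0)) \<le> \<epsilon>" if "\<epsilon> > 0" for \<epsilon>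
  proof -
    define \<epsilon>' where "\<epsilon>' = \<epsilon> / (Kg * N)"
    have "\<epsilon>' > 0" using that Kg N by (simp add: \<epsilon>'_def)
    from strict_derivD[OF A this] obtain d' where d': "d' > 0"
      "\<And>x y. x \<in> ball w d' \<Longrightarrow> y \<in> ball w d' \<Longrightarrow> norm (A x - A y - A' (x - y)) \<le> \<epsilon>' * norm (x - y)"
      by blast
    have "norm (G (Gh x 0)) \<le> \<epsilon>" if x: "0 < x" "x < d' / N" for x
    proof -
      have "norm (x *\<^sub>R e) \<le> x * N" using x by (simp add: N_def)
      also have "\<dots> < d'" using x N by (simp add: field_simps)
      finally have "w + x *\<^sub>R e \<in> ball w d'" by (simp add: dist_norm)
      from d'(2)[OF this, of w] d'(1)
      have "norm (A (w + x *\<^sub>R e) - A w - A' (x *\<^sub>R e)) \<le> \<epsilon>' * norm (x *\<^sub>R e)" by simp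
      from Gh0[OF x(1) this] have "norm (Gh x 0) \<le> \<epsilon>' * norm e" .
      also have "\<dots> \<le> \<epsilon>' * N" using \<open>\<epsilon>' > 0\<close> by (intro mult_left_mono) (auto simp: N_def)
      finally have "Kg * norm (Gh x 0) \<le> Kg * (\<epsilon>' * N)" using Kg(1) by (intro mult_left_mono) auto
      also have "\<dots> = \<epsilon>" using Kg(1) N by (simp add: \<epsilon>'_def)
      finally show ?thesis using Kg(2) order_trans by blast
    qed
    then show ?thesis using d'(1) N by (intro exI[of _ "d' / N"]) auto
  qed
  obtain a1 where a1: "a1 > 0" "\<And>x. 0 < x \<Longrightarrow> x < a1 \<Longrightarrow> norm (G (Gh x 0)) \<le> \<rho> / 2"
    using small[of "\<rho>/2"] rho0 by auto
  define a where "a = min a0 a1 / 2"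
  have a: "a > 0" "a < a0" "a < a1" using a0 a1(1) by (auto simp: a_def)
  have "\<exists>y. y \<in> cball 0 \<rho> \<and> Ph x y = y" if x: "0 < x" "x \<le> a" for x
  proof -
    have xa: "x < a0" "x < a1" using x a by auto
    have "\<exists>!y\<in>cball 0 \<rho>. Ph x y = y"
    proof (rule Banach_fix[where c = "1/2"])
      show "complete (cball (0::'a \<times> real) \<rho>)" by (simp add: complete_eq_closed)
      show "cball (0::'a \<times> real) \<rho> \<noteq> {}" using rho0 by simp
      show "Ph x ` cball 0 \<rho> \<subseteq> cball 0 \<rho>"
      proof
        fix v assume "v \<in> Ph x ` cball 0 \<rho>"
        then obtain y where y: "y \<in> cball 0 \<rho>" "v = Ph x y" by blast
        have "norm (Ph x y - Ph x 0) \<le> 1/2 * norm (y - 0)" using rho0 by (intro contr y x xa) auto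
        moreover have "norm (Ph x 0) \<le> \<rho> / 2" using a1(2)[OF x(1) xa(2)] by (simp add: Ph_def)
        ultimately have "norm v \<le> \<rho>" using y norm_triangle_ineq[of "Ph x y - Ph x 0" "Ph x 0"] by simp
        then show "v \<in> cball 0 \<rho>" by simp
      qed
    qed (use contr x xa in \<open>auto simp: dist_norm\<close>)
    then show ?thesis by blast
  qed
  then obtain Y where Y: "\<And>x. 0 < x \<Longrightarrow> x \<le> a \<Longrightarrow> Y x \<in> cball 0 \<rho> \<and> Ph x (Y x) = Y x" by metis
  \<comment> \<open>At \<open>x = 0\<close> the rescaled equation degenerates, so the value 0 is
    prescribed there and its continuity rests on \<open>small\<close>.\<close>
  define y where "y x = (if x = 0 then 0 else Y x)" for x
  have yb: "y x \<in> cball 0 \<rho>" if "x \<in> {0..a}" for x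
    using that Y[of x] rho0 by (auto simp: y_def)
  have yfix: "Ph x (y x) = y x" if "0 < x" "x \<le> a" for x
    using that Y[of x] by (auto simp: y_def)
  \<comment> \<open>A posteriori estimate for contractions: the defect of z bounds its distance to
    the fixed point. With \<open>z = y x0\<close>, or \<open>z = 0\<close> when
    \<open>x0 = 0\<close>, it gives continuity in x.\<close>
  have ybound: "norm (y x - z) \<le> 2 * norm (Ph x z - z)" if "0 < x" "x \<le> a" "z \<in> cball 0 \<rho>" for x z
  proof -
    have "norm (Ph x (y x) - Ph x z) \<le> 1/2 * norm (y x - z)"
      using that yb[of x] a by (intro contr) auto
    then have "norm (y x - Ph x z) \<le> 1/2 * norm (y x - z)" using yfix that by simp
    then show ?thesis using norm_triangle_ineq[of "y x - Ph x z" "Ph x z - z"] by simp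
  qed
  have contI: "continuous (at p) f"
    if "K \<ge> 0" "\<And>q. q \<in> ball w d \<Longrightarrow> norm (f q - f p) \<le> K * norm (q - p)" "p \<in> ball w d"
    for f :: "'a \<Rightarrow> 'a" and p K
  proof -
    have "\<forall>\<^sub>F q in at p. q \<in> ball w d"
      using eventually_at_in_open'[OF open_ball that(3)] .
    then have ev: "\<forall>\<^sub>F q in at p. norm (f q - f p) \<le> K * norm (q - p)"
      by (rule eventually_mono) (rule that(2))
    have "((\<lambda>q. K * norm (q - p)) \<longlongrightarrow> K * norm (p - p)) (at p)"
      by (intro tendsto_intros)
    then have "((\<lambda>q. K * norm (q - p)) \<longlongrightarrow> 0) (at p)" by simp
    from Lim_null_comparison[OF ev this] have "((\<lambda>q. f q - f p) \<longlongrightarrow> 0) (at p)" .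
    then have "(f \<longlongrightarrow> f p) (at p)" by (rule Lim_null[THEN iffD2])
    then show ?thesis by (simp add: continuous_at)
  qed
  have contA: "continuous (at p) A" if "p \<in> ball w d" for p
  proof (rule contI[OF _ _ that, of "\<epsilon>1 + Ka"])
    fix q assume "q \<in> ball w d"
    from d(2)[OF this that] Ka(2)[of "q - p"]
    show "norm (A q - A p) \<le> (\<epsilon>1 + Ka) * norm (q - p)"
      using norm_triangle_ineq[of "A q - A p - A' (q - p)" "A' (q - p)"] by (simp add: distrib_right)
  qed (use e1 Ka(1) in simp)
  have contB: "continuous (at p) B" if "p \<in> ball w d" for p
  proof (rule contI[OF _ _ that, of "\<epsilon>1 + Kb"])
    fix q assume "q \<in> ball w d"
    from d(3)[OF this that] Kb(2)[of "q - p"]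
    show "norm (B q - B p) \<le> (\<epsilon>1 + Kb) * norm (q - p)"
      using norm_triangle_ineq[of "B q - B p - B' (q - p)" "B' (q - p)"] by (simp add: distrib_right)
  qed (use e1 Kb(1) in simp)
  have conty: "continuous (at x0 within {0..a}) y" if x0: "x0 \<in> {0..a}" for x0
  proof (cases "x0 = 0")
    case False
    then have x0': "0 < x0" "x0 \<le> a" using x0 by auto
    define z where "z = y x0"
    have z: "z \<in> cball 0 \<rho>" using yb x0 by (simp add: z_def)
    have ptz: "pt x0 (fst z) \<in> ball w d" using ptb[OF z x0'(1)] x0' a by simp
    have cp: "((\<lambda>x. pt x (fst z)) \<longlongrightarrow> pt x0 (fst z)) (at x0 within {0..a})"
      unfolding pt_def by (intro tendsto_intros)
    have "((\<lambda>x. Gh x z) \<longlongrightarrow> Gh x0 z) (at x0 within {0..a})"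
      unfolding Gh_def using x0'
      by (intro tendsto_intros isCont_tendsto_compose[OF contA[OF ptz] cp]
          isCont_tendsto_compose[OF contB[OF ptz] cp]) auto
    then have "((\<lambda>x. Ph x z) \<longlongrightarrow> Ph x0 z) (at x0 within {0..a})"
      unfolding Ph_def by (intro tendsto_intros bounded_linear.tendsto[OF linear_conv_bounded_linear[THEN iffD1, OF linG]])
    then have "((\<lambda>x. 2 * norm (Ph x z - z)) \<longlongrightarrow> 2 * norm (Ph x0 z - z)) (at x0 within {0..a})"
      by (intro tendsto_mult_left tendsto_norm tendsto_diff tendsto_const)
    moreover have "Ph x0 z - z = 0" using yfix[OF x0'] by (simp add: z_def)
    ultimately have lim: "((\<lambda>x. 2 * norm (Ph x z - z)) \<longlongrightarrow> 0) (at x0 within {0..a})" by simp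
    have "\<forall>\<^sub>F x in at x0 within {0..a}. norm (y x - z) \<le> 2 * norm (Ph x z - z)"
    proof -
      have "\<forall>\<^sub>F x in at x0 within {0..a}. 0 < x"
        using order_tendstoD(1)[OF tendsto_ident_at x0'(1)] .
      moreover have "\<forall>\<^sub>F x in at x0 within {0..a}. x \<in> {0..a}" by (simp add: eventually_at_filter)
      ultimately show ?thesis
      proof eventually_elim
        case (elim x)
        then show ?case using ybound[OF _ _ z] by simp
      qed
    qed
    from Lim_null_comparison[OF this lim] have "((\<lambda>x. y x - z) \<longlongrightarrow> 0) (at x0 within {0..a})" .
    then have "(y \<longlongrightarrow> z) (at x0 within {0..a})" by (rule Lim_null[THEN iffD2])
    then show ?thesis by (simp add: continuous_within z_def)
  next
    case True
    have *: "\<exists>b>0. \<forall>x\<in>{0..a}. dist x x0 < b \<longrightarrow> dist (y x) (y x0) \<le> \<epsilon>" if pos: "\<epsilon> > 0" for \<epsilon>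
    proof -
      obtain b where b: "b > 0" "\<And>x. 0 < x \<Longrightarrow> x < b \<Longrightarrow> norm (G (Gh x 0)) \<le> \<epsilon> / 2"
        using small[of "\<epsilon>/2"] half_gt_zero[OF pos] by blast
      have "norm (y x) \<le> \<epsilon>" if "x \<in> {0..a}" "x < b" for x
      proof (cases "x = 0")
        case False
        then have "norm (y x - 0) \<le> 2 * norm (Ph x 0 - 0)" using that rho0 by (intro ybound) auto
        then show ?thesis using b(2)[of x] that False by (simp add: Ph_def)
      qed (use \<open>\<epsilon> > 0\<close> in \<open>simp add: y_def\<close>)
      then show ?thesis using b(1) True by (intro exI[of _ b]) (auto simp: y_def)
    qed
    show ?thesis
      unfolding continuous_within_eps_delta
    proof (intro allI impI)
      fix \<epsilon> :: real assume "\<epsilon> > 0"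
      then obtain b where "b > 0" "\<forall>x\<in>{0..a}. dist x x0 < b \<longrightarrow> dist (y x) (y x0) \<le> \<epsilon> / 2"
        using *[of "\<epsilon> / 2"] by auto
      then show "\<exists>b>0. \<forall>x\<in>{0..a}. dist x x0 < b \<longrightarrow> dist (y x) (y x0) < \<epsilon>"
        using \<open>\<epsilon> > 0\<close> by (intro exI[of _ b]) fastforce
    qed
  qed
  have cy: "continuous_on {0..a} y" using conty by (simp add: continuous_on_eq_continuous_within)
  show thesis
  proof (rule that[of a "\<lambda>x. fst (y x)" "\<lambda>x. snd (y x)"])
    fix x assume x: "x \<in> {0..a}"
    show "fst (y x) \<in> V \<and> inner e (fst (y x)) = 0 \<and>
       A (w + x *\<^sub>R (e + fst (y x))) + snd (y x) *\<^sub>R B (w + x *\<^sub>R (e + fst (y x))) = 0"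
    proof (cases "x = 0")
      case True
      then show ?thesis using Aw Bw V by (simp add: y_def subspace_0)
    next
      case False
      then have x': "0 < x" "x \<le> a" using x by auto
      have "G (Gh x (y x)) = 0" using yfix[OF x'] by (simp add: Ph_def)
      then have "Gh x (y x) = 0" using TG[of "Gh x (y x)"] linear_0[OF linT] by simp
      then have 1: "(1/x) *\<^sub>R (A (pt x (fst (y x))) + snd (y x) *\<^sub>R B (pt x (fst (y x)))) + (fst (y x) - P (fst (y x))) = 0"
        and 2: "inner e (fst (y x)) = 0" by (auto simp: Gh_def zero_prod_def)
      have pV: "x *\<^sub>R P (e + fst (y x)) \<in> V" using PV V by (simp add: subspace_scale)
      have "(1/x) *\<^sub>R (A (pt x (fst (y x))) + snd (y x) *\<^sub>R B (pt x (fst (y x)))) \<in> V"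
        unfolding pt_def using AV[OF pV] BV[OF pV] V by (intro subspace_scale subspace_add) auto
      from split0[OF this 1] have a: "A (pt x (fst (y x))) + snd (y x) *\<^sub>R B (pt x (fst (y x))) = 0"
        and b: "P (fst (y x)) = fst (y x)" using x' by auto
      have "P (e + fst (y x)) = e + fst (y x)" using b Pid[OF eV] by (simp add: linear_add[OF P])
      then show ?thesis using a 2 b PV[of "fst (y x)"] by (simp add: pt_def)
    qed
  qed (use a(1) cy in \<open>auto simp: y_def intro!: continuous_intros\<close>)
qed

section \<open>Simple zeros of the determinant of a matrix pencil\<close>

text \<open>By the Leibniz formula the determinant is a polynomial in the entries.\<close>

lemma tendsto_mat_det:
  fixes M :: "'b \<Rightarrow> real mat"
  assumes M: "\<And>t. M t \<in> carrier_mat n n" "N \<in> carrier_mat n n"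
    and lim: "\<And>i j. i < n \<Longrightarrow> j < n \<Longrightarrow> ((\<lambda>t. M t $$ (i, j)) \<longlongrightarrow> N $$ (i, j)) F"
  shows "((\<lambda>t. Determinant.det (M t)) \<longlongrightarrow> Determinant.det N) F"
proof -
  have eq: "Determinant.det A = (\<Sum>p\<in>{p. p permutes {0..<n}}. signof p * (\<Prod>i = 0..<n. A $$ (i, p i)))"
    if "A \<in> carrier_mat n n" for A :: "real mat"
    using that by (auto simp: Determinant.det_def)
  have "((\<lambda>t. \<Sum>p\<in>{p. p permutes {0..<n}}. signof p * (\<Prod>i = 0..<n. M t $$ (i, p i))) \<longlongrightarrow>
      (\<Sum>p\<in>{p. p permutes {0..<n}}. signof p * (\<Prod>i = 0..<n. N $$ (i, p i)))) F"
  proof (intro tendsto_intros lim)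
    fix p i assume "p \<in> {p. p permutes {0..<n}}" "i \<in> {0..<n}"
    then show "p i < n" "i < n"
      using permutes_in_image[of p "{0..<n}" i] by auto
  qed
  then show ?thesis using eq M by simp
qed

text \<open>If \<open>det (D0 + t D1) = t g t\<close> with \<open>g\<close> nonzero in the limit and \<open>e\<close> is in the kernel of \<open>D0\<close>,
  Cramer's rule for \<open>(D0 + t D1) (e / t) = D1 e\<close> shows that replacing a column of \<open>D0\<close> by \<open>D1 e\<close>
  gives a nonsingular matrix.\<close>

lemma pencil_simple_zero:
  fixes D0 D1 :: "real mat" and e \<eta> :: "real Matrix.vec"
  assumes D0: "D0 \<in> carrier_mat n n" and D1: "D1 \<in> carrier_mat n n"
    and det: "\<forall>\<^sub>F t in at 0. Determinant.det (D0 + t \<cdot>\<^sub>m D1) = t * g t"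
    and g: "(g \<longlongrightarrow> g0) (at 0)" "g0 \<noteq> 0"
    and e: "e \<in> carrier_vec n" "D0 *\<^sub>v e = 0\<^sub>v n" "e \<noteq> 0\<^sub>v n"
    and \<eta>: "\<eta> \<in> carrier_vec n" "D0 *\<^sub>v \<eta> + s \<cdot>\<^sub>v (D1 *\<^sub>v e) = 0\<^sub>v n"
  shows "s = 0 \<and> (\<exists>c. \<eta> = c \<cdot>\<^sub>v e)"
proof -
  obtain k where k: "k < n" "vec_index e k \<noteq> 0"
    using e by (metis (no_types, lifting) carrier_vecD eq_vecI index_zero_vec(1) index_zero_vec(2))
  define M where "M t = replace_col (D0 + t \<cdot>\<^sub>m D1) (D1 *\<^sub>v e) k" for t
  have Mc: "M t \<in> carrier_mat n n" for t using D0 D1 by (auto simp: M_def replace_col_def)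
  have M: "M t $$ (i, j) = (if j = k then vec_index (D1 *\<^sub>v e) i else D0 $$ (i, j) + t * D1 $$ (i, j))"
    if "i < n" "j < n" for t i j
    using that D0 D1 by (auto simp: M_def replace_col_def)
  have c1: "\<forall>\<^sub>F t in at 0. Determinant.det (M t) = vec_index e k * g t"
    using det eventually_neq_at_within[of 0 0 UNIV]
  proof eventually_elim
    case (elim t)
    have "(D0 + t \<cdot>\<^sub>m D1) *\<^sub>v ((1/t) \<cdot>\<^sub>v e) = D1 *\<^sub>v e"
    proof (rule eq_vecI)
      fix i assume "i < dim_vec (D1 *\<^sub>v e)"
      then have i: "i < n" using D1 by simp
      have a: "vec_index (D0 *\<^sub>v e) i = 0" using e(2) i by simp
      have "vec_index ((D0 + t \<cdot>\<^sub>m D1) *\<^sub>v ((1/t) \<cdot>\<^sub>v e)) i =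
          (1/t) * (vec_index (D0 *\<^sub>v e) i + t * vec_index (D1 *\<^sub>v e) i)"
        using i D0 D1 e(1)
        by (simp add: scalar_prod_def sum_distrib_left sum.distrib[symmetric] algebra_simps)
      then show "vec_index ((D0 + t \<cdot>\<^sub>m D1) *\<^sub>v ((1/t) \<cdot>\<^sub>v e)) i = vec_index (D1 *\<^sub>v e) i"
        using a elim(2) by simp
    qed (use D0 D1 in auto)
    then have "Determinant.det (M t) = vec_index ((1/t) \<cdot>\<^sub>v e) k * Determinant.det (D0 + t \<cdot>\<^sub>m D1)"
      unfolding M_def using D0 D1 e(1) k(1)
      by (metis add_carrier_mat cramer_lemma_mat smult_carrier_mat smult_carrier_vec)
    then show ?case using elim k(1) e(1) by simp
  qed
  have "((\<lambda>t. Determinant.det (M t)) \<longlongrightarrow> Determinant.det (M 0)) (at 0)"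
  proof (rule tendsto_mat_det[OF Mc Mc])
    fix i j assume "i < n" "j < n"
    then show "((\<lambda>t. M t $$ (i, j)) \<longlongrightarrow> M 0 $$ (i, j)) (at 0)"
      by (auto simp: M intro!: tendsto_eq_intros)
  qed
  moreover have "((\<lambda>t. Determinant.det (M t)) \<longlongrightarrow> vec_index e k * g0) (at 0)"
    using c1 by (rule tendsto_cong[THEN iffD2]) (intro tendsto_intros g)
  ultimately have "Determinant.det (M 0) = vec_index e k * g0"
    using LIM_unique by blast
  then have nz: "Determinant.det (M 0) \<noteq> 0" using k g by simp
  \<comment> \<open>Column k of \<open>M 0\<close> is D1 e, so slot k of the vector carries s;
    elsewhere it is \<open>\<eta>\<close> minus the multiple of e that clears entry k. Hence
    \<open>M 0\<close> maps it to D0 \<eta> + s D1 e = 0.\<close>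
  define y where "y = Matrix.vec n (\<lambda>j. if j = k then s else vec_index \<eta> j - vec_index \<eta> k / vec_index e k * vec_index e j)"
  have y: "y \<in> carrier_vec n" by (simp add: y_def)
  have "M 0 *\<^sub>v y = 0\<^sub>v n"
  proof (rule eq_vecI)
    fix i assume "i < dim_vec (0\<^sub>v n)"
    then have i: "i < n" by simp
    define z where "z j = vec_index \<eta> j - vec_index \<eta> k / vec_index e k * vec_index e j" for j
    have zk: "z k = 0" using k by (simp add: z_def)
    have "vec_index (M 0 *\<^sub>v y) i = (\<Sum>j = 0..<n. M 0 $$ (i, j) * vec_index y j)"
      using i Mc[of 0] y by (auto simp: scalar_prod_def intro!: sum.cong)
    also have "\<dots> = (\<Sum>j = 0..<n. D0 $$ (i, j) * z j + (if j = k then vec_index (D1 *\<^sub>v e) i * s else 0))"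
      using i zk by (intro sum.cong) (auto simp: M y_def z_def)
    also have "\<dots> = (\<Sum>j = 0..<n. D0 $$ (i, j) * z j) + vec_index (D1 *\<^sub>v e) i * s"
      using k by (simp add: sum.distrib)
    also have "(\<Sum>j = 0..<n. D0 $$ (i, j) * z j) = vec_index (D0 *\<^sub>v \<eta>) i - vec_index \<eta> k / vec_index e k * vec_index (D0 *\<^sub>v e) i"
      using i D0 e(1) \<eta>(1)
      by (simp add: scalar_prod_def z_def sum_distrib_left sum_subtractf[symmetric] algebra_simps)
    also have "\<dots> + vec_index (D1 *\<^sub>v e) i * s = vec_index (D0 *\<^sub>v \<eta> + s \<cdot>\<^sub>v (D1 *\<^sub>v e)) i"
      using i D0 D1 e by (simp add: mult.commute)
    finally show "vec_index (M 0 *\<^sub>v y) i = vec_index (0\<^sub>v n) i" using \<eta>(2) i by simp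
  qed (use Mc[of 0] in auto)
  then have y0: "y = 0\<^sub>v n"
    using nz det_0_iff_vec_prod_zero_field[OF Mc[of 0]] y by blast
  have s0: "s = 0"
    using arg_cong[OF y0, of "\<lambda>v. vec_index v k"] k by (simp add: y_def)
  have "\<eta> = (vec_index \<eta> k / vec_index e k) \<cdot>\<^sub>v e"
  proof (rule eq_vecI)
    fix j assume "j < dim_vec ((vec_index \<eta> k / vec_index e k) \<cdot>\<^sub>v e)"
    then have j: "j < n" using e by simp
    show "vec_index \<eta> j = vec_index ((vec_index \<eta> k / vec_index e k) \<cdot>\<^sub>v e) j"
      using arg_cong[OF y0, of "\<lambda>v. vec_index v j"] j k e(1) by (auto simp: y_def split: if_splits)
  qed (use \<eta> e in auto)
  with s0 show ?thesis by blast
qed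

section \<open>Bodies and forces\<close>

lemma UNIV_13: "(UNIV :: 13 set) = {1, 2, 3, 4, 5, 6, 7, 8, 9, 10, 11, 12, 13}"
proof -
  have "x \<in> {1, 2, 3, 4, 5, 6, 7, 8, 9, 10, 11, 12, 13}" for x :: 13
  proof (cases x)
    case (of_int z)
    then have "0 \<le> z" "z < 13" by simp_all
    then have "z = 0 \<or> z = 1 \<or> z = 2 \<or> z = 3 \<or> z = 4 \<or> z = 5 \<or> z = 6 \<or> z = 7 \<or> z = 8 \<or>
        z = 9 \<or> z = 10 \<or> z = 11 \<or> z = 12" by arith
    moreover have "(0::13) = 13" by simp
    ultimately show ?thesis using of_int(1) by (elim disjE) simp_all
  qed
  then show ?thesis by (rule UNIV_eq_I)
qed

lemma sum_13: "(\<Sum>i\<in>UNIV. f i) = f (1::13) + f 2 + f 3 + f 4 + f 5 + f 6 + f 7 + f 8 + f 9 + f 10 + f 11 + f 12 + f 13"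
proof -
  have d: "distinct [1, 2, 3, 4, 5, 6, 7, 8, 9, 10, 11, 12, 13 :: 13]" by simp
  have "UNIV = set [1, 2, 3, 4, 5, 6, 7, 8, 9, 10, 11, 12, 13 :: 13]" by (simp only: UNIV_13 list.set)
  then have "(\<Sum>i\<in>UNIV. f i) = sum_list (map f [1, 2, 3, 4, 5, 6, 7, 8, 9, 10, 11, 12, 13])"
    using sum.distinct_set_conv_list[OF d, of f] by (simp only:)
  then show ?thesis by (simp only: list.map sum_list.Cons sum_list.Nil add_0_right add.assoc)
qed

lemma forall_13: "(\<forall>i::13. P i) \<longleftrightarrow> P 1 \<and> P 2 \<and> P 3 \<and> P 4 \<and> P 5 \<and> P 6 \<and> P 7 \<and> P 8 \<and> P 9 \<and> P 10 \<and> P 11 \<and> P 12 \<and> P 13"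
proof -
  have "(\<forall>i::13. P i) \<longleftrightarrow> (\<forall>i\<in>UNIV. P i)" by simp
  then show ?thesis unfolding UNIV_13 by (simp only: ball_simps simp_thms)
qed

lemma vector_13:
  "(vector [a,b,c,d,e,f,g,h,i,j,k,l,m] :: 'a::zero^13) $ 1 = a"
  "(vector [a,b,c,d,e,f,g,h,i,j,k,l,m] :: 'a::zero^13) $ 2 = b"
  "(vector [a,b,c,d,e,f,g,h,i,j,k,l,m] :: 'a::zero^13) $ 3 = c"
  "(vector [a,b,c,d,e,f,g,h,i,j,k,l,m] :: 'a::zero^13) $ 4 = d"
  "(vector [a,b,c,d,e,f,g,h,i,j,k,l,m] :: 'a::zero^13) $ 5 = e"
  "(vector [a,b,c,d,e,f,g,h,i,j,k,l,m] :: 'a::zero^13) $ 6 = f"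
  "(vector [a,b,c,d,e,f,g,h,i,j,k,l,m] :: 'a::zero^13) $ 7 = g"
  "(vector [a,b,c,d,e,f,g,h,i,j,k,l,m] :: 'a::zero^13) $ 8 = h"
  "(vector [a,b,c,d,e,f,g,h,i,j,k,l,m] :: 'a::zero^13) $ 9 = i"
  "(vector [a,b,c,d,e,f,g,h,i,j,k,l,m] :: 'a::zero^13) $ 10 = j"
  "(vector [a,b,c,d,e,f,g,h,i,j,k,l,m] :: 'a::zero^13) $ 11 = k"
  "(vector [a,b,c,d,e,f,g,h,i,j,k,l,m] :: 'a::zero^13) $ 12 = l"
  "(vector [a,b,c,d,e,f,g,h,i,j,k,l,m] :: 'a::zero^13) $ 13 = m"
  by (simp_all add: vector_def)

lemma vec2_eq_iff: "(x::real^2) = y \<longleftrightarrow> x $ 1 = y $ 1 \<and> x $ 2 = y $ 2"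
  by (simp add: Finite_Cartesian_Product.vec_eq_iff forall_2)

lemma inner_vec2: "inner (x::real^2) y = x $ 1 * y $ 1 + x $ 2 * y $ 2"
  by (simp add: inner_vec_def sum_2)

lemma norm_vec2: "norm (x::real^2) = sqrt (x $ 1 * x $ 1 + x $ 2 * x $ 2)"
  by (simp add: norm_eq_sqrt_inner inner_vec2)

text \<open>The value at 0 is 0 by the convention for division, so sums over all bodies may include
  the body itself.\<close>

definition acc :: "real^2 \<Rightarrow> real^2" where
  "acc x = (1 / norm x ^ 3) *\<^sub>R x"

definition acc_deriv :: "real^2 \<Rightarrow> real^2 \<Rightarrow> real^2" where
  "acc_deriv x v = (1 / norm x ^ 3) *\<^sub>R v - (3 * inner x v / norm x ^ 5) *\<^sub>R x"

lemma has_derivative_acc [derivative_intros]: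
  assumes "(f has_derivative f') (at x)" "f x \<noteq> 0"
  shows "((\<lambda>x. acc (f x)) has_derivative (\<lambda>h. acc_deriv (f x) (f' h))) (at x)"
proof -
  have n: "norm (f x) \<noteq> 0" using assms by simp
  have *: "(acc has_derivative acc_deriv y) (at y)" if "y \<noteq> 0" for y
  proof -
    have ny: "norm y \<noteq> 0" using that by simp
    have gn: "(norm has_derivative (\<lambda>h. inner h (sgn y))) (at y)"
      using GDERIV_norm[OF that] by (simp add: gderiv_def)
    have "((\<lambda>x. 1 / norm x ^ 3) has_derivative (\<lambda>h. - (3 * inner y h / norm y ^ 5))) (at y)"
    proof (rule has_derivative_eq_rhs[OF has_derivative_divide'[OF has_derivative_const has_derivative_power[OF gn]]])
      show "norm y ^ 3 \<noteq> 0" using ny by simp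
      show "(\<lambda>h. (0 * norm y ^ 3 - 1 * (of_nat 3 * inner h (sgn y) * norm y ^ (3 - 1))) / (norm y ^ 3 * norm y ^ 3)) =
          (\<lambda>h. - (3 * inner y h / norm y ^ 5))"
        using ny by (simp add: fun_eq_iff sgn_div_norm inner_commute power2_eq_square divide_simps power_eq_if)
    qed
    from has_derivative_scaleR[OF this has_derivative_ident]
    show ?thesis unfolding acc_def[abs_def] by (rule has_derivative_eq_rhs) (simp add: fun_eq_iff acc_deriv_def)
  qed
  show ?thesis using has_derivative_compose[OF assms(1) *[OF assms(2)]] .
qed


lemma acc_0 [simp]: "acc 0 = 0" by (simp add: acc_def)

lemma acc_deriv_0 [simp]: "acc_deriv 0 v = 0" by (simp add: acc_deriv_def)

lemma acc_deriv_zero_right [simp]: "acc_deriv x 0 = 0" by (simp add: acc_deriv_def)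

lemma acc_minus: "acc (- x) = - acc x" by (simp add: acc_def)

lemma has_derivative_vec_lambda:
  fixes f :: "'i::finite \<Rightarrow> 'a::euclidean_space \<Rightarrow> 'b::real_normed_vector"
  assumes "\<And>i. (f i has_derivative f' i) (at x)"
  shows "((\<lambda>x. \<chi> i. f i x) has_derivative (\<lambda>h. \<chi> i. f' i h)) (at x)"
  unfolding has_derivative_at2
proof
  have lin: "linear (f' i)" for i using assms has_derivative_linear by blast
  have "linear (\<lambda>h. \<chi> i. f' i h)"
    by (rule linearI)
      (simp_all add: Finite_Cartesian_Product.vec_eq_iff linear_add[OF lin] linear_scale[OF lin])
  then show "bounded_linear (\<lambda>h. \<chi> i. f' i h)" by (simp add: linear_conv_bounded_linear)
  show "((\<lambda>y. (1 / norm (y - x)) *\<^sub>R ((\<chi> i. f i y) - ((\<chi> i. f i x) + (\<chi> i. f' i (y - x))))) \<longlongrightarrow> 0) (at x)"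
  proof (rule vec_tendstoI)
    fix i
    have "((\<lambda>y. (1 / norm (y - x)) *\<^sub>R (f i y - (f i x + f' i (y - x)))) \<longlongrightarrow> 0) (at x)"
      using assms[of i] unfolding has_derivative_at2 by blast
    then show "((\<lambda>y. ((1 / norm (y - x)) *\<^sub>R ((\<chi> i. f i y) - ((\<chi> i. f i x) + (\<chi> i. f' i (y - x))))) $ i) \<longlongrightarrow> 0 $ i) (at x)"
      by simp
  qed
qed

text \<open>The gradient of the potential with its component at body i divided by the mass of that
  body. In this form it is linear in the pair of \<open>\<mu>\<close> and \<open>l\<close>.\<close>

definition force :: "real^13 \<Rightarrow> real \<Rightarrow> config \<Rightarrow> config" where
  "force \<mu> l q = (\<chi> i. l *\<^sub>R (q $ i) - (\<Sum>j\<in>UNIV. \<mu> $ j *\<^sub>R acc (q $ i - q $ j)))"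

definition force_deriv :: "real^13 \<Rightarrow> real \<Rightarrow> config \<Rightarrow> config \<Rightarrow> config" where
  "force_deriv \<mu> l q v = (\<chi> i. l *\<^sub>R (v $ i) - (\<Sum>j\<in>UNIV. \<mu> $ j *\<^sub>R acc_deriv (q $ i - q $ j) (v $ i - v $ j)))"

lemma open_Omega: "open Omega"
proof -
  have eq: "Omega = (\<Inter>i. \<Inter>j. (if i = j then UNIV else {q. q $ i \<noteq> q $ j}))"
    by (auto simp: Omega_def split: if_splits)
  moreover have "open {q :: config. q $ i \<noteq> q $ j}" for i j :: 13
    by (intro open_Collect_neq continuous_intros)
  ultimately show ?thesis unfolding eq by (intro open_INT ballI finite) simp_all
qed

lemma has_derivative_force:
  assumes "q \<in> Omega"
  shows "(force \<mu> l has_derivative force_deriv \<mu> l q) (at q)"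
proof -
  have 1: "((\<lambda>q. acc (q $ i - q $ j)) has_derivative (\<lambda>h. acc_deriv (q $ i - q $ j) (h $ i - h $ j))) (at q)"
    for i j :: 13
  proof (cases "i = j")
    case False
    then have "q $ i - q $ j \<noteq> 0" using assms by (auto simp: Omega_def)
    then show ?thesis
      by (intro has_derivative_acc has_derivative_diff bounded_linear_imp_has_derivative bounded_linear_vec_nth)
  qed simp
  show ?thesis
    unfolding force_def[abs_def] force_deriv_def[abs_def]
    by (intro has_derivative_vec_lambda has_derivative_diff has_derivative_sum has_derivative_scaleR_right 1
        bounded_linear_imp_has_derivative bounded_linear_vec_nth)
qed

text \<open>The diagonal terms are quotients by 0 and hence 0, so the double sum counts every
  unordered pair twice.\<close>

lemma newton_U_sym:
  "newton_U q \<mu> = 1/2 * (\<Sum>i\<in>UNIV. \<Sum>j\<in>UNIV. \<mu> $ i * \<mu> $ j / norm (q $ i - q $ j))"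
proof -
  define f where "f = (\<lambda>(i, j). \<mu> $ i * \<mu> $ j / norm (q $ i - q $ j))"
  have "(\<Sum>i\<in>UNIV. \<Sum>j\<in>UNIV. \<mu> $ i * \<mu> $ j / norm (q $ i - q $ j)) = sum f (UNIV \<times> UNIV)"
    by (simp add: f_def sum.cartesian_product)
  also have "\<dots> = sum f ({(i, j). i < j} \<union> ({(i, j). j < i} \<union> {(i, j). i = j}))"
    by (rule arg_cong[of _ _ "sum f"]) auto
  also have "\<dots> =
      sum f {(i, j). i < j} + (sum f {(i, j). j < i} + sum f {(i, j). i = j})"
    by (subst sum.union_disjoint, (auto)[3], subst sum.union_disjoint, auto)
  also have "sum f {(i, j). i = j} = 0" by (rule sum.neutral) (auto simp: f_def)
  also have "sum f {(i, j). j < i} = sum f {(i, j). i < j}"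
    by (rule sum.reindex_bij_witness[of _ prod.swap prod.swap])
      (auto simp: f_def norm_minus_commute mult.commute)
  finally show ?thesis by (simp add: newton_U_def f_def)
qed

lemma has_derivative_phi:
  assumes "q \<in> Omega"
  shows "((\<lambda>q. newton_U q \<mu> + l * inertia q \<mu>) has_derivative
    (\<lambda>h. inner h (\<chi> i. \<mu> $ i *\<^sub>R force \<mu> l q $ i))) (at q)"
proof -
  have nth: "((\<lambda>q. q $ i) has_derivative (\<lambda>h. h $ i)) (at q)" for i :: 13
    by (intro bounded_linear_imp_has_derivative bounded_linear_vec_nth)
  have 1: "((\<lambda>q. \<mu> $ i * \<mu> $ j / norm (q $ i - q $ j)) has_derivative
      (\<lambda>h. - (\<mu> $ i * \<mu> $ j * inner (acc (q $ i - q $ j)) (h $ i - h $ j)))) (at q)" for i j :: 13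
  proof (cases "i = j")
    case False
    then have n: "q $ i - q $ j \<noteq> 0" using assms by (auto simp: Omega_def)
    have d: "((\<lambda>q. q $ i - q $ j) has_derivative (\<lambda>h. h $ i - h $ j)) (at q)"
      by (intro has_derivative_diff nth)
    have "((\<lambda>q. norm (q $ i - q $ j)) has_derivative (\<lambda>h. inner (h $ i - h $ j) (sgn (q $ i - q $ j)))) (at q)"
      by (rule has_derivative_compose[OF d has_derivative_norm[OF n]])
    then show ?thesis
      by (rule has_derivative_eq_rhs[OF has_derivative_divide'[OF has_derivative_const]])
        (use n in \<open>simp_all add: fun_eq_iff acc_def sgn_div_norm inner_commute power3_eq_cube divide_simps\<close>)
  qed simp
  have 2: "((\<lambda>q. newton_U q \<mu>) has_derivative
      (\<lambda>h. 1/2 * (\<Sum>i\<in>UNIV. \<Sum>j\<in>UNIV. - (\<mu> $ i * \<mu> $ j * inner (acc (q $ i - q $ j)) (h $ i - h $ j))))) (at q)"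
    unfolding newton_U_sym by (intro has_derivative_mult_right has_derivative_sum 1)
  have 3: "((\<lambda>q. inertia q \<mu>) has_derivative (\<lambda>h. 1/2 * (\<Sum>j\<in>UNIV. \<mu> $ j * (2 * inner (q $ j) (h $ j))))) (at q)"
    unfolding inertia_def power2_norm_eq_inner
    by (intro has_derivative_mult_right has_derivative_sum)
      (rule has_derivative_eq_rhs[OF has_derivative_inner[OF nth nth]], simp add: fun_eq_iff inner_commute)
  \<comment> \<open>Exchanging the summation indices and using that \<open>acc\<close> is odd moves
    the test vector from body j to body i, so the two halves of each pair contribute
    equally.\<close>
  have sw: "(\<Sum>i\<in>UNIV. \<Sum>j\<in>UNIV. \<mu> $ i * \<mu> $ j * inner (acc (q $ i - q $ j)) (h $ j)) =
      - (\<Sum>i\<in>UNIV. \<Sum>j\<in>UNIV. \<mu> $ i * \<mu> $ j * inner (acc (q $ i - q $ j)) (h $ i))" for h :: config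
  proof -
    have "(\<Sum>i\<in>UNIV. \<Sum>j\<in>UNIV. \<mu> $ i * \<mu> $ j * inner (acc (q $ i - q $ j)) (h $ j)) =
        (\<Sum>i\<in>UNIV. \<Sum>j\<in>UNIV. \<mu> $ j * \<mu> $ i * inner (acc (q $ j - q $ i)) (h $ i))"
      by (rule sum.swap)
    also have "\<dots> = (\<Sum>i\<in>UNIV. \<Sum>j\<in>UNIV. - (\<mu> $ i * \<mu> $ j * inner (acc (q $ i - q $ j)) (h $ i)))"
      by (intro sum.cong refl) (metis (no_types) acc_minus inner_minus_left minus_diff_eq mult.commute mult_minus_right)
    finally show ?thesis by (simp add: sum_negf)
  qed
  show ?thesis
  proof (rule has_derivative_eq_rhs[OF has_derivative_add[OF 2 has_derivative_mult_right[OF 3]]], rule ext)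
    fix h :: config
    have "(\<Sum>i\<in>UNIV. \<Sum>j\<in>UNIV. - (\<mu> $ i * \<mu> $ j * inner (acc (q $ i - q $ j)) (h $ i - h $ j))) =
      (\<Sum>i\<in>UNIV. \<Sum>j\<in>UNIV. \<mu> $ i * \<mu> $ j * inner (acc (q $ i - q $ j)) (h $ j)) -
      (\<Sum>i\<in>UNIV. \<Sum>j\<in>UNIV. \<mu> $ i * \<mu> $ j * inner (acc (q $ i - q $ j)) (h $ i))"
      by (simp add: sum_subtractf[symmetric] inner_diff_right algebra_simps)
    also have "\<dots> = - 2 * (\<Sum>i\<in>UNIV. \<Sum>j\<in>UNIV. \<mu> $ i * \<mu> $ j * inner (acc (q $ i - q $ j)) (h $ i))"
      unfolding sw by simp
    finally have a: "1/2 * (\<Sum>i\<in>UNIV. \<Sum>j\<in>UNIV. - (\<mu> $ i * \<mu> $ j * inner (acc (q $ i - q $ j)) (h $ i - h $ j))) =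
      - (\<Sum>i\<in>UNIV. \<Sum>j\<in>UNIV. \<mu> $ i * \<mu> $ j * inner (acc (q $ i - q $ j)) (h $ i))" by simp
    have b: "1/2 * (\<Sum>j\<in>UNIV. \<mu> $ j * (2 * inner (q $ j) (h $ j))) = (\<Sum>j\<in>UNIV. \<mu> $ j * inner (q $ j) (h $ j))"
      by (simp add: sum_distrib_left)
    have c: "inner h (\<chi> i. \<mu> $ i *\<^sub>R force \<mu> l q $ i) =
       l * (\<Sum>j\<in>UNIV. \<mu> $ j * inner (q $ j) (h $ j)) -
       (\<Sum>i\<in>UNIV. \<Sum>j\<in>UNIV. \<mu> $ i * \<mu> $ j * inner (acc (q $ i - q $ j)) (h $ i))"
      by (simp add: inner_vec_def[of h] force_def inner_diff_right inner_sum_right sum_distrib_left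
          sum_subtractf[symmetric] inner_commute algebra_simps)
    show "1/2 * (\<Sum>i\<in>UNIV. \<Sum>j\<in>UNIV. - (\<mu> $ i * \<mu> $ j * inner (acc (q $ i - q $ j)) (h $ i - h $ j))) +
       l * (1/2 * (\<Sum>j\<in>UNIV. \<mu> $ j * (2 * inner (q $ j) (h $ j)))) =
       inner h (\<chi> i. \<mu> $ i *\<^sub>R force \<mu> l q $ i)"
      unfolding a b c by simp
  qed
qed

lemma grad_eqI:
  assumes "(f has_derivative (\<lambda>h. inner h D)) (at x)"
  shows "grad f x = D"
proof -
  have "GDERIV f x :> D" using assms by (simp add: gderiv_def)
  moreover have "D' = D" if "GDERIV f x :> D'" for D'
  proof -
    have "(\<lambda>h. inner h D') = (\<lambda>h. inner h D)"
      using has_derivative_unique[OF that[unfolded gderiv_def] assms] .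
    then have "inner (D' - D) (D' - D) = 0" by (metis inner_diff_right right_minus_eq)
    then show ?thesis by simp
  qed
  ultimately show ?thesis unfolding grad_def by blast
qed

lemma grad_phi:
  assumes "q \<in> Omega"
  shows "grad (\<lambda>q. phi q p) q = (\<chi> i. rosette_mass p $ i *\<^sub>R force (rosette_mass p) (lam p) q $ i)"
  unfolding phi_def by (intro grad_eqI has_derivative_phi assms)

lemma frechet_derivative_grad_phi:
  assumes "q \<in> Omega"
  shows "frechet_derivative (grad (\<lambda>q. phi q p)) (at q) =
    (\<lambda>v. \<chi> i. rosette_mass p $ i *\<^sub>R force_deriv (rosette_mass p) (lam p) q v $ i)"
proof -
  have "((\<lambda>q. \<chi> i. rosette_mass p $ i *\<^sub>R force (rosette_mass p) (lam p) q $ i) has_derivative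
    (\<lambda>v. \<chi> i. rosette_mass p $ i *\<^sub>R force_deriv (rosette_mass p) (lam p) q v $ i)) (at q)"
    by (intro has_derivative_vec_lambda has_derivative_scaleR_right
        bounded_linear.has_derivative[OF bounded_linear_vec_nth] has_derivative_force assms)
  then have "(grad (\<lambda>q. phi q p) has_derivative
    (\<lambda>v. \<chi> i. rosette_mass p $ i *\<^sub>R force_deriv (rosette_mass p) (lam p) q v $ i)) (at q)"
    by (rule has_derivative_transform_within_open[OF _ open_Omega assms]) (simp add: grad_phi)
  then show ?thesis by (rule frechet_derivative_at[symmetric])
qed

section \<open>The rosette and its symmetries\<close>

lemma vec2_simps [simp]:
  "(vector [a, b] :: real^2) - vector [c, d] = vector [a - c, b - d]"
  "(vector [a, b] :: real^2) + vector [c, d] = vector [a + c, b + d]"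
  "- (vector [a, b] :: real^2) = vector [- a, - b]"
  "k *\<^sub>R (vector [a, b] :: real^2) = vector [k * a, k * b]"
  by (simp_all add: vec2_eq_iff)

lemma Phi_vec: "Phi s *v v = vector [cos s * v $ 1 - sin s * v $ 2, sin s * v $ 1 + cos s * v $ 2]"
  by (simp add: vec2_eq_iff Phi_def matrix_vector_mult_def sum_2)

lemma Phi_third: "Phi (pi / 3) *v v = vector [1/2 * v $ 1 - sqrt 3 / 2 * v $ 2, sqrt 3 / 2 * v $ 1 + 1/2 * v $ 2]"
  by (simp add: Phi_vec cos_60 sin_60)

lemma rosette_eq:
  "rosette p = vector [vector [1/2, 0], vector [1/4, sqrt 3 / 4], vector [- 1/4, sqrt 3 / 4],
     vector [- 1/2, 0], vector [- 1/4, - sqrt 3 / 4], vector [1/4, - sqrt 3 / 4],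
     vector [3/4, sqrt 3 / 4], vector [0, sqrt 3 / 2], vector [- 3/4, sqrt 3 / 4],
     vector [- 3/4, - sqrt 3 / 4], vector [0, - sqrt 3 / 2], vector [3/4, - sqrt 3 / 4], 0]"
proof -
  have u: "[0..<6] = [0, 1, 2, 3, 4, 5]" by (simp add: upt_rec)
  have a: "2 * pi / 6 * real 0 = 0" "2 * pi / 6 * real 1 = pi / 3" "2 * pi / 6 * real 2 = pi - pi / 3"
    "2 * pi / 6 * real 3 = pi" "2 * pi / 6 * real 4 = pi + pi / 3" "2 * pi / 6 * real 5 = 2 * pi - pi / 3"
    by simp_all
  have b: "pi / 6 + 2 * pi / 6 * real 0 = pi / 6" "pi / 6 + 2 * pi / 6 * real 1 = pi / 2"
    "pi / 6 + 2 * pi / 6 * real 2 = pi - pi / 6" "pi / 6 + 2 * pi / 6 * real 3 = pi + pi / 6"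
    "pi / 6 + 2 * pi / 6 * real 4 = pi + pi / 2" "pi / 6 + 2 * pi / 6 * real 5 = 2 * pi - pi / 6"
    by simp_all
  have 1: "Phi 0 *v vector [cos (pi / 3), 0] = vector [1/2, 0]"
    "Phi (pi / 3) *v vector [cos (pi / 3), 0] = vector [1/4, sqrt 3 / 4]"
    "Phi (pi - pi / 3) *v vector [cos (pi / 3), 0] = vector [- 1/4, sqrt 3 / 4]"
    "Phi pi *v vector [cos (pi / 3), 0] = vector [- 1/2, 0]"
    "Phi (pi + pi / 3) *v vector [cos (pi / 3), 0] = vector [- 1/4, - sqrt 3 / 4]"
    "Phi (2 * pi - pi / 3) *v vector [cos (pi / 3), 0] = vector [1/4, - sqrt 3 / 4]"
    unfolding Phi_vec cos_add sin_add cos_diff sin_diff cos_pi sin_pi cos_two_pi sin_two_pi cos_pi_half sin_pi_half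
      cos_60 sin_60 cos_30 sin_30
    by (simp_all add: vec2_eq_iff)
  have 2: "Phi (pi / 6) *v vector [sin (pi / 3), 0] = vector [3/4, sqrt 3 / 4]"
    "Phi (pi / 2) *v vector [sin (pi / 3), 0] = vector [0, sqrt 3 / 2]"
    "Phi (pi - pi / 6) *v vector [sin (pi / 3), 0] = vector [- 3/4, sqrt 3 / 4]"
    "Phi (pi + pi / 6) *v vector [sin (pi / 3), 0] = vector [- 3/4, - sqrt 3 / 4]"
    "Phi (pi + pi / 2) *v vector [sin (pi / 3), 0] = vector [0, - sqrt 3 / 2]"
    "Phi (2 * pi - pi / 6) *v vector [sin (pi / 3), 0] = vector [3/4, - sqrt 3 / 4]"
    unfolding Phi_vec cos_add sin_add cos_diff sin_diff cos_pi sin_pi cos_two_pi sin_two_pi cos_pi_half sin_pi_half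
      cos_60 sin_60 cos_30 sin_30
    by (simp_all add: vec2_eq_iff)
  show ?thesis
    unfolding rosette_def u list.map b unfolding a 1 2 append_Cons append_Nil ..
qed

lemma rosette_nth:
  "rosette p $ 1 = vector [1/2, 0]" "rosette p $ 2 = vector [1/4, sqrt 3 / 4]"
  "rosette p $ 3 = vector [- 1/4, sqrt 3 / 4]" "rosette p $ 4 = vector [- 1/2, 0]"
  "rosette p $ 5 = vector [- 1/4, - sqrt 3 / 4]" "rosette p $ 6 = vector [1/4, - sqrt 3 / 4]"
  "rosette p $ 7 = vector [3/4, sqrt 3 / 4]" "rosette p $ 8 = vector [0, sqrt 3 / 2]"
  "rosette p $ 9 = vector [- 3/4, sqrt 3 / 4]" "rosette p $ 10 = vector [- 3/4, - sqrt 3 / 4]"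
  "rosette p $ 11 = vector [0, - sqrt 3 / 2]" "rosette p $ 12 = vector [3/4, - sqrt 3 / 4]"
  "rosette p $ 13 = 0"
  unfolding rosette_eq by (simp_all only: vector_13)

lemma rosette_const: "rosette p = rosette p'"
  unfolding rosette_eq ..

definition ring_mass :: "real \<Rightarrow> real \<Rightarrow> real \<Rightarrow> real^13" where
  "ring_mass a b c = vector [a, a, a, a, a, a, b, b, b, b, b, b, c]"

lemma ring_mass_nth:
  "ring_mass a b c $ 1 = a" "ring_mass a b c $ 2 = a" "ring_mass a b c $ 3 = a"
  "ring_mass a b c $ 4 = a" "ring_mass a b c $ 5 = a" "ring_mass a b c $ 6 = a"
  "ring_mass a b c $ 7 = b" "ring_mass a b c $ 8 = b" "ring_mass a b c $ 9 = b"
  "ring_mass a b c $ 10 = b" "ring_mass a b c $ 11 = b" "ring_mass a b c $ 12 = b"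
  "ring_mass a b c $ 13 = c"
  unfolding ring_mass_def by (simp_all only: vector_13)

lemma rosette_mass_eq: "rosette_mass p = ring_mass (snd p) (m2 p) (fst p)"
  unfolding rosette_mass_def ring_mass_def by (simp add: eval_nat_numeral)

section \<open>Symmetries of the rosette acting on configurations\<close>

definition gact :: "(real^2 \<Rightarrow> real^2) \<Rightarrow> (13 \<Rightarrow> 13) \<Rightarrow> config \<Rightarrow> config" where
  "gact f \<pi> q = (\<chi> i. f (q $ \<pi> i))"

lemma gact_nth [simp]: "gact f \<pi> q $ i = f (q $ \<pi> i)" by (simp add: gact_def)

lemma orthogonal_norm: "orthogonal_transformation f \<Longrightarrow> norm (f v) = norm v"
  by (rule orthogonal_transformation_norm)

lemma acc_orthogonal:
  assumes "orthogonal_transformation f"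
  shows "acc (f x) = f (acc x)"
  using assms by (simp add: acc_def orthogonal_norm linear_scale orthogonal_transformation_linear)

lemma acc_deriv_orthogonal:
  assumes "orthogonal_transformation f"
  shows "acc_deriv (f x) (f v) = f (acc_deriv x v)"
proof -
  have l: "linear f" and i: "\<And>x y. inner (f x) (f y) = inner x y"
    using assms by (auto simp: orthogonal_transformation_def)
  show ?thesis
    by (simp add: acc_deriv_def orthogonal_norm[OF assms] linear_diff[OF l] linear_scale[OF l] i)
qed

lemma sum_reindex_bij: "bij \<pi> \<Longrightarrow> (\<Sum>j\<in>UNIV. g (\<pi> j)) = (\<Sum>j\<in>UNIV. g j)" for \<pi> :: "13 \<Rightarrow> 13"
  by (simp add: sum.reindex_bij_betw)

text \<open>Orthogonal maps commute with \<open>acc\<close>, and the sum over j may be relabelled by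
  \<open>\<pi>\<close> because the masses are constant along its orbits.\<close>

lemma force_gact:
  assumes "orthogonal_transformation f" "bij \<pi>" "\<And>j. \<mu> $ \<pi> j = \<mu> $ j"
  shows "force \<mu> l (gact f \<pi> q) = gact f \<pi> (force \<mu> l q)"
proof -
  have l: "linear f" using assms(1) by (rule orthogonal_transformation_linear)
  have "(\<Sum>j\<in>UNIV. \<mu> $ j *\<^sub>R acc (f (q $ \<pi> i) - f (q $ \<pi> j))) =
      f (\<Sum>j\<in>UNIV. \<mu> $ j *\<^sub>R acc (q $ \<pi> i - q $ j))" for i
  proof -
    have "(\<Sum>j\<in>UNIV. \<mu> $ j *\<^sub>R acc (f (q $ \<pi> i) - f (q $ \<pi> j))) =
        (\<Sum>j\<in>UNIV. \<mu> $ \<pi> j *\<^sub>R f (acc (q $ \<pi> i - q $ \<pi> j)))"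
      by (simp add: assms(3) linear_diff[OF l, symmetric] acc_orthogonal[OF assms(1)])
    also have "\<dots> = (\<Sum>j\<in>UNIV. \<mu> $ j *\<^sub>R f (acc (q $ \<pi> i - q $ j)))"
      using sum_reindex_bij[OF assms(2), of "\<lambda>j. \<mu> $ j *\<^sub>R f (acc (q $ \<pi> i - q $ j))"] .
    finally show ?thesis by (simp add: linear_sum[OF l] linear_scale[OF l])
  qed
  then show ?thesis
    by (simp add: force_def Finite_Cartesian_Product.vec_eq_iff linear_diff[OF l] linear_scale[OF l])
qed

lemma force_deriv_gact:
  assumes "orthogonal_transformation f" "bij \<pi>" "\<And>j. \<mu> $ \<pi> j = \<mu> $ j"
  shows "force_deriv \<mu> l (gact f \<pi> q) (gact f \<pi> v) = gact f \<pi> (force_deriv \<mu> l q v)"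
proof -
  have l: "linear f" using assms(1) by (rule orthogonal_transformation_linear)
  have "(\<Sum>j\<in>UNIV. \<mu> $ j *\<^sub>R acc_deriv (f (q $ \<pi> i) - f (q $ \<pi> j)) (f (v $ \<pi> i) - f (v $ \<pi> j))) =
      f (\<Sum>j\<in>UNIV. \<mu> $ j *\<^sub>R acc_deriv (q $ \<pi> i - q $ j) (v $ \<pi> i - v $ j))" for i
  proof -
    have "(\<Sum>j\<in>UNIV. \<mu> $ j *\<^sub>R acc_deriv (f (q $ \<pi> i) - f (q $ \<pi> j)) (f (v $ \<pi> i) - f (v $ \<pi> j))) =
        (\<Sum>j\<in>UNIV. \<mu> $ \<pi> j *\<^sub>R f (acc_deriv (q $ \<pi> i - q $ \<pi> j) (v $ \<pi> i - v $ \<pi> j)))"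
      by (simp add: assms(3) linear_diff[OF l, symmetric] acc_deriv_orthogonal[OF assms(1)])
    also have "\<dots> = (\<Sum>j\<in>UNIV. \<mu> $ j *\<^sub>R f (acc_deriv (q $ \<pi> i - q $ j) (v $ \<pi> i - v $ j)))"
      using sum_reindex_bij[OF assms(2), of "\<lambda>j. \<mu> $ j *\<^sub>R f (acc_deriv (q $ \<pi> i - q $ j) (v $ \<pi> i - v $ j))"] .
    finally show ?thesis by (simp add: linear_sum[OF l] linear_scale[OF l])
  qed
  then show ?thesis
    by (simp add: force_deriv_def Finite_Cartesian_Product.vec_eq_iff linear_diff[OF l] linear_scale[OF l])
qed

lemma linear_gact: "linear f \<Longrightarrow> linear (gact f \<pi>)"
  by (rule linearI) (simp_all add: Finite_Cartesian_Product.vec_eq_iff linear_add linear_scale)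

lemma inner_gact:
  assumes "orthogonal_transformation f" "bij \<pi>"
  shows "inner (gact f \<pi> u) (gact f \<pi> v) = inner u v"
proof -
  have "inner (gact f \<pi> u) (gact f \<pi> v) = (\<Sum>i\<in>UNIV. inner (u $ \<pi> i) (v $ \<pi> i))"
    using assms(1) by (simp add: inner_vec_def[of "gact f \<pi> u"] orthogonal_transformation_def)
  also have "\<dots> = inner u v"
    using sum_reindex_bij[OF assms(2), of "\<lambda>i. inner (u $ i) (v $ i)"] by (simp add: inner_vec_def[of u])
  finally show ?thesis .
qed

text \<open>The predecessor within each ring: after a rotation by pi/3 place i is occupied by the
  image of the body before it. With this direction \<open>Rot\<close> fixes the rosette.\<close>

definition rot_perm :: "13 \<Rightarrow> 13" where
  "rot_perm i = vector [6, 1, 2, 3, 4, 5, 12, 7, 8, 9, 10, 11, 13] $ i"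

definition ref_perm :: "13 \<Rightarrow> 13" where
  "ref_perm i = vector [1, 6, 5, 4, 3, 2, 12, 11, 10, 9, 8, 7, 13] $ i"

lemma rot_perm_simps [simp]:
  "rot_perm 1 = 6" "rot_perm 2 = 1" "rot_perm 3 = 2" "rot_perm 4 = 3" "rot_perm 5 = 4" "rot_perm 6 = 5"
  "rot_perm 7 = 12" "rot_perm 8 = 7" "rot_perm 9 = 8" "rot_perm 10 = 9" "rot_perm 11 = 10"
  "rot_perm 12 = 11" "rot_perm 13 = 13"
  unfolding rot_perm_def by (simp_all only: vector_13)

lemma ref_perm_simps [simp]:
  "ref_perm 1 = 1" "ref_perm 2 = 6" "ref_perm 3 = 5" "ref_perm 4 = 4" "ref_perm 5 = 3" "ref_perm 6 = 2"
  "ref_perm 7 = 12" "ref_perm 8 = 11" "ref_perm 9 = 10" "ref_perm 10 = 9" "ref_perm 11 = 8"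
  "ref_perm 12 = 7" "ref_perm 13 = 13"
  unfolding ref_perm_def by (simp_all only: vector_13)

definition mirror :: "real^2 \<Rightarrow> real^2" where "mirror x = vector [x $ 1, - x $ 2]"

definition Rot :: "config \<Rightarrow> config" where "Rot = gact ((*v) (Phi (pi / 3))) rot_perm"

definition Ref :: "config \<Rightarrow> config" where "Ref = gact mirror ref_perm"

lemma rotation_inner_identity:
  fixes c s :: real
  shows "(c * x1 - s * x2) * (c * y1 - s * y2) + (s * x1 + c * x2) * (s * y1 + c * y2) =
    (s\<^sup>2 + c\<^sup>2) * (x1 * y1 + x2 * y2)"
  by (simp add: power2_eq_square algebra_simps)

lemma orthogonal_Phi: "orthogonal_transformation ((*v) (Phi s))"
proof -
  have "inner (Phi s *v x) (Phi s *v y) = inner x y" for x y :: "real^2"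
  proof -
    have "inner (Phi s *v x) (Phi s *v y) = ((sin s)\<^sup>2 + (cos s)\<^sup>2) * inner x y"
      by (simp only: inner_vec2 Phi_vec vector_2 rotation_inner_identity)
    then show ?thesis by simp
  qed
  then show ?thesis by (simp add: orthogonal_transformation_def matrix_vector_mul_linear)
qed

lemma orthogonal_mirror: "orthogonal_transformation mirror"
  by (auto simp: orthogonal_transformation_def mirror_def inner_vec2 vec2_eq_iff intro!: linearI)

lemma rot_perm_6: "rot_perm (rot_perm (rot_perm (rot_perm (rot_perm (rot_perm i))))) = i"
  using forall_13[of "\<lambda>i. rot_perm (rot_perm (rot_perm (rot_perm (rot_perm (rot_perm i))))) = i"]
  by (simp only: rot_perm_simps simp_thms)

lemma ref_perm_2: "ref_perm (ref_perm i) = i"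
  using forall_13[of "\<lambda>i. ref_perm (ref_perm i) = i"] by (simp only: ref_perm_simps simp_thms)

lemma rot_ref_rot_perm: "rot_perm (ref_perm (rot_perm i)) = ref_perm i"
  using forall_13[of "\<lambda>i. rot_perm (ref_perm (rot_perm i)) = ref_perm i"]
  by (simp only: ref_perm_simps rot_perm_simps simp_thms)

lemma bij_rot_perm: "bij rot_perm"
  by (rule bij_betw_byWitness[where f' = "\<lambda>i. rot_perm (rot_perm (rot_perm (rot_perm (rot_perm i))))"])
    (auto simp: rot_perm_6)

lemma bij_ref_perm: "bij ref_perm"
  by (rule bij_betw_byWitness[where f' = ref_perm]) (auto simp: ref_perm_2)

lemma ring_mass_rot: "ring_mass a b c $ rot_perm j = ring_mass a b c $ j"
  using forall_13[of "\<lambda>j. ring_mass a b c $ rot_perm j = ring_mass a b c $ j"]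
  by (simp only: rot_perm_simps ring_mass_nth simp_thms)

lemma ring_mass_ref: "ring_mass a b c $ ref_perm j = ring_mass a b c $ j"
  using forall_13[of "\<lambda>j. ring_mass a b c $ ref_perm j = ring_mass a b c $ j"]
  by (simp only: ref_perm_simps ring_mass_nth simp_thms)

text \<open>Together with \<open>Ref_2\<close> and \<open>Rot_Ref_Rot\<close> these are the defining
  relations of the dihedral group of order 12. The third power of the rotation by pi/3 is -1 on the
  plane, so the sixth is the identity.\<close>

lemma Rot_6: "Rot (Rot (Rot (Rot (Rot (Rot q))))) = q"
proof -
  have "Phi (pi/3) *v (Phi (pi/3) *v (Phi (pi/3) *v x)) = - x" for x
    by (simp add: Phi_third vec2_eq_iff algebra_simps)
  moreover have "Phi (pi/3) *v (- x) = - (Phi (pi/3) *v x)" for x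
    by (simp add: Phi_third vec2_eq_iff)
  ultimately show ?thesis
    by (simp add: Rot_def Finite_Cartesian_Product.vec_eq_iff rot_perm_6)
qed

lemma Ref_2: "Ref (Ref q) = q"
  by (simp add: Ref_def Finite_Cartesian_Product.vec_eq_iff ref_perm_2) (simp add: mirror_def vec2_eq_iff forall_2)

lemma Rot_Ref_Rot: "Rot (Ref (Rot q)) = Ref q"
proof -
  have "Phi (pi/3) *v (mirror (Phi (pi/3) *v x)) = mirror x" for x
    by (simp add: Phi_third vec2_eq_iff mirror_def algebra_simps)
  then show ?thesis
    by (simp add: Rot_def Ref_def Finite_Cartesian_Product.vec_eq_iff rot_ref_rot_perm)
qed

lemma linear_Rot: "linear Rot" and linear_Ref: "linear Ref"
  unfolding Rot_def Ref_def
  using linear_gact orthogonal_Phi orthogonal_mirror orthogonal_transformation_linear by blast+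

lemma inner_Rot: "inner (Rot u) (Rot v) = inner u v" and inner_Ref: "inner (Ref u) (Ref v) = inner u v"
  unfolding Rot_def Ref_def
  using inner_gact orthogonal_Phi orthogonal_mirror bij_rot_perm bij_ref_perm by blast+

lemma Rot_rosette: "Rot (rosette p) = rosette p"
  unfolding Finite_Cartesian_Product.vec_eq_iff forall_13 Rot_def gact_nth rot_perm_simps rosette_nth
  by (simp add: Phi_third vec2_eq_iff forall_2)

lemma Ref_rosette: "Ref (rosette p) = rosette p"
  unfolding Finite_Cartesian_Product.vec_eq_iff forall_13 Ref_def gact_nth ref_perm_simps rosette_nth
  by (simp add: mirror_def vec2_eq_iff forall_2)

lemma force_Rot: "force (ring_mass a b c) l (Rot q) = Rot (force (ring_mass a b c) l q)"
  and force_Ref: "force (ring_mass a b c) l (Ref q) = Ref (force (ring_mass a b c) l q)"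
  unfolding Rot_def Ref_def
  by (rule force_gact orthogonal_Phi orthogonal_mirror bij_rot_perm bij_ref_perm ring_mass_rot ring_mass_ref)+

text \<open>The rosette does not depend on its argument, so \<open>(1, 1)\<close> is an arbitrary
  label. The masses and the multiplier are independent arguments here; they are tied to a parameter
  only in \<open>phess\<close>.\<close>

definition hess :: "real \<Rightarrow> real \<Rightarrow> real \<Rightarrow> real \<Rightarrow> config \<Rightarrow> config" where
  "hess a b c l = force_deriv (ring_mass a b c) l (rosette (1, 1))"

lemma hess_Rot: "hess a b c l (Rot v) = Rot (hess a b c l v)"
proof -
  have "force_deriv (ring_mass a b c) l (Rot (rosette (1, 1))) (Rot v) = Rot (hess a b c l v)"
    unfolding hess_def Rot_def
    by (rule force_deriv_gact orthogonal_Phi bij_rot_perm ring_mass_rot)+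
  then show ?thesis by (simp add: hess_def Rot_rosette)
qed

lemma hess_Ref: "hess a b c l (Ref v) = Ref (hess a b c l v)"
proof -
  have "force_deriv (ring_mass a b c) l (Ref (rosette (1, 1))) (Ref v) = Ref (hess a b c l v)"
    unfolding hess_def Ref_def
    by (rule force_deriv_gact orthogonal_mirror bij_ref_perm ring_mass_ref)+
  then show ?thesis by (simp add: hess_def Ref_rosette)
qed

section \<open>Explicit forces and Hessian on the sixfold symmetric subspace\<close>

lemma norm_vec2_eqI:
  assumes "x * x + y * y = d * d" "d \<ge> 0"
  shows "norm (vector [x, y] :: real^2) = d"
  using assms by (simp add: norm_vec2)

text \<open>Here \<open>k\<close> is 1/d^3 in rationalised form, and in
  \<open>acc_deriv_eval\<close> below \<open>e\<close> is 3/d^5. Characterising them by products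
  lets every side condition be checked by multiplication, using \<open>sqrt3_cancel\<close>, without
  dividing by a root.\<close>

lemma acc_eval:
  assumes "x * x + y * y = d * d" "d > 0" "k * (d * d * d) = 1" "r = k * x" "s = k * y"
  shows "acc (vector [x, y]) = vector [r, s]"
proof -
  have "norm (vector [x, y] :: real^2) = d" using assms by (intro norm_vec2_eqI) auto
  moreover have "1 / d ^ 3 = k" using assms(2,3) by (simp add: field_simps power3_eq_cube)
  ultimately show ?thesis using assms(4,5) by (simp add: acc_def)
qed

lemma acc_deriv_eval:
  assumes "x * x + y * y = d * d" "d > 0" "k * (d * d * d) = 1" "e * (d * d) = 3 * k"
    "r = k - e * (x * x)" "s = - e * (x * y)" "t = k - e * (y * y)"
  shows "acc_deriv (vector [x, y]) v = vector [r * v $ 1 + s * v $ 2, s * v $ 1 + t * v $ 2]"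
proof -
  have n: "norm (vector [x, y] :: real^2) = d" using assms by (intro norm_vec2_eqI) auto
  have k: "1 / d ^ 3 = k" using assms(2,3) by (simp add: field_simps power3_eq_cube)
  have "e * (d * d) * (d * d * d) = 3"
    using assms(3,4) by (simp only: mult.assoc)
  then have e: "3 / d ^ 5 = e" using assms(2) by (simp add: field_simps power_eq_if)
  have "acc_deriv (vector [x, y]) v = k *\<^sub>R v - (e * (x * v $ 1 + y * v $ 2)) *\<^sub>R vector [x, y]"
    unfolding acc_deriv_def n k inner_vec2 vector_2 e[symmetric] by simp
  then show ?thesis unfolding assms(5-7) by (simp add: vec2_eq_iff algebra_simps)
qed

lemma zero_vec2: "(0 :: real^2) = vector [0, 0]"
  by (simp add: vec2_eq_iff)

lemma sqrt3_cancel: "sqrt 3 * (sqrt 3 * x) = 3 * x" "sqrt 7 * (sqrt 7 * x) = 7 * x"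
  by (simp_all add: mult.assoc[symmetric])

text \<open>Rotation symmetry reduces all computations to bodies 1 and 7, one on each ring. Body 1
  sees the distances 1/2, sqrt 3 / 2, 1 and sqrt 7 / 2; body 7 sees in addition 3/2 and sqrt
  3.\<close>

lemma acc_rosette_1:
  "acc (rosette p $ 1 - rosette p $ 2) = vector [(2), (- 2 * sqrt 3)]"
  "acc (rosette p $ 1 - rosette p $ 3) = vector [((2 * sqrt 3) / 3), ((- 2) / 3)]"
  "acc (rosette p $ 1 - rosette p $ 4) = vector [(1), 0]"
  "acc (rosette p $ 1 - rosette p $ 5) = vector [((2 * sqrt 3) / 3), ((2) / 3)]"
  "acc (rosette p $ 1 - rosette p $ 6) = vector [(2), (2 * sqrt 3)]"
  "acc (rosette p $ 1 - rosette p $ 7) = vector [(- 2), (- 2 * sqrt 3)]"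
  "acc (rosette p $ 1 - rosette p $ 8) = vector [((1) / 2), ((- sqrt 3) / 2)]"
  "acc (rosette p $ 1 - rosette p $ 9) = vector [((10 * sqrt 7) / 49), ((- 2 * (sqrt 3 * sqrt 7)) / 49)]"
  "acc (rosette p $ 1 - rosette p $ 10) = vector [((10 * sqrt 7) / 49), ((2 * (sqrt 3 * sqrt 7)) / 49)]"
  "acc (rosette p $ 1 - rosette p $ 11) = vector [((1) / 2), ((sqrt 3) / 2)]"
  "acc (rosette p $ 1 - rosette p $ 12) = vector [(- 2), (2 * sqrt 3)]"
  "acc (rosette p $ 1 - rosette p $ 13) = vector [(4), 0]"
  unfolding rosette_nth zero_vec2 vec2_simps
  by ((rule acc_eval[where d = "1" and k = "(1)"]
      acc_eval[where d = "1/2" and k = "(8)"]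
      acc_eval[where d = "sqrt 3 / 2" and k = "((8 * sqrt 3) / 9)"]
      acc_eval[where d = "sqrt 7 / 2" and k = "((8 * sqrt 7) / 49)"];
      (simp add: algebra_simps sqrt3_cancel; fail))+)

lemma acc_deriv_rosette_1:
  "acc_deriv (rosette p $ 1 - rosette p $ 2) v =
    vector [(2) * v $ 1 + (6 * sqrt 3) * v $ 2, (6 * sqrt 3) * v $ 1 + (- 10) * v $ 2]"
  "acc_deriv (rosette p $ 1 - rosette p $ 3) v =
    vector [((- 10 * sqrt 3) / 9) * v $ 1 + (2) * v $ 2, (2) * v $ 1 + ((2 * sqrt 3) / 9) * v $ 2]"
  "acc_deriv (rosette p $ 1 - rosette p $ 4) v =
    vector [(- 2) * v $ 1 + 0 * v $ 2, 0 * v $ 1 + (1) * v $ 2]"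
  "acc_deriv (rosette p $ 1 - rosette p $ 5) v =
    vector [((- 10 * sqrt 3) / 9) * v $ 1 + (- 2) * v $ 2, (- 2) * v $ 1 + ((2 * sqrt 3) / 9) * v $ 2]"
  "acc_deriv (rosette p $ 1 - rosette p $ 6) v =
    vector [(2) * v $ 1 + (- 6 * sqrt 3) * v $ 2, (- 6 * sqrt 3) * v $ 1 + (- 10) * v $ 2]"
  "acc_deriv (rosette p $ 1 - rosette p $ 7) v =
    vector [(2) * v $ 1 + (- 6 * sqrt 3) * v $ 2, (- 6 * sqrt 3) * v $ 1 + (- 10) * v $ 2]"
  "acc_deriv (rosette p $ 1 - rosette p $ 8) v =
    vector [((1) / 4) * v $ 1 + ((3 * sqrt 3) / 4) * v $ 2, ((3 * sqrt 3) / 4) * v $ 1 + ((- 5) / 4) * v $ 2]"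
  "acc_deriv (rosette p $ 1 - rosette p $ 9) v =
    vector [((- 94 * sqrt 7) / 343) * v $ 1 + ((30 * (sqrt 3 * sqrt 7)) / 343) * v $ 2, ((30 * (sqrt 3 * sqrt 7)) / 343) * v $ 1 + ((38 * sqrt 7) / 343) * v $ 2]"
  "acc_deriv (rosette p $ 1 - rosette p $ 10) v =
    vector [((- 94 * sqrt 7) / 343) * v $ 1 + ((- 30 * (sqrt 3 * sqrt 7)) / 343) * v $ 2, ((- 30 * (sqrt 3 * sqrt 7)) / 343) * v $ 1 + ((38 * sqrt 7) / 343) * v $ 2]"
  "acc_deriv (rosette p $ 1 - rosette p $ 11) v =
    vector [((1) / 4) * v $ 1 + ((- 3 * sqrt 3) / 4) * v $ 2, ((- 3 * sqrt 3) / 4) * v $ 1 + ((- 5) / 4) * v $ 2]"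
  "acc_deriv (rosette p $ 1 - rosette p $ 12) v =
    vector [(2) * v $ 1 + (6 * sqrt 3) * v $ 2, (6 * sqrt 3) * v $ 1 + (- 10) * v $ 2]"
  "acc_deriv (rosette p $ 1 - rosette p $ 13) v =
    vector [(- 16) * v $ 1 + 0 * v $ 2, 0 * v $ 1 + (8) * v $ 2]"
  unfolding rosette_nth zero_vec2 vec2_simps
  by ((rule acc_deriv_eval[where d = "1" and k = "(1)" and e = "(3)"]
      acc_deriv_eval[where d = "1/2" and k = "(8)" and e = "(96)"]
      acc_deriv_eval[where d = "sqrt 3 / 2" and k = "((8 * sqrt 3) / 9)" and e = "((32 * sqrt 3) / 9)"]
      acc_deriv_eval[where d = "sqrt 7 / 2" and k = "((8 * sqrt 7) / 49)" and e = "((96 * sqrt 7) / 343)"];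
      (simp add: algebra_simps sqrt3_cancel; fail))+)

lemma acc_rosette_7:
  "acc (rosette p $ 7 - rosette p $ 1) = vector [(2), (2 * sqrt 3)]"
  "acc (rosette p $ 7 - rosette p $ 2) = vector [(4), 0]"
  "acc (rosette p $ 7 - rosette p $ 3) = vector [(1), 0]"
  "acc (rosette p $ 7 - rosette p $ 4) = vector [((10 * sqrt 7) / 49), ((2 * (sqrt 3 * sqrt 7)) / 49)]"
  "acc (rosette p $ 7 - rosette p $ 5) = vector [((8 * sqrt 7) / 49), ((4 * (sqrt 3 * sqrt 7)) / 49)]"
  "acc (rosette p $ 7 - rosette p $ 6) = vector [((1) / 2), ((sqrt 3) / 2)]"
  "acc (rosette p $ 7 - rosette p $ 8) = vector [((2 * sqrt 3) / 3), ((- 2) / 3)]"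
  "acc (rosette p $ 7 - rosette p $ 9) = vector [((4) / 9), 0]"
  "acc (rosette p $ 7 - rosette p $ 10) = vector [((sqrt 3) / 6), ((1) / 6)]"
  "acc (rosette p $ 7 - rosette p $ 11) = vector [((2) / 9), ((2 * sqrt 3) / 9)]"
  "acc (rosette p $ 7 - rosette p $ 12) = vector [0, ((4) / 3)]"
  "acc (rosette p $ 7 - rosette p $ 13) = vector [((2 * sqrt 3) / 3), ((2) / 3)]"
  unfolding rosette_nth zero_vec2 vec2_simps
  by ((rule acc_eval[where d = "1" and k = "(1)"]
      acc_eval[where d = "1/2" and k = "(8)"]
      acc_eval[where d = "3/2" and k = "((8) / 27)"]
      acc_eval[where d = "sqrt 3 / 2" and k = "((8 * sqrt 3) / 9)"]
      acc_eval[where d = "sqrt 3" and k = "((sqrt 3) / 9)"]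
      acc_eval[where d = "sqrt 7 / 2" and k = "((8 * sqrt 7) / 49)"];
      (simp add: algebra_simps sqrt3_cancel; fail))+)

lemma acc_deriv_rosette_7:
  "acc_deriv (rosette p $ 7 - rosette p $ 1) v =
    vector [(2) * v $ 1 + (- 6 * sqrt 3) * v $ 2, (- 6 * sqrt 3) * v $ 1 + (- 10) * v $ 2]"
  "acc_deriv (rosette p $ 7 - rosette p $ 2) v =
    vector [(- 16) * v $ 1 + 0 * v $ 2, 0 * v $ 1 + (8) * v $ 2]"
  "acc_deriv (rosette p $ 7 - rosette p $ 3) v =
    vector [(- 2) * v $ 1 + 0 * v $ 2, 0 * v $ 1 + (1) * v $ 2]"
  "acc_deriv (rosette p $ 7 - rosette p $ 4) v =
    vector [((- 94 * sqrt 7) / 343) * v $ 1 + ((- 30 * (sqrt 3 * sqrt 7)) / 343) * v $ 2, ((- 30 * (sqrt 3 * sqrt 7)) / 343) * v $ 1 + ((38 * sqrt 7) / 343) * v $ 2]"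
  "acc_deriv (rosette p $ 7 - rosette p $ 5) v =
    vector [((- 40 * sqrt 7) / 343) * v $ 1 + ((- 48 * (sqrt 3 * sqrt 7)) / 343) * v $ 2, ((- 48 * (sqrt 3 * sqrt 7)) / 343) * v $ 1 + ((- 16 * sqrt 7) / 343) * v $ 2]"
  "acc_deriv (rosette p $ 7 - rosette p $ 6) v =
    vector [((1) / 4) * v $ 1 + ((- 3 * sqrt 3) / 4) * v $ 2, ((- 3 * sqrt 3) / 4) * v $ 1 + ((- 5) / 4) * v $ 2]"
  "acc_deriv (rosette p $ 7 - rosette p $ 8) v =
    vector [((- 10 * sqrt 3) / 9) * v $ 1 + (2) * v $ 2, (2) * v $ 1 + ((2 * sqrt 3) / 9) * v $ 2]"
  "acc_deriv (rosette p $ 7 - rosette p $ 9) v =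
    vector [((- 16) / 27) * v $ 1 + 0 * v $ 2, 0 * v $ 1 + ((8) / 27) * v $ 2]"
  "acc_deriv (rosette p $ 7 - rosette p $ 10) v =
    vector [((- 5 * sqrt 3) / 36) * v $ 1 + ((- 1) / 4) * v $ 2, ((- 1) / 4) * v $ 1 + ((sqrt 3) / 36) * v $ 2]"
  "acc_deriv (rosette p $ 7 - rosette p $ 11) v =
    vector [((2) / 27) * v $ 1 + ((- 2 * sqrt 3) / 9) * v $ 2, ((- 2 * sqrt 3) / 9) * v $ 1 + ((- 10) / 27) * v $ 2]"
  "acc_deriv (rosette p $ 7 - rosette p $ 12) v =
    vector [((8 * sqrt 3) / 9) * v $ 1 + 0 * v $ 2, 0 * v $ 1 + ((- 16 * sqrt 3) / 9) * v $ 2]"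
  "acc_deriv (rosette p $ 7 - rosette p $ 13) v =
    vector [((- 10 * sqrt 3) / 9) * v $ 1 + (- 2) * v $ 2, (- 2) * v $ 1 + ((2 * sqrt 3) / 9) * v $ 2]"
  unfolding rosette_nth zero_vec2 vec2_simps
  by ((rule acc_deriv_eval[where d = "1" and k = "(1)" and e = "(3)"]
      acc_deriv_eval[where d = "1/2" and k = "(8)" and e = "(96)"]
      acc_deriv_eval[where d = "3/2" and k = "((8) / 27)" and e = "((32) / 81)"]
      acc_deriv_eval[where d = "sqrt 3 / 2" and k = "((8 * sqrt 3) / 9)" and e = "((32 * sqrt 3) / 9)"]
      acc_deriv_eval[where d = "sqrt 3" and k = "((sqrt 3) / 9)" and e = "((sqrt 3) / 9)"]
      acc_deriv_eval[where d = "sqrt 7 / 2" and k = "((8 * sqrt 7) / 49)" and e = "((96 * sqrt 7) / 343)"];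
      (simp add: algebra_simps sqrt3_cancel; fail))+)

text \<open>In \<open>upos x y z t\<close> and \<open>uneg x y z t\<close> the radial and tangential displacements are \<open>x\<close>, \<open>y\<close> at the
  first body of the inner ring and \<open>z\<close>, \<open>t\<close> at the first body of the outer ring; along each ring they
  keep their sign (\<open>upos\<close>) or alternate in sign (\<open>uneg\<close>).\<close>

definition upos :: "real \<Rightarrow> real \<Rightarrow> real \<Rightarrow> real \<Rightarrow> config" where
  "upos x y z t = vector [
vector [(1) * x, (1) * y],
    vector [((1) / 2) * x + ((- sqrt 3) / 2) * y, ((sqrt 3) / 2) * x + ((1) / 2) * y],
    vector [((- 1) / 2) * x + ((- sqrt 3) / 2) * y, ((sqrt 3) / 2) * x + ((- 1) / 2) * y],
    vector [(- 1) * x, (- 1) * y],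
    vector [((- 1) / 2) * x + ((sqrt 3) / 2) * y, ((- sqrt 3) / 2) * x + ((- 1) / 2) * y],
    vector [((1) / 2) * x + ((sqrt 3) / 2) * y, ((- sqrt 3) / 2) * x + ((1) / 2) * y],
    vector [((sqrt 3) / 2) * z + ((- 1) / 2) * t, ((1) / 2) * z + ((sqrt 3) / 2) * t],
    vector [(- 1) * t, (1) * z],
    vector [((- sqrt 3) / 2) * z + ((- 1) / 2) * t, ((1) / 2) * z + ((- sqrt 3) / 2) * t],
    vector [((- sqrt 3) / 2) * z + ((1) / 2) * t, ((- 1) / 2) * z + ((- sqrt 3) / 2) * t],
    vector [(1) * t, (- 1) * z],
    vector [((sqrt 3) / 2) * z + ((1) / 2) * t, ((- 1) / 2) * z + ((sqrt 3) / 2) * t],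
    vector [0, 0]]"

lemma upos_nth:
  "upos x y z t $ 1 = vector [(1) * x, (1) * y]"
  "upos x y z t $ 2 = vector [((1) / 2) * x + ((- sqrt 3) / 2) * y, ((sqrt 3) / 2) * x + ((1) / 2) * y]"
  "upos x y z t $ 3 = vector [((- 1) / 2) * x + ((- sqrt 3) / 2) * y, ((sqrt 3) / 2) * x + ((- 1) / 2) * y]"
  "upos x y z t $ 4 = vector [(- 1) * x, (- 1) * y]"
  "upos x y z t $ 5 = vector [((- 1) / 2) * x + ((sqrt 3) / 2) * y, ((- sqrt 3) / 2) * x + ((- 1) / 2) * y]"
  "upos x y z t $ 6 = vector [((1) / 2) * x + ((sqrt 3) / 2) * y, ((- sqrt 3) / 2) * x + ((1) / 2) * y]"
  "upos x y z t $ 7 = vector [((sqrt 3) / 2) * z + ((- 1) / 2) * t, ((1) / 2) * z + ((sqrt 3) / 2) * t]"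
  "upos x y z t $ 8 = vector [(- 1) * t, (1) * z]"
  "upos x y z t $ 9 = vector [((- sqrt 3) / 2) * z + ((- 1) / 2) * t, ((1) / 2) * z + ((- sqrt 3) / 2) * t]"
  "upos x y z t $ 10 = vector [((- sqrt 3) / 2) * z + ((1) / 2) * t, ((- 1) / 2) * z + ((- sqrt 3) / 2) * t]"
  "upos x y z t $ 11 = vector [(1) * t, (- 1) * z]"
  "upos x y z t $ 12 = vector [((sqrt 3) / 2) * z + ((1) / 2) * t, ((- 1) / 2) * z + ((sqrt 3) / 2) * t]"
  "upos x y z t $ 13 = vector [0, 0]"
  unfolding upos_def by (simp_all only: vector_13)

definition uneg :: "real \<Rightarrow> real \<Rightarrow> real \<Rightarrow> real \<Rightarrow> config" where
  "uneg x y z t = vector [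
vector [(1) * x, (1) * y],
    vector [((- 1) / 2) * x + ((sqrt 3) / 2) * y, ((- sqrt 3) / 2) * x + ((- 1) / 2) * y],
    vector [((- 1) / 2) * x + ((- sqrt 3) / 2) * y, ((sqrt 3) / 2) * x + ((- 1) / 2) * y],
    vector [(1) * x, (1) * y],
    vector [((- 1) / 2) * x + ((sqrt 3) / 2) * y, ((- sqrt 3) / 2) * x + ((- 1) / 2) * y],
    vector [((- 1) / 2) * x + ((- sqrt 3) / 2) * y, ((sqrt 3) / 2) * x + ((- 1) / 2) * y],
    vector [((sqrt 3) / 2) * z + ((- 1) / 2) * t, ((1) / 2) * z + ((sqrt 3) / 2) * t],
    vector [(1) * t, (- 1) * z],
    vector [((- sqrt 3) / 2) * z + ((- 1) / 2) * t, ((1) / 2) * z + ((- sqrt 3) / 2) * t],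
    vector [((sqrt 3) / 2) * z + ((- 1) / 2) * t, ((1) / 2) * z + ((sqrt 3) / 2) * t],
    vector [(1) * t, (- 1) * z],
    vector [((- sqrt 3) / 2) * z + ((- 1) / 2) * t, ((1) / 2) * z + ((- sqrt 3) / 2) * t],
    vector [0, 0]]"

lemma uneg_nth:
  "uneg x y z t $ 1 = vector [(1) * x, (1) * y]"
  "uneg x y z t $ 2 = vector [((- 1) / 2) * x + ((sqrt 3) / 2) * y, ((- sqrt 3) / 2) * x + ((- 1) / 2) * y]"
  "uneg x y z t $ 3 = vector [((- 1) / 2) * x + ((- sqrt 3) / 2) * y, ((sqrt 3) / 2) * x + ((- 1) / 2) * y]"
  "uneg x y z t $ 4 = vector [(1) * x, (1) * y]"
  "uneg x y z t $ 5 = vector [((- 1) / 2) * x + ((sqrt 3) / 2) * y, ((- sqrt 3) / 2) * x + ((- 1) / 2) * y]"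
  "uneg x y z t $ 6 = vector [((- 1) / 2) * x + ((- sqrt 3) / 2) * y, ((sqrt 3) / 2) * x + ((- 1) / 2) * y]"
  "uneg x y z t $ 7 = vector [((sqrt 3) / 2) * z + ((- 1) / 2) * t, ((1) / 2) * z + ((sqrt 3) / 2) * t]"
  "uneg x y z t $ 8 = vector [(1) * t, (- 1) * z]"
  "uneg x y z t $ 9 = vector [((- sqrt 3) / 2) * z + ((- 1) / 2) * t, ((1) / 2) * z + ((- sqrt 3) / 2) * t]"
  "uneg x y z t $ 10 = vector [((sqrt 3) / 2) * z + ((- 1) / 2) * t, ((1) / 2) * z + ((sqrt 3) / 2) * t]"
  "uneg x y z t $ 11 = vector [(1) * t, (- 1) * z]"
  "uneg x y z t $ 12 = vector [((- sqrt 3) / 2) * z + ((- 1) / 2) * t, ((1) / 2) * z + ((- sqrt 3) / 2) * t]"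
  "uneg x y z t $ 13 = vector [0, 0]"
  unfolding uneg_def by (simp_all only: vector_13)

text \<open>This sum and the following ones group the sources into inner ring, outer ring and
  centre, because these carry the three different masses.\<close>

lemma acc_deriv_upos_1_inner:
  "acc_deriv (rosette p $ 1 - rosette p $ 2) (upos x y z t $ 1 - upos x y z t $ 2) +
   acc_deriv (rosette p $ 1 - rosette p $ 3) (upos x y z t $ 1 - upos x y z t $ 3) +
   acc_deriv (rosette p $ 1 - rosette p $ 4) (upos x y z t $ 1 - upos x y z t $ 4) +
   acc_deriv (rosette p $ 1 - rosette p $ 5) (upos x y z t $ 1 - upos x y z t $ 5) +
   acc_deriv (rosette p $ 1 - rosette p $ 6) (upos x y z t $ 1 - upos x y z t $ 6) =
   vector [((- 60 - 16 * sqrt 3) / 3) * x, ((30 + 8 * sqrt 3) / 3) * y]"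
  unfolding upos_nth acc_deriv_rosette_1 vec2_simps vector_2
  by (simp add: vec2_eq_iff algebra_simps sqrt3_cancel) (simp add: field_simps sqrt3_cancel)?

lemma acc_deriv_upos_1_outer:
  "acc_deriv (rosette p $ 1 - rosette p $ 7) (upos x y z t $ 1 - upos x y z t $ 7) +
   acc_deriv (rosette p $ 1 - rosette p $ 8) (upos x y z t $ 1 - upos x y z t $ 8) +
   acc_deriv (rosette p $ 1 - rosette p $ 9) (upos x y z t $ 1 - upos x y z t $ 9) +
   acc_deriv (rosette p $ 1 - rosette p $ 10) (upos x y z t $ 1 - upos x y z t $ 10) +
   acc_deriv (rosette p $ 1 - rosette p $ 11) (upos x y z t $ 1 - upos x y z t $ 11) +
   acc_deriv (rosette p $ 1 - rosette p $ 12) (upos x y z t $ 1 - upos x y z t $ 12) =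
   vector [((3087 - 376 * sqrt 7) / 686) * x + ((1715 * sqrt 3 - 248 * (sqrt 3 * sqrt 7)) / 686) * z, ((- 15435 + 152 * sqrt 7) / 686) * y + ((3773 * sqrt 3 + 136 * (sqrt 3 * sqrt 7)) / 686) * t]"
  unfolding upos_nth acc_deriv_rosette_1 vec2_simps vector_2
  by (simp add: vec2_eq_iff algebra_simps sqrt3_cancel) (simp add: field_simps sqrt3_cancel)?

lemma acc_deriv_upos_1_centre:
  "acc_deriv (rosette p $ 1 - rosette p $ 13) (upos x y z t $ 1 - upos x y z t $ 13) =
   vector [(- 16) * x, (8) * y]"
  unfolding upos_nth acc_deriv_rosette_1 vec2_simps vector_2
  by (simp add: vec2_eq_iff algebra_simps sqrt3_cancel) (simp add: field_simps sqrt3_cancel)?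

lemma acc_deriv_upos_7_inner:
  "acc_deriv (rosette p $ 7 - rosette p $ 1) (upos x y z t $ 7 - upos x y z t $ 1) +
   acc_deriv (rosette p $ 7 - rosette p $ 2) (upos x y z t $ 7 - upos x y z t $ 2) +
   acc_deriv (rosette p $ 7 - rosette p $ 3) (upos x y z t $ 7 - upos x y z t $ 3) +
   acc_deriv (rosette p $ 7 - rosette p $ 4) (upos x y z t $ 7 - upos x y z t $ 4) +
   acc_deriv (rosette p $ 7 - rosette p $ 5) (upos x y z t $ 7 - upos x y z t $ 5) +
   acc_deriv (rosette p $ 7 - rosette p $ 6) (upos x y z t $ 7 - upos x y z t $ 6) =
   vector [((5145 - 744 * sqrt 7) / 1372) * x + ((- 3773 * sqrt 3 - 136 * (sqrt 3 * sqrt 7)) / 1372) * y + ((- 15435 * sqrt 3 - 424 * (sqrt 3 * sqrt 7)) / 1372) * z + ((- 3087 - 200 * sqrt 7) / 1372) * t, ((1715 * sqrt 3 - 248 * (sqrt 3 * sqrt 7)) / 1372) * x + ((11319 + 408 * sqrt 7) / 1372) * y + ((- 15435 - 424 * sqrt 7) / 1372) * z + ((3087 * sqrt 3 + 200 * (sqrt 3 * sqrt 7)) / 1372) * t]"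
  unfolding upos_nth acc_deriv_rosette_7 vec2_simps vector_2
  by (simp add: vec2_eq_iff algebra_simps sqrt3_cancel) (simp add: field_simps sqrt3_cancel)?

lemma acc_deriv_upos_7_outer:
  "acc_deriv (rosette p $ 7 - rosette p $ 8) (upos x y z t $ 7 - upos x y z t $ 8) +
   acc_deriv (rosette p $ 7 - rosette p $ 9) (upos x y z t $ 7 - upos x y z t $ 9) +
   acc_deriv (rosette p $ 7 - rosette p $ 10) (upos x y z t $ 7 - upos x y z t $ 10) +
   acc_deriv (rosette p $ 7 - rosette p $ 11) (upos x y z t $ 7 - upos x y z t $ 11) +
   acc_deriv (rosette p $ 7 - rosette p $ 12) (upos x y z t $ 7 - upos x y z t $ 12) =
   vector [((- 30 - 8 * sqrt 3) / 9) * z + ((- 4 - 5 * sqrt 3) / 9) * t, ((- 8 - 10 * sqrt 3) / 9) * z + ((15 + 4 * sqrt 3) / 9) * t]"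
  unfolding upos_nth acc_deriv_rosette_7 vec2_simps vector_2
  by (simp add: vec2_eq_iff algebra_simps sqrt3_cancel) (simp add: field_simps sqrt3_cancel)?

lemma acc_deriv_upos_7_centre:
  "acc_deriv (rosette p $ 7 - rosette p $ 13) (upos x y z t $ 7 - upos x y z t $ 13) =
   vector [((- 8) / 3) * z + ((- 4 * sqrt 3) / 9) * t, ((- 8 * sqrt 3) / 9) * z + ((4) / 3) * t]"
  unfolding upos_nth acc_deriv_rosette_7 vec2_simps vector_2
  by (simp add: vec2_eq_iff algebra_simps sqrt3_cancel) (simp add: field_simps sqrt3_cancel)?

lemma acc_deriv_uneg_1_inner:
  "acc_deriv (rosette p $ 1 - rosette p $ 2) (uneg x y z t $ 1 - uneg x y z t $ 2) +
   acc_deriv (rosette p $ 1 - rosette p $ 3) (uneg x y z t $ 1 - uneg x y z t $ 3) +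
   acc_deriv (rosette p $ 1 - rosette p $ 4) (uneg x y z t $ 1 - uneg x y z t $ 4) +
   acc_deriv (rosette p $ 1 - rosette p $ 5) (uneg x y z t $ 1 - uneg x y z t $ 5) +
   acc_deriv (rosette p $ 1 - rosette p $ 6) (uneg x y z t $ 1 - uneg x y z t $ 6) =
   vector [((72 - 16 * sqrt 3) / 3) * x, ((- 144 + 8 * sqrt 3) / 3) * y]"
  unfolding uneg_nth acc_deriv_rosette_1 vec2_simps vector_2
  by (simp add: vec2_eq_iff algebra_simps sqrt3_cancel) (simp add: field_simps sqrt3_cancel)?

lemma acc_deriv_uneg_1_outer:
  "acc_deriv (rosette p $ 1 - rosette p $ 7) (uneg x y z t $ 1 - uneg x y z t $ 7) +
   acc_deriv (rosette p $ 1 - rosette p $ 8) (uneg x y z t $ 1 - uneg x y z t $ 8) +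
   acc_deriv (rosette p $ 1 - rosette p $ 9) (uneg x y z t $ 1 - uneg x y z t $ 9) +
   acc_deriv (rosette p $ 1 - rosette p $ 10) (uneg x y z t $ 1 - uneg x y z t $ 10) +
   acc_deriv (rosette p $ 1 - rosette p $ 11) (uneg x y z t $ 1 - uneg x y z t $ 11) +
   acc_deriv (rosette p $ 1 - rosette p $ 12) (uneg x y z t $ 1 - uneg x y z t $ 12) =
   vector [((3087 - 376 * sqrt 7) / 686) * x + ((13377 - 8 * sqrt 7) / 686) * t, ((- 15435 + 152 * sqrt 7) / 686) * y + ((17493 + 104 * sqrt 7) / 686) * z]"
  unfolding uneg_nth acc_deriv_rosette_1 vec2_simps vector_2
  by (simp add: vec2_eq_iff algebra_simps sqrt3_cancel) (simp add: field_simps sqrt3_cancel)?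

lemma acc_deriv_uneg_1_centre:
  "acc_deriv (rosette p $ 1 - rosette p $ 13) (uneg x y z t $ 1 - uneg x y z t $ 13) =
   vector [(- 16) * x, (8) * y]"
  unfolding uneg_nth acc_deriv_rosette_1 vec2_simps vector_2
  by (simp add: vec2_eq_iff algebra_simps sqrt3_cancel) (simp add: field_simps sqrt3_cancel)?

lemma acc_deriv_uneg_7_inner:
  "acc_deriv (rosette p $ 7 - rosette p $ 1) (uneg x y z t $ 7 - uneg x y z t $ 1) +
   acc_deriv (rosette p $ 7 - rosette p $ 2) (uneg x y z t $ 7 - uneg x y z t $ 2) +
   acc_deriv (rosette p $ 7 - rosette p $ 3) (uneg x y z t $ 7 - uneg x y z t $ 3) +
   acc_deriv (rosette p $ 7 - rosette p $ 4) (uneg x y z t $ 7 - uneg x y z t $ 4) +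
   acc_deriv (rosette p $ 7 - rosette p $ 5) (uneg x y z t $ 7 - uneg x y z t $ 5) +
   acc_deriv (rosette p $ 7 - rosette p $ 6) (uneg x y z t $ 7 - uneg x y z t $ 6) =
   vector [((- 13377 + 8 * sqrt 7) / 1372) * x + ((17493 * sqrt 3 + 104 * (sqrt 3 * sqrt 7)) / 1372) * y + ((- 15435 * sqrt 3 - 424 * (sqrt 3 * sqrt 7)) / 1372) * z + ((- 3087 - 200 * sqrt 7) / 1372) * t, ((13377 * sqrt 3 - 8 * (sqrt 3 * sqrt 7)) / 1372) * x + ((17493 + 104 * sqrt 7) / 1372) * y + ((- 15435 - 424 * sqrt 7) / 1372) * z + ((3087 * sqrt 3 + 200 * (sqrt 3 * sqrt 7)) / 1372) * t]"
  unfolding uneg_nth acc_deriv_rosette_7 vec2_simps vector_2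
  by (simp add: vec2_eq_iff algebra_simps sqrt3_cancel) (simp add: field_simps sqrt3_cancel)?

lemma acc_deriv_uneg_7_outer:
  "acc_deriv (rosette p $ 7 - rosette p $ 8) (uneg x y z t $ 7 - uneg x y z t $ 8) +
   acc_deriv (rosette p $ 7 - rosette p $ 9) (uneg x y z t $ 7 - uneg x y z t $ 9) +
   acc_deriv (rosette p $ 7 - rosette p $ 10) (uneg x y z t $ 7 - uneg x y z t $ 10) +
   acc_deriv (rosette p $ 7 - rosette p $ 11) (uneg x y z t $ 7 - uneg x y z t $ 11) +
   acc_deriv (rosette p $ 7 - rosette p $ 12) (uneg x y z t $ 7 - uneg x y z t $ 12) =
   vector [((36 - 8 * sqrt 3) / 9) * z + ((- 4 + 24 * sqrt 3) / 9) * t, ((- 8 + 12 * sqrt 3) / 9) * z + ((- 72 + 4 * sqrt 3) / 9) * t]"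
  unfolding uneg_nth acc_deriv_rosette_7 vec2_simps vector_2
  by (simp add: vec2_eq_iff algebra_simps sqrt3_cancel) (simp add: field_simps sqrt3_cancel)?

lemma acc_deriv_uneg_7_centre:
  "acc_deriv (rosette p $ 7 - rosette p $ 13) (uneg x y z t $ 7 - uneg x y z t $ 13) =
   vector [((- 8) / 3) * z + ((- 4 * sqrt 3) / 9) * t, ((- 8 * sqrt 3) / 9) * z + ((4) / 3) * t]"
  unfolding uneg_nth acc_deriv_rosette_7 vec2_simps vector_2
  by (simp add: vec2_eq_iff algebra_simps sqrt3_cancel) (simp add: field_simps sqrt3_cancel)?

lemma config_eq_iff: "(q :: config) = r \<longleftrightarrow> (\<forall>i. q $ i = r $ i)"
  by (rule Finite_Cartesian_Product.vec_eq_iff)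

section \<open>The eigenspaces of the rotation for the eigenvalues 1 and -1\<close>

lemma Rot_upos: "Rot (upos x y z t) = upos x y z t"
  unfolding config_eq_iff forall_13 Rot_def gact_nth rot_perm_simps upos_nth Phi_third vector_2
  by (simp add: vec2_eq_iff algebra_simps sqrt3_cancel)

lemma Rot_uneg: "Rot (uneg x y z t) = - uneg x y z t"
  unfolding config_eq_iff forall_13 Rot_def gact_nth rot_perm_simps uneg_nth Phi_third vector_2
    vector_uminus_component vec2_simps
  by (simp add: vec2_eq_iff algebra_simps sqrt3_cancel)

lemma Ref_upos: "Ref (upos x y z t) = upos x (- y) z (- t)"
  unfolding config_eq_iff forall_13 Ref_def gact_nth ref_perm_simps upos_nth mirror_def vector_2
  by (simp add: vec2_eq_iff algebra_simps)

lemma Ref_uneg: "Ref (uneg x y z t) = uneg x (- y) (- z) t"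
  unfolding config_eq_iff forall_13 Ref_def gact_nth ref_perm_simps uneg_nth mirror_def vector_2
  by (simp add: vec2_eq_iff algebra_simps)

lemma rosette_in_Omega: "rosette p \<in> Omega"
  unfolding Omega_def mem_Collect_eq forall_13 rosette_nth by (simp add: vec2_eq_iff)

lemma linear_hess: "linear (hess a b c l)"
  unfolding hess_def by (rule has_derivative_linear[OF has_derivative_force[OF rosette_in_Omega]])

text \<open>With \<open>tan7\<close>, the coordinates in the frame turned by pi/6, the polar angle
  of body 7.\<close>

definition rad7 :: "real^2 \<Rightarrow> real" where "rad7 v = sqrt 3 / 2 * v $ 1 + 1/2 * v $ 2"

definition tan7 :: "real^2 \<Rightarrow> real" where "tan7 v = - 1/2 * v $ 1 + sqrt 3 / 2 * v $ 2"

lemma frame7: "vector [sqrt 3 / 2 * rad7 v - 1/2 * tan7 v, 1/2 * rad7 v + sqrt 3 / 2 * tan7 v] = v"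
  by (simp add: rad7_def tan7_def vec2_eq_iff algebra_simps sqrt3_cancel)

text \<open>The eigenvalue equation transports the value at one body around its ring, so bodies 1
  and 7 determine both rings. The centre must vanish because a rotation by pi/3 has no real
  eigenvector.\<close>

lemma Rot_eigen_cases:
  assumes q: "Rot q = e *\<^sub>R q" and r: "Rot r = e *\<^sub>R r" and e: "e * e = 1"
    and eq: "q $ 1 = r $ 1" "q $ 7 = r $ 7"
  shows "q = r"
proof -
  have s: "v $ i = e *\<^sub>R (Phi (pi / 3) *v (v $ rot_perm i))" if "Rot v = e *\<^sub>R v" for v i
  proof -
    have "e *\<^sub>R (Rot v $ i) = (e * e) *\<^sub>R v $ i" using that by simp
    then show ?thesis using e by (simp add: Rot_def)
  qed
  have d: "q $ i = r $ i" if "q $ rot_perm i = r $ rot_perm i" for i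
    using s[OF q, of i] s[OF r, of i] that by simp
  have 13: "q $ 13 = r $ 13"
  proof -
    have z: "v = 0" if "v = e *\<^sub>R (Phi (pi / 3) *v v)" for v :: "real^2"
    proof -
      have "e = 1 \<or> e = - 1" using e square_eq_1_iff[of e] by simp
      moreover have "v $ 1 = e * (1/2 * v $ 1 - sqrt 3 / 2 * v $ 2)" "v $ 2 = e * (sqrt 3 / 2 * v $ 1 + 1/2 * v $ 2)"
        using that by (metis Phi_third vector_scaleR_component real_scaleR_def vector_2)+
      ultimately have "(v $ 1 + sqrt 3 * v $ 2 = 0 \<and> v $ 2 = sqrt 3 * v $ 1) \<or>
          (3 * v $ 1 = sqrt 3 * v $ 2 \<and> 3 * v $ 2 + sqrt 3 * v $ 1 = 0)" by auto
      then have "v $ 1 = 0 \<and> v $ 2 = 0"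
      proof
        assume h: "v $ 1 + sqrt 3 * v $ 2 = 0 \<and> v $ 2 = sqrt 3 * v $ 1"
        then have "v $ 1 + sqrt 3 * (sqrt 3 * v $ 1) = 0" by metis
        then show ?thesis using h by (simp add: sqrt3_cancel)
      next
        assume h: "3 * v $ 1 = sqrt 3 * v $ 2 \<and> 3 * v $ 2 + sqrt 3 * v $ 1 = 0"
        then have "v $ 2 = - (sqrt 3 * v $ 1) / 3" by simp
        then have "3 * v $ 1 = sqrt 3 * (- (sqrt 3 * v $ 1) / 3)" using h by metis
        then have "v $ 1 = 0" by (simp add: sqrt3_cancel)
        then show ?thesis using h by simp
      qed
      then show ?thesis by (simp add: vec2_eq_iff)
    qed
    show ?thesis using z[OF s[OF q, of 13, simplified]] z[OF s[OF r, of 13, simplified]] by simp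
  qed
  have 2: "q $ 2 = r $ 2" "q $ 8 = r $ 8" by (rule d; simp add: eq)+
  have 3: "q $ 3 = r $ 3" "q $ 9 = r $ 9" by (rule d; simp add: 2)+
  have 4: "q $ 4 = r $ 4" "q $ 10 = r $ 10" by (rule d; simp add: 3)+
  have 5: "q $ 5 = r $ 5" "q $ 11 = r $ 11" by (rule d; simp add: 4)+
  have 6: "q $ 6 = r $ 6" "q $ 12 = r $ 12" by (rule d; simp add: 5)+
  show ?thesis
    unfolding config_eq_iff forall_13 using eq 2 3 4 5 6 13 by blast
qed

lemma Rot_fixed_eq_upos:
  assumes "Rot q = q"
  shows "q = upos (q $ 1 $ 1) (q $ 1 $ 2) (rad7 (q $ 7)) (tan7 (q $ 7))"
proof (rule Rot_eigen_cases[where e = 1])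
  show "q $ 1 = upos (q $ 1 $ 1) (q $ 1 $ 2) (rad7 (q $ 7)) (tan7 (q $ 7)) $ 1"
    by (simp add: upos_nth vec2_eq_iff)
  show "q $ 7 = upos (q $ 1 $ 1) (q $ 1 $ 2) (rad7 (q $ 7)) (tan7 (q $ 7)) $ 7"
    using frame7[of "q $ 7"] by (simp add: upos_nth vec2_eq_iff)
qed (use assms in \<open>simp_all add: Rot_upos\<close>)

lemma Rot_neg_eq_uneg:
  assumes "Rot q = - q"
  shows "q = uneg (q $ 1 $ 1) (q $ 1 $ 2) (rad7 (q $ 7)) (tan7 (q $ 7))"
proof (rule Rot_eigen_cases[where e = "- 1"])
  show "q $ 1 = uneg (q $ 1 $ 1) (q $ 1 $ 2) (rad7 (q $ 7)) (tan7 (q $ 7)) $ 1"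
    by (simp add: uneg_nth vec2_eq_iff)
  show "q $ 7 = uneg (q $ 1 $ 1) (q $ 1 $ 2) (rad7 (q $ 7)) (tan7 (q $ 7)) $ 7"
    using frame7[of "q $ 7"] by (simp add: uneg_nth vec2_eq_iff)
qed (use assms in \<open>simp_all add: Rot_uneg\<close>)

lemma sum_ring_mass:
  fixes g :: "13 \<Rightarrow> 'a::real_vector"
  shows "(\<Sum>j\<in>UNIV. ring_mass a b c $ j *\<^sub>R g j) =
    a *\<^sub>R (g 1 + (g 2 + g 3 + g 4 + g 5 + g 6)) + b *\<^sub>R (g 7 + (g 8 + g 9 + g 10 + g 11 + g 12)) + c *\<^sub>R g 13"
  unfolding sum_13 ring_mass_nth by (simp add: scaleR_add_right add.assoc)

lemma sum_ring_mass_1: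
  fixes g :: "13 \<Rightarrow> 'a::real_vector"
  assumes "g 1 = 0"
  shows "(\<Sum>j\<in>UNIV. ring_mass a b c $ j *\<^sub>R g j) =
    a *\<^sub>R (g 2 + g 3 + g 4 + g 5 + g 6) + b *\<^sub>R (g 7 + g 8 + g 9 + g 10 + g 11 + g 12) + c *\<^sub>R g 13"
  unfolding sum_13 ring_mass_nth assms by (simp add: scaleR_add_right add.assoc)

lemma sum_ring_mass_7:
  fixes g :: "13 \<Rightarrow> 'a::real_vector"
  assumes "g 7 = 0"
  shows "(\<Sum>j\<in>UNIV. ring_mass a b c $ j *\<^sub>R g j) =
    a *\<^sub>R (g 1 + g 2 + g 3 + g 4 + g 5 + g 6) + b *\<^sub>R (g 8 + g 9 + g 10 + g 11 + g 12) + c *\<^sub>R g 13"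
  unfolding sum_13 ring_mass_nth assms by (simp add: scaleR_add_right add.assoc)

text \<open>Naming of the block entries: \<open>pos\<close> and \<open>neg\<close> refer to the
  eigenvalue 1 or -1 of \<open>Rot\<close>, \<open>rad\<close> and \<open>tan\<close> to the
  displacement of the inner ring, and the indices 1 and 2 to the inner and outer ring. The entries
  belong to the derivative of the force before weighting by masses, so the blocks are not
  symmetric.\<close>

definition pos_rad11 :: "real \<Rightarrow> real \<Rightarrow> real \<Rightarrow> real \<Rightarrow> real" where
  "pos_rad11 a b c l = l + ((60 + 16 * sqrt 3) / 3) * a + ((- 3087 + 376 * sqrt 7) / 686) * b + (16) * c"

definition pos_rad12 :: "real \<Rightarrow> real \<Rightarrow> real \<Rightarrow> real \<Rightarrow> real" where
  "pos_rad12 a b c l = ((- 1715 * sqrt 3 + 248 * (sqrt 3 * sqrt 7)) / 686) * b"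

definition pos_rad21 :: "real \<Rightarrow> real \<Rightarrow> real \<Rightarrow> real \<Rightarrow> real" where
  "pos_rad21 a b c l = ((- 1715 * sqrt 3 + 248 * (sqrt 3 * sqrt 7)) / 686) * a"

definition pos_rad22 :: "real \<Rightarrow> real \<Rightarrow> real \<Rightarrow> real \<Rightarrow> real" where
  "pos_rad22 a b c l = l + ((15435 + 424 * sqrt 7) / 686) * a + ((16 + 20 * sqrt 3) / 9) * b + ((16 * sqrt 3) / 9) * c"

definition pos_tan11 :: "real \<Rightarrow> real \<Rightarrow> real \<Rightarrow> real \<Rightarrow> real" where
  "pos_tan11 a b c l = l + ((- 30 - 8 * sqrt 3) / 3) * a + ((15435 - 152 * sqrt 7) / 686) * b + (- 8) * c"

definition pos_tan12 :: "real \<Rightarrow> real \<Rightarrow> real \<Rightarrow> real \<Rightarrow> real" where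
  "pos_tan12 a b c l = ((- 3773 * sqrt 3 - 136 * (sqrt 3 * sqrt 7)) / 686) * b"

definition pos_tan21 :: "real \<Rightarrow> real \<Rightarrow> real \<Rightarrow> real \<Rightarrow> real" where
  "pos_tan21 a b c l = ((- 3773 * sqrt 3 - 136 * (sqrt 3 * sqrt 7)) / 686) * a"

definition pos_tan22 :: "real \<Rightarrow> real \<Rightarrow> real \<Rightarrow> real \<Rightarrow> real" where
  "pos_tan22 a b c l = l + ((- 3087 - 200 * sqrt 7) / 686) * a + ((- 8 - 10 * sqrt 3) / 9) * b + ((- 8 * sqrt 3) / 9) * c"

text \<open>\<open>hess\<close> commutes with \<open>Rot\<close>, so the image is again an
  \<open>upos\<close> and can be read off at bodies 1 and 7. The decoupling of radial from
  tangential displacements reflects the symmetry under \<open>Ref\<close>.\<close>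

lemma hess_upos:
  "hess a b c l (upos x y z t) = upos
    (pos_rad11 a b c l * x + pos_rad12 a b c l * z)
    (pos_tan11 a b c l * y + pos_tan12 a b c l * t)
    (pos_rad21 a b c l * x + pos_rad22 a b c l * z)
    (pos_tan21 a b c l * y + pos_tan22 a b c l * t)"
proof -
  define q where "q = hess a b c l (upos x y z t)"
  have "Rot q = q"
    unfolding q_def using hess_Rot[of a b c l "upos x y z t"]
    by (simp add: Rot_upos linear_neg[OF linear_hess])
  then have q: "q = upos (q $ 1 $ 1) (q $ 1 $ 2) (rad7 (q $ 7)) (tan7 (q $ 7))" by (rule Rot_fixed_eq_upos)
  have q1: "q $ 1 = l *\<^sub>R upos x y z t $ 1 -
      (a *\<^sub>R vector [((- 60 - 16 * sqrt 3) / 3) * x, ((30 + 8 * sqrt 3) / 3) * y] +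
       b *\<^sub>R vector [((3087 - 376 * sqrt 7) / 686) * x + ((1715 * sqrt 3 - 248 * (sqrt 3 * sqrt 7)) / 686) * z, ((- 15435 + 152 * sqrt 7) / 686) * y + ((3773 * sqrt 3 + 136 * (sqrt 3 * sqrt 7)) / 686) * t] +
       c *\<^sub>R vector [(- 16) * x, (8) * y])"
    unfolding q_def hess_def force_deriv_def vec_lambda_beta
    by (subst sum_ring_mass_1) (simp_all only: acc_deriv_upos_1_inner acc_deriv_upos_1_outer acc_deriv_upos_1_centre diff_self acc_deriv_0)
  have q7: "q $ 7 = l *\<^sub>R upos x y z t $ 7 -
      (a *\<^sub>R vector [((5145 - 744 * sqrt 7) / 1372) * x + ((- 3773 * sqrt 3 - 136 * (sqrt 3 * sqrt 7)) / 1372) * y + ((- 15435 * sqrt 3 - 424 * (sqrt 3 * sqrt 7)) / 1372) * z + ((- 3087 - 200 * sqrt 7) / 1372) * t, ((1715 * sqrt 3 - 248 * (sqrt 3 * sqrt 7)) / 1372) * x + ((11319 + 408 * sqrt 7) / 1372) * y + ((- 15435 - 424 * sqrt 7) / 1372) * z + ((3087 * sqrt 3 + 200 * (sqrt 3 * sqrt 7)) / 1372) * t] +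
       b *\<^sub>R vector [((- 30 - 8 * sqrt 3) / 9) * z + ((- 4 - 5 * sqrt 3) / 9) * t, ((- 8 - 10 * sqrt 3) / 9) * z + ((15 + 4 * sqrt 3) / 9) * t] +
       c *\<^sub>R vector [((- 8) / 3) * z + ((- 4 * sqrt 3) / 9) * t, ((- 8 * sqrt 3) / 9) * z + ((4) / 3) * t])"
    unfolding q_def hess_def force_deriv_def vec_lambda_beta
    by (subst sum_ring_mass_7) (simp_all only: acc_deriv_upos_7_inner acc_deriv_upos_7_outer acc_deriv_upos_7_centre diff_self acc_deriv_0)
  have "q $ 1 $ 1 = pos_rad11 a b c l * x + pos_rad12 a b c l * z"
    unfolding q1 upos_nth vec2_simps vector_2 pos_rad11_def pos_rad12_def pos_rad21_def pos_rad22_def pos_tan11_def pos_tan12_def pos_tan21_def pos_tan22_def by (simp add: field_simps sqrt3_cancel)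
  moreover have "q $ 1 $ 2 = pos_tan11 a b c l * y + pos_tan12 a b c l * t"
    unfolding q1 upos_nth vec2_simps vector_2 pos_rad11_def pos_rad12_def pos_rad21_def pos_rad22_def pos_tan11_def pos_tan12_def pos_tan21_def pos_tan22_def by (simp add: field_simps sqrt3_cancel)
  moreover have "rad7 (q $ 7) = pos_rad21 a b c l * x + pos_rad22 a b c l * z"
    unfolding q7 upos_nth vec2_simps vector_2 rad7_def pos_rad11_def pos_rad12_def pos_rad21_def pos_rad22_def pos_tan11_def pos_tan12_def pos_tan21_def pos_tan22_def by (simp add: field_simps sqrt3_cancel)
  moreover have "tan7 (q $ 7) = pos_tan21 a b c l * y + pos_tan22 a b c l * t"
    unfolding q7 upos_nth vec2_simps vector_2 tan7_def pos_rad11_def pos_rad12_def pos_rad21_def pos_rad22_def pos_tan11_def pos_tan12_def pos_tan21_def pos_tan22_def by (simp add: field_simps sqrt3_cancel)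
  ultimately show ?thesis using q by (simp only: q_def[symmetric])
qed

text \<open>For alternating displacements the reflection preserves \<open>uneg x 0 0 t\<close> (see
  \<open>Ref_uneg\<close>), so the radial displacement of the inner ring is coupled with the
  tangential one of the outer ring.\<close>

definition neg_rad11 :: "real \<Rightarrow> real \<Rightarrow> real \<Rightarrow> real \<Rightarrow> real" where
  "neg_rad11 a b c l = l + ((- 72 + 16 * sqrt 3) / 3) * a + ((- 3087 + 376 * sqrt 7) / 686) * b + (16) * c"

definition neg_rad12 :: "real \<Rightarrow> real \<Rightarrow> real \<Rightarrow> real \<Rightarrow> real" where
  "neg_rad12 a b c l = ((- 13377 + 8 * sqrt 7) / 686) * b"

definition neg_rad21 :: "real \<Rightarrow> real \<Rightarrow> real \<Rightarrow> real \<Rightarrow> real" where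
  "neg_rad21 a b c l = ((- 13377 + 8 * sqrt 7) / 686) * a"

definition neg_rad22 :: "real \<Rightarrow> real \<Rightarrow> real \<Rightarrow> real \<Rightarrow> real" where
  "neg_rad22 a b c l = l + ((- 3087 - 200 * sqrt 7) / 686) * a + ((- 8 + 48 * sqrt 3) / 9) * b + ((- 8 * sqrt 3) / 9) * c"

definition neg_tan11 :: "real \<Rightarrow> real \<Rightarrow> real \<Rightarrow> real \<Rightarrow> real" where
  "neg_tan11 a b c l = l + ((144 - 8 * sqrt 3) / 3) * a + ((15435 - 152 * sqrt 7) / 686) * b + (- 8) * c"

definition neg_tan12 :: "real \<Rightarrow> real \<Rightarrow> real \<Rightarrow> real \<Rightarrow> real" where
  "neg_tan12 a b c l = ((- 17493 - 104 * sqrt 7) / 686) * b"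

definition neg_tan21 :: "real \<Rightarrow> real \<Rightarrow> real \<Rightarrow> real \<Rightarrow> real" where
  "neg_tan21 a b c l = ((- 17493 - 104 * sqrt 7) / 686) * a"

definition neg_tan22 :: "real \<Rightarrow> real \<Rightarrow> real \<Rightarrow> real \<Rightarrow> real" where
  "neg_tan22 a b c l = l + ((15435 + 424 * sqrt 7) / 686) * a + ((16 - 24 * sqrt 3) / 9) * b + ((16 * sqrt 3) / 9) * c"

lemma hess_uneg:
  "hess a b c l (uneg x y z t) = uneg
    (neg_rad11 a b c l * x + neg_rad12 a b c l * t)
    (neg_tan11 a b c l * y + neg_tan12 a b c l * z)
    (neg_tan21 a b c l * y + neg_tan22 a b c l * z)
    (neg_rad21 a b c l * x + neg_rad22 a b c l * t)"
proof -
  define q where "q = hess a b c l (uneg x y z t)"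
  have "Rot q = - q"
    unfolding q_def using hess_Rot[of a b c l "uneg x y z t"]
    by (simp add: Rot_uneg linear_neg[OF linear_hess])
  then have q: "q = uneg (q $ 1 $ 1) (q $ 1 $ 2) (rad7 (q $ 7)) (tan7 (q $ 7))" by (rule Rot_neg_eq_uneg)
  have q1: "q $ 1 = l *\<^sub>R uneg x y z t $ 1 -
      (a *\<^sub>R vector [((72 - 16 * sqrt 3) / 3) * x, ((- 144 + 8 * sqrt 3) / 3) * y] +
       b *\<^sub>R vector [((3087 - 376 * sqrt 7) / 686) * x + ((13377 - 8 * sqrt 7) / 686) * t, ((- 15435 + 152 * sqrt 7) / 686) * y + ((17493 + 104 * sqrt 7) / 686) * z] +
       c *\<^sub>R vector [(- 16) * x, (8) * y])"
    unfolding q_def hess_def force_deriv_def vec_lambda_beta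
    by (subst sum_ring_mass_1) (simp_all only: acc_deriv_uneg_1_inner acc_deriv_uneg_1_outer acc_deriv_uneg_1_centre diff_self acc_deriv_0)
  have q7: "q $ 7 = l *\<^sub>R uneg x y z t $ 7 -
      (a *\<^sub>R vector [((- 13377 + 8 * sqrt 7) / 1372) * x + ((17493 * sqrt 3 + 104 * (sqrt 3 * sqrt 7)) / 1372) * y + ((- 15435 * sqrt 3 - 424 * (sqrt 3 * sqrt 7)) / 1372) * z + ((- 3087 - 200 * sqrt 7) / 1372) * t, ((13377 * sqrt 3 - 8 * (sqrt 3 * sqrt 7)) / 1372) * x + ((17493 + 104 * sqrt 7) / 1372) * y + ((- 15435 - 424 * sqrt 7) / 1372) * z + ((3087 * sqrt 3 + 200 * (sqrt 3 * sqrt 7)) / 1372) * t] +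
       b *\<^sub>R vector [((36 - 8 * sqrt 3) / 9) * z + ((- 4 + 24 * sqrt 3) / 9) * t, ((- 8 + 12 * sqrt 3) / 9) * z + ((- 72 + 4 * sqrt 3) / 9) * t] +
       c *\<^sub>R vector [((- 8) / 3) * z + ((- 4 * sqrt 3) / 9) * t, ((- 8 * sqrt 3) / 9) * z + ((4) / 3) * t])"
    unfolding q_def hess_def force_deriv_def vec_lambda_beta
    by (subst sum_ring_mass_7) (simp_all only: acc_deriv_uneg_7_inner acc_deriv_uneg_7_outer acc_deriv_uneg_7_centre diff_self acc_deriv_0)
  have "q $ 1 $ 1 = neg_rad11 a b c l * x + neg_rad12 a b c l * t"
    unfolding q1 uneg_nth vec2_simps vector_2 neg_rad11_def neg_rad12_def neg_rad21_def neg_rad22_def neg_tan11_def neg_tan12_def neg_tan21_def neg_tan22_def by (simp add: field_simps sqrt3_cancel)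
  moreover have "q $ 1 $ 2 = neg_tan11 a b c l * y + neg_tan12 a b c l * z"
    unfolding q1 uneg_nth vec2_simps vector_2 neg_rad11_def neg_rad12_def neg_rad21_def neg_rad22_def neg_tan11_def neg_tan12_def neg_tan21_def neg_tan22_def by (simp add: field_simps sqrt3_cancel)
  moreover have "rad7 (q $ 7) = neg_tan21 a b c l * y + neg_tan22 a b c l * z"
    unfolding q7 uneg_nth vec2_simps vector_2 rad7_def neg_rad11_def neg_rad12_def neg_rad21_def neg_rad22_def neg_tan11_def neg_tan12_def neg_tan21_def neg_tan22_def by (simp add: field_simps sqrt3_cancel)
  moreover have "tan7 (q $ 7) = neg_rad21 a b c l * x + neg_rad22 a b c l * t"
    unfolding q7 uneg_nth vec2_simps vector_2 tan7_def neg_rad11_def neg_rad12_def neg_rad21_def neg_rad22_def neg_tan11_def neg_tan12_def neg_tan21_def neg_tan22_def by (simp add: field_simps sqrt3_cancel)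
  ultimately show ?thesis using q by (simp only: q_def[symmetric])
qed

section \<open>Central configurations and signs of the blocks\<close>

text \<open>The product of the two roots is bounded separately because linear arithmetic treats it
  as a further atom.\<close>

lemma sqrt_bounds:
  "17320508/10000000 < sqrt 3" "sqrt 3 < 17320509/10000000"
  "26457513/10000000 < sqrt 7" "sqrt 7 < 26457514/10000000"
  "45825756/10000000 < sqrt 3 * sqrt 7" "sqrt 3 * sqrt 7 < 45825757/10000000"
proof -
  have eq: "sqrt 3 * sqrt 7 = sqrt 21" by (simp add: real_sqrt_mult[symmetric])
  show "17320508/10000000 < sqrt 3" "26457513/10000000 < sqrt 7" "45825756/10000000 < sqrt 3 * sqrt 7"
    unfolding eq by (rule real_less_rsqrt, simp add: power2_eq_square)+
  show "sqrt 3 < 17320509/10000000" "sqrt 7 < 26457514/10000000" "sqrt 3 * sqrt 7 < 45825757/10000000"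
    unfolding eq by (rule real_less_lsqrt; simp add: power2_eq_square)+
qed

lemma sqrt_mult_bounds:
  assumes "x \<ge> (0::real)"
  shows "17320508/10000000 * x \<le> sqrt 3 * x" "sqrt 3 * x \<le> 17320509/10000000 * x"
    "26457513/10000000 * x \<le> sqrt 7 * x" "sqrt 7 * x \<le> 26457514/10000000 * x"
    "45825756/10000000 * x \<le> sqrt 3 * sqrt 7 * x" "sqrt 3 * sqrt 7 * x \<le> 45825757/10000000 * x"
  by (intro mult_right_mono assms less_imp_le sqrt_bounds)+

definition m2_den :: real where
  "m2_den = - 1862 * sqrt 3 - 7203 + 810 * sqrt 7 + 90 * sqrt 7 * sqrt 3"

lemma m2_den_bounds: "- 7873 < m2_den" "m2_den < - 7872"
  using sqrt_bounds unfolding m2_den_def by (simp_all add: mult.commute mult.left_commute)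

lemma m2_mult_den:
  "m2 p * m2_den = - 7644 * fst p + 6 * (81 * sqrt 7 - 441 * sqrt 3 + 9 * sqrt 3 * sqrt 7 - 147) * snd p"
proof -
  have "m2 p = (- 7644 * fst p + 6 * (81 * sqrt 7 - 441 * sqrt 3 + 9 * sqrt 3 * sqrt 7 - 147) * snd p) / m2_den"
    by (cases p) (simp only: m2_def m2_den_def prod.case fst_conv snd_conv)
  then show ?thesis using m2_den_bounds by simp
qed

lemma m2_linear: "m2 p = m2 (1, 0) * fst p + m2 (0, 1) * snd p"
proof -
  have "(m2 (1, 0) * fst p + m2 (0, 1) * snd p) * m2_den = (m2 (1, 0) * m2_den) * fst p + (m2 (0, 1) * m2_den) * snd p"
    by (simp add: algebra_simps)
  also have "\<dots> = m2 p * m2_den" unfolding m2_mult_den by (simp add: algebra_simps)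
  finally show ?thesis using m2_den_bounds by simp
qed

text \<open>This is the equilibrium condition at body 7 when the multiplier is \<open>lamf\<close>.
  Since 9 + sqrt 3 times the coefficient of \<open>m2 p\<close> equals 4 \<open>m2_den\<close>,
  multiplying by 9 + sqrt 3 reduces it to the defining formula of \<open>m2\<close>.\<close>

lemma m2_relation:
  "m2 p * (360 * sqrt 7 - 490 * sqrt 3 - 3038) =
    (392 * sqrt 3 - 3528) * fst p + (216 * sqrt 7 - 1176 * sqrt 3) * snd p" (is "?l = ?r")
proof -
  have "(9 + sqrt 3) * (?l - ?r) = 4 * (m2 p * m2_den) - (9 + sqrt 3) * ?r"
    by (simp add: m2_den_def algebra_simps sqrt3_cancel)
  also have "\<dots> = 0" unfolding m2_mult_den by (simp add: algebra_simps sqrt3_cancel)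
  finally have "9 + sqrt 3 = 0 \<or> ?l - ?r = 0" by simp
  moreover have "9 + sqrt 3 \<noteq> 0" using sqrt_bounds by linarith
  ultimately show ?thesis by simp
qed

lemma m2_bounds:
  assumes "fst p \<ge> 0" "snd p \<ge> 0"
  shows "97/100 * fst p + 4994/10000 * snd p \<le> m2 p" "m2 p \<le> 971/1000 * fst p + 4995/10000 * snd p"
proof -
  note b = sqrt_mult_bounds[OF assms(1)] sqrt_mult_bounds[OF assms(2)]
  have 1: "m2 p * (- m2_den) = 7644 * fst p - 486 * (sqrt 7 * snd p) + 2646 * (sqrt 3 * snd p)
      - 54 * (sqrt 3 * sqrt 7 * snd p) + 882 * snd p"
    using m2_mult_den[of p] by (simp add: algebra_simps)
  have 2: "(x * fst p + y * snd p) * (- m2_den) = x * (1862 * (sqrt 3 * fst p) + 7203 * fst p - 810 * (sqrt 7 * fst p) - 90 * (sqrt 3 * sqrt 7 * fst p))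
    + y * (1862 * (sqrt 3 * snd p) + 7203 * snd p - 810 * (sqrt 7 * snd p) - 90 * (sqrt 3 * sqrt 7 * snd p))" for x y
    by (simp add: m2_den_def algebra_simps)
  have "(97/100 * fst p + 4994/10000 * snd p) * (- m2_den) \<le> m2 p * (- m2_den)"
    unfolding 1 2 using b assms by argo
  then show "97/100 * fst p + 4994/10000 * snd p \<le> m2 p" using m2_den_bounds by simp
  have "m2 p * (- m2_den) \<le> (971/1000 * fst p + 4995/10000 * snd p) * (- m2_den)"
    unfolding 1 2 using b assms by argo
  then show "m2 p \<le> 971/1000 * fst p + 4995/10000 * snd p" using m2_den_bounds by simp
qed

text \<open>The multiplier that balances the force on body 1. It is linear in the parameters and
  agrees on the quadrant with the quotient \<open>lam\<close> (\<open>lam_eq_lamf\<close>).\<close>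

definition lamf :: "real \<times> real \<Rightarrow> real" where
  "lamf p = 8 * fst p + (10 + 8/3 * sqrt 3) * snd p + (40/49 * sqrt 7 - 6) * m2 p"

abbreviation entry :: "(real \<Rightarrow> real \<Rightarrow> real \<Rightarrow> real \<Rightarrow> real) \<Rightarrow> real \<times> real \<Rightarrow> real" where
  "entry k p \<equiv> k (snd p) (m2 p) (fst p) (lamf p)"

lemma lamf_linear: "lamf p = lamf (1, 0) * fst p + lamf (0, 1) * snd p"
  unfolding lamf_def m2_linear[of p] by (simp add: algebra_simps)

definition mass :: "real \<times> real \<Rightarrow> real^13" where
  "mass p = ring_mass (snd p) (m2 p) (fst p)"

definition pforce :: "real \<times> real \<Rightarrow> config \<Rightarrow> config" where
  "pforce p = force (mass p) (lamf p)"

definition phess :: "real \<times> real \<Rightarrow> config \<Rightarrow> config" where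
  "phess p = hess (snd p) (m2 p) (fst p) (lamf p)"

text \<open>Rotation invariance leaves only bodies 1 and 7 to check: the first is settled by the
  choice of \<open>lamf\<close>, the second by \<open>m2_relation\<close>.\<close>

lemma central_configuration: "pforce p (rosette p') = 0"
proof -
  define q where "q = pforce p (rosette p')"
  have "Rot q = q"
    unfolding q_def pforce_def mass_def
    using force_Rot[of "snd p" "m2 p" "fst p" "lamf p" "rosette p'"] by (simp add: Rot_rosette)
  then have q: "q = upos (q $ 1 $ 1) (q $ 1 $ 2) (rad7 (q $ 7)) (tan7 (q $ 7))" by (rule Rot_fixed_eq_upos)
  have "q $ 1 = 0"
    unfolding q_def pforce_def mass_def force_def vec_lambda_beta
    by (subst sum_ring_mass_1, simp, simp only: acc_rosette_1, simp only: rosette_nth(1) vec2_simps, simp add: lamf_def vec2_eq_iff field_simps)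
  moreover have "q $ 7 = 0"
  proof -
    have "q $ 7 = ((m2 p * (360 * sqrt 7 - 490 * sqrt 3 - 3038) -
      ((392 * sqrt 3 - 3528) * fst p + (216 * sqrt 7 - 1176 * sqrt 3) * snd p)) / 441) *\<^sub>R rosette p' $ 7"
      unfolding q_def pforce_def mass_def force_def vec_lambda_beta
      by (subst sum_ring_mass_7, simp, simp only: acc_rosette_7, simp only: rosette_nth(7) vec2_simps, simp add: lamf_def vec2_eq_iff field_simps sqrt3_cancel)
    then show ?thesis unfolding m2_relation by simp
  qed
  ultimately have "q = upos 0 0 0 0" using q by (simp add: rad7_def tan7_def)
  also have "\<dots> = 0" unfolding config_eq_iff forall_13 upos_nth by (simp add: vec2_eq_iff)
  finally show ?thesis by (simp add: q_def)
qed

lemma mass_pos: "p \<in> quadrant \<Longrightarrow> 0 < mass p $ i"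
proof -
  assume p: "p \<in> quadrant"
  then have "fst p > 0" "snd p > 0" by (auto simp: quadrant_def)
  moreover from this have "m2 p > 0"
    using m2_bounds[of p] by linarith
  ultimately have "\<forall>i. 0 < mass p $ i"
    unfolding forall_13 mass_def ring_mass_nth by blast
  then show ?thesis by blast
qed

lemma rosette_mass_mass: "rosette_mass p = mass p"
  by (simp add: rosette_mass_eq mass_def)

text \<open>Euler's identity: pairing the vanishing force with the weighted position gives 2 I times
  the multiplier minus U, since U is homogeneous of degree -1. The moment of inertia is positive
  because the masses are.\<close>

lemma lam_eq_lamf:
  assumes "p \<in> quadrant"
  shows "lam p = lamf p"
proof -
  define q where "q = rosette p"
  define \<mu> where "\<mu> = mass p"
  have acc_in: "inner (acc z) z = 1 / norm z" for z
    by (cases "z = 0") (simp_all add: acc_def dot_square_norm power2_eq_square power3_eq_cube)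
  have sw: "(\<Sum>i\<in>UNIV. \<Sum>j\<in>UNIV. \<mu> $ i * \<mu> $ j * inner (acc (q $ i - q $ j)) (q $ j)) =
      - (\<Sum>i\<in>UNIV. \<Sum>j\<in>UNIV. \<mu> $ i * \<mu> $ j * inner (acc (q $ i - q $ j)) (q $ i))"
  proof -
    have "(\<Sum>i\<in>UNIV. \<Sum>j\<in>UNIV. \<mu> $ i * \<mu> $ j * inner (acc (q $ i - q $ j)) (q $ j)) =
        (\<Sum>i\<in>UNIV. \<Sum>j\<in>UNIV. \<mu> $ j * \<mu> $ i * inner (acc (q $ j - q $ i)) (q $ i))"
      by (rule sum.swap)
    also have "\<dots> = (\<Sum>i\<in>UNIV. \<Sum>j\<in>UNIV. - (\<mu> $ i * \<mu> $ j * inner (acc (q $ i - q $ j)) (q $ i)))"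
      by (intro sum.cong refl) (metis (no_types) acc_minus inner_minus_left minus_diff_eq mult.commute mult_minus_right)
    finally show ?thesis by (simp add: sum_negf)
  qed
  have U: "newton_U q \<mu> = (\<Sum>i\<in>UNIV. \<Sum>j\<in>UNIV. \<mu> $ i * \<mu> $ j * inner (acc (q $ i - q $ j)) (q $ i))"
  proof -
    have "2 * newton_U q \<mu> = (\<Sum>i\<in>UNIV. \<Sum>j\<in>UNIV. \<mu> $ i * \<mu> $ j * inner (acc (q $ i - q $ j)) (q $ i - q $ j))"
      unfolding newton_U_sym acc_in by simp
    also have "\<dots> = (\<Sum>i\<in>UNIV. \<Sum>j\<in>UNIV. \<mu> $ i * \<mu> $ j * inner (acc (q $ i - q $ j)) (q $ i)) -
       (\<Sum>i\<in>UNIV. \<Sum>j\<in>UNIV. \<mu> $ i * \<mu> $ j * inner (acc (q $ i - q $ j)) (q $ j))"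
      by (simp add: sum_subtractf[symmetric] inner_diff_right algebra_simps)
    finally show ?thesis unfolding sw by simp
  qed
  have I: "2 * inertia q \<mu> = (\<Sum>j\<in>UNIV. \<mu> $ j * (norm (q $ j))\<^sup>2)" by (simp add: inertia_def)
  have "0 = (\<Sum>i\<in>UNIV. \<mu> $ i * inner (pforce p q $ i) (q $ i))"
    by (simp add: central_configuration q_def)
  also have "\<dots> = lamf p * (2 * inertia q \<mu>) - newton_U q \<mu>"
    unfolding pforce_def force_def \<mu>_def[symmetric] U I
    by (simp add: inner_diff_left inner_sum_left sum_distrib_left sum_subtractf[symmetric]
        power2_norm_eq_inner algebra_simps)
  finally have eq: "newton_U q \<mu> = lamf p * (2 * inertia q \<mu>)" by simp
  have "0 < \<mu> $ 1 * (norm (q $ 1))\<^sup>2"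
    using mass_pos[OF assms, of 1] by (simp add: \<mu>_def q_def rosette_nth vec2_eq_iff zero_vec2)
  also have "\<dots> \<le> (\<Sum>j\<in>UNIV. \<mu> $ j * (norm (q $ j))\<^sup>2)"
    using mass_pos[OF assms] by (intro member_le_sum) (auto simp: \<mu>_def less_imp_le)
  finally have "2 * inertia q \<mu> \<noteq> 0" unfolding I by simp
  then show ?thesis unfolding lam_def rosette_mass_mass using eq by (simp add: q_def \<mu>_def)
qed

section \<open>Signs of the two by two blocks\<close>

lemma pos_rad11_expand:
  "pos_rad11 a b c l = (20/1) * (a) + (16/3) * (sqrt 3 * a) + (-9/2) * (b) + (188/343) * (sqrt 7 * b) + (16/1) * (c) + l"
  by (simp add: pos_rad11_def field_simps)

lemma pos_rad22_expand:
  "pos_rad22 a b c l = (45/2) * (a) + (212/343) * (sqrt 7 * a) + (16/9) * (b) + (20/9) * (sqrt 3 * b) + (16/9) * (sqrt 3 * c) + l"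
  by (simp add: pos_rad22_def field_simps)

lemma neg_rad11_expand:
  "neg_rad11 a b c l = (-24/1) * (a) + (16/3) * (sqrt 3 * a) + (-9/2) * (b) + (188/343) * (sqrt 7 * b) + (16/1) * (c) + l"
  by (simp add: neg_rad11_def field_simps)

lemma neg_rad22_expand:
  "neg_rad22 a b c l = (-9/2) * (a) + (-100/343) * (sqrt 7 * a) + (-8/9) * (b) + (16/3) * (sqrt 3 * b) + (-8/9) * (sqrt 3 * c) + l"
  by (simp add: neg_rad22_def field_simps)

lemma neg_tan11_expand:
  "neg_tan11 a b c l = (48/1) * (a) + (-8/3) * (sqrt 3 * a) + (45/2) * (b) + (-76/343) * (sqrt 7 * b) + (-8/1) * (c) + l"
  by (simp add: neg_tan11_def field_simps)

lemma neg_tan22_expand: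
  "neg_tan22 a b c l = (45/2) * (a) + (212/343) * (sqrt 7 * a) + (16/9) * (b) + (-8/3) * (sqrt 3 * b) + (16/9) * (sqrt 3 * c) + l"
  by (simp add: neg_tan22_def field_simps)

text \<open>The letters \<open>a\<close> and \<open>b\<close> stand for the eigenvalue 1 or -1 of
  \<open>Rot\<close>, the digits 1 and 2 for symmetric or antisymmetric under \<open>Ref\<close>.
  The remaining block, tangential for the eigenvalue 1, is singular because of the rotations;
  \<open>zeta\<close> takes its place.\<close>

definition b1_det :: "real \<times> real \<Rightarrow> real" where
  "b1_det p = entry neg_rad11 p * entry neg_rad22 p -
    entry neg_rad12 p * entry neg_rad21 p"

definition b2_det :: "real \<times> real \<Rightarrow> real" where
  "b2_det p = entry neg_tan11 p * entry neg_tan22 p -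
    entry neg_tan12 p * entry neg_tan21 p"

definition a1_det :: "real \<times> real \<Rightarrow> real" where
  "a1_det p = entry pos_rad11 p * entry pos_rad22 p -
    entry pos_rad12 p * entry pos_rad21 p"

lemma lamf_expand:
  "lamf p = 8 * fst p + 10 * snd p + 8/3 * (sqrt 3 * snd p) + 40/49 * (sqrt 7 * m2 p) - 6 * m2 p"
  by (simp add: lamf_def algebra_simps)

lemma block_bounds:
  assumes "fst p \<ge> 0" "snd p \<ge> 0"
  shows "17 * fst p + 40 * snd p \<le> entry pos_rad11 p"
    "12 * fst p + 39 * snd p \<le> entry pos_rad22 p"
    "35/2 * fst p + 67 * snd p \<le> entry neg_tan11 p"
    "45/10 * fst p + 35 * snd p \<le> entry neg_tan22 p"
    "173/10 * fst p - 36/10 * snd p \<le> entry neg_rad11 p"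
    "entry neg_rad11 p \<le> 174/10 * fst p - 35/10 * snd p"
    "108/10 * fst p + 115/10 * snd p \<le> entry neg_rad22 p"
    "entry neg_rad22 p \<le> 109/10 * fst p + 117/10 * snd p"
proof -
  have m: "m2 p \<ge> 0" using m2_bounds[OF assms] assms by linarith
  note b = sqrt_mult_bounds[OF assms(1)] sqrt_mult_bounds[OF assms(2)] sqrt_mult_bounds[OF m]
    m2_bounds[OF assms]
  show "17 * fst p + 40 * snd p \<le> entry pos_rad11 p"
    "12 * fst p + 39 * snd p \<le> entry pos_rad22 p"
    "35/2 * fst p + 67 * snd p \<le> entry neg_tan11 p"
    "45/10 * fst p + 35 * snd p \<le> entry neg_tan22 p"
    "173/10 * fst p - 36/10 * snd p \<le> entry neg_rad11 p"
    "entry neg_rad11 p \<le> 174/10 * fst p - 35/10 * snd p"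
    "108/10 * fst p + 115/10 * snd p \<le> entry neg_rad22 p"
    "entry neg_rad22 p \<le> 109/10 * fst p + 117/10 * snd p"
    unfolding pos_rad11_expand pos_rad22_expand neg_tan11_expand neg_tan22_expand
      neg_rad11_expand neg_rad22_expand lamf_expand
    using b assms by linarith+
qed

lemma off_diagonal:
  "pos_rad12 a b c l = (- 1715 * sqrt 3 + 248 * (sqrt 3 * sqrt 7)) / 686 * b"
  "pos_rad21 a b c l = (- 1715 * sqrt 3 + 248 * (sqrt 3 * sqrt 7)) / 686 * a"
  "neg_tan12 a b c l = (- 17493 - 104 * sqrt 7) / 686 * b"
  "neg_tan21 a b c l = (- 17493 - 104 * sqrt 7) / 686 * a"
  "neg_rad12 a b c l = (- 13377 + 8 * sqrt 7) / 686 * b"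
  "neg_rad21 a b c l = (- 13377 + 8 * sqrt 7) / 686 * a"
  by (simp_all add: pos_rad12_def pos_rad21_def neg_tan12_def neg_tan21_def neg_rad12_def neg_rad21_def)

lemma product_le:
  fixes k :: real
  assumes "\<bar>k\<bar> \<le> r" "a \<ge> 0" "b \<ge> 0" "b \<le> B"
  shows "(k * b) * (k * a) \<le> r * r * (a * B)"
proof -
  have "k * k \<le> r * r" using assms(1) abs_le_square_iff[of k r] by (simp add: power2_eq_square)
  moreover have "b * a \<le> a * B" using mult_left_mono[OF assms(4,2)] by (simp add: mult.commute)
  moreover have "0 \<le> b * a" using assms by simp
  ultimately have "(k * k) * (b * a) \<le> (r * r) * (a * B)" by - (rule mult_mono; simp)
  then show ?thesis by (simp add: mult_ac)
qed

text \<open>The diagonal dominates: the quadratic form bounding the product of the off-diagonal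
  entries is smaller, coefficient by coefficient, than the product of the linear bounds for the
  diagonal. The same works for \<open>b2_det\<close>.\<close>

lemma a1_det_pos: assumes "p \<in> quadrant" shows "a1_det p > 0"
proof -
  have p: "fst p > 0" "snd p > 0" using assms by (auto simp: quadrant_def)
  then have p': "fst p \<ge> 0" "snd p \<ge> 0" by auto
  note B = block_bounds[OF p'] m2_bounds[OF p']
  have m: "0 \<le> m2 p" using B p by linarith
  have "\<bar>(- 1715 * sqrt 3 + 248 * (sqrt 3 * sqrt 7)) / 686\<bar> \<le> (27/10::real)"
    using sqrt_bounds by (simp add: abs_le_iff)
  from product_le[OF this p'(2) m B(10)]
  have 1: "entry pos_rad12 p * entry pos_rad21 p
      \<le> 27/10 * (27/10) * (snd p * (971/1000 * fst p + 4995/10000 * snd p))"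
    unfolding off_diagonal .
  have 2: "(17 * fst p + 40 * snd p) * (12 * fst p + 39 * snd p) \<le>
      entry pos_rad11 p * entry pos_rad22 p"
    using B(1,2) p by (intro mult_mono) auto
  have "27/10 * (27/10) * (snd p * (971/1000 * fst p + 4995/10000 * snd p)) < (17 * fst p + 40 * snd p) * (12 * fst p + 39 * snd p)"
  proof -
    have "0 < fst p * fst p" "0 < snd p * snd p" "0 < fst p * snd p" using p by auto
    then show ?thesis by (simp add: algebra_simps)
  qed
  then show ?thesis unfolding a1_det_def using 1 2 by linarith
qed

lemma b2_det_pos: assumes "p \<in> quadrant" shows "b2_det p > 0"
proof -
  have p: "fst p > 0" "snd p > 0" using assms by (auto simp: quadrant_def)
  then have p': "fst p \<ge> 0" "snd p \<ge> 0" by auto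
  note B = block_bounds[OF p'] m2_bounds[OF p']
  have m: "0 \<le> m2 p" using B p by linarith
  have "\<bar>(- 17493 - 104 * sqrt 7) / 686\<bar> \<le> (26::real)"
    using sqrt_bounds by (simp add: abs_le_iff)
  from product_le[OF this p'(2) m B(10)]
  have 1: "entry neg_tan12 p * entry neg_tan21 p
      \<le> 26 * 26 * (snd p * (971/1000 * fst p + 4995/10000 * snd p))"
    unfolding off_diagonal .
  have 2: "(35/2 * fst p + 67 * snd p) * (45/10 * fst p + 35 * snd p) \<le>
      entry neg_tan11 p * entry neg_tan22 p"
    using B(3,4) p by (intro mult_mono) auto
  have "26 * 26 * (snd p * (971/1000 * fst p + 4995/10000 * snd p)) < (35/2 * fst p + 67 * snd p) * (45/10 * fst p + 35 * snd p)"
  proof -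
    have "0 < fst p * fst p" "0 < snd p * snd p" "0 < fst p * snd p" using p by auto
    then show ?thesis by (simp add: algebra_simps)
  qed
  then show ?thesis unfolding b2_det_def using 1 2 by linarith
qed

lemma block_linear:
  "entry neg_rad11 p = neg_rad11 0 (m2 (1, 0)) 1 (lamf (1, 0)) * fst p + neg_rad11 1 (m2 (0, 1)) 0 (lamf (0, 1)) * snd p"
  "entry neg_rad22 p = neg_rad22 0 (m2 (1, 0)) 1 (lamf (1, 0)) * fst p + neg_rad22 1 (m2 (0, 1)) 0 (lamf (0, 1)) * snd p"
  unfolding neg_rad11_def neg_rad22_def lamf_linear[of p] m2_linear[of p] by (simp_all add: algebra_simps add_divide_distrib diff_divide_distrib)

text \<open>Outer coefficients of opposite sign mean that exactly one ray in the quadrant is a zero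
  set. It is simple: at a zero, m0 times the derivative in m0 equals \<alpha> m0^2 - \<gamma> m1^2 >
  0. All transversality arguments use this form.\<close>

lemma b1_det_quadratic:
  obtains \<alpha> \<beta> \<gamma> where "\<alpha> > 0" "\<gamma> < 0"
    "\<And>p. b1_det p = \<alpha> * (fst p)\<^sup>2 + \<beta> * (fst p * snd p) + \<gamma> * (snd p)\<^sup>2"
proof -
  define x0 where "x0 = neg_rad11 0 (m2 (1, 0)) 1 (lamf (1, 0))"
  define x1 where "x1 = neg_rad11 1 (m2 (0, 1)) 0 (lamf (0, 1))"
  define y0 where "y0 = neg_rad22 0 (m2 (1, 0)) 1 (lamf (1, 0))"
  define y1 where "y1 = neg_rad22 1 (m2 (0, 1)) 0 (lamf (0, 1))"
  define k where "k = (- 13377 + 8 * sqrt 7) / 686"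
  have x0: "x0 > 0" using block_bounds(5)[of "(1, 0)"] by (simp add: x0_def)
  have x1: "x1 < 0" using block_bounds(6)[of "(0, 1)"] by (simp add: x1_def)
  have y0: "y0 > 0" using block_bounds(7)[of "(1, 0)"] by (simp add: y0_def)
  have y1: "y1 > 0" using block_bounds(7)[of "(0, 1)"] by (simp add: y1_def)
  have m: "m2 (0, 1) > 0" using m2_bounds(1)[of "(0, 1)"] by simp
  have eq: "b1_det p = (x0 * y0) * (fst p)\<^sup>2 + (x0 * y1 + x1 * y0 - k * k * m2 (1, 0)) * (fst p * snd p) +
      (x1 * y1 - k * k * m2 (0, 1)) * (snd p)\<^sup>2" for p
  proof -
    have "b1_det p = (x0 * fst p + x1 * snd p) * (y0 * fst p + y1 * snd p) - (k * m2 p) * (k * snd p)"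
      unfolding b1_det_def block_linear off_diagonal x0_def x1_def y0_def y1_def k_def ..
    then show ?thesis by (subst (asm) m2_linear) (simp add: algebra_simps power2_eq_square)
  qed
  show thesis
  proof (rule that[OF _ _ eq])
    show "x0 * y0 > 0" using x0 y0 by simp
    have "x1 * y1 < 0" using x1 y1 by (simp add: mult_neg_pos)
    moreover have "k * k * m2 (0, 1) \<ge> 0" using m by simp
    ultimately show "x1 * y1 - k * k * m2 (0, 1) < 0" by linarith
  qed
qed

section \<open>Characteristic polynomials in adapted bases\<close>

lemma orthogonal_expansion:
  fixes b :: "nat \<Rightarrow> 'a::euclidean_space"
  assumes orth: "\<And>i j. i < m \<Longrightarrow> j < m \<Longrightarrow> i \<noteq> j \<Longrightarrow> inner (b i) (b j) = 0"
    and nz: "\<And>i. i < m \<Longrightarrow> b i \<noteq> 0" and m: "m = DIM('a)"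
  shows "v = (\<Sum>i<m. (inner (b i) v / inner (b i) (b i)) *\<^sub>R b i)"
proof -
  have inj: "inj_on b {..<m}"
  proof (rule inj_onI)
    fix i j assume "i \<in> {..<m}" "j \<in> {..<m}" "b i = b j"
    then show "i = j" using orth[of i j] nz[of j] by auto
  qed
  have ind: "independent (b ` {..<m})"
    using nz by (intro pairwise_orthogonal_independent)
      (auto simp: pairwise_def real_inner_class.orthogonal_def intro!: orth)
  have "card (b ` {..<m}) = DIM('a)" using inj m by (simp add: card_image)
  then have "dim (b ` {..<m}) = DIM('a)" using ind by (simp add: dim_eq_card_independent)
  then have "span (b ` {..<m}) = UNIV" using dim_eq_full by blast
  define r where "r = v - (\<Sum>i<m. (inner (b i) v / inner (b i) (b i)) *\<^sub>R b i)"
  have "inner (b j) r = 0" if "j < m" for j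
  proof -
    have "inner (b j) (\<Sum>i<m. (inner (b i) v / inner (b i) (b i)) *\<^sub>R b i) =
        (\<Sum>i<m. if i = j then inner (b j) v else 0)"
      unfolding inner_sum_right inner_scaleR_right
      by (intro sum.cong) (use that orth nz in auto)
    then show ?thesis using that by (simp add: r_def inner_diff_right)
  qed
  then have "real_inner_class.orthogonal r x" if "x \<in> b ` {..<m}" for x
    using that by (auto simp: real_inner_class.orthogonal_def inner_commute)
  then have "real_inner_class.orthogonal r r"
    using orthogonal_to_span \<open>span (b ` {..<m}) = UNIV\<close> UNIV_I by metis
  then show ?thesis by (simp add: real_inner_class.orthogonal_def r_def)
qed

text \<open>The basis is orthogonal but not normalised, since the adapted vectors have squared
  lengths 6, 1 and 3; this accounts for the division. The change of basis P has the inverse Q, so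
  the two matrices are similar.\<close>

lemma char_poly_orthogonal_basis:
  fixes T :: "'a::euclidean_space \<Rightarrow> 'a" and b e :: "nat \<Rightarrow> 'a"
  assumes T: "linear T" and m: "m = DIM('a)"
    and e: "\<And>i j. i < m \<Longrightarrow> j < m \<Longrightarrow> inner (e i) (e j) = (if i = j then 1 else 0)"
    and b: "\<And>i j. i < m \<Longrightarrow> j < m \<Longrightarrow> i \<noteq> j \<Longrightarrow> inner (b i) (b j) = 0" "\<And>i. i < m \<Longrightarrow> b i \<noteq> 0"
  shows "char_poly (Matrix.mat m m (\<lambda>(i, j). inner (e i) (T (e j)))) =
    char_poly (Matrix.mat m m (\<lambda>(i, j). inner (b i) (T (b j)) / inner (b i) (b i)))"
proof -
  define A where "A = Matrix.mat m m (\<lambda>(i, j). inner (e i) (T (e j)))"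
  define B where "B = Matrix.mat m m (\<lambda>(i, j). inner (b i) (T (b j)) / inner (b i) (b i))"
  define P where "P = Matrix.mat m m (\<lambda>(i, j). inner (e i) (b j))"
  define Q where "Q = Matrix.mat m m (\<lambda>(i, j). inner (b i) (e j) / inner (b i) (b i))"
  have en: "e i \<noteq> 0" if "i < m" for i using e[OF that that] by auto
  have ex_e: "v = (\<Sum>i<m. inner (e i) v *\<^sub>R e i)" for v
  proof -
    have "v = (\<Sum>i<m. (inner (e i) v / inner (e i) (e i)) *\<^sub>R e i)"
      by (rule orthogonal_expansion[OF _ en m]) (simp_all add: e)
    also have "\<dots> = (\<Sum>i<m. inner (e i) v *\<^sub>R e i)" by (intro sum.cong) (simp_all add: e)
    finally show ?thesis .
  qed
  have ex_b: "v = (\<Sum>i<m. (inner (b i) v / inner (b i) (b i)) *\<^sub>R b i)" for v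
    by (rule orthogonal_expansion[OF b m])
  have pars: "(\<Sum>k<m. inner u (e k) * inner (e k) v) = inner u v" for u v
  proof -
    have "inner u v = inner u (\<Sum>k<m. inner (e k) v *\<^sub>R e k)" using ex_e[of v] by simp
    then show ?thesis by (simp add: inner_sum_right mult.commute)
  qed
  have car: "A \<in> carrier_mat m m" "B \<in> carrier_mat m m" "P \<in> carrier_mat m m" "Q \<in> carrier_mat m m"
    by (auto simp: A_def B_def P_def Q_def)
  have QP: "Q * P = 1\<^sub>m m"
  proof (rule eq_matI)
    fix i j assume "i < dim_row (1\<^sub>m m :: real mat)" "j < dim_col (1\<^sub>m m :: real mat)"
    then have ij: "i < m" "j < m" by auto
    have "(Q * P) $$ (i, j) = (\<Sum>k<m. inner (b i) (e k) * inner (e k) (b j)) / inner (b i) (b i)"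
      using ij by (simp add: Q_def P_def scalar_prod_def sum_divide_distrib atLeast0LessThan)
    also have "\<dots> = (if i = j then 1 else 0)" unfolding pars using ij b by auto
    finally show "(Q * P) $$ (i, j) = 1\<^sub>m m $$ (i, j)" using ij by simp
  qed (use car in auto)
  have PQ: "P * Q = 1\<^sub>m m" using mat_mult_left_right_inverse[OF car(4,3) QP] .
  have AP: "A * P = P * B"
  proof (rule eq_matI)
    fix i j assume "i < dim_row (P * B)" "j < dim_col (P * B)"
    then have ij: "i < m" "j < m" using car by auto
    have "(A * P) $$ (i, j) = (\<Sum>k<m. inner (e i) (T (e k)) * inner (e k) (b j))"
      using ij by (simp add: A_def P_def scalar_prod_def atLeast0LessThan)
    also have "\<dots> = inner (e i) (T (\<Sum>k<m. inner (e k) (b j) *\<^sub>R e k))"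
      by (simp add: linear_sum[OF T] linear_scale[OF T] inner_sum_right mult.commute)
    also have "\<dots> = inner (e i) (T (b j))" using ex_e[of "b j"] by simp
    also have "\<dots> = inner (e i) (\<Sum>k<m. (inner (b k) (T (b j)) / inner (b k) (b k)) *\<^sub>R b k)"
      using ex_b[of "T (b j)"] by simp
    also have "\<dots> = (P * B) $$ (i, j)"
      using ij by (simp add: P_def B_def scalar_prod_def atLeast0LessThan inner_sum_right mult.commute)
    finally show "(A * P) $$ (i, j) = (P * B) $$ (i, j)" .
  qed (use car in auto)
  have "A = A * (P * Q)" using car by (simp add: PQ)
  also have "\<dots> = P * B * Q" using car AP by (metis assoc_mult_mat)
  finally have "similar_mat A B"
    using car PQ QP by (intro similar_matI[of _ _ P Q m]) auto
  then show ?thesis unfolding A_def[symmetric] B_def[symmetric] by (rule char_poly_similar)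
qed

lemma char_poly_block_split:
  fixes f :: "nat \<times> nat \<Rightarrow> real"
  assumes z1: "\<And>i j. i < n \<Longrightarrow> j < m \<Longrightarrow> f (i, j + n) = 0" and z2: "\<And>i j. i < m \<Longrightarrow> j < n \<Longrightarrow> f (i + n, j) = 0"
  shows "char_poly (Matrix.mat (n + m) (n + m) f) =
    char_poly (Matrix.mat n n f) * char_poly (Matrix.mat m m (\<lambda>(i, j). f (i + n, j + n)))"
proof -
  define A where "A = Matrix.mat n n f"
  define B where "B = Matrix.mat m m (\<lambda>(i, j). f (i + n, j + n))"
  have car: "char_poly_matrix A \<in> carrier_mat n n" "char_poly_matrix B \<in> carrier_mat m m"
    by (auto simp: A_def B_def char_poly_matrix_def)
  have "char_poly_matrix (Matrix.mat (n + m) (n + m) f) =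
      four_block_mat (char_poly_matrix A) (0\<^sub>m n m) (0\<^sub>m m n) (char_poly_matrix B)"
  proof (rule eq_matI)
    fix i j assume "i < dim_row (four_block_mat (char_poly_matrix A) (0\<^sub>m n m) (0\<^sub>m m n) (char_poly_matrix B))"
      "j < dim_col (four_block_mat (char_poly_matrix A) (0\<^sub>m n m) (0\<^sub>m m n) (char_poly_matrix B))"
    then have ij: "i < n + m" "j < n + m" using car by auto
    have 1: "f (i, j) = 0" if "i < n" "\<not> j < n" using z1[of i "j - n"] that ij by simp
    have 2: "f (i, j) = 0" if "\<not> i < n" "j < n" using z2[of "i - n" j] that ij by simp
    show "char_poly_matrix (Matrix.mat (n + m) (n + m) f) $$ (i, j) =
      four_block_mat (char_poly_matrix A) (0\<^sub>m n m) (0\<^sub>m m n) (char_poly_matrix B) $$ (i, j)"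
      using ij 1 2 by (auto simp: char_poly_matrix_def A_def B_def)
  qed (use car in \<open>auto simp: char_poly_matrix_def A_def B_def\<close>)
  then have "char_poly (Matrix.mat (n + m) (n + m) f) = Determinant.det (char_poly_matrix A) * Determinant.det (char_poly_matrix B)"
    unfolding char_poly_def
    using det_four_block_mat_lower_left_zero[OF car(1) zero_carrier_mat refl car(2)] by simp
  then show ?thesis by (simp add: char_poly_def A_def B_def)
qed

lemma char_poly_2:
  fixes f :: "nat \<times> nat \<Rightarrow> real"
  shows "char_poly (Matrix.mat 2 2 f) =
    [: f (0, 0) * f (1, 1) - f (0, 1) * f (1, 0), - f (0, 0) - f (1, 1), 1 :]"
proof -
  have "char_poly_matrix (Matrix.mat 2 2 f) =
      Matrix.mat 2 2 (\<lambda>(i, j). if i = j then [:- f (i, j), 1:] else [:- f (i, j):])"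
    by (rule eq_matI) (auto simp: char_poly_matrix_def)
  moreover have "Determinant.det M = M $$ (0, 0) * M $$ (1, 1) - M $$ (0, 1) * M $$ (1, 0)"
    if "M \<in> carrier_mat 2 2" for M :: "real poly mat"
  proof -
    have "mat_delete M i 0 \<in> carrier_mat 1 1" for i
      using that by (auto simp: mat_delete_def)
    then have "Determinant.det (mat_delete M i 0) = mat_delete M i 0 $$ (0, 0)" for i
      by (rule det_single)
    then show ?thesis
      using laplace_expansion_column[OF that, of 0] that
      by (simp add: cofactor_def mat_delete_def numeral_2_eq_2 algebra_simps)
  qed
  ultimately show ?thesis unfolding char_poly_def by simp
qed

lemma coeff_0_char_poly:
  fixes A :: "real mat"
  assumes "A \<in> carrier_mat n n"
  shows "coeff (char_poly A) 0 = (- 1) ^ n * Determinant.det A"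
proof -
  have "coeff (char_poly A) 0 = poly (char_poly A) 0" by (simp add: poly_0_coeff_0)
  also have "\<dots> = Determinant.det (- char_matrix A 0)" by (rule char_poly_matrix[OF assms])
  also have "- char_matrix A 0 = (- 1) \<cdot>\<^sub>m A"
    using assms by (intro eq_matI) (auto simp: char_matrix_def)
  finally show ?thesis using assms by simp
qed

section \<open>Isotypic decomposition of the Hessian\<close>

text \<open>The square of \<open>Rot\<close> is the rotation by 2 pi/3. Its fixed vectors are
  spanned by those on which \<open>Rot\<close> is 1 or -1, that is by the one-dimensional
  representations of the dihedral group.\<close>

definition triple_sym :: "config set" where
  "triple_sym = {v. Rot (Rot v) = v}"

text \<open>The kernel of the averaging projection onto \<open>triple_sym\<close>, hence its
  orthogonal complement; it collects the two-dimensional irreducible representations.\<close>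

definition triple_free :: "config set" where
  "triple_free = {v. v + Rot (Rot v) + Rot (Rot (Rot (Rot v))) = 0}"

definition free_sym :: "config set" where
  "free_sym = triple_free \<inter> {v. Ref v = v}"

text \<open>Intertwines the reflection-symmetric and the antisymmetric part of \<open>triple_free\<close>; this is why
  the corresponding factor of the characteristic polynomial is a square.\<close>

definition swap_sym :: "config \<Rightarrow> config" where
  "swap_sym v = Rot v - Rot (Rot (Rot (Rot (Rot v))))"

lemmas Rot_linear = linear_add[OF linear_Rot] linear_diff[OF linear_Rot] linear_scale[OF linear_Rot]
  linear_neg[OF linear_Rot] linear_0[OF linear_Rot]
lemmas Ref_linear = linear_add[OF linear_Ref] linear_diff[OF linear_Ref] linear_scale[OF linear_Ref]
  linear_neg[OF linear_Ref] linear_0[OF linear_Ref]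

lemma subspace_triple_sym: "subspace triple_sym"
  by (rule subspaceI) (simp_all add: triple_sym_def Rot_linear)

lemma subspace_triple_free: "subspace triple_free"
proof (rule subspaceI)
  fix x y assume "x \<in> triple_free" "y \<in> triple_free"
  then have "(x + Rot (Rot x) + Rot (Rot (Rot (Rot x)))) + (y + Rot (Rot y) + Rot (Rot (Rot (Rot y)))) = 0"
    by (simp add: triple_free_def)
  then show "x + y \<in> triple_free" by (simp add: triple_free_def Rot_linear algebra_simps)
next
  fix c x assume "x \<in> triple_free"
  then have "c *\<^sub>R (x + Rot (Rot x) + Rot (Rot (Rot (Rot x)))) = 0"
    by (simp add: triple_free_def)
  then show "c *\<^sub>R x \<in> triple_free" by (simp add: triple_free_def Rot_linear scaleR_add_right)
qed (simp add: triple_free_def Rot_linear)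

lemma subspace_Ref_fixed: "subspace {v. Ref v = v}"
  by (rule subspaceI) (simp_all add: Ref_linear)

lemma subspace_free_sym: "subspace free_sym"
  unfolding free_sym_def by (intro subspace_inter subspace_triple_free subspace_Ref_fixed)

lemma inner_Rot2: "inner (Rot (Rot u)) (Rot (Rot v)) = inner u v" by (simp add: inner_Rot)

lemma inner_sym_free:
  assumes "u \<in> triple_sym" "v \<in> triple_free"
  shows "inner u v = 0"
proof -
  have u: "Rot (Rot u) = u" using assms(1) by (simp add: triple_sym_def)
  have a: "inner u (Rot (Rot x)) = inner u x" for x using inner_Rot2[of u x] u by simp
  have "0 = inner u (v + Rot (Rot v) + Rot (Rot (Rot (Rot v))))"
    using assms(2) by (simp add: triple_free_def)
  also have "\<dots> = 3 * inner u v" by (simp add: inner_add_right a)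
  finally show ?thesis by simp
qed

lemma inner_Ref_sign:
  assumes "Ref u = u" "Ref v = - v"
  shows "inner u v = 0"
  using inner_Ref[of u v] assms by simp

lemma sym_free_decomposition: "\<exists>u\<in>triple_sym. \<exists>w\<in>triple_free. v = u + w"
proof -
  define u where "u = (1/3) *\<^sub>R (v + Rot (Rot v) + Rot (Rot (Rot (Rot v))))"
  have u: "Rot (Rot u) = u" by (simp add: u_def Rot_linear Rot_6 add_ac)
  have "(v - u) + Rot (Rot (v - u)) + Rot (Rot (Rot (Rot (v - u)))) =
      (v + Rot (Rot v) + Rot (Rot (Rot (Rot v)))) - 3 *\<^sub>R u"
  proof -
    have "3 *\<^sub>R u = u + u + u" using scaleR_add_left[of 2 1 u] by (simp add: scaleR_2)
    then show ?thesis by (simp add: Rot_linear u)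
  qed
  also have "\<dots> = 0" by (simp add: u_def)
  finally have "v - u \<in> triple_free" by (simp add: triple_free_def)
  moreover have "u \<in> triple_sym" using u by (simp add: triple_sym_def)
  ultimately show ?thesis by (intro bexI[of _ u] bexI[of _ "v - u"]) auto
qed

lemma Ref_Rot: "Ref (Rot v) = Rot (Rot (Rot (Rot (Rot (Ref v)))))"
proof -
  have "Rot (Rot (Rot (Rot (Rot (Rot (Ref (Rot v))))))) = Rot (Rot (Rot (Rot (Rot (Ref v)))))"
    by (simp only: Rot_Ref_Rot)
  then show ?thesis by (simp only: Rot_6)
qed

lemma swap_sym_linear:
  "swap_sym (x + y) = swap_sym x + swap_sym y" "swap_sym (c *\<^sub>R x) = c *\<^sub>R swap_sym x" "swap_sym (- x) = - swap_sym x"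
  by (simp_all add: swap_sym_def Rot_linear algebra_simps)

text \<open>With R for \<open>Rot\<close>, the square of R - R^(-1) is R^2 + R^(-2) - 2, where
  R^(-2) = R^4; on \<open>triple_free\<close> the first two terms sum to -1.\<close>

lemma swap_sym_twice:
  assumes "v \<in> triple_free"
  shows "swap_sym (swap_sym v) = - 3 *\<^sub>R v"
proof -
  have "swap_sym (swap_sym v) = (v + Rot (Rot v) + Rot (Rot (Rot (Rot v)))) - 3 *\<^sub>R v"
  proof -
    have "swap_sym (swap_sym v) = Rot (Rot v) - v - v + Rot (Rot (Rot (Rot v)))"
      by (simp add: swap_sym_def Rot_linear Rot_6 algebra_simps)
    moreover have "3 *\<^sub>R v = v + v + v" using scaleR_add_left[of 2 1 v] by (simp add: scaleR_2)
    ultimately show ?thesis by simp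
  qed
  then show ?thesis using assms by (simp add: triple_free_def)
qed

lemma swap_sym_free: "v \<in> triple_free \<Longrightarrow> swap_sym v \<in> triple_free"
proof -
  assume "v \<in> triple_free"
  then have "swap_sym (v + Rot (Rot v) + Rot (Rot (Rot (Rot v)))) = swap_sym 0"
    by (simp add: triple_free_def)
  then show ?thesis by (simp add: triple_free_def swap_sym_def Rot_linear algebra_simps)
qed

lemma inner_swap_sym: "inner (swap_sym u) v = - inner u (swap_sym v)"
proof -
  have "inner (Rot u) v = inner u (Rot (Rot (Rot (Rot (Rot v)))))" for u v
    using inner_Rot[of u "Rot (Rot (Rot (Rot (Rot v))))"] by (simp add: Rot_6)
  then show ?thesis by (simp add: swap_sym_def inner_diff_left inner_diff_right Rot_6)
qed

lemma Ref_swap_sym: "Ref (swap_sym v) = - swap_sym (Ref v)"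
  by (simp add: swap_sym_def Ref_linear Ref_Rot Rot_6)

lemma Ref_triple_free: "v \<in> triple_free \<Longrightarrow> Ref v \<in> triple_free"
proof -
  assume "v \<in> triple_free"
  then have "Ref (v + Rot (Rot v) + Rot (Rot (Rot (Rot v)))) = 0"
    by (simp add: triple_free_def Ref_linear)
  then show ?thesis by (simp add: triple_free_def Ref_linear Ref_Rot Rot_6 add_ac)
qed

lemma free_decomposition:
  assumes w: "w \<in> triple_free"
  shows "\<exists>u\<in>free_sym. \<exists>v\<in>free_sym. w = u + swap_sym v"
proof -
  define u where "u = (1/2) *\<^sub>R (w + Ref w)"
  define x where "x = (1/2) *\<^sub>R (w - Ref w)"
  \<comment> \<open>The square of \<open>swap_sym\<close> is -3 on \<open>triple_free\<close>, so
    this is the preimage of the antisymmetric part x.\<close>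
  define v where "v = (- 1/3) *\<^sub>R swap_sym x"
  note sub = subspace_triple_free
  have Rw: "Ref w \<in> triple_free" by (rule Ref_triple_free[OF w])
  have u: "u \<in> free_sym"
    unfolding free_sym_def u_def using w Rw sub
    by (auto intro!: subspace_scale subspace_add simp: Ref_linear Ref_2 add.commute)
  have xf: "x \<in> triple_free"
    unfolding x_def using w Rw sub by (auto intro!: subspace_scale subspace_diff)
  have Rx: "Ref x = - x" by (simp add: x_def Ref_linear Ref_2 algebra_simps)
  have "v \<in> free_sym"
    unfolding free_sym_def v_def using swap_sym_free[OF xf] sub
    by (auto intro!: subspace_scale subspace_neg simp: Ref_linear Ref_swap_sym Rx swap_sym_linear)
  moreover have "w = u + swap_sym v"
  proof -
    have "swap_sym v = x" by (simp add: v_def swap_sym_linear swap_sym_twice[OF xf])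
    moreover have "w = u + x"
    proof -
      have "u + x = (1/2) *\<^sub>R ((w + Ref w) + (w - Ref w))"
        by (simp only: u_def x_def scaleR_add_right)
      also have "(w + Ref w) + (w - Ref w) = 2 *\<^sub>R w" by (simp add: scaleR_2)
      finally show ?thesis by simp
    qed
    ultimately show ?thesis by simp
  qed
  ultimately show ?thesis using u by blast
qed

section \<open>The Hessian as mass matrix times derivative of the force\<close>

definition weight :: "real \<times> real \<Rightarrow> config \<Rightarrow> config" where
  "weight p v = (\<chi> i. mass p $ i *\<^sub>R v $ i)"

lemma linear_weight: "linear (weight p)"
  by (rule linearI) (simp_all add: weight_def config_eq_iff scaleR_add_right)

lemma weight_gact:
  assumes "linear f" "\<And>j. mass p $ \<pi> j = mass p $ j"
  shows "weight p (gact f \<pi> v) = gact f \<pi> (weight p v)"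
  by (simp add: weight_def config_eq_iff assms linear_scale[OF assms(1)])

lemma weight_Rot: "weight p (Rot v) = Rot (weight p v)" and weight_Ref: "weight p (Ref v) = Ref (weight p v)"
  unfolding Rot_def Ref_def
  by (rule weight_gact; simp add: mass_def ring_mass_rot ring_mass_ref orthogonal_transformation_linear orthogonal_Phi orthogonal_mirror)+

lemma weight_eq_0: "p \<in> quadrant \<Longrightarrow> weight p v = 0 \<Longrightarrow> v = 0"
  using mass_pos[of p] by (auto simp: weight_def config_eq_iff less_le)

lemma linear_phess: "linear (phess p)" unfolding phess_def by (rule linear_hess)

lemma phess_Rot: "phess p (Rot v) = Rot (phess p v)" and phess_Ref: "phess p (Ref v) = Ref (phess p v)"
  unfolding phess_def by (rule hess_Rot hess_Ref)+

definition full_hess :: "real \<times> real \<Rightarrow> config \<Rightarrow> config" where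
  "full_hess p v = weight p (phess p v)"

lemma linear_full_hess: "linear (full_hess p)"
  using linear_compose[OF linear_phess linear_weight] by (simp add: full_hess_def[abs_def] o_def)

lemma full_hess_Rot: "full_hess p (Rot v) = Rot (full_hess p v)"
  and full_hess_Ref: "full_hess p (Ref v) = Ref (full_hess p v)"
  by (simp_all add: full_hess_def phess_Rot phess_Ref weight_Rot weight_Ref)

lemma commuting_preserves:
  assumes "linear T" "\<And>v. T (Rot v) = Rot (T v)" "\<And>v. T (Ref v) = Ref (T v)"
  shows "v \<in> triple_sym \<Longrightarrow> T v \<in> triple_sym" "v \<in> triple_free \<Longrightarrow> T v \<in> triple_free"
    "v \<in> free_sym \<Longrightarrow> T v \<in> free_sym" "T (swap_sym v) = swap_sym (T v)"
proof -
  show s: "v \<in> triple_sym \<Longrightarrow> T v \<in> triple_sym" for v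
    by (simp add: triple_sym_def assms(2)[symmetric])
  show f: "v \<in> triple_free \<Longrightarrow> T v \<in> triple_free" for v
    by (simp add: triple_free_def assms(2)[symmetric] linear_add[OF assms(1), symmetric] linear_0[OF assms(1)])
  show "v \<in> free_sym \<Longrightarrow> T v \<in> free_sym"
    using f by (auto simp: free_sym_def assms(3)[symmetric])
  show "T (swap_sym v) = swap_sym (T v)"
    by (simp add: swap_sym_def assms(2) linear_diff[OF assms(1)])
qed

lemmas phess_preserves = commuting_preserves[OF linear_phess phess_Rot phess_Ref]
lemmas weight_preserves = commuting_preserves[OF linear_weight weight_Rot weight_Ref]
lemmas full_hess_preserves = commuting_preserves[OF linear_full_hess full_hess_Rot full_hess_Ref]

lemma hessian_phi:
  assumes "p \<in> quadrant"
  shows "hessian (\<lambda>q. phi q p) (rosette p) =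
    Matrix.mat 26 26 (\<lambda>(i, j). inner (unit_config i) (full_hess p (unit_config j)))"
proof -
  have "frechet_derivative (grad (\<lambda>q. phi q p)) (at (rosette p)) = full_hess p"
    unfolding frechet_derivative_grad_phi[OF rosette_in_Omega] full_hess_def[abs_def] weight_def phess_def
      hess_def rosette_mass_mass lam_eq_lamf[OF assms] mass_def rosette_const[of p "(1, 1)"] ..
  then show ?thesis by (simp add: hessian_def)
qed

lemma inner_unit_config:
  assumes "i < 26" "j < 26"
  shows "inner (unit_config i) (unit_config j) = (if i = j then 1 else 0)"
proof -
  have inj13: "inj_on (of_nat :: nat \<Rightarrow> 13) {0, 1, 2, 3, 4, 5, 6, 7, 8, 9, 10, 11, 12}"
    by (simp add: inj_on_def)
  have inj2: "inj_on (of_nat :: nat \<Rightarrow> 2) {0, 1}" by (simp add: inj_on_def)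
  have m: "k div 2 \<in> {0, 1, 2, 3, 4, 5, 6, 7, 8, 9, 10, 11, 12} \<and> k mod 2 \<in> {0, 1}" if "k < 26" for k :: nat
    using that by (simp only: insert_iff empty_iff) presburger
  have "(of_nat (i div 2) :: 13) = of_nat (j div 2) \<longleftrightarrow> i div 2 = j div 2"
    by (rule inj_on_eq_iff[OF inj13]) (use m assms in blast)+
  moreover have "(of_nat (i mod 2) :: 2) = of_nat (j mod 2) \<longleftrightarrow> i mod 2 = j mod 2"
    by (rule inj_on_eq_iff[OF inj2]) (use m assms in blast)+
  moreover have "i = j \<longleftrightarrow> i div 2 = j div 2 \<and> i mod 2 = j mod 2" by (metis div_mod_decomp)
  ultimately show ?thesis by (simp add: unit_config_def inner_axis_axis)
qed

lemma upos_add: "upos x y z t + upos x' y' z' t' = upos (x + x') (y + y') (z + z') (t + t')"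
  and upos_scale: "k *\<^sub>R upos x y z t = upos (k * x) (k * y) (k * z) (k * t)"
  and uneg_add: "uneg x y z t + uneg x' y' z' t' = uneg (x + x') (y + y') (z + z') (t + t')"
  and uneg_scale: "k *\<^sub>R uneg x y z t = uneg (k * x) (k * y) (k * z) (k * t)"
  unfolding config_eq_iff forall_13 vector_add_component vector_scaleR_component upos_nth uneg_nth vec2_simps
  by (simp_all add: vec2_eq_iff algebra_simps add_divide_distrib diff_divide_distrib)

lemma inner_upos: "inner (upos x y z t) (upos x' y' z' t') = 6 * (x * x' + y * y' + z * z' + t * t')"
  and inner_uneg: "inner (uneg x y z t) (uneg x' y' z' t') = 6 * (x * x' + y * y' + z * z' + t * t')"
  unfolding inner_vec_def[where 'b = 13] sum_13 upos_nth uneg_nth inner_vec2 vector_2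
  by (simp_all add: field_simps sqrt3_cancel)

lemma inner_upos_uneg: "inner (upos x y z t) (uneg x' y' z' t') = 0"
  using inner_Rot[of "upos x y z t" "uneg x' y' z' t'"] by (simp add: Rot_upos Rot_uneg)

lemma weight_upos: "weight p (upos x y z t) = upos (snd p * x) (snd p * y) (m2 p * z) (m2 p * t)"
  and weight_uneg: "weight p (uneg x y z t) = uneg (snd p * x) (snd p * y) (m2 p * z) (m2 p * t)"
  unfolding config_eq_iff forall_13 weight_def vec_lambda_beta mass_def ring_mass_nth upos_nth uneg_nth vec2_simps
  by (simp_all add: vec2_eq_iff algebra_simps)

text \<open>The tangential block annihilates (1, sqrt 3), the direction of a rigid rotation: the
  tangential velocities are proportional to the radii 1/2 and sqrt 3 / 2.\<close>

lemma rotation_kernel: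
  "entry pos_tan11 p = - sqrt 3 * entry pos_tan12 p"
  "entry pos_tan21 p = - sqrt 3 * entry pos_tan22 p"
proof -
  show "entry pos_tan11 p = - sqrt 3 * entry pos_tan12 p"
    unfolding pos_tan11_def pos_tan12_def lamf_def by (simp add: field_simps sqrt3_cancel)
  have "entry pos_tan21 p + sqrt 3 * entry pos_tan22 p =
     sqrt 3 / 441 * (m2 p * (360 * sqrt 7 - 490 * sqrt 3 - 3038) -
        ((392 * sqrt 3 - 3528) * fst p + (216 * sqrt 7 - 1176 * sqrt 3) * snd p))"
    unfolding pos_tan21_def pos_tan22_def lamf_def by (simp add: field_simps sqrt3_cancel)
  then show "entry pos_tan21 p = - sqrt 3 * entry pos_tan22 p"
    unfolding m2_relation by simp
qed

text \<open>Consecutive pairs span the four invariant blocks, so \<open>i div 2\<close> names the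
  block. In the third pair the first vector is the infinitesimal rotation and the second its
  orthogonal complement within the block.\<close>

definition sym_basis :: "nat \<Rightarrow> config" where
  "sym_basis i = [upos 1 0 0 0, upos 0 0 1 0, uneg 1 0 0 0, uneg 0 0 0 1,
     upos 0 (1/2) 0 (sqrt 3 / 2), upos 0 (sqrt 3 / 2) 0 (- 1/2), uneg 0 1 0 0, uneg 0 0 1 0] ! i"

lemma sym_basis_simps [simp]:
  "sym_basis 0 = upos 1 0 0 0" "sym_basis (Suc 0) = upos 0 0 1 0" "sym_basis 1 = upos 0 0 1 0"
  "sym_basis (Suc (Suc 0)) = uneg 1 0 0 0" "sym_basis (Suc (Suc (Suc 0))) = uneg 0 0 0 1"
  "sym_basis 2 = uneg 1 0 0 0" "sym_basis 3 = uneg 0 0 0 1"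
  "sym_basis 4 = upos 0 (1/2) 0 (sqrt 3 / 2)" "sym_basis 5 = upos 0 (sqrt 3 / 2) 0 (- 1/2)"
  "sym_basis 6 = uneg 0 1 0 0" "sym_basis 7 = uneg 0 0 1 0"
  by (simp_all add: sym_basis_def)

text \<open>An orthonormal basis of \<open>free_sym\<close> obtained from existence alone; the
  two-dimensional representations are never put into coordinates.\<close>

definition free_basis :: "nat \<Rightarrow> (nat \<Rightarrow> config) \<Rightarrow> bool" where
  "free_basis n f \<longleftrightarrow> (\<forall>i<n. f i \<in> free_sym) \<and>
     (\<forall>i<n. \<forall>j<n. inner (f i) (f j) = (if i = j then 1 else 0)) \<and>
     (\<forall>v\<in>free_sym. v = (\<Sum>i<n. inner (f i) v *\<^sub>R f i))"

lemma free_basis_exists: "\<exists>n f. free_basis n f"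
proof -
  obtain B where B: "B \<subseteq> free_sym" "pairwise real_inner_class.orthogonal B" "\<And>x. x \<in> B \<Longrightarrow> norm x = 1"
      "independent B" "span B = free_sym"
    using orthonormal_basis_subspace[OF subspace_free_sym] by metis
  have "finite B" using B(4) independent_imp_finite by blast
  then obtain xs where xs: "set xs = B" "distinct xs" using finite_distinct_list by blast
  define n where "n = length xs"
  define f where "f i = xs ! i" for i
  have fB: "f i \<in> B" if "i < n" for i using that xs by (auto simp: f_def n_def)
  have orth: "inner (f i) (f j) = (if i = j then 1 else 0)" if "i < n" "j < n" for i j
  proof (cases "i = j")
    case True
    then show ?thesis using B(3)[OF fB[OF that(1)]] by (simp add: dot_square_norm)
  next
    case False
    then have "f i \<noteq> f j" using that xs(2) by (simp add: f_def n_def nth_eq_iff_index_eq)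
    then show ?thesis using False B(2) fB that by (simp add: pairwise_def real_inner_class.orthogonal_def)
  qed
  have "v = (\<Sum>i<n. inner (f i) v *\<^sub>R f i)" if "v \<in> free_sym" for v
  proof -
    define r where "r = v - (\<Sum>i<n. inner (f i) v *\<^sub>R f i)"
    have "r \<in> span B"
      unfolding r_def B(5) using that fB B(1) subspace_free_sym
      by (intro subspace_diff subspace_sum subspace_scale) auto
    moreover have "real_inner_class.orthogonal r b" if "b \<in> B" for b
    proof -
      obtain j where j: "j < n" "b = f j" using \<open>b \<in> B\<close> xs(1) by (auto simp: in_set_conv_nth f_def n_def)
      have "inner b (\<Sum>i<n. inner (f i) v *\<^sub>R f i) = (\<Sum>i<n. if i = j then inner b v else 0)"
        unfolding inner_sum_right j(2) using orth j(1) by (intro sum.cong) auto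
      then show ?thesis using j(1) by (simp add: real_inner_class.orthogonal_def r_def inner_commute[of _ b] inner_diff_right)
    qed
    ultimately have "real_inner_class.orthogonal r r" using orthogonal_to_span by blast
    then show ?thesis by (simp add: real_inner_class.orthogonal_def r_def)
  qed
  then have "free_basis n f" using orth fB B(1) by (auto simp: free_basis_def)
  then show ?thesis by blast
qed

definition adapted_basis :: "nat \<Rightarrow> (nat \<Rightarrow> config) \<Rightarrow> nat \<Rightarrow> config" where
  "adapted_basis n f i = (if i < 8 then sym_basis i else if i < 8 + n then f (i - 8) else swap_sym (f (i - 8 - n)))"

lemma less_8: "i < (8::nat) \<Longrightarrow> i = 0 \<or> i = 1 \<or> i = 2 \<or> i = 3 \<or> i = 4 \<or> i = 5 \<or> i = 6 \<or> i = 7"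
  by arith

lemma sym_basis_triple_sym: "i < 8 \<Longrightarrow> sym_basis i \<in> triple_sym"
  using less_8[of i] by (auto simp: triple_sym_def Rot_upos Rot_uneg Rot_linear)

lemma inner_uneg_upos: "inner (uneg x y z t) (upos x' y' z' t') = 0"
  by (simp add: inner_commute[of "uneg x y z t"] inner_upos_uneg)

lemma inner_sym_basis: "i < 8 \<Longrightarrow> j < 8 \<Longrightarrow> inner (sym_basis i) (sym_basis j) = (if i = j then 6 else 0)"
  apply (drule less_8, drule less_8)
  by (elim disjE; simp add: inner_upos inner_uneg inner_upos_uneg inner_uneg_upos)

lemma free_basisD:
  assumes "free_basis n f" "i < n"
  shows "f i \<in> free_sym" "f i \<in> triple_free" "Ref (f i) = f i"
    "swap_sym (f i) \<in> triple_free" "Ref (swap_sym (f i)) = - swap_sym (f i)"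
  using assms swap_sym_free Ref_swap_sym by (auto simp: free_basis_def free_sym_def)

lemma inner_swap_basis:
  assumes "free_basis n f" "i < n" "v \<in> triple_free"
  shows "inner (swap_sym (f i)) (swap_sym v) = 3 * inner (f i) v"
  using assms by (simp add: inner_swap_sym swap_sym_twice)

lemma adapted_basis_free:
  assumes "free_basis n f" "8 \<le> k" "k < 8 + 2 * n"
  shows "adapted_basis n f k \<in> triple_free"
  using assms free_basisD[OF assms(1)] by (auto simp: adapted_basis_def)

lemma adapted_basis_orth:
  assumes f: "free_basis n f" and ij: "i < 8 + 2 * n" "j < 8 + 2 * n"
  shows "inner (adapted_basis n f i) (adapted_basis n f j) =
    (if i = j then if i < 8 then 6 else if i < 8 + n then 1 else 3 else 0)"
proof -
  have o: "inner (f i) (f j) = (if i = j then 1 else 0)" if "i < n" "j < n" for i j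
    using f that by (simp add: free_basis_def)
  have ref: "inner (f i) (swap_sym (f j)) = 0" if "i < n" "j < n" for i j
    using free_basisD[OF f] that by (intro inner_Ref_sign) auto
  have sf: "inner (adapted_basis n f i) (adapted_basis n f j) = 0" if "i < 8" "8 \<le> j" "j < 8 + 2 * n" for i j
    using inner_sym_free[OF sym_basis_triple_sym[OF that(1)] adapted_basis_free[OF f that(2,3)]] that(1)
    by (simp add: adapted_basis_def)
  consider "i < 8" "j < 8" | "i < 8" "8 \<le> j" | "8 \<le> i" "j < 8" | "8 \<le> i" "8 \<le> j" by linarith
  then show ?thesis
  proof cases
    case 1
    then show ?thesis by (simp add: adapted_basis_def inner_sym_basis)
  next
    case 2
    then show ?thesis using sf[of i j] ij by simp
  next
    case 3
    then show ?thesis using sf[of j i] ij by (simp add: inner_commute)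
  next
    case 4
    consider "i < 8 + n" "j < 8 + n" | "i < 8 + n" "8 + n \<le> j" | "8 + n \<le> i" "j < 8 + n" | "8 + n \<le> i" "8 + n \<le> j"
      by linarith
    then show ?thesis
    proof cases
      case 1
      then show ?thesis using 4 o[of "i - 8" "j - 8"] by (auto simp: adapted_basis_def)
    next
      case 2
      then show ?thesis using 4 ij ref[of "i - 8" "j - 8 - n"] by (auto simp: adapted_basis_def)
    next
      case 3
      then show ?thesis using 4 ij ref[of "j - 8" "i - 8 - n"] by (auto simp: adapted_basis_def inner_commute)
    next
      case 4
      then have "i - 8 - n < n" "j - 8 - n < n" using ij by auto
      then have "inner (swap_sym (f (i - 8 - n))) (swap_sym (f (j - 8 - n))) = (if i - 8 - n = j - 8 - n then 3 else 0)"
        using o inner_swap_basis[OF f _ free_basisD(2)[OF f]] by simp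
      then show ?thesis using 4 by (auto simp: adapted_basis_def)
    qed
  qed
qed

lemma adapted_basis_nonzero:
  assumes "free_basis n f" "i < 8 + 2 * n"
  shows "adapted_basis n f i \<noteq> 0"
  using adapted_basis_orth[OF assms(1,2,2)] by (auto split: if_splits)

lemma triple_sym_decomposition:
  assumes "v \<in> triple_sym"
  shows "\<exists>x y z t x' y' z' t'. v = upos x y z t + uneg x' y' z' t'"
proof -
  have v: "Rot (Rot v) = v" using assms by (simp add: triple_sym_def)
  define u where "u = (1/2) *\<^sub>R (v + Rot v)"
  define w where "w = (1/2) *\<^sub>R (v - Rot v)"
  have "Rot u = u" by (simp add: u_def Rot_linear v add.commute)
  moreover have "Rot w = - w" by (simp add: w_def Rot_linear v) (simp add: scaleR_diff_right)
  moreover have "v = u + w"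
  proof -
    have "u + w = (1/2) *\<^sub>R ((v + Rot v) + (v - Rot v))" by (simp only: u_def w_def scaleR_add_right)
    also have "(v + Rot v) + (v - Rot v) = 2 *\<^sub>R v" by (simp add: scaleR_2)
    finally show ?thesis by simp
  qed
  ultimately show ?thesis using Rot_fixed_eq_upos Rot_neg_eq_uneg by metis
qed

text \<open>The basis vectors, their images under \<open>swap_sym\<close> and the eight vectors of
  \<open>sym_basis\<close> are orthogonal and span everything, so 8 + 2 n = 26. The value fixes the
  block sizes and the sign of the determinant in \<open>cp_coeff_25\<close>.\<close>

lemma free_basis_card:
  assumes f: "free_basis n f"
  shows "n = 9"
proof -
  define S where "S = adapted_basis n f ` {..<8 + 2 * n}"
  have inj: "inj_on (adapted_basis n f) {..<8 + 2 * n}"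
  proof (rule inj_onI)
    fix i j assume "i \<in> {..<8 + 2 * n}" "j \<in> {..<8 + 2 * n}" "adapted_basis n f i = adapted_basis n f j"
    then show "i = j"
      using adapted_basis_orth[OF f, of i j] adapted_basis_nonzero[OF f, of j] by (cases "i = j") auto
  qed
  have "independent S"
    unfolding S_def
  proof (rule pairwise_orthogonal_independent)
    show "pairwise real_inner_class.orthogonal (adapted_basis n f ` {..<8 + 2 * n})"
      unfolding pairwise_def real_inner_class.orthogonal_def
      using adapted_basis_orth[OF f] by (auto split: if_splits)
    show "0 \<notin> adapted_basis n f ` {..<8 + 2 * n}"
      using adapted_basis_nonzero[OF f] by force
  qed
  then have dim: "dim S = 8 + 2 * n"
    using inj by (simp add: dim_eq_card_independent S_def card_image)
  have in_S: "adapted_basis n f i \<in> span S" if "i < 8 + 2 * n" for i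
    using that by (auto simp: S_def intro: span_base)
  have sb: "sym_basis i \<in> span S" if "i < 8" for i
    using in_S[of i] that by (simp add: adapted_basis_def)
  have fb: "f i \<in> span S" "swap_sym (f i) \<in> span S" if "i < n" for i
    using in_S[of "i + 8"] in_S[of "i + 8 + n"] that by (simp_all add: adapted_basis_def)
  have sub: "subspace (span S)" by simp
  have up: "upos x y z t + uneg x' y' z' t' \<in> span S" for x y z t x' y' z' t'
  proof -
    have "upos x y z t = x *\<^sub>R sym_basis 0 + z *\<^sub>R sym_basis 1 + (1/2 * y + sqrt 3 / 2 * t) *\<^sub>R sym_basis 4
        + (sqrt 3 / 2 * y - 1/2 * t) *\<^sub>R sym_basis 5"
      unfolding sym_basis_simps upos_scale upos_add by (rule arg_cong4[where f = upos]) (simp_all add: field_simps sqrt3_cancel)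
    moreover have "uneg x' y' z' t' = x' *\<^sub>R sym_basis 2 + y' *\<^sub>R sym_basis 6 + z' *\<^sub>R sym_basis 7 + t' *\<^sub>R sym_basis 3"
      unfolding sym_basis_simps uneg_scale uneg_add by simp
    ultimately show ?thesis
      by (simp only:) (intro subspace_add[OF sub] subspace_scale[OF sub] sb; simp)
  qed
  have free: "v \<in> span S" "swap_sym v \<in> span S" if "v \<in> free_sym" for v
  proof -
    have v: "v = (\<Sum>i<n. inner (f i) v *\<^sub>R f i)" using f that by (simp add: free_basis_def)
    show "v \<in> span S"
      by (subst v, intro subspace_sum[OF sub] subspace_scale[OF sub] fb) simp
    have "swap_sym v = (\<Sum>i<n. inner (f i) v *\<^sub>R swap_sym (f i))"
    proof -
      have "linear swap_sym" by (rule linearI) (simp_all add: swap_sym_linear)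
      then show ?thesis using v by (metis (no_types, lifting) linear_scale linear_sum sum.cong)
    qed
    then show "swap_sym v \<in> span S"
      by (simp only:) (intro subspace_sum[OF sub] subspace_scale[OF sub] fb, simp)
  qed
  have "v \<in> span S" for v
  proof -
    obtain u w where uw: "u \<in> triple_sym" "w \<in> triple_free" "v = u + w"
      using sym_free_decomposition by blast
    obtain x y where "x \<in> free_sym" "y \<in> free_sym" "w = x + swap_sym y"
      using free_decomposition[OF uw(2)] by blast
    then have "w \<in> span S" using free sub by (simp add: subspace_add)
    moreover have "u \<in> span S" using triple_sym_decomposition[OF uw(1)] up by force
    ultimately show ?thesis using uw(3) sub by (simp add: subspace_add)
  qed
  then have "span S = UNIV" by blast
  then have "dim S = DIM(config)" using dim_eq_full by blast
  then show ?thesis using dim by simp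
qed

lemma full_hess_upos:
  "full_hess p (upos x y z t) = upos
    (snd p * (entry pos_rad11 p * x + entry pos_rad12 p * z))
    (snd p * (entry pos_tan11 p * y + entry pos_tan12 p * t))
    (m2 p * (entry pos_rad21 p * x + entry pos_rad22 p * z))
    (m2 p * (entry pos_tan21 p * y + entry pos_tan22 p * t))"
  unfolding full_hess_def phess_def hess_upos weight_upos ..

lemma full_hess_uneg:
  "full_hess p (uneg x y z t) = uneg
    (snd p * (entry neg_rad11 p * x + entry neg_rad12 p * t))
    (snd p * (entry neg_tan11 p * y + entry neg_tan12 p * z))
    (m2 p * (entry neg_tan21 p * y + entry neg_tan22 p * z))
    (m2 p * (entry neg_rad21 p * x + entry neg_rad22 p * t))"
  unfolding full_hess_def phess_def hess_uneg weight_uneg ..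

lemma full_hess_block_orth:
  "inner (upos x 0 z 0) (full_hess p (upos 0 y' 0 t')) = 0"
  "inner (upos 0 y 0 t) (full_hess p (upos x' 0 z' 0)) = 0"
  "inner (uneg x 0 0 t) (full_hess p (uneg 0 y' z' 0)) = 0"
  "inner (uneg 0 y z 0) (full_hess p (uneg x' 0 0 t')) = 0"
  "inner (upos x y z t) (full_hess p (uneg x' y' z' t')) = 0"
  "inner (uneg x y z t) (full_hess p (upos x' y' z' t')) = 0"
  unfolding full_hess_upos full_hess_uneg inner_upos inner_uneg inner_upos_uneg inner_uneg_upos by simp_all

lemma sym_basis_block_orth:
  assumes "i < 8" "j < 8" "i div 2 \<noteq> j div 2"
  shows "inner (sym_basis i) (full_hess p (sym_basis j)) = 0"
  using less_8[OF assms(1)] less_8[OF assms(2)] assms(3)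
  by (elim disjE; hypsubst; simp only: sym_basis_simps full_hess_block_orth; simp)

text \<open>The trace of the weighted tangential block, rewritten with
  \<open>rotation_kernel\<close>. As the rotation has eigenvalue 0, this is the other eigenvalue of
  the block.\<close>

definition zeta :: "real \<times> real \<Rightarrow> real" where
  "zeta p = m2 p * entry pos_tan22 p - sqrt 3 * snd p * entry pos_tan12 p"

definition free_det :: "nat \<Rightarrow> (nat \<Rightarrow> config) \<Rightarrow> real \<times> real \<Rightarrow> real" where
  "free_det n f p = Determinant.det (Matrix.mat n n (\<lambda>(i, j). inner (f i) (phess p (f j))))"

definition weight_det :: "nat \<Rightarrow> (nat \<Rightarrow> config) \<Rightarrow> real \<times> real \<Rightarrow> real" where
  "weight_det n f p = Determinant.det (Matrix.mat n n (\<lambda>(i, j). inner (f i) (weight p (f j))))"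

text \<open>\<open>free_sym\<close> is invariant under both factors of \<open>full_hess\<close>, so
  the matrices multiply. Splitting off the masses leaves \<open>free_det\<close>, whose matrix is
  linear in the parameter.\<close>

lemma free_det_full:
  assumes f: "free_basis n f"
  shows "Determinant.det (Matrix.mat n n (\<lambda>(i, j). inner (f i) (full_hess p (f j)))) = weight_det n f p * free_det n f p"
proof -
  have "Matrix.mat n n (\<lambda>(i, j). inner (f i) (full_hess p (f j))) =
      Matrix.mat n n (\<lambda>(i, j). inner (f i) (weight p (f j))) * Matrix.mat n n (\<lambda>(i, j). inner (f i) (phess p (f j)))"
  proof (rule eq_matI)
    fix i j assume "i < dim_row (Matrix.mat n n (\<lambda>(i, j). inner (f i) (weight p (f j))) * Matrix.mat n n (\<lambda>(i, j). inner (f i) (phess p (f j))))"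
      "j < dim_col (Matrix.mat n n (\<lambda>(i, j). inner (f i) (weight p (f j))) * Matrix.mat n n (\<lambda>(i, j). inner (f i) (phess p (f j))))"
    then have ij: "i < n" "j < n" by auto
    have "phess p (f j) \<in> free_sym" using phess_preserves(3) free_basisD(1)[OF f ij(2)] by blast
    then have "phess p (f j) = (\<Sum>k<n. inner (f k) (phess p (f j)) *\<^sub>R f k)"
      using f by (simp add: free_basis_def)
    then have "full_hess p (f j) = (\<Sum>k<n. inner (f k) (phess p (f j)) *\<^sub>R weight p (f k))"
      unfolding full_hess_def
      by (metis (no_types, lifting) linear_weight linear_scale linear_sum sum.cong)
    then show "Matrix.mat n n (\<lambda>(i, j). inner (f i) (full_hess p (f j))) $$ (i, j) =
        (Matrix.mat n n (\<lambda>(i, j). inner (f i) (weight p (f j))) * Matrix.mat n n (\<lambda>(i, j). inner (f i) (phess p (f j)))) $$ (i, j)"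
      using ij by (simp add: scalar_prod_def inner_sum_right atLeast0LessThan mult.commute)
  qed auto
  then show ?thesis
    unfolding weight_det_def free_det_def by (simp add: Determinant.det_mult[of _ n])
qed

lemma weight_det_nonzero:
  assumes f: "free_basis n f" and p: "p \<in> quadrant"
  shows "weight_det n f p \<noteq> 0"
proof
  define M where "M = Matrix.mat n n (\<lambda>(i, j). inner (f i) (weight p (f j)))"
  assume "weight_det n f p = 0"
  then have "Determinant.det M = 0" by (simp add: weight_det_def M_def)
  moreover have M: "M \<in> carrier_mat n n" by (simp add: M_def)
  ultimately obtain x where x: "x \<in> carrier_vec n" "x \<noteq> 0\<^sub>v n" "M *\<^sub>v x = 0\<^sub>v n"
    using det_0_iff_vec_prod_zero_field by blast
  define v where "v = (\<Sum>j<n. vec_index x j *\<^sub>R f j)"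
  have v: "v \<in> free_sym"
    unfolding v_def using free_basisD(1)[OF f] subspace_free_sym by (intro subspace_sum subspace_scale) auto
  have "inner (f i) (weight p v) = 0" if "i < n" for i
  proof -
    have "inner (f i) (weight p v) = vec_index (M *\<^sub>v x) i"
      using that x(1) by (simp add: M_def v_def linear_sum[OF linear_weight] linear_scale[OF linear_weight]
          inner_sum_right scalar_prod_def atLeast0LessThan mult.commute)
    then show ?thesis using x(3) that by simp
  qed
  moreover have "weight p v = (\<Sum>i<n. inner (f i) (weight p v) *\<^sub>R f i)"
    using f weight_preserves(3)[OF v] by (simp add: free_basis_def)
  ultimately have "weight p v = 0" by simp
  then have v0: "v = 0" using weight_eq_0[OF p] by blast
  have "vec_index x i = 0" if "i < n" for i
  proof -
    have "inner (f i) v = (\<Sum>j<n. if j = i then vec_index x i else 0)"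
      unfolding v_def inner_sum_right using f that by (intro sum.cong) (auto simp: free_basis_def)
    then show ?thesis using v0 that by simp
  qed
  then have "x = 0\<^sub>v n" using x(1) by (intro eq_vecI) auto
  then show False using x(2) by simp
qed

text \<open>Up to sign \<open>a_25\<close> is the coefficient of x in the characteristic polynomial.
  The block of the infinitesimal rotation contributes the factor x, so what remains is the product
  of the constant coefficients of the other blocks with \<open>zeta\<close>.\<close>

lemma cp_coeff_25:
  assumes f: "free_basis n f" and p: "p \<in> quadrant"
  shows "cp_coeff 25 p = zeta p * (snd p * m2 p) ^ 3 * a1_det p * b2_det p * (weight_det n f p)\<^sup>2 * b1_det p * (free_det n f p)\<^sup>2"
proof -
  have n: "n = 9" by (rule free_basis_card[OF f])
  define b where "b = adapted_basis n f"
  define g where "g = (\<lambda>(i, j). inner (b i) (full_hess p (b j)) / inner (b i) (b i))"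
  have less26: "i < 26 \<longleftrightarrow> i < 8 + 2 * n" for i unfolding n by simp
  have orth: "inner (b i) (b j) = (if i = j then if i < 8 then 6 else if i < 17 then 1 else 3 else 0)"
    if "i < 26" "j < 26" for i j
    using adapted_basis_orth[OF f, of i j] that unfolding b_def n by simp
  have free: "b i \<in> triple_free" if "8 \<le> i" "i < 26" for i
    using adapted_basis_free[OF f that(1)] that(2) unfolding b_def n by simp
  have symb: "b i = sym_basis i" if "i < 8" for i using that by (simp add: b_def adapted_basis_def)
  have symm: "b i \<in> triple_sym" if "i < 8" for i using that symb sym_basis_triple_sym by simp
  have fb: "b (i + 8) = f i" "b (i + 17) = swap_sym (f i)" if "i < 9" for i
    using that by (auto simp: b_def adapted_basis_def n)
  have "char_poly (hessian (\<lambda>q. phi q p) (rosette p)) = char_poly (Matrix.mat 26 26 g)"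
    unfolding hessian_phi[OF p] g_def
    by (rule char_poly_orthogonal_basis[OF linear_full_hess _ inner_unit_config])
      (use orth adapted_basis_nonzero[OF f] less26 in \<open>auto simp: b_def\<close>)
  also have "\<dots> = char_poly (Matrix.mat 8 8 g) * char_poly (Matrix.mat 18 18 (\<lambda>(i, j). g (i + 8, j + 8)))"
  proof -
    have 1: "g (i, j + 8) = 0" if "i < 8" "j < 18" for i j
      using inner_sym_free[OF symm[OF that(1)] full_hess_preserves(2)[OF free[of "j + 8"]]] that by (simp add: g_def)
    have 2: "g (i + 8, j) = 0" if "i < 18" "j < 8" for i j
      using inner_sym_free[OF full_hess_preserves(1)[OF symm[OF that(2)]] free[of "i + 8"]] that
      by (simp add: g_def inner_commute)
    show ?thesis using char_poly_block_split[of 8 18 g] 1 2 by simp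
  qed
  also have "char_poly (Matrix.mat 18 18 (\<lambda>(i, j). g (i + 8, j + 8))) =
     char_poly (Matrix.mat 9 9 (\<lambda>(i, j). g (i + 8, j + 8))) * char_poly (Matrix.mat 9 9 (\<lambda>(i, j). g (i + 17, j + 17)))"
  proof -
    have H: "Ref (full_hess p (f i)) = full_hess p (f i)"
      "Ref (full_hess p (swap_sym (f i))) = - full_hess p (swap_sym (f i))" if "i < 9" for i
      using free_basisD[OF f, of i] that n
      by (simp_all add: full_hess_Ref[symmetric] linear_neg[OF linear_full_hess])
    have 1: "g (i + 8, j + 17) = 0" if "i < 9" "j < 9" for i j
      using inner_Ref_sign[OF free_basisD(3)[OF f] H(2)] that n by (simp add: g_def fb)
    have 2: "g (i + 17, j + 8) = 0" if "i < 9" "j < 9" for i j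
      using inner_Ref_sign[OF H(1) free_basisD(5)[OF f]] that n by (simp add: g_def fb inner_commute)
    show ?thesis using char_poly_block_split[of 9 9 "\<lambda>(i, j). g (i + 8, j + 8)"] 1 2 by (simp add: add.assoc)
  qed
  \<comment> \<open>The Hessian commutes with \<open>swap_sym\<close>, which multiplies the inner
    products in question by 3; dividing by the squared length 3 gives the same matrix as on
    \<open>free_sym\<close>. This makes the factor a square.\<close>
  also have "Matrix.mat 9 9 (\<lambda>(i, j). g (i + 17, j + 17)) = Matrix.mat 9 9 (\<lambda>(i, j). inner (f i) (full_hess p (f j)))"
  proof (rule eq_matI)
    fix i j assume "i < dim_row (Matrix.mat 9 9 (\<lambda>(i, j). inner (f i) (full_hess p (f j))))"
      "j < dim_col (Matrix.mat 9 9 (\<lambda>(i, j). inner (f i) (full_hess p (f j))))"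
    then have ij: "i < 9" "j < 9" by auto
    have "inner (swap_sym (f i)) (full_hess p (swap_sym (f j))) = 3 * inner (f i) (full_hess p (f j))"
      unfolding full_hess_preserves(4)
      using ij n by (intro inner_swap_basis[OF f] full_hess_preserves(2) free_basisD(2)[OF f]) auto
    then show "Matrix.mat 9 9 (\<lambda>(i, j). g (i + 17, j + 17)) $$ (i, j) = Matrix.mat 9 9 (\<lambda>(i, j). inner (f i) (full_hess p (f j))) $$ (i, j)"
      using ij orth[of "i + 17" "i + 17"] by (simp add: g_def fb)
  qed auto
  also have "Matrix.mat 9 9 (\<lambda>(i, j). g (i + 8, j + 8)) = Matrix.mat 9 9 (\<lambda>(i, j). inner (f i) (full_hess p (f j)))"
  proof (rule eq_matI)
    fix i j assume "i < dim_row (Matrix.mat 9 9 (\<lambda>(i, j). inner (f i) (full_hess p (f j))))"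
      "j < dim_col (Matrix.mat 9 9 (\<lambda>(i, j). inner (f i) (full_hess p (f j))))"
    then have ij: "i < 9" "j < 9" by auto
    then show "Matrix.mat 9 9 (\<lambda>(i, j). g (i + 8, j + 8)) $$ (i, j) = Matrix.mat 9 9 (\<lambda>(i, j). inner (f i) (full_hess p (f j))) $$ (i, j)"
      using orth[of "i + 8" "i + 8"] by (simp add: g_def fb)
  qed auto
  finally have cp: "char_poly (hessian (\<lambda>q. phi q p) (rosette p)) = char_poly (Matrix.mat 8 8 g) *
     (char_poly (Matrix.mat 9 9 (\<lambda>(i, j). inner (f i) (full_hess p (f j)))) *
      char_poly (Matrix.mat 9 9 (\<lambda>(i, j). inner (f i) (full_hess p (f j)))))" .
  have gs: "g (i, j) = inner (sym_basis i) (full_hess p (sym_basis j)) / 6" if "i < 8" "j < 8" for i j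
    using that orth[of i i] by (simp add: g_def symb)
  note ev = gs full_hess_upos full_hess_uneg inner_upos inner_uneg
  have z: "g (i, j) = 0" if "i < 8" "j < 8" "i div 2 \<noteq> j div 2" for i j
    using gs[OF that(1,2)] sym_basis_block_orth[OF that] by simp
  have "char_poly (Matrix.mat 8 8 g) = char_poly (Matrix.mat 2 2 g) * char_poly (Matrix.mat 6 6 (\<lambda>(i, j). g (i + 2, j + 2)))"
  proof -
    have "g (i, j + 2) = 0" "g (j + 2, i) = 0" if "i < 2" "j < 6" for i j
      using that by (intro z; presburger)+
    then show ?thesis using char_poly_block_split[of 2 6 g] by simp
  qed
  also have "char_poly (Matrix.mat 6 6 (\<lambda>(i, j). g (i + 2, j + 2))) =
    char_poly (Matrix.mat 2 2 (\<lambda>(i, j). g (i + 2, j + 2))) * char_poly (Matrix.mat 4 4 (\<lambda>(i, j). g (i + 4, j + 4)))"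
  proof -
    have "g (i + 2, j + 4) = 0" "g (j + 4, i + 2) = 0" if "i < 2" "j < 4" for i j
      using that by (intro z; presburger)+
    then show ?thesis using char_poly_block_split[of 2 4 "\<lambda>(i, j). g (i + 2, j + 2)"]
      by (simp add: add.assoc del: add_2_eq_Suc')
  qed
  also have "char_poly (Matrix.mat 4 4 (\<lambda>(i, j). g (i + 4, j + 4))) =
    char_poly (Matrix.mat 2 2 (\<lambda>(i, j). g (i + 4, j + 4))) * char_poly (Matrix.mat 2 2 (\<lambda>(i, j). g (i + 6, j + 6)))"
  proof -
    have "g (i + 4, j + 6) = 0" "g (j + 6, i + 4) = 0" if "i < 2" "j < 2" for i j
      using that by (intro z; presburger)+
    then show ?thesis using char_poly_block_split[of 2 2 "\<lambda>(i, j). g (i + 4, j + 4)"] by (simp add: add_ac)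
  qed
  finally have cp8: "char_poly (Matrix.mat 8 8 g) = char_poly (Matrix.mat 2 2 g) *
    (char_poly (Matrix.mat 2 2 (\<lambda>(i, j). g (i + 2, j + 2))) * (char_poly (Matrix.mat 2 2 (\<lambda>(i, j). g (i + 4, j + 4))) *
     char_poly (Matrix.mat 2 2 (\<lambda>(i, j). g (i + 6, j + 6)))))" .
  have A1: "coeff (char_poly (Matrix.mat 2 2 g)) 0 = snd p * m2 p * a1_det p"
    unfolding char_poly_2 by (simp add: ev a1_det_def algebra_simps)
  have B1: "coeff (char_poly (Matrix.mat 2 2 (\<lambda>(i, j). g (i + 2, j + 2)))) 0 = snd p * m2 p * b1_det p"
    unfolding char_poly_2 by (simp add: ev b1_det_def algebra_simps)
  have B2: "coeff (char_poly (Matrix.mat 2 2 (\<lambda>(i, j). g (i + 6, j + 6)))) 0 = snd p * m2 p * b2_det p"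
    unfolding char_poly_2 by (simp add: ev b2_det_def algebra_simps)
  have g44: "g (4, 4) = 0" "g (5, 4) = 0" by (simp_all add: ev rotation_kernel)
  have g55: "g (5, 5) = zeta p"
    by (simp add: ev rotation_kernel zeta_def field_simps sqrt3_cancel)
  have A2: "char_poly (Matrix.mat 2 2 (\<lambda>(i, j). g (i + 4, j + 4))) = pCons 0 [:- zeta p, 1:]"
    unfolding char_poly_2 by (simp add: g44 g55)
  have E: "coeff (char_poly (Matrix.mat 9 9 (\<lambda>(i, j). inner (f i) (full_hess p (f j))))) 0 =
      - (weight_det n f p * free_det n f p)"
    using coeff_0_char_poly[of "Matrix.mat 9 9 (\<lambda>(i, j). inner (f i) (full_hess p (f j)))" 9]
      free_det_full[OF f, of p] unfolding n by simp
  have "coeff (char_poly (hessian (\<lambda>q. phi q p) (rosette p))) 1 =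
    (snd p * m2 p * a1_det p) * ((snd p * m2 p * b1_det p) * (- zeta p * (snd p * m2 p * b2_det p))) *
    ((weight_det n f p * free_det n f p) * (weight_det n f p * free_det n f p))"
  proof -
    \<comment> \<open>One factor is divisible by x, so the linear coefficient of the product only
      involves constant coefficients of the others.\<close>
    have c: "coeff (P * (Q * (pCons 0 r * T)) * E) (Suc 0) = coeff P 0 * (coeff Q 0 * (coeff r 0 * coeff T 0)) * coeff E 0"
      for P Q r T E :: "real poly"
      by (simp add: mult_pCons_left mult_pCons_right coeff_mult_0)
    show ?thesis unfolding cp cp8 A2 One_nat_def c coeff_mult_0 A1 B1 B2 E by simp
  qed
  then show ?thesis by (simp add: cp_coeff_def power2_eq_square power3_eq_cube algebra_simps)
qed

section \<open>Linear dependence on the parameter\<close>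

lemma mass_linear: "mass p = fst p *\<^sub>R mass (1, 0) + snd p *\<^sub>R mass (0, 1)"
  unfolding Finite_Cartesian_Product.vec_eq_iff forall_13 vector_add_component vector_scaleR_component mass_def ring_mass_nth
  using m2_linear[of p] by (simp add: mult.commute)

lemma force_linear:
  "force (x *\<^sub>R \<mu> + y *\<^sub>R \<nu>) (x * k + y * l) q = x *\<^sub>R force \<mu> k q + y *\<^sub>R force \<nu> l q"
  by (simp add: force_def config_eq_iff scaleR_add_left sum.distrib scaleR_diff_right scaleR_sum_right)

lemma force_deriv_linear:
  "force_deriv (x *\<^sub>R \<mu> + y *\<^sub>R \<nu>) (x * k + y * l) q v = x *\<^sub>R force_deriv \<mu> k q v + y *\<^sub>R force_deriv \<nu> l q v"
  by (simp add: force_deriv_def config_eq_iff scaleR_add_left sum.distrib scaleR_diff_right scaleR_sum_right)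

text \<open>Linearity turns a shift of m0 by t into the addition of t times
  \<open>pforce (1, 0)\<close>, the shape that \<open>bifurcation_from_simple_zero\<close> asks
  for.\<close>

lemma pforce_linear: "pforce p q = fst p *\<^sub>R pforce (1, 0) q + snd p *\<^sub>R pforce (0, 1) q"
proof -
  have "lamf p = fst p * lamf (1, 0) + snd p * lamf (0, 1)" using lamf_linear[of p] by (simp add: mult.commute)
  then have "pforce p q = force (fst p *\<^sub>R mass (1, 0) + snd p *\<^sub>R mass (0, 1)) (fst p * lamf (1, 0) + snd p * lamf (0, 1)) q"
    using mass_linear[of p] by (simp add: pforce_def)
  then show ?thesis unfolding force_linear by (simp add: pforce_def)
qed

lemma phess_eq: "phess p = force_deriv (mass p) (lamf p) (rosette (1, 1))"
  by (simp add: phess_def hess_def mass_def)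

lemma phess_linear: "phess p v = fst p *\<^sub>R phess (1, 0) v + snd p *\<^sub>R phess (0, 1) v"
proof -
  have "lamf p = fst p * lamf (1, 0) + snd p * lamf (0, 1)" using lamf_linear[of p] by (simp add: mult.commute)
  then have "phess p v = force_deriv (fst p *\<^sub>R mass (1, 0) + snd p *\<^sub>R mass (0, 1)) (fst p * lamf (1, 0) + snd p * lamf (0, 1)) (rosette (1, 1)) v"
    using mass_linear[of p] by (simp add: phess_eq)
  then show ?thesis unfolding force_deriv_linear by (simp add: phess_eq)
qed

text \<open>Continuity of the derivative at w for each fixed direction suffices in finite dimension:
  expanding v in \<open>Basis\<close> bounds the operator norm of f' x - f' w. The mean value
  inequality for f minus its linear part does the rest.\<close>

lemma strict_derivI:
  fixes f :: "'a::euclidean_space \<Rightarrow> 'b::real_normed_vector"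
  assumes S: "open S" "w \<in> S" and f: "\<And>x. x \<in> S \<Longrightarrow> (f has_derivative f' x) (at x)"
    and cont: "\<And>v. isCont (\<lambda>x. f' x v) w"
  shows "strict_deriv f (f' w) w"
  unfolding strict_deriv_def
proof (intro conjI allI impI)
  show lin: "linear (f' w)" using f[OF S(2)] has_derivative_linear by blast
  fix \<epsilon> :: real assume "\<epsilon> > 0"
  have "((\<lambda>x. \<Sum>b\<in>Basis. norm (f' x b - f' w b)) \<longlongrightarrow> (\<Sum>b\<in>Basis. norm (f' w b - f' w b))) (at w)"
    using cont by (intro tendsto_intros) (auto simp: isCont_def)
  then have "((\<lambda>x. \<Sum>b\<in>Basis. norm (f' x b - f' w b)) \<longlongrightarrow> 0) (at w)" by simp
  from order_tendstoD(2)[OF this \<open>\<epsilon> > 0\<close>]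
  obtain d where d: "d > 0" "\<And>x. x \<noteq> w \<Longrightarrow> dist x w < d \<Longrightarrow> (\<Sum>b\<in>Basis. norm (f' x b - f' w b)) < \<epsilon>"
    unfolding eventually_at by auto
  obtain r where r: "r > 0" "ball w r \<subseteq> S" using S openE by blast
  define \<delta> where "\<delta> = min d r"
  have bound: "norm (f' x v - f' w v) \<le> \<epsilon> * norm v" if "x \<in> ball w \<delta>" for x v
  proof -
    have sm: "(\<Sum>b\<in>Basis. norm (f' x b - f' w b)) \<le> \<epsilon>"
      using d(2)[of x] that \<open>\<epsilon> > 0\<close> by (cases "x = w") (auto simp: \<delta>_def dist_commute less_imp_le)
    have l: "linear (\<lambda>v. f' x v - f' w v)"
    proof (rule linear_compose_sub[OF _ lin])
      have "x \<in> S" using that r by (auto simp: \<delta>_def)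
      then show "linear (f' x)" using f has_derivative_linear by blast
    qed
    have "f' x v - f' w v = (\<lambda>v. f' x v - f' w v) (\<Sum>b\<in>Basis. inner v b *\<^sub>R b)"
      by (simp add: euclidean_representation)
    also have "\<dots> = (\<Sum>b\<in>Basis. inner v b *\<^sub>R (f' x b - f' w b))"
      by (simp only: linear_sum[OF l] linear_scale[OF l])
    finally have "norm (f' x v - f' w v) \<le> (\<Sum>b\<in>Basis. norm (inner v b *\<^sub>R (f' x b - f' w b)))"
      by (simp only: norm_sum)
    also have "\<dots> \<le> (\<Sum>b\<in>Basis. norm v * norm (f' x b - f' w b))"
      by (intro sum_mono) (simp add: mult_right_mono Basis_le_norm)
    also have "\<dots> = norm v * (\<Sum>b\<in>Basis. norm (f' x b - f' w b))" by (simp add: sum_distrib_left)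
    also have "\<dots> \<le> norm v * \<epsilon>" using sm by (intro mult_left_mono) auto
    finally show ?thesis by (simp add: mult.commute)
  qed
  have "norm (f x - f y - f' w (x - y)) \<le> \<epsilon> * norm (x - y)" if "x \<in> ball w \<delta>" "y \<in> ball w \<delta>" for x y
  proof -
    have "norm ((f x - f' w x) - (f y - f' w y)) \<le> \<epsilon> * norm (x - y)"
    proof (rule differentiable_bound[of "ball w \<delta>" _ "\<lambda>z v. f' z v - f' w v"])
      fix z assume z: "z \<in> ball w \<delta>"
      have fz: "(f has_derivative f' z) (at z)" using f z r by (auto simp: \<delta>_def)
      show "((\<lambda>x. f x - f' w x) has_derivative (\<lambda>v. f' z v - f' w v)) (at z within ball w \<delta>)"
        by (rule has_derivative_at_withinI[OF has_derivative_diff[OF fz linear_imp_has_derivative[OF lin]]])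
      show "onorm (\<lambda>v. f' z v - f' w v) \<le> \<epsilon>" by (rule onorm_le) (rule bound[OF z])
    qed (use that in auto)
    moreover have "f x - f y - f' w (x - y) = (f x - f' w x) - (f y - f' w y)"
      unfolding linear_diff[OF lin] by simp
    ultimately show ?thesis by (simp only:)
  qed
  then show "\<exists>\<delta>>0. \<forall>x\<in>ball w \<delta>. \<forall>y\<in>ball w \<delta>. norm (f x - f y - f' w (x - y)) \<le> \<epsilon> * norm (x - y)"
  proof (intro exI[of _ \<delta>] conjI)
    show "\<delta> > 0" using d(1) r(1) by (simp add: \<delta>_def)
  qed blast
qed

lemma isCont_force_deriv:
  assumes "w \<in> Omega"
  shows "isCont (\<lambda>x. force_deriv \<mu> l x v) w"
proof -
  have "isCont (\<lambda>x. acc_deriv (x $ i - x $ j) (v $ i - v $ j)) w" for i j :: 13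
  proof (cases "i = j")
    case False
    then have n: "norm (w $ i - w $ j) \<noteq> 0" using assms by (auto simp: Omega_def)
    show ?thesis unfolding acc_deriv_def
      by (intro continuous_intros) (use n in auto)
  qed simp
  then show ?thesis
    unfolding force_deriv_def isCont_def
    by (intro tendsto_vec_lambda tendsto_intros) (auto simp: isCont_def)
qed

lemma strict_deriv_pforce: "strict_deriv (pforce p) (phess p) (rosette p')"
  unfolding pforce_def phess_eq rosette_const[of "(1, 1)" p']
  by (rule strict_derivI[OF open_Omega rosette_in_Omega])
    (auto intro: has_derivative_force isCont_force_deriv rosette_in_Omega)

lemma crit_iff:
  assumes "q \<in> Omega" "p \<in> quadrant"
  shows "grad (\<lambda>q. phi q p) q = 0 \<longleftrightarrow> pforce p q = 0"
proof -
  have "mass p $ i \<noteq> 0" for i using mass_pos[OF assms(2), of i] by simp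
  then show ?thesis
    unfolding grad_phi[OF assms(1)] rosette_mass_mass lam_eq_lamf[OF assms(2)]
    by (simp add: config_eq_iff pforce_def)
qed

section \<open>Rotations and isolated orbits\<close>

definition Jrot :: "config \<Rightarrow> config" where
  "Jrot q = (\<chi> i. vector [- (q $ i $ 2), q $ i $ 1])"

text \<open>A rotation written through its cosine and sine, so that the orbit is parametrised by c^2
  + s^2 = 1 and compositions are polynomial identities.\<close>

definition turn :: "real \<Rightarrow> real \<Rightarrow> config \<Rightarrow> config" where
  "turn c s q = c *\<^sub>R q + s *\<^sub>R Jrot q"

lemma rotation_matrix_vec:
  fixes A :: "real^2^2"
  assumes "rotation_matrix A"
  shows "\<exists>c s. c\<^sup>2 + s\<^sup>2 = 1 \<and> (\<forall>v. A *v v = vector [c * v $ 1 - s * v $ 2, s * v $ 1 + c * v $ 2])"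
proof -
  define a b c d where "a = A $ 1 $ 1" and "b = A $ 1 $ 2" and "c = A $ 2 $ 1" and "d = A $ 2 $ 2"
  have o: "Finite_Cartesian_Product.transpose A ** A = Finite_Cartesian_Product.mat 1" and dt: "a * d - b * c = 1"
    using assms by (auto simp: rotation_matrix_def orthogonal_matrix_def det_2 a_def b_def c_def d_def)
  have "(Finite_Cartesian_Product.transpose A ** A) $ i $ j = Finite_Cartesian_Product.mat 1 $ i $ j" for i j using o by simp
  from this[of 1 1] this[of 2 2] this[of 1 2]
  have e: "a * a + c * c = 1" "b * b + d * d = 1" "a * b + c * d = 0"
    by (simp_all add: matrix_matrix_mult_def Finite_Cartesian_Product.transpose_def sum_2 Finite_Cartesian_Product.mat_def a_def b_def c_def d_def)
  \<comment> \<open>A sum of two squares that vanishes by orthonormality of the columns and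
    determinant 1; it forces the shape of a rotation matrix.\<close>
  have "(a - d) * (a - d) + (b + c) * (b + c) = (a * a + c * c) + (b * b + d * d) - 2 * (a * d - b * c)"
    by (simp add: algebra_simps)
  also have "\<dots> = 0" using e dt by simp
  finally have "a = d" "b = - c" by (simp_all add: sum_squares_eq_zero_iff)
  then show ?thesis
    using e(1) by (intro exI[of _ a] exI[of _ c])
      (auto simp: vec2_eq_iff matrix_vector_mult_def sum_2 power2_eq_square a_def b_def c_def d_def)
qed

lemma rotation_matrix_Phi: "rotation_matrix (Phi s)"
proof -
  have "Phi s = matrix ((*v) (Phi s))" by (simp add: matrix_of_matrix_vector_mul)
  moreover have "orthogonal_matrix (matrix ((*v) (Phi s)))"
    using orthogonal_Phi orthogonal_transformation_matrix by blast
  moreover have "Determinants.det (Phi s) = 1" by (simp add: det_2 Phi_def power2_eq_square[symmetric])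
  ultimately show ?thesis by (simp add: rotation_matrix_def)
qed

lemma turn_Phi: "(\<chi> j. Phi s *v (q $ j)) = turn (cos s) (sin s) q"
  by (simp add: turn_def Jrot_def config_eq_iff Phi_vec vec2_eq_iff)

lemma SO2_orbit_eq: "SO2_orbit q = {turn c s q | c s. c\<^sup>2 + s\<^sup>2 = 1}"
proof (intro equalityI subsetI)
  fix x assume "x \<in> SO2_orbit q"
  then obtain A where A: "rotation_matrix A" "x = (\<chi> j. A *v (q $ j))" by (auto simp: SO2_orbit_def)
  obtain c s where "c\<^sup>2 + s\<^sup>2 = 1" "\<And>v. A *v v = vector [c * v $ 1 - s * v $ 2, s * v $ 1 + c * v $ 2]"
    using rotation_matrix_vec[OF A(1)] by blast
  moreover from this have "x = turn c s q"
    using A(2) by (simp add: turn_def Jrot_def config_eq_iff vec2_eq_iff)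
  ultimately show "x \<in> {turn c s q | c s. c\<^sup>2 + s\<^sup>2 = 1}" by blast
next
  fix x assume "x \<in> {turn c s q | c s. c\<^sup>2 + s\<^sup>2 = 1}"
  then obtain c s where x: "x = turn c s q" "c\<^sup>2 + s\<^sup>2 = 1" by blast
  obtain t where "c = cos t" "s = sin t" using sincos_total_2pi[OF x(2)] by metis
  then have "x = (\<chi> j. Phi t *v (q $ j))" using x turn_Phi by simp
  then show "x \<in> SO2_orbit q" unfolding SO2_orbit_def using rotation_matrix_Phi by blast
qed

lemma inner_Jrot: "inner (Jrot u) (Jrot v) = inner u v" "inner u (Jrot v) = - inner (Jrot u) v"
  by (simp_all add: inner_vec_def[where 'b = 13] Jrot_def inner_vec2 sum_negf[symmetric] add.commute)

lemma Jrot_Jrot: "Jrot (Jrot q) = - q"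
  by (simp add: Jrot_def config_eq_iff vec2_eq_iff)

lemma linear_Jrot: "linear Jrot"
  by (rule linearI) (simp_all add: Jrot_def config_eq_iff vec2_eq_iff)

lemma turn_turn: "turn c s (turn c' s' q) = turn (c * c' - s * s') (s * c' + c * s') q"
  by (simp add: turn_def linear_add[OF linear_Jrot] linear_scale[OF linear_Jrot] Jrot_Jrot algebra_simps)

lemma pforce_turn:
  assumes "c\<^sup>2 + s\<^sup>2 = 1"
  shows "pforce p (turn c s q) = turn c s (pforce p q)"
proof -
  obtain t where t: "c = cos t" "s = sin t" using sincos_total_2pi[OF assms] by metis
  have eq: "turn c s q = gact ((*v) (Phi t)) id q" for q
    unfolding t turn_Phi[symmetric] by (simp add: gact_def)
  show ?thesis unfolding eq pforce_def by (intro force_gact orthogonal_Phi) auto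
qed

lemma Jrot_rosette: "Jrot (rosette p) = upos 0 (1/2) 0 (sqrt 3 / 2)"
  unfolding config_eq_iff forall_13 Jrot_def vec_lambda_beta upos_nth rosette_nth
  by (simp add: vec2_eq_iff)

section \<open>The kernel of the Hessian at a nondegenerate parameter\<close>

lemma unit_config_expansion: "v = (\<Sum>k<26. inner (unit_config k) v *\<^sub>R unit_config k)"
proof -
  have "v = (\<Sum>k<26. (inner (unit_config k) v / inner (unit_config k) (unit_config k)) *\<^sub>R unit_config k)"
  proof (rule orthogonal_expansion)
    show "unit_config k \<noteq> 0" if "k < 26" for k using inner_unit_config[OF that that] by auto
  qed (simp_all add: inner_unit_config)
  also have "\<dots> = (\<Sum>k<26. inner (unit_config k) v *\<^sub>R unit_config k)"
    by (intro sum.cong) (simp_all add: inner_unit_config)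
  finally show ?thesis .
qed

lemma full_hess_rotation: "full_hess p (Jrot (rosette p')) = 0"
proof -
  have "full_hess p (Jrot (rosette p')) = upos 0 0 0 0"
    unfolding Jrot_rosette full_hess_upos by (simp add: rotation_kernel)
  then show ?thesis using upos_scale[of 0 0 0 0 0] by simp
qed

text \<open>The rotation makes 0 a root of the characteristic polynomial, and \<open>a_25\<close>
  nonzero says that it is a simple root. The kernel is therefore one-dimensional.\<close>

lemma kernel_of_simple:
  assumes p: "p \<in> quadrant" and cp0: "cp_coeff 25 p \<noteq> 0" and u: "phess p u = 0"
  shows "\<exists>c. u = c *\<^sub>R Jrot (rosette p')"
proof -
  define H where "H = Matrix.mat 26 26 (\<lambda>(i, j). inner (unit_config i) (full_hess p (unit_config j)))"
  define co where "co v = Matrix.vec 26 (\<lambda>k. inner (unit_config k) v)" for v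
  have H: "H \<in> carrier_mat 26 26" by (simp add: H_def)
  have Hco: "H *\<^sub>v co v = co (full_hess p v)" for v
  proof (rule eq_vecI)
    fix i assume "i < dim_vec (co (full_hess p v))"
    then have i: "i < 26" by (simp add: co_def)
    have "vec_index (H *\<^sub>v co v) i = (\<Sum>k<26. inner (unit_config i) (full_hess p (unit_config k)) * inner (unit_config k) v)"
      using i by (simp add: H_def co_def scalar_prod_def atLeast0LessThan)
    also have "\<dots> = inner (unit_config i) (full_hess p (\<Sum>k<26. inner (unit_config k) v *\<^sub>R unit_config k))"
      by (simp add: linear_sum[OF linear_full_hess] linear_scale[OF linear_full_hess] inner_sum_right mult.commute)
    also have "\<dots> = inner (unit_config i) (full_hess p v)" using unit_config_expansion[of v] by simp
    finally show "vec_index (H *\<^sub>v co v) i = vec_index (co (full_hess p v)) i" using i by (simp add: co_def)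
  qed (simp add: H_def co_def)
  have co_inj: "v = 0" if "co v = 0\<^sub>v 26" for v
  proof -
    have "inner (unit_config k) v = 0" if "k < 26" for k
      using arg_cong[OF \<open>co v = 0\<^sub>v 26\<close>, of "\<lambda>x. vec_index x k"] that by (simp add: co_def)
    then show ?thesis using unit_config_expansion[of v] by simp
  qed
  have co0: "co 0 = 0\<^sub>v 26" by (rule eq_vecI) (auto simp: co_def)
  define cpol where "cpol = char_poly H"
  have det: "Determinant.det ((- 1) \<cdot>\<^sub>m H + t \<cdot>\<^sub>m (1\<^sub>m 26)) = poly cpol t" for t
  proof -
    have "poly cpol t = Determinant.det (- char_matrix H t)" unfolding cpol_def by (rule char_poly_matrix[OF H])
    also have "- char_matrix H t = (- 1) \<cdot>\<^sub>m H + t \<cdot>\<^sub>m (1\<^sub>m 26)"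
      using H by (intro eq_matI) (auto simp: char_matrix_def)
    finally show ?thesis by simp
  qed
  define J where "J = Jrot (rosette p')"
  have J0: "J \<noteq> 0"
  proof
    assume "J = 0"
    then have "inner J J = 0" by simp
    then show False by (simp add: J_def Jrot_rosette inner_upos)
  qed
  have HJ: "H *\<^sub>v co J = 0\<^sub>v 26" unfolding Hco J_def full_hess_rotation by (rule co0)
  have coJ: "co J \<in> carrier_vec 26" "co J \<noteq> 0\<^sub>v 26" using co_inj J0 by (auto simp: co_def)
  have "Determinant.det H = 0" using det_0_iff_vec_prod_zero_field[OF H] coJ HJ by blast
  then have "coeff cpol 0 = 0" unfolding cpol_def coeff_0_char_poly[OF H] by simp
  then obtain r where r: "cpol = pCons 0 r" by (cases cpol) auto
  have "coeff cpol 1 \<noteq> 0" using cp0 hessian_phi[OF p] by (simp add: cp_coeff_def cpol_def H_def)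
  then have r0: "poly r 0 \<noteq> 0" by (simp add: r poly_0_coeff_0)
  have uv: "full_hess p u = 0" using u by (simp add: full_hess_def linear_0[OF linear_weight])
  have Hu: "H *\<^sub>v co u = 0\<^sub>v 26" unfolding Hco uv by (rule co0)
  have "(0::real) = 0 \<and> (\<exists>c. co u = c \<cdot>\<^sub>v co J)"
  \<comment> \<open>The pencil is t - H, whose determinant is the characteristic polynomial, with s
    = 0 and the coordinates of u as \<eta>.\<close>
  proof (rule pencil_simple_zero[where ?D0.0 = "(- 1) \<cdot>\<^sub>m H" and ?D1.0 = "1\<^sub>m 26" and n = 26 and g = "poly r" and ?g0.0 = "poly r 0"])
    show "\<forall>\<^sub>F t in at 0. Determinant.det ((- 1) \<cdot>\<^sub>m H + t \<cdot>\<^sub>m (1\<^sub>m 26)) = t * poly r t"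
      unfolding det r by simp
    show "(poly r \<longlongrightarrow> poly r 0) (at 0)" by (intro isContD poly_isCont)
    show "(- 1) \<cdot>\<^sub>m H *\<^sub>v co J = 0\<^sub>v 26"
    proof (rule eq_vecI)
      fix i assume "i < dim_vec (0\<^sub>v 26 :: real Matrix.vec)"
      then show "vec_index ((- 1) \<cdot>\<^sub>m H *\<^sub>v co J) i = vec_index (0\<^sub>v 26) i"
        using arg_cong[OF HJ, of "\<lambda>x. vec_index x i"] H coJ(1) by simp
    qed (use H in auto)
    show "(- 1) \<cdot>\<^sub>m H *\<^sub>v co u + 0 \<cdot>\<^sub>v (1\<^sub>m 26 *\<^sub>v co J) = 0\<^sub>v 26"
    proof (rule eq_vecI)
      fix i assume "i < dim_vec (0\<^sub>v 26 :: real Matrix.vec)"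
      then show "vec_index ((- 1) \<cdot>\<^sub>m H *\<^sub>v co u + 0 \<cdot>\<^sub>v (1\<^sub>m 26 *\<^sub>v co J)) i = vec_index (0\<^sub>v 26) i"
        using arg_cong[OF Hu, of "\<lambda>x. vec_index x i"] H coJ(1) by (simp add: co_def)
    qed (use H in auto)
  qed (use H coJ r0 in \<open>auto simp: co_def\<close>)
  then obtain c where c: "co u = c \<cdot>\<^sub>v co J" by blast
  have "co (u - c *\<^sub>R J) = 0\<^sub>v 26"
  proof (rule eq_vecI)
    fix i assume "i < dim_vec (0\<^sub>v 26 :: real Matrix.vec)"
    then show "vec_index (co (u - c *\<^sub>R J)) i = vec_index (0\<^sub>v 26) i"
      using arg_cong[OF c, of "\<lambda>x. vec_index x i"] by (simp add: co_def inner_diff_right)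
  qed (simp add: co_def)
  then show ?thesis using co_inj[of "u - c *\<^sub>R J"] by (auto simp: J_def)
qed


section \<open>Local uniqueness in a slice transversal to the orbit\<close>

lemma inner_turn_norm:
  assumes "c\<^sup>2 + s\<^sup>2 = 1"
  shows "inner (turn c s q) (turn c s q) = inner q q"
proof -
  have "inner q (Jrot q) = 0" "inner (Jrot q) q = 0"
    using inner_Jrot(2)[of q q] by (simp_all add: inner_commute)
  then have "inner (turn c s q) (turn c s q) = (c\<^sup>2 + s\<^sup>2) * inner q q"
    by (simp add: turn_def inner_add_left inner_add_right inner_Jrot(1)
        algebra_simps power2_eq_square)
  then show ?thesis using assms by simp
qed

text \<open>The angle is chosen to maximise the inner product with w, which then equals r. That
  point of the orbit is nearest to w, so its distance has not grown and it is orthogonal to the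
  direction of rotation.\<close>

lemma rotate_to_slice:
  obtains c s where "c\<^sup>2 + s\<^sup>2 = 1" "inner (turn c s q - w) (Jrot w) = 0" "dist w (turn c s q) \<le> dist w q"
proof -
  define a where "a = inner q w"
  define b where "b = inner (Jrot q) w"
  define r where "r = sqrt (a\<^sup>2 + b\<^sup>2)"
  have r2: "r * r = a\<^sup>2 + b\<^sup>2" by (simp add: r_def)
  have ra: "a \<le> r"
    unfolding r_def by (metis abs_le_D1 real_sqrt_abs real_sqrt_le_mono le_add_same_cancel1 zero_le_power2)
  define c where "c = (if r = 0 then 1 else a / r)"
  define s where "s = (if r = 0 then 0 else b / r)"
  have cs: "c\<^sup>2 + s\<^sup>2 = 1"
  proof (cases "r = 0")
    case False
    have "c\<^sup>2 + s\<^sup>2 = (a\<^sup>2 + b\<^sup>2) / (r * r)"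
      using False by (simp add: c_def s_def power_divide add_divide_distrib power2_eq_square)
    also have "\<dots> = 1" unfolding r2[symmetric] using False by simp
    finally show ?thesis .
  qed (simp add: c_def s_def)
  have ab0: "r = 0 \<Longrightarrow> a = 0 \<and> b = 0" using r2 by (simp add: sum_power2_eq_zero_iff)
  have i1: "inner (turn c s q) w = r"
  proof -
    have "inner (turn c s q) w = c * a + s * b" by (simp add: turn_def inner_add_left a_def b_def)
    also have "\<dots> = r"
    proof (cases "r = 0")
      case False
      then have "c * a + s * b = (r * r) / r" unfolding r2 by (simp add: c_def s_def add_divide_distrib power2_eq_square)
      then show ?thesis using False by simp
    qed (simp add: ab0)
    finally show ?thesis .
  qed
  have i2: "inner (turn c s q) (Jrot w) = 0"
  proof -
    have "inner (turn c s q) (Jrot w) = - c * b + s * a"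
      by (simp add: turn_def inner_add_left a_def b_def inner_Jrot(1) inner_Jrot(2)[of q w])
    then show ?thesis by (cases "r = 0") (simp_all add: ab0 c_def s_def)
  qed
  have iw: "inner w (Jrot w) = 0" using inner_Jrot(2)[of w w] by (simp add: inner_commute)
  have "(dist w (turn c s q))\<^sup>2 = inner w w + inner q q - 2 * r"
    using i1 inner_turn_norm[OF cs, of q]
    by (simp add: dist_norm power2_norm_eq_inner inner_diff_left inner_diff_right inner_commute)
  also have "\<dots> \<le> inner w w + inner q q - 2 * a" using ra by simp
  also have "\<dots> = (dist w q)\<^sup>2"
    by (simp add: dist_norm power2_norm_eq_inner inner_diff_left inner_diff_right inner_commute a_def)
  finally have "dist w (turn c s q) \<le> dist w q" by (rule power2_le_imp_le) simp
  moreover have "inner (turn c s q - w) (Jrot w) = 0" using i2 iw by (simp only: inner_diff_left diff_self)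
  ultimately show thesis using that[OF cs] by blast
qed

text \<open>On the slice \<open>phess p\<close> is injective and hence bounded below by some c. The
  linearization error and the change of parameter each cost at most c/4 times the distance to w,
  which leaves w as the only zero.\<close>

lemma locally_unique_in_slice:
  assumes p: "p \<in> quadrant" and cp: "cp_coeff 25 p \<noteq> 0"
  obtains \<delta> where "\<delta> > 0" "\<And>q p'. dist w q < \<delta> \<Longrightarrow> dist p p' < \<delta> \<Longrightarrow> inner (q - w) (Jrot w) = 0 \<Longrightarrow>
    w = rosette p \<Longrightarrow> pforce p' q = 0 \<Longrightarrow> q = w"
proof (cases "w = rosette p")
  case True
  define S where "S = {u. inner u (Jrot w) = 0}"
  have subS: "subspace S" unfolding S_def by (rule subspaceI) (simp_all add: inner_add_left)
  have J0: "inner (Jrot w) (Jrot w) \<noteq> 0" unfolding True Jrot_rosette inner_upos by simp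
  obtain c where c: "c > 0" "\<And>u. u \<in> S \<Longrightarrow> norm (phess p u) \<ge> c * norm u"
  proof -
    have "\<forall>u\<in>S. phess p u = 0 \<longrightarrow> u = 0"
    proof (intro ballI impI)
      fix u assume u: "u \<in> S" "phess p u = 0"
      obtain k where k: "u = k *\<^sub>R Jrot (rosette p)" using kernel_of_simple[OF p cp u(2)] by blast
      then have "k * inner (Jrot w) (Jrot w) = 0" using u(1) True by (simp add: S_def)
      then show "u = 0" using J0 k by simp
    qed
    moreover have "bounded_linear (phess p)" using linear_phess by (simp add: linear_conv_bounded_linear)
    ultimately obtain e where "e > 0" "\<forall>u\<in>S. e * norm u \<le> norm (phess p u)"
      using injective_imp_isometric[OF closed_subspace[OF subS] subS] by blast
    then show thesis using that by blast
  qed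
  have sd: "strict_deriv (pforce r) (phess r) w" for r unfolding True by (rule strict_deriv_pforce)
  have z: "pforce r w = 0" for r unfolding True by (rule central_configuration)
  have "c / 4 > 0" using c by simp
  from strict_derivD[OF sd this, of p] obtain d1 where d1: "d1 > 0"
    "\<And>x y. x \<in> ball w d1 \<Longrightarrow> y \<in> ball w d1 \<Longrightarrow> norm (pforce p x - pforce p y - phess p (x - y)) \<le> c / 4 * norm (x - y)"
    by blast
  \<comment> \<open>Every \<open>pforce r\<close> vanishes at w, so it is at most linear in the
    distance to w; the change of parameter is then a small multiple of that distance.\<close>
  have lin_bound: "\<exists>d>0. \<exists>K>0. \<forall>q\<in>ball w d. norm (pforce r q) \<le> K * norm (q - w)" for r
  proof -
    obtain d where d: "d > 0" "\<And>x y. x \<in> ball w d \<Longrightarrow> y \<in> ball w d \<Longrightarrow>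
        norm (pforce r x - pforce r y - phess r (x - y)) \<le> 1 * norm (x - y)"
      using strict_derivD[OF sd, of 1 r] by auto
    obtain B where B: "B > 0" "\<And>x. norm (phess r x) \<le> B * norm x"
      using linear_bounded_pos[OF linear_phess] by blast
    have "norm (pforce r q) \<le> (1 + B) * norm (q - w)" if "q \<in> ball w d" for q
    proof -
      have "norm (pforce r q - phess r (q - w)) \<le> norm (q - w)" using d(2)[OF that, of w] d(1) z[of r] by simp
      then show ?thesis
        using B(2)[of "q - w"] norm_triangle_ineq[of "pforce r q - phess r (q - w)" "phess r (q - w)"]
        by (simp add: distrib_right)
    qed
    then show ?thesis using d(1) B(1) by (intro exI[of _ d] conjI exI[of _ "1 + B"]) auto
  qed
  obtain d2 K2 where d2: "d2 > 0" "K2 > 0" "\<And>q. q \<in> ball w d2 \<Longrightarrow> norm (pforce (1, 0) q) \<le> K2 * norm (q - w)"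
    using lin_bound[of "(1, 0)"] by blast
  obtain d3 K3 where d3: "d3 > 0" "K3 > 0" "\<And>q. q \<in> ball w d3 \<Longrightarrow> norm (pforce (0, 1) q) \<le> K3 * norm (q - w)"
    using lin_bound[of "(0, 1)"] by blast
  define \<delta> where "\<delta> = min (min d1 d2) (min d3 (c / 4 / (K2 + K3)))"
  show thesis
  proof (rule that)
    show "\<delta> > 0" using d1 d2 d3 c by (simp add: \<delta>_def)
    fix q p' assume q: "dist w q < \<delta>" and p': "dist p p' < \<delta>" and slice: "inner (q - w) (Jrot w) = 0"
      and zero: "pforce p' q = 0"
    define n where "n = norm (q - w)"
    have x: "\<bar>fst p' - fst p\<bar> \<le> \<delta>" "\<bar>snd p' - snd p\<bar> \<le> \<delta>"
      using p' dist_fst_le[of p p'] dist_snd_le[of p p'] by (simp_all add: dist_real_def)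
    have eq: "pforce p q = - ((fst p' - fst p) *\<^sub>R pforce (1, 0) q + (snd p' - snd p) *\<^sub>R pforce (0, 1) q)"
      using zero pforce_linear[of p' q] pforce_linear[of p q] by (simp add: algebra_simps)
    have "norm (pforce p q) \<le> \<bar>fst p' - fst p\<bar> * norm (pforce (1, 0) q) + \<bar>snd p' - snd p\<bar> * norm (pforce (0, 1) q)"
      unfolding eq norm_minus_cancel
      using norm_triangle_ineq[of "(fst p' - fst p) *\<^sub>R pforce (1, 0) q" "(snd p' - snd p) *\<^sub>R pforce (0, 1) q"] by simp
    also have "\<dots> \<le> \<delta> * (K2 * n) + \<delta> * (K3 * n)"
      using x d2(3)[of q] d3(3)[of q] q d2 d3 by (intro add_mono mult_mono) (auto simp: n_def \<delta>_def)
    also have "\<dots> = \<delta> * (K2 + K3) * n" by (simp add: algebra_simps)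
    also have "\<dots> \<le> c / 4 * n"
    proof (rule mult_right_mono)
      have "\<delta> \<le> c / 4 / (K2 + K3)" by (simp add: \<delta>_def)
      moreover have "0 < K2 + K3" using d2 d3 by simp
      ultimately show "\<delta> * (K2 + K3) \<le> c / 4" by (simp only: pos_le_divide_eq)
    qed (simp add: n_def)
    finally have 1: "norm (pforce p q) \<le> c / 4 * n" .
    have 2: "norm (pforce p q - phess p (q - w)) \<le> c / 4 * n"
      using d1(2)[of q w] q d1(1) z by (simp add: n_def \<delta>_def)
    have "c * n \<le> norm (phess p (q - w))" using c(2)[of "q - w"] slice by (simp add: S_def n_def)
    also have "\<dots> \<le> norm (pforce p q) + norm (pforce p q - phess p (q - w))"
      using norm_triangle_ineq4[of "pforce p q" "pforce p q - phess p (q - w)"] by simp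
    also have "\<dots> \<le> c / 2 * n" using 1 2 by simp
    finally have "n \<le> 0" using c(1) by (simp add: mult_le_cancel_right_pos zero_less_mult_iff mult_le_0_iff)
    then show "q = w" by (simp add: n_def)
  qed
\<comment> \<open>If w is not the rosette, the conclusion has a false premise and any positive
  radius serves.\<close>
qed (use that[of 1] in auto)

lemma rosette_orbit_refl: "rosette p \<in> SO2_orbit (rosette p')"
proof -
  have "rosette p = turn 1 0 (rosette p')" unfolding rosette_const[of p p'] by (simp add: turn_def)
  then show ?thesis unfolding SO2_orbit_eq by (intro CollectI exI[of _ 1] exI[of _ 0]) simp
qed

text \<open>A nontrivial solution near the rosette can be rotated into the slice without moving away
  from w. There it equals w, so it was on the trivial orbit.\<close>

lemma not_local_bif:
  assumes seg: "\<And>\<rho>. \<sigma> \<rho> = b + \<rho> *\<^sub>R d" and J: "\<sigma> ` J \<subseteq> quadrant" and \<rho>: "\<rho>1 \<in> J"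
    and cp: "cp_coeff 25 (\<sigma> \<rho>1) \<noteq> 0"
  shows "\<not> local_bif \<sigma> J \<rho>1"
proof
  assume "local_bif \<sigma> J \<rho>1"
  define w where "w = rosette (\<sigma> \<rho>1)"
  have lim: "(w, \<rho>1) islimpt nontrivial_set \<sigma> J" using \<open>local_bif \<sigma> J \<rho>1\<close> by (simp add: local_bif_def w_def)
  have p: "\<sigma> \<rho>1 \<in> quadrant" using J \<rho> by auto
  obtain \<delta> where \<delta>: "\<delta> > 0" "\<And>q p'. dist w q < \<delta> \<Longrightarrow> dist (\<sigma> \<rho>1) p' < \<delta> \<Longrightarrow> inner (q - w) (Jrot w) = 0 \<Longrightarrow>
    w = rosette (\<sigma> \<rho>1) \<Longrightarrow> pforce p' q = 0 \<Longrightarrow> q = w"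
    using locally_unique_in_slice[OF p cp] by metis
  define r where "r = \<delta> / (norm d + 1)"
  have r: "r > 0" using \<delta> by (simp add: r_def add_nonneg_pos)
  have "open (ball w \<delta> \<times> ball \<rho>1 r)" "(w, \<rho>1) \<in> ball w \<delta> \<times> ball \<rho>1 r"
    using \<delta> r by (auto intro: open_Times)
  from islimptE[OF lim this(2,1)]
  obtain y where y: "y \<in> nontrivial_set \<sigma> J" "y \<in> ball w \<delta> \<times> ball \<rho>1 r" by metis
  obtain q \<rho> where qr: "y = (q, \<rho>)" by (cases y)
  have q: "(q, \<rho>) \<in> nontrivial_set \<sigma> J" "q \<in> ball w \<delta>" "\<rho> \<in> ball \<rho>1 r"
    using y unfolding qr by auto
  then have Om: "q \<in> Omega" "\<rho> \<in> J" "(q, \<rho>) \<notin> trivial_set \<sigma> J" "grad (\<lambda>q. phi q (\<sigma> \<rho>)) q = 0"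
    by (auto simp: nontrivial_set_def)
  have "\<sigma> \<rho> \<in> quadrant" using J Om(2) by blast
  then have z: "pforce (\<sigma> \<rho>) q = 0" using crit_iff[OF Om(1)] Om(4) by blast
  have ds: "dist (\<sigma> \<rho>1) (\<sigma> \<rho>) < \<delta>"
  proof -
    have "dist (\<sigma> \<rho>1) (\<sigma> \<rho>) = \<bar>\<rho>1 - \<rho>\<bar> * norm d"
      by (simp add: seg dist_norm scaleR_diff_left[symmetric])
    also have "\<dots> \<le> r * norm d" using q(3) by (intro mult_right_mono) (auto simp: dist_real_def)
    also have "\<dots> < r * (norm d + 1)" using r by simp
    also have "\<dots> = \<delta>" by (simp add: r_def add_nonneg_eq_0_iff)
    finally show ?thesis .
  qed
  obtain c s where cs: "c\<^sup>2 + s\<^sup>2 = 1" "inner (turn c s q - w) (Jrot w) = 0" "dist w (turn c s q) \<le> dist w q"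
    by (rule rotate_to_slice)
  have "turn c s q = w"
  proof (rule \<delta>(2)[OF _ ds cs(2) w_def])
    show "dist w (turn c s q) < \<delta>" using cs(3) q(2) by simp
    show "pforce (\<sigma> \<rho>) (turn c s q) = 0"
      unfolding pforce_turn[OF cs(1)] z by (simp add: turn_def linear_0[OF linear_Jrot])
  qed
  then have "turn c (- s) w = turn c (- s) (turn c s q)" by simp
  also have "\<dots> = turn (c\<^sup>2 + s\<^sup>2) 0 q" unfolding turn_turn by (simp add: power2_eq_square mult.commute)
  finally have "q = turn c (- s) w" using cs(1) by (simp add: turn_def)
  then have "q \<in> SO2_orbit (rosette (\<sigma> \<rho>))"
    unfolding SO2_orbit_eq w_def rosette_const[of "\<sigma> \<rho>1" "\<sigma> \<rho>"] using cs(1) by (intro CollectI exI[of _ c] exI[of _ "- s"]) simp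
  then show False using Om(2,3) by (auto simp: trivial_set_def)
qed

section \<open>Orders of vanishing along the singular rays\<close>

lemma bipoly_mult: "bipoly (F * G) p = bipoly F p * bipoly G p"
  and bipoly_power: "bipoly (F ^ k) p = bipoly F p ^ k"
  by (cases p, simp add: bipoly_def poly_mult poly_power)+

text \<open>F is a polynomial in m1 over R[m0], so restricting to m1 = k m0 means evaluating it at
  the ring element \<open>[:0, k:]\<close>. Vanishing on the whole ray becomes having a root, that
  is a linear divisor.\<close>

lemma bipoly_ray: "bipoly F (x, k * x) = poly (poly F [:0, k:]) x"
proof -
  have "poly (poly F [:k * x:]) x = poly (poly F [:0, k:]) x"
    by (induction F) (simp_all add: algebra_simps)
  then show ?thesis by (simp add: bipoly_def)
qed

lemma isCont_bipoly: "isCont (\<lambda>t. bipoly F (p + (t, 0))) t0"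
proof -
  have "isCont (\<lambda>t. poly (poly F [:snd p:]) (fst p + t)) t0"
    by (rule isCont_o2[OF _ poly_isCont]) (intro continuous_intros)
  then show ?thesis by (cases p) (simp add: bipoly_def)
qed

text \<open>The divisor in question is L = m1 - k m0. It divides some \<open>C j\<close>;
  squarefreeness excludes L^2 from the product, so L divides only that factor and only once.
  \<open>C0\<close> has no zero in the quadrant and hence not the root
  \<open>[:0, k:]\<close>.\<close>

lemma ray_factor:
  assumes fac: "a25_factorization C0 C" and k: "k > 0"
    and zero: "\<And>x. x > 0 \<Longrightarrow> cp_coeff 25 (x, k * x) = 0"
  obtains j D where "j \<in> {1, 2, 3}" "C j = [:- [:0, k:], 1:] * D" "poly D [:0, k:] \<noteq> 0"
    "\<And>i. i \<in> {1, 2, 3} \<Longrightarrow> i \<noteq> j \<Longrightarrow> poly (C i) [:0, k:] \<noteq> 0" "poly C0 [:0, k:] \<noteq> 0"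
proof -
  define c where "c = [:0, k:]"
  define L where "L = [:- c, 1:]"
  have eq: "cp_coeff 25 p = bipoly C0 p * (bipoly (C 1) p)\<^sup>2 * bipoly (C 2) p * (bipoly (C 3) p)\<^sup>2"
    and nz: "bipoly C0 p \<noteq> 0" if "p \<in> quadrant" for p
    using fac that by (auto simp: a25_factorization_def)
  have sq: "squarefree (C 1 * C 2 * C 3)" using fac by (simp add: a25_factorization_def)
  have ray: "(x, k * x) \<in> quadrant" if "x > 0" for x using that k by (auto simp: quadrant_def)
  have C0: "poly C0 c \<noteq> 0"
  proof
    assume "poly C0 c = 0"
    then have "bipoly C0 (1, k * 1) = 0" unfolding bipoly_ray c_def by simp
    then show False using nz[OF ray[of 1]] by simp
  qed
  \<comment> \<open>Otherwise the product restricted to the ray would be a nonzero polynomial in x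
    with finitely many zeros, although \<open>a_25\<close> vanishes along the ray and
    \<open>C0\<close> does not.\<close>
  have prod0: "poly (C 1 * C 2 * C 3) c = 0"
  proof (rule ccontr)
    assume "poly (C 1 * C 2 * C 3) c \<noteq> 0"
    then have "finite {x. poly (poly (C 1 * C 2 * C 3) c) x = 0}" by (rule poly_roots_finite)
    moreover have "infinite {0<..(1::real)}" by simp
    ultimately obtain x where x: "x \<in> {0<..1}" "poly (poly (C 1 * C 2 * C 3) c) x \<noteq> 0"
      by (metis (mono_tags, lifting) mem_Collect_eq rev_finite_subset subsetI)
    then have "bipoly (C 1 * C 2 * C 3) (x, k * x) \<noteq> 0" unfolding bipoly_ray c_def by simp
    then have "cp_coeff 25 (x, k * x) \<noteq> 0"
      using eq[OF ray] nz[OF ray] x(1) by (simp add: bipoly_mult)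
    then show False using zero x(1) by simp
  qed
  have no_sq: False if "L * L dvd C 1 * C 2 * C 3"
  proof -
    have "L ^ 2 dvd C 1 * C 2 * C 3" using that by (simp add: power2_eq_square)
    then have "L dvd 1" using sq by (auto simp: squarefree_def)
    then obtain E where "1 = L * E" by (auto elim: dvdE)
    then have "poly 1 c = poly L c * poly E c" by (metis poly_mult)
    then show False by (simp add: L_def)
  qed
  have dv: "L dvd F" if "poly F c = 0" for F :: "real poly poly"
    using that poly_eq_0_iff_dvd[of F c] by (simp add: L_def)
  obtain j where j: "j \<in> {1, 2, 3}" "poly (C j) c = 0" using prod0 by auto
  obtain D where D: "C j = L * D" using dv[OF j(2)] by (auto elim: dvdE)
  have two: False if "i \<in> {1, 2, 3}" "i \<noteq> j" "poly (C i) c = 0" for i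
  proof -
    have a: "L dvd C i" "L dvd C j" using dv that(3) j(2) by auto
    then have "L * L dvd C i * C j" by (rule mult_dvd_mono)
    moreover have "C i * C j dvd C 1 * C 2 * C 3"
      using that(1,2) j(1) by (auto simp: mult.assoc mult.left_commute mult.commute)
    ultimately show False using no_sq dvd_trans by blast
  qed
  have "poly D c \<noteq> 0"
  proof
    assume "poly D c = 0"
    then have "L dvd D" by (rule dv)
    then have "L * L dvd C j" unfolding D by (rule mult_dvd_mono[OF dvd_refl])
    moreover have "C j dvd C 1 * C 2 * C 3" using j(1) by (auto simp: mult.assoc)
    ultimately show False using no_sq dvd_trans by blast
  qed
  then show thesis
    using that[of j D] j(1) D two C0 by (auto simp: L_def c_def)
qed

lemma limits_agree:
  fixes f g :: "real \<Rightarrow> real"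
  assumes "(f \<longlongrightarrow> a) (at 0)" "(g \<longlongrightarrow> b) (at 0)" "r > 0" "\<And>t. t \<noteq> 0 \<Longrightarrow> \<bar>t\<bar> < r \<Longrightarrow> f t = g t"
  shows "a = b"
proof -
  have "\<forall>\<^sub>F t in at 0. f t = g t"
    unfolding eventually_at using assms(3,4) by (intro exI[of _ r]) auto
  then have "(g \<longlongrightarrow> a) (at 0)" using assms(1) tendsto_cong by blast
  then show ?thesis using assms(2) LIM_unique by blast
qed

section \<open>Homogeneity and zeros of first order\<close>

lemma b1_det_scale: "b1_det (s *\<^sub>R p) = s\<^sup>2 * b1_det p"
proof -
  obtain \<alpha> \<beta> \<gamma> where "\<And>p. b1_det p = \<alpha> * (fst p)\<^sup>2 + \<beta> * (fst p * snd p) + \<gamma> * (snd p)\<^sup>2"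
    using b1_det_quadratic by metis
  then show ?thesis by (simp add: algebra_simps power2_eq_square)
qed

lemma phess_scale: "phess (s *\<^sub>R p) v = s *\<^sub>R phess p v"
  using phess_linear[of "s *\<^sub>R p" v] phess_linear[of p v] by (simp add: scaleR_add_right)

lemma phess_shift: "phess (p + (t, 0)) v = phess p v + t *\<^sub>R phess (1, 0) v"
  using phess_linear[of "p + (t, 0)" v] phess_linear[of p v] by (simp add: scaleR_add_left)

lemma pforce_shift: "pforce (p + (t, 0)) q = pforce p q + t *\<^sub>R pforce (1, 0) q"
  using pforce_linear[of "p + (t, 0)" q] pforce_linear[of p q] by (simp add: scaleR_add_left)

lemma free_det_scale: "free_det n f (s *\<^sub>R p) = s ^ n * free_det n f p"
proof -
  have "Matrix.mat n n (\<lambda>(i, j). inner (f i) (phess (s *\<^sub>R p) (f j))) = s \<cdot>\<^sub>m Matrix.mat n n (\<lambda>(i, j). inner (f i) (phess p (f j)))"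
    by (rule eq_matI) (auto simp: phess_scale)
  then show ?thesis by (simp add: free_det_def)
qed

lemma free_det_poly: "\<exists>P. \<forall>t. free_det n f (p + (t, 0)) = poly P t"
proof -
  define M where "M = Matrix.mat n n (\<lambda>(i, j). [: inner (f i) (phess p (f j)), inner (f i) (phess (1, 0) (f j)) :])"
  have "poly (Determinant.det M) t = free_det n f (p + (t, 0))" for t
    unfolding free_det_def
    by (rule poly_det_cong[of _ n]) (auto simp: M_def phess_shift inner_add_right)
  then show ?thesis by metis
qed

text \<open>A zero of exactly first order in the direction of m0, in the form that
  \<open>pencil_simple_zero\<close> consumes.\<close>

definition simple_free :: "nat \<Rightarrow> (nat \<Rightarrow> config) \<Rightarrow> real \<times> real \<Rightarrow> bool" where
  "simple_free n f p \<longleftrightarrow> (\<exists>g g0. (g \<longlongrightarrow> g0) (at 0) \<and> g0 \<noteq> 0 \<and> (\<forall>t. free_det n f (p + (t, 0)) = t * g t))"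

lemma simple_free_scale:
  assumes "simple_free n f p" "s > 0"
  shows "simple_free n f (s *\<^sub>R p)"
proof -
  obtain g g0 where g: "(g \<longlongrightarrow> g0) (at 0)" "g0 \<noteq> 0" "\<And>t. free_det n f (p + (t, 0)) = t * g t"
    using assms(1) unfolding simple_free_def by blast
  have "free_det n f (s *\<^sub>R p + (t, 0)) = t * (s ^ n / s * g (t / s))" for t
  proof -
    have "s *\<^sub>R p + (t, 0) = s *\<^sub>R (p + (t / s, 0))" using assms(2) by (simp add: prod_eq_iff algebra_simps)
    then show ?thesis using assms(2) by (simp add: free_det_scale g(3))
  qed
  moreover have "((\<lambda>t. s ^ n / s * g (t / s)) \<longlongrightarrow> s ^ n / s * g0) (at 0)"
  proof (intro tendsto_intros)
    have "filterlim (\<lambda>t. t / s) (at 0) (at 0)"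
      unfolding filterlim_at
    proof
      have "((\<lambda>t. t / s) \<longlongrightarrow> 0 / s) (at 0)" using assms(2) by (intro tendsto_intros) auto
      then show "((\<lambda>t. t / s) \<longlongrightarrow> 0) (at 0)" by simp
      show "\<forall>\<^sub>F t in at 0. t / s \<in> UNIV \<and> t / s \<noteq> 0"
        using eventually_neq_at_within[of "0::real" 0 UNIV] by eventually_elim (use assms(2) in simp)
    qed
    then show "((\<lambda>t. g (t / s)) \<longlongrightarrow> g0) (at 0)" using g(1) filterlim_compose by blast
  qed
  ultimately show ?thesis unfolding simple_free_def using g(2) assms(2)
    by (intro exI[of _ "\<lambda>t. s ^ n / s * g (t / s)"] exI[of _ "s ^ n / s * g0"]) auto
qed

text \<open>The part of the product in \<open>cp_coeff_25\<close> that has no zero in the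
  quadrant.\<close>

definition cp_unit :: "nat \<Rightarrow> (nat \<Rightarrow> config) \<Rightarrow> real \<times> real \<Rightarrow> real" where
  "cp_unit n f p = zeta p * (snd p * m2 p) ^ 3 * a1_det p * b2_det p * (weight_det n f p)\<^sup>2"

text \<open>The off-diagonal entries of the tangential block are negative on the quadrant, and
  \<open>rotation_kernel\<close> then makes the lower diagonal entry positive.\<close>

lemma zeta_pos:
  assumes "p \<in> quadrant"
  shows "zeta p > 0"
proof -
  define k where "k = (3773 * sqrt 3 + 136 * (sqrt 3 * sqrt 7)) / 686"
  have k: "k > 0" unfolding k_def by (intro divide_pos_pos add_pos_pos mult_pos_pos) auto
  have p: "snd p > 0" "m2 p > 0"
    using assms mass_pos[OF assms, of 7] by (auto simp: quadrant_def mass_def ring_mass_nth)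
  have 1: "entry pos_tan12 p = - k * m2 p"
    by (simp add: pos_tan12_def k_def field_simps)
  have 2: "entry pos_tan21 p = - k * snd p"
    by (simp add: pos_tan21_def k_def field_simps)
  have "sqrt 3 * entry pos_tan22 p = k * snd p"
    using rotation_kernel(2)[of p] 2 by simp
  then have "entry pos_tan22 p > 0"
    using k p by (metis mult_pos_pos real_sqrt_gt_zero zero_less_mult_pos zero_less_numeral)
  then have "m2 p * entry pos_tan22 p > 0" using p by simp
  moreover have "sqrt 3 * snd p * (k * m2 p) > 0" using k p by simp
  ultimately show ?thesis unfolding zeta_def 1 by simp
qed

lemma cp_unit_nonzero:
  assumes "free_basis n f" "p \<in> quadrant"
  shows "cp_unit n f p \<noteq> 0"
proof -
  have "snd p > 0" "m2 p > 0"
    using assms mass_pos[OF assms(2), of 7] by (auto simp: quadrant_def mass_def ring_mass_nth)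
  then show ?thesis
    using zeta_pos[OF assms(2)] a1_det_pos[OF assms(2)] b2_det_pos[OF assms(2)] weight_det_nonzero[OF assms]
    by (simp add: cp_unit_def)
qed

lemma cp_coeff_cp_unit:
  "free_basis n f \<Longrightarrow> p \<in> quadrant \<Longrightarrow> cp_coeff 25 p = cp_unit n f p * b1_det p * (free_det n f p)\<^sup>2"
  by (simp add: cp_coeff_25 cp_unit_def)

lemma cp_unit_tendsto: "((\<lambda>t. cp_unit n f (p + (t, 0))) \<longlongrightarrow> cp_unit n f p) (at 0)"
proof -
  have m: "m2 (p + (t, 0)) = m2 p + t * m2 (1, 0)" for t
    using m2_linear[of "p + (t, 0)"] m2_linear[of p] by (simp add: algebra_simps)
  have l: "lamf (p + (t, 0)) = lamf p + t * lamf (1, 0)" for t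
    using lamf_linear[of "p + (t, 0)"] lamf_linear[of p] by (simp add: algebra_simps)
  have w: "isCont (\<lambda>t. weight_det n f (p + (t, 0))) 0"
    unfolding isCont_def weight_det_def
  proof (rule tendsto_mat_det[where n = n])
    fix i j assume ij: "i < n" "j < n"
    have "((\<lambda>t. mass (p + (t, 0)) $ k) \<longlongrightarrow> mass p $ k) (at 0)" for k
    proof -
      have "mass (p + (t, 0)) = mass p + t *\<^sub>R mass (1, 0)" for t
        using mass_linear[of "p + (t, 0)"] mass_linear[of p] by (simp add: scaleR_add_left)
      then show ?thesis by (auto intro!: tendsto_eq_intros)
    qed
    then have "((\<lambda>t. mass (p + (t, 0))) \<longlongrightarrow> mass p) (at 0)" by (rule vec_tendstoI)
    then have "((\<lambda>t. inner (f i) (weight (p + (t, 0)) (f j))) \<longlongrightarrow> inner (f i) (weight p (f j))) (at 0)"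
      unfolding weight_def by (intro tendsto_intros)
    then show "((\<lambda>t. Matrix.mat n n (\<lambda>(i, j). inner (f i) (weight (p + (t, 0)) (f j))) $$ (i, j)) \<longlongrightarrow>
        Matrix.mat n n (\<lambda>(i, j). inner (f i) (weight (p + (0, 0)) (f j))) $$ (i, j)) (at 0)"
      using ij by (simp add: zero_prod_def[symmetric])
  qed auto
  have "isCont (\<lambda>t. cp_unit n f (p + (t, 0))) 0"
    unfolding cp_unit_def zeta_def a1_det_def b2_det_def m l
      pos_tan22_def pos_tan12_def pos_rad11_def pos_rad12_def pos_rad21_def pos_rad22_def
      neg_tan11_def neg_tan12_def neg_tan21_def neg_tan22_def fst_add snd_add fst_conv snd_conv
    by (intro continuous_intros w) auto
  then show ?thesis by (simp add: isCont_def zero_prod_def[symmetric])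
qed

text \<open>Two descriptions of \<open>a_25\<close> are compared along lines in direction m0: (m1 -
  k m0)^m times H with m = 1 or 2, and a unit times \<open>b1_det\<close> times the square of
  \<open>free_det\<close>. If \<open>b1_det\<close> is nonzero, the square carries all of m, so m =
  2 and \<open>free_det\<close> has order one. If \<open>b1_det\<close> vanishes, it has order one,
  and a zero of \<open>free_det\<close> would raise the total to at least three.\<close>

lemma order_dichotomy:
  assumes fac: "a25_factorization C0 C" and p: "p \<in> quadrant" and f: "free_basis n f"
    and zero: "cp_coeff 25 p = 0"
  shows "b1_det p = 0 \<and> free_det n f p \<noteq> 0 \<or> b1_det p \<noteq> 0 \<and> simple_free n f p \<and> bipoly (C 2) p \<noteq> 0"
proof -
  obtain \<alpha> \<beta> \<gamma> where abc: "\<alpha> > 0" "\<gamma> < 0" and b1: "\<And>p. b1_det p = \<alpha> * (fst p)\<^sup>2 + \<beta> * (fst p * snd p) + \<gamma> * (snd p)\<^sup>2"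
    using b1_det_quadratic by metis
  have pp: "fst p > 0" "snd p > 0" using p by (auto simp: quadrant_def)
  define k where "k = snd p / fst p"
  have k: "k > 0" using pp by (simp add: k_def)
  have on_ray: "(x, k * x) = (x / fst p) *\<^sub>R p" for x using pp by (simp add: prod_eq_iff k_def)
  have ray_in: "(x, k * x) \<in> quadrant" if "x > 0" for x using that k by (simp add: quadrant_def)
  have zero_prod: "b1_det p * (free_det n f p)\<^sup>2 = 0"
    using zero cp_coeff_cp_unit[OF f p] cp_unit_nonzero[OF f p] by simp
  have zero_ray: "cp_coeff 25 (x, k * x) = 0" if "x > 0" for x
  proof -
    have "b1_det (x, k * x) * (free_det n f (x, k * x))\<^sup>2 = 0"
      unfolding on_ray b1_det_scale free_det_scale using zero_prod by (auto simp: power_mult_distrib)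
    then show ?thesis using cp_coeff_cp_unit[OF f ray_in[OF that]] by auto
  qed
  obtain j D where j: "j \<in> {1, 2, 3}" "C j = [:- [:0, k:], 1:] * D" "poly D [:0, k:] \<noteq> 0"
    and others: "\<And>i. i \<in> {1, 2, 3} \<Longrightarrow> i \<noteq> j \<Longrightarrow> poly (C i) [:0, k:] \<noteq> 0" and C0: "poly C0 [:0, k:] \<noteq> 0"
    using ray_factor[OF fac k zero_ray] by metis
  \<comment> \<open>The multiplicity of m1 - k m0 in \<open>a_25\<close>; H is the corresponding
    cofactor.\<close>
  define m :: nat where "m = (if j = 2 then 1 else 2)"
  define H where "H = (if j = 1 then C0 * D\<^sup>2 * C 2 * (C 3)\<^sup>2 else if j = 2 then C0 * (C 1)\<^sup>2 * D * (C 3)\<^sup>2 else C0 * (C 1)\<^sup>2 * C 2 * D\<^sup>2)"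
  have m: "m \<ge> 1" "m = 1 \<or> m = 2" by (auto simp: m_def)
  have Hnz: "poly H [:0, k:] \<noteq> 0"
    using j(1,3) others C0 by (auto simp: H_def)
  have cp_eq: "cp_coeff 25 q = (snd q - k * fst q) ^ m * bipoly H q" if "q \<in> quadrant" for q
  proof -
    have "bipoly [:- [:0, k:], 1:] q = snd q - k * fst q"
      by (cases q) (simp add: bipoly_def algebra_simps)
    then have Cj: "bipoly (C j) q = (snd q - k * fst q) * bipoly D q" unfolding j(2) bipoly_mult by simp
    have "cp_coeff 25 q = bipoly C0 q * (bipoly (C 1) q)\<^sup>2 * bipoly (C 2) q * (bipoly (C 3) q)\<^sup>2"
      using fac that by (simp add: a25_factorization_def)
    then show ?thesis
      using j(1) Cj by (auto simp: H_def m_def bipoly_mult bipoly_power power_mult_distrib)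
  qed
  \<comment> \<open>H may still vanish at isolated points of the ray, because the remaining factors
    are not assumed homogeneous. The orders are therefore compared at a point p' with H nonzero and
    carried over to p by homogeneity.\<close>
  have "finite {x. poly (poly H [:0, k:]) x = 0}" using Hnz by (rule poly_roots_finite)
  moreover have "infinite {0<..(1::real)}" by simp
  ultimately obtain x0 where x0: "x0 > 0" "poly (poly H [:0, k:]) x0 \<noteq> 0"
    by (metis (mono_tags, lifting) mem_Collect_eq rev_finite_subset subsetI greaterThanAtMost_iff)
  define p' where "p' = (x0, k * x0)"
  have p': "p' \<in> quadrant" using ray_in x0 by (simp add: p'_def)
  have Hp': "bipoly H p' \<noteq> 0" unfolding p'_def bipoly_ray by (rule x0(2))
  have expand: "cp_unit n f (q + (t, 0)) * b1_det (q + (t, 0)) * (free_det n f (q + (t, 0)))\<^sup>2 = (- k * t) ^ m * bipoly H (q + (t, 0))"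
    if "q \<in> quadrant" "snd q = k * fst q" "\<bar>t\<bar> < fst q" for q t
  proof -
    have "q + (t, 0) \<in> quadrant" using that by (cases q) (auto simp: quadrant_def)
    from cp_eq[OF this] cp_coeff_cp_unit[OF f this] show ?thesis
      using that(2) by (simp add: algebra_simps)
  qed
  have limH: "((\<lambda>t. bipoly H (q + (t, 0))) \<longlongrightarrow> bipoly H q) (at 0)" for q
    using isCont_bipoly[where F = H and p = q and ?t0.0 = 0] by (simp add: isCont_def zero_prod_def[symmetric])
  have limb: "((\<lambda>t. b1_det (q + (t, 0))) \<longlongrightarrow> b1_det q) (at 0)" for q
    unfolding b1 fst_add snd_add fst_conv snd_conv by (auto intro!: tendsto_eq_intros)
  have fdiv: "\<exists>R. \<forall>t. free_det n f (q + (t, 0)) = t * poly R t" if "free_det n f q = 0" for q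
  proof -
    obtain P where P: "\<And>t. free_det n f (q + (t, 0)) = poly P t" using free_det_poly by metis
    then have "poly P 0 = 0" using that by (metis add.right_neutral zero_prod_def)
    then obtain R where "P = pCons 0 R" by (cases P) (auto split: if_splits)
    then show ?thesis using P by auto
  qed
  have limR: "(poly R \<longlongrightarrow> poly R 0) (at 0)" for R :: "real poly" by (intro isContD poly_isCont)
  define s where "s = fst p / x0"
  have s: "s > 0" "p = s *\<^sub>R p'" using pp x0 by (auto simp: s_def p'_def k_def prod_eq_iff)
  note lims = tendsto_mult[OF tendsto_mult[OF cp_unit_tendsto limb]]
  show ?thesis
  proof (cases "b1_det p' = 0")
    case False
    have z: "(- k * 0) ^ m * bipoly H (p' + (0, 0)) = 0" using m by (auto simp: power_0_left)
    have "cp_unit n f p' * b1_det p' * (free_det n f p')\<^sup>2 = 0"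
      using expand[OF p', of 0] x0(1) unfolding z by (simp add: p'_def zero_prod_def[symmetric])
    then have "free_det n f p' = 0" using False cp_unit_nonzero[OF f p'] by simp
    then obtain R where R: "\<And>t. free_det n f (p' + (t, 0)) = t * poly R t" using fdiv by blast
    \<comment> \<open>For m = 1, dividing by t and letting t tend to 0 would leave a factor t on one
      side only, so H would vanish at p'.\<close>
    have m2: "m = 2"
    proof (rule ccontr)
      assume "m \<noteq> 2"
      then have "m = 1" using m by simp
      have "cp_unit n f p' * b1_det p' * (0 * (poly R 0)\<^sup>2) = - k * bipoly H p'"
      proof (rule limits_agree[OF _ _ x0(1)])
        show "((\<lambda>t. cp_unit n f (p' + (t, 0)) * b1_det (p' + (t, 0)) * (t * (poly R t)\<^sup>2)) \<longlongrightarrow>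
            cp_unit n f p' * b1_det p' * (0 * (poly R 0)\<^sup>2)) (at 0)"
          by (intro lims tendsto_intros limR)
        show "((\<lambda>t. - k * bipoly H (p' + (t, 0))) \<longlongrightarrow> - k * bipoly H p') (at 0)"
          by (intro tendsto_intros limH)
        fix t :: real assume t: "t \<noteq> 0" "\<bar>t\<bar> < x0"
        have "t * (cp_unit n f (p' + (t, 0)) * b1_det (p' + (t, 0)) * (t * (poly R t)\<^sup>2)) = t * (- k * bipoly H (p' + (t, 0)))"
          using expand[OF p', of t] t \<open>m = 1\<close> unfolding R by (simp add: p'_def power2_eq_square algebra_simps)
        then show "cp_unit n f (p' + (t, 0)) * b1_det (p' + (t, 0)) * (t * (poly R t)\<^sup>2) = - k * bipoly H (p' + (t, 0))"
          using t(1) by (simp only: mult_cancel_left) simp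
      qed
      then show False using Hp' k by simp
    qed
    \<comment> \<open>Comparison of the coefficients of t^2. It is stated for every point of the
      ray: at p' it shows that \<open>free_det\<close> has a simple zero, and at p it excludes a
      zero of \<open>C 2\<close>, which would be a zero of H.\<close>
    have second: "cp_unit n f q * b1_det q * g0\<^sup>2 = k\<^sup>2 * bipoly H q"
      if q: "q \<in> quadrant" "snd q = k * fst q" and g: "(g \<longlongrightarrow> g0) (at 0)" "\<And>t. free_det n f (q + (t, 0)) = t * g t" for q g g0
    proof (rule limits_agree)
      show "((\<lambda>t. cp_unit n f (q + (t, 0)) * b1_det (q + (t, 0)) * (g t)\<^sup>2) \<longlongrightarrow> cp_unit n f q * b1_det q * g0\<^sup>2) (at 0)"
        by (intro lims tendsto_intros g)
      show "((\<lambda>t. k\<^sup>2 * bipoly H (q + (t, 0))) \<longlongrightarrow> k\<^sup>2 * bipoly H q) (at 0)"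
        by (intro tendsto_intros limH)
      show "fst q > 0" using q(1) by (auto simp: quadrant_def)
      fix t :: real assume t: "t \<noteq> 0" "\<bar>t\<bar> < fst q"
      have "t\<^sup>2 * (cp_unit n f (q + (t, 0)) * b1_det (q + (t, 0)) * (g t)\<^sup>2) = t\<^sup>2 * (k\<^sup>2 * bipoly H (q + (t, 0)))"
        using expand[OF q t(2)] m2 unfolding g(2) by (simp add: power_mult_distrib algebra_simps)
      then show "cp_unit n f (q + (t, 0)) * b1_det (q + (t, 0)) * (g t)\<^sup>2 = k\<^sup>2 * bipoly H (q + (t, 0))"
        using t(1) by (simp only: mult_cancel_left) simp
    qed
    have "poly R 0 \<noteq> 0"
      using second[OF p' _ limR R] Hp' k by (auto simp: p'_def)
    then have "simple_free n f p'" unfolding simple_free_def using limR R by blast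
    then have sp: "simple_free n f p" unfolding s(2) using s(1) by (rule simple_free_scale)
    have b1p: "b1_det p \<noteq> 0" unfolding s(2) b1_det_scale using False s(1) by simp
    have "bipoly (C 2) p \<noteq> 0"
    proof
      assume "bipoly (C 2) p = 0"
      moreover have "j \<noteq> 2" using m2 by (auto simp: m_def)
      ultimately have "bipoly H p = 0" using j(1) by (auto simp: H_def bipoly_mult)
      moreover obtain g g0 where "(g \<longlongrightarrow> g0) (at 0)" "g0 \<noteq> 0" "\<And>t. free_det n f (p + (t, 0)) = t * g t"
        using sp unfolding simple_free_def by blast
      moreover have "snd p = k * fst p" using pp by (simp add: k_def)
      ultimately have "cp_unit n f p * b1_det p * g0\<^sup>2 = 0" using second[OF p, of g g0] by simp
      then show False using b1p cp_unit_nonzero[OF f p] \<open>g0 \<noteq> 0\<close> by simp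
    qed
    then show ?thesis using sp b1p by blast
  next
    case True
    define y0 where "y0 = k * x0"
    define b where "b t = \<alpha> * (2 * x0 + t) + \<beta> * y0" for t
    have e0: "\<alpha> * x0\<^sup>2 + \<beta> * (x0 * y0) + \<gamma> * y0\<^sup>2 = 0" using True by (simp add: b1 p'_def y0_def)
    have bt: "b1_det (p' + (t, 0)) = t * b t" for t
      using e0 by (simp add: b1 p'_def y0_def[symmetric] b_def algebra_simps power2_eq_square)
    have y0: "y0 > 0" using k x0 by (simp add: y0_def)
    have "x0 * b 0 = \<alpha> * x0\<^sup>2 - \<gamma> * y0\<^sup>2" using e0 by (simp add: b_def algebra_simps power2_eq_square)
    moreover have "\<alpha> * x0\<^sup>2 > 0" "\<gamma> * y0\<^sup>2 < 0" using abc x0 y0 by (auto simp: mult_neg_pos)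
    ultimately have "x0 * b 0 > 0" by simp
    then have b0: "b 0 \<noteq> 0" by auto
    have limbb: "(b \<longlongrightarrow> b 0) (at 0)" unfolding b_def by (auto intro!: tendsto_eq_intros)
    have "free_det n f p' \<noteq> 0"
    proof
      assume "free_det n f p' = 0"
      then obtain R where R: "\<And>t. free_det n f (p' + (t, 0)) = t * poly R t" using fdiv by blast
      \<comment> \<open>With t^m cancelled, the side of the determinants keeps the factor t^(3 - m)
        with 3 - m at least 1, so the limit contradicts H p' being nonzero.\<close>
      have E: "cp_unit n f p' * b 0 * (0 ^ (3 - m) * (poly R 0)\<^sup>2) = (- k) ^ m * bipoly H p'"
      proof (rule limits_agree[OF _ _ x0(1)])
        show "((\<lambda>t. cp_unit n f (p' + (t, 0)) * b t * (t ^ (3 - m) * (poly R t)\<^sup>2)) \<longlongrightarrow>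
            cp_unit n f p' * b 0 * (0 ^ (3 - m) * (poly R 0)\<^sup>2)) (at 0)"
          by (intro tendsto_intros cp_unit_tendsto limbb limR)
        show "((\<lambda>t. (- k) ^ m * bipoly H (p' + (t, 0))) \<longlongrightarrow> (- k) ^ m * bipoly H p') (at 0)"
          by (intro tendsto_intros limH)
        fix t :: real assume t: "t \<noteq> 0" "\<bar>t\<bar> < x0"
        have "m + (3 - m) = 3" using m by auto
        then have t3: "t ^ m * t ^ (3 - m) = t ^ 3" by (metis power_add)
        have "t ^ m * (cp_unit n f (p' + (t, 0)) * b t * (t ^ (3 - m) * (poly R t)\<^sup>2)) =
            (t ^ m * t ^ (3 - m)) * (cp_unit n f (p' + (t, 0)) * b t * (poly R t)\<^sup>2)"
          by (simp only: mult_ac)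
        also have "\<dots> = cp_unit n f (p' + (t, 0)) * (t * b t) * (t * poly R t)\<^sup>2"
          unfolding t3 by (simp add: power2_eq_square power3_eq_cube)
        also have "\<dots> = (- k * t) ^ m * bipoly H (p' + (t, 0))"
          using expand[OF p', of t] t unfolding R bt by (simp add: p'_def)
        also have "\<dots> = t ^ m * ((- k) ^ m * bipoly H (p' + (t, 0)))"
          by (simp only: power_mult_distrib mult_ac)
        finally show "cp_unit n f (p' + (t, 0)) * b t * (t ^ (3 - m) * (poly R t)\<^sup>2) = (- k) ^ m * bipoly H (p' + (t, 0))"
          using t(1) by (simp only: mult_cancel_left) simp
      qed
      have z: "(0::real) ^ (3 - m) = 0" using m by (auto simp: power_0_left)
      have "(- k) ^ m * bipoly H p' = 0" using E unfolding z by simp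
      then show False using Hp' k by simp
    qed
    then have "free_det n f p \<noteq> 0" unfolding s(2) free_det_scale using s(1) by simp
    moreover have "b1_det p = 0" unfolding s(2) b1_det_scale True by simp
    ultimately show ?thesis by blast
  qed
qed

section \<open>Local bifurcation\<close>

lemma pforce_Rot: "pforce p (Rot q) = Rot (pforce p q)" and pforce_Ref: "pforce p (Ref q) = Ref (pforce p q)"
  unfolding pforce_def mass_def by (rule force_Rot force_Ref)+

text \<open>Symmetry under the reflection puts body 1 on the axis, so the rotation is by 0 or pi.
  The rotation by pi moves body 1 by 1, which the distance bound excludes.\<close>

lemma turn_rosette_slice:
  assumes q: "q \<in> SO2_orbit (rosette p)" and "Ref q = q" and "dist q (rosette p) < 1"
  shows "q = rosette p"
proof -
  obtain c s where cs: "q = turn c s (rosette p)" "c\<^sup>2 + s\<^sup>2 = 1" using q unfolding SO2_orbit_eq by blast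
  have q1: "q $ 1 = vector [c / 2, s / 2]"
    by (simp add: cs(1) turn_def Jrot_def rosette_nth vec2_eq_iff)
  have "mirror (q $ 1) = q $ 1" using \<open>Ref q = q\<close> by (metis Ref_def gact_nth ref_perm_simps(1))
  then have s: "s = 0" by (simp add: q1 mirror_def vec2_eq_iff)
  then have c: "c = 1 \<or> c = - 1" using cs(2) by (simp add: power2_eq_1_iff)
  have "c \<noteq> - 1"
  proof
    assume "c = - 1"
    then have "q $ 1 - rosette p $ 1 = vector [- 1, 0]" by (simp add: q1 s rosette_nth)
    then have "norm (q $ 1 - rosette p $ 1) = 1" by (simp add: norm_vec2)
    moreover have "norm (q $ 1 - rosette p $ 1) \<le> dist q (rosette p)"
      using Finite_Cartesian_Product.norm_nth_le[of "q - rosette p" 1] by (simp add: dist_norm)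
    ultimately show False using assms(3) by simp
  qed
  then show ?thesis using c s cs(1) by (simp add: turn_def)
qed

text \<open>The abstract theorem with A = \<open>pforce p\<close> and B =
  \<open>pforce (1, 0)\<close>, so \<tau> is the displacement of m0. The interval is shortened to
  stay in \<open>Omega\<close> and in the quadrant, and within distance 1 of the rosette as
  \<open>turn_rosette_slice\<close> requires.\<close>

lemma bifurcation_branch:
  assumes p: "p \<in> quadrant" and V: "subspace V" "\<And>v. v \<in> V \<Longrightarrow> Ref v = v"
    and inv: "\<And>r v. v \<in> V \<Longrightarrow> phess r v \<in> V" "\<And>r v. v \<in> V \<Longrightarrow> pforce r (rosette p + v) \<in> V"
    and e: "e \<in> V" "e \<noteq> 0" "phess p e = 0"
    and inj: "\<And>\<eta> s. \<eta> \<in> V \<Longrightarrow> inner e \<eta> = 0 \<Longrightarrow> phess p \<eta> + s *\<^sub>R phess (1, 0) e = 0 \<Longrightarrow> \<eta> = 0 \<and> s = 0"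
  obtains a :: real and h \<tau> where "a > 0" "continuous_on {0..a} h" "continuous_on {0..a} \<tau>"
    "h 0 = 0" "\<tau> 0 = (0::real)"
    "\<And>x. x \<in> {0..a} \<Longrightarrow> h x \<in> V \<and> inner e (h x) = 0"
    "\<And>x. x \<in> {0..a} \<Longrightarrow> p + (\<tau> x, 0) \<in> quadrant"
    "\<And>x. x \<in> {0..a} \<Longrightarrow> rosette p + x *\<^sub>R (e + h x) \<in> Omega"
    "\<And>x. x \<in> {0..a} \<Longrightarrow> pforce (p + (\<tau> x, 0)) (rosette p + x *\<^sub>R (e + h x)) = 0"
    "\<And>x. x \<in> {0<..a} \<Longrightarrow> rosette p + x *\<^sub>R (e + h x) \<notin> SO2_orbit (rosette p)"
proof -
  define w where "w = rosette p"
  obtain a :: real and h \<tau> where a: "a > 0" "continuous_on {0..a} h" "continuous_on {0..a} \<tau>"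
    "h 0 = 0" "\<tau> 0 = (0::real)" and sol: "\<And>x. x \<in> {0..a} \<Longrightarrow> h x \<in> V \<and> inner e (h x) = 0 \<and>
       pforce p (w + x *\<^sub>R (e + h x)) + \<tau> x *\<^sub>R pforce (1, 0) (w + x *\<^sub>R (e + h x)) = 0"
    by (rule bifurcation_from_simple_zero[of "pforce p" "phess p" w "pforce (1, 0)" "phess (1, 0)" V e])
      (use assms in \<open>auto simp: w_def strict_deriv_pforce central_configuration\<close>)
  obtain r where r: "r > 0" "ball w r \<subseteq> Omega" using openE[OF open_Omega rosette_in_Omega[of p]] unfolding w_def by blast
  define q where "q x = w + x *\<^sub>R (e + h x)" for x
  have cq: "continuous_on {0..a} q" unfolding q_def using a by (intro continuous_intros)
  have pf: "fst p > 0" using p by (auto simp: quadrant_def)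
  have 0: "0 \<in> {0..a}" using a by simp
  obtain d1 where d1: "d1 > 0" "\<And>x. x \<in> {0..a} \<Longrightarrow> dist x 0 < d1 \<Longrightarrow> dist (q x) (q 0) < min r 1"
    using cq 0 r(1) unfolding continuous_on_iff by (metis less_numeral_extra(1) min_less_iff_conj)
  obtain d2 where d2: "d2 > 0" "\<And>x. x \<in> {0..a} \<Longrightarrow> dist x 0 < d2 \<Longrightarrow> dist (\<tau> x) (\<tau> 0) < fst p"
    using a(3) 0 pf unfolding continuous_on_iff by metis
  define a' where "a' = min a (min (d1 / 2) (d2 / 2))"
  have a': "a' > 0" "a' \<le> a" using a(1) d1(1) d2(1) by (auto simp: a'_def)
  have small: "x \<in> {0..a} \<and> dist x 0 < d1 \<and> dist x 0 < d2" if "x \<in> {0..a'}" for x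
    using that d1(1) d2(1) by (auto simp: a'_def)
  have close: "dist (q x) w < r" "dist (q x) w < 1" if "x \<in> {0..a'}" for x
    using d1(2)[of x] small[OF that] by (auto simp: q_def)
  show thesis
  proof (rule that[of a' h \<tau>])
    fix x assume x: "x \<in> {0..a'}"
    show "h x \<in> V \<and> inner e (h x) = 0" using sol small[OF x] by blast
    show "p + (\<tau> x, 0) \<in> quadrant"
      using d2(2)[of x] small[OF x] a(5) p by (cases p) (auto simp: quadrant_def dist_real_def)
    show "rosette p + x *\<^sub>R (e + h x) \<in> Omega"
      using close(1)[OF x] r(2) by (auto simp: q_def w_def dist_commute)
    show "pforce (p + (\<tau> x, 0)) (rosette p + x *\<^sub>R (e + h x)) = 0"
      unfolding pforce_shift using sol[of x] small[OF x] by (simp add: w_def)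
  next
    fix x assume x: "x \<in> {0<..a'}"
    then have x': "x \<in> {0..a'}" by simp
    show "rosette p + x *\<^sub>R (e + h x) \<notin> SO2_orbit (rosette p)"
    proof
      assume orb: "rosette p + x *\<^sub>R (e + h x) \<in> SO2_orbit (rosette p)"
      have hx: "h x \<in> V" "inner e (h x) = 0" using sol small[OF x'] by auto
      have "Ref (rosette p + x *\<^sub>R (e + h x)) = rosette p + x *\<^sub>R (e + h x)"
        using V(2)[OF e(1)] V(2)[OF hx(1)] by (simp add: Ref_linear Ref_rosette)
      from turn_rosette_slice[OF orb this] close(2)[OF x']
      have "x *\<^sub>R (e + h x) = 0" by (simp add: q_def w_def)
      \<comment> \<open>Impossible, since \<open>h x\<close> is orthogonal to the nonzero vector
        e.\<close>
      then have "e + h x = 0" using x by simp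
      then have "inner e (e + h x) = 0" by simp
      then show False using hx(2) e(2) by (simp add: inner_add_right)
    qed
  qed (use a a' in \<open>auto intro: continuous_on_subset\<close>)
qed

definition shift_segment :: "real \<times> real \<Rightarrow> real \<Rightarrow> real \<times> real" where
  "shift_segment p \<rho> = p + \<rho> *\<^sub>R (1, 0)"

lemma shift_segment_eq: "shift_segment p \<rho> = p + (\<rho>, 0)"
  by (simp add: shift_segment_def)

lemma shift_segment_family:
  assumes "p \<in> quadrant" "b \<le> fst p"
  shows "segment_family (shift_segment p) {- b<..<b}"
proof -
  have "\<exists>c d. d \<noteq> 0 \<and> (\<forall>\<rho>. shift_segment p \<rho> = c + \<rho> *\<^sub>R d)"
    unfolding shift_segment_def by (intro exI[of _ p] exI[of _ "(1, 0)"]) (simp add: zero_prod_def)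
  moreover have "shift_segment p ` {- b<..<b} \<subseteq> quadrant"
    using assms by (cases p) (auto simp: shift_segment_eq quadrant_def)
  ultimately show ?thesis by (simp add: segment_family_def is_interval_oo)
qed

lemma branch_nontrivial:
  assumes "p + (t, 0) \<in> quadrant" "q \<in> Omega" "pforce (p + (t, 0)) q = 0" "q \<notin> SO2_orbit (rosette p)" "t \<in> J"
  shows "(q, t) \<in> nontrivial_set (shift_segment p) J"
  using assms crit_iff[OF assms(2,1)]
  by (auto simp: nontrivial_set_def trivial_set_def shift_segment_eq rosette_const[of "p + (t, 0)" p])

lemma branch_BIF:
  assumes p: "p \<in> quadrant" and V: "subspace V" "\<And>v. v \<in> V \<Longrightarrow> Ref v = v"
    and inv: "\<And>r v. v \<in> V \<Longrightarrow> phess r v \<in> V" "\<And>r v. v \<in> V \<Longrightarrow> pforce r (rosette p + v) \<in> V"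
    and e: "e \<in> V" "e \<noteq> 0" "phess p e = 0"
    and inj: "\<And>\<eta> s. \<eta> \<in> V \<Longrightarrow> inner e \<eta> = 0 \<Longrightarrow> phess p \<eta> + s *\<^sub>R phess (1, 0) e = 0 \<Longrightarrow> \<eta> = 0 \<and> s = 0"
  shows "p \<in> BIF"
proof -
  obtain a :: real and h \<tau> where a: "a > 0" "continuous_on {0..a} h" "continuous_on {0..a} \<tau>"
    "h 0 = 0" "\<tau> 0 = (0::real)"
    and b: "\<And>x. x \<in> {0..a} \<Longrightarrow> p + (\<tau> x, 0) \<in> quadrant"
    "\<And>x. x \<in> {0..a} \<Longrightarrow> rosette p + x *\<^sub>R (e + h x) \<in> Omega"
    "\<And>x. x \<in> {0..a} \<Longrightarrow> pforce (p + (\<tau> x, 0)) (rosette p + x *\<^sub>R (e + h x)) = 0"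
    "\<And>x. x \<in> {0<..a} \<Longrightarrow> rosette p + x *\<^sub>R (e + h x) \<notin> SO2_orbit (rosette p)"
    by (rule bifurcation_branch[OF assms]) blast+
  define J where "J = {- fst p<..<fst p}"
  have pf: "fst p > 0" using p by (auto simp: quadrant_def)
  have seg: "segment_family (shift_segment p) J" unfolding J_def using p by (rule shift_segment_family) simp
  define c where "c x = (rosette p + x *\<^sub>R (e + h x), \<tau> x)" for x
  have cc: "continuous_on {0..a} c" unfolding c_def using a by (intro continuous_intros)
  have "(rosette p, 0) islimpt nontrivial_set (shift_segment p) J"
    unfolding islimpt_approachable
  proof (intro allI impI)
    fix \<epsilon> :: real assume "\<epsilon> > 0"
    have "0 \<in> {0..a}" using a by simp
    then obtain d where d: "d > 0" "\<And>x. x \<in> {0..a} \<Longrightarrow> dist x 0 < d \<Longrightarrow> dist (c x) (c 0) < min \<epsilon> (fst p)"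
      using cc \<open>\<epsilon> > 0\<close> pf unfolding continuous_on_iff by (metis min_less_iff_conj)
    define x where "x = min a (d / 2)"
    have x: "x \<in> {0<..a}" "x \<in> {0..a}" "dist x 0 < d" using a d by (auto simp: x_def)
    have dc: "dist (c x) (c 0) < \<epsilon>" "dist (c x) (c 0) < fst p" using d(2)[OF x(2,3)] by auto
    have c0: "c 0 = (rosette p, 0)" by (simp add: c_def a)
    have "\<bar>\<tau> x\<bar> < fst p"
      using dc(2) dist_snd_le[of "c x" "c 0"] a(5) by (simp add: c_def dist_real_def)
    then have "\<tau> x \<in> J" by (auto simp: J_def)
    then have "c x \<in> nontrivial_set (shift_segment p) J"
      unfolding c_def using b x by (intro branch_nontrivial) auto
    moreover have "c x \<noteq> (rosette p, 0)"
      using b(4)[OF x(1)] rosette_orbit_refl[of p p] by (auto simp: c_def)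
    ultimately show "\<exists>x'\<in>nontrivial_set (shift_segment p) J. x' \<noteq> (rosette p, 0) \<and> dist x' (rosette p, 0) < \<epsilon>"
      using dc(1) c0 by auto
  qed
  then have "local_bif (shift_segment p) J 0"
    using pf by (simp add: local_bif_def J_def shift_segment_eq zero_prod_def[symmetric])
  moreover have "p = shift_segment p 0" by (simp add: shift_segment_eq zero_prod_def[symmetric])
  ultimately show ?thesis unfolding BIF_def using p seg by blast
qed

lemma phess_upos:
  "phess p (upos x y z t) = upos
    (entry pos_rad11 p * x + entry pos_rad12 p * z)
    (entry pos_tan11 p * y + entry pos_tan12 p * t)
    (entry pos_rad21 p * x + entry pos_rad22 p * z)
    (entry pos_tan21 p * y + entry pos_tan22 p * t)"
  unfolding phess_def hess_upos ..

lemma phess_uneg: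
  "phess p (uneg x y z t) = uneg
    (entry neg_rad11 p * x + entry neg_rad12 p * t)
    (entry neg_tan11 p * y + entry neg_tan12 p * z)
    (entry neg_tan21 p * y + entry neg_tan22 p * z)
    (entry neg_rad21 p * x + entry neg_rad22 p * t)"
  unfolding phess_def hess_uneg ..

lemma upos_uneg_zero:
  assumes "upos x y z t + uneg x' y' z' t' = 0"
  shows "x = 0 \<and> y = 0 \<and> z = 0 \<and> t = 0 \<and> x' = 0 \<and> y' = 0 \<and> z' = 0 \<and> t' = 0"
proof -
  have "inner (upos x y z t + uneg x' y' z' t') (upos x y z t + uneg x' y' z' t') = 0" using assms by simp
  then have "x\<^sup>2 + y\<^sup>2 + z\<^sup>2 + t\<^sup>2 + x'\<^sup>2 + y'\<^sup>2 + z'\<^sup>2 + t'\<^sup>2 = 0"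
    by (simp add: inner_add_left inner_add_right inner_upos inner_uneg inner_upos_uneg inner_uneg_upos power2_eq_square)
  moreover have "0 \<le> x\<^sup>2" "0 \<le> y\<^sup>2" "0 \<le> z\<^sup>2" "0 \<le> t\<^sup>2" "0 \<le> x'\<^sup>2" "0 \<le> y'\<^sup>2" "0 \<le> z'\<^sup>2" "0 \<le> t'\<^sup>2" by simp_all
  ultimately have "x\<^sup>2 = 0 \<and> y\<^sup>2 = 0 \<and> z\<^sup>2 = 0 \<and> t\<^sup>2 = 0 \<and> x'\<^sup>2 = 0 \<and> y'\<^sup>2 = 0 \<and> z'\<^sup>2 = 0 \<and> t'\<^sup>2 = 0"
    by linarith
  then show ?thesis by simp
qed

lemma triple_sym_Ref_decomposition:
  assumes "v \<in> triple_sym" "Ref v = v"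
  shows "\<exists>x z x' t'. v = upos x 0 z 0 + uneg x' 0 0 t'"
proof -
  obtain x y z t x' y' z' t' where v: "v = upos x y z t + uneg x' y' z' t'"
    using triple_sym_decomposition[OF assms(1)] by blast
  have "v + Ref v = 2 *\<^sub>R v" using assms(2) by (simp add: scaleR_2)
  moreover have "v + Ref v = (upos x y z t + upos x (- y) z (- t)) + (uneg x' y' z' t' + uneg x' (- y') (- z') t')"
    unfolding v Ref_linear Ref_upos Ref_uneg by simp
  ultimately have "upos (x + x) 0 (z + z) 0 + uneg (x' + x') 0 0 (t' + t') = 2 *\<^sub>R v"
    unfolding upos_add uneg_add by simp
  then have "v = (1/2) *\<^sub>R (upos (x + x) 0 (z + z) 0 + uneg (x' + x') 0 0 (t' + t'))" by simp
  then have "v = upos x 0 z 0 + uneg x' 0 0 t'"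
    by (simp add: scaleR_add_right upos_scale uneg_scale)
  then show ?thesis by blast
qed

lemma det2_zero:
  fixes a b c d :: real
  assumes "a * d - b * c \<noteq> 0" "a * x + b * y = 0" "c * x + d * y = 0"
  shows "x = 0 \<and> y = 0"
proof -
  have "(a * d - b * c) * x = d * (a * x + b * y) - b * (c * x + d * y)" by (simp add: algebra_simps)
  moreover have "(a * d - b * c) * y = a * (c * x + d * y) - c * (a * x + b * y)" by (simp add: algebra_simps)
  ultimately have "(a * d - b * c) * x = 0" "(a * d - b * c) * y = 0" by (simp_all only: assms(2,3) mult_zero_right diff_self)
  then show ?thesis using assms(1) by simp
qed

text \<open>A reflection symmetric \<eta> splits into a part in \<open>triple_sym\<close> and one in
  \<open>free_sym\<close>, and both the Hessian and the transversality term respect the splitting.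
  The first part is excluded by the determinants \<open>a1_det\<close> and \<open>b1_det\<close>,
  the second by \<open>pencil_simple_zero\<close> in coordinates of
  \<open>free_basis\<close>.\<close>

lemma free_kernel_BIF:
  assumes f: "free_basis n f" and p: "p \<in> quadrant" and b1: "b1_det p \<noteq> 0" and sf: "simple_free n f p"
  shows "p \<in> BIF"
proof -
  define D0 where "D0 = Matrix.mat n n (\<lambda>(i, j). inner (f i) (phess p (f j)))"
  define D1 where "D1 = Matrix.mat n n (\<lambda>(i, j). inner (f i) (phess (1, 0) (f j)))"
  have D: "D0 \<in> carrier_mat n n" "D1 \<in> carrier_mat n n" by (auto simp: D0_def D1_def)
  obtain g g0 where g: "(g \<longlongrightarrow> g0) (at 0)" "g0 \<noteq> 0" "\<And>t. free_det n f (p + (t, 0)) = t * g t"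
    using sf unfolding simple_free_def by blast
  have det: "Determinant.det (D0 + t \<cdot>\<^sub>m D1) = t * g t" for t
  proof -
    have "D0 + t \<cdot>\<^sub>m D1 = Matrix.mat n n (\<lambda>(i, j). inner (f i) (phess (p + (t, 0)) (f j)))"
      by (rule eq_matI) (auto simp: D0_def D1_def phess_shift inner_add_right)
    then show ?thesis using g(3)[of t] by (simp add: free_det_def)
  qed
  have "D0 + 0 \<cdot>\<^sub>m D1 = D0" using D by (intro eq_matI) auto
  then have "Determinant.det D0 = 0" using det[of 0] by simp
  then obtain c where c: "c \<in> carrier_vec n" "c \<noteq> 0\<^sub>v n" "D0 *\<^sub>v c = 0\<^sub>v n"
    using det_0_iff_vec_prod_zero_field[OF D(1)] by blast
  define of_co where "of_co x = (\<Sum>j<n. vec_index x j *\<^sub>R f j)" for x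
  define co where "co v = Matrix.vec n (\<lambda>i. inner (f i) v)" for v
  have co_of: "co (of_co x) = x" if "x \<in> carrier_vec n" for x
  proof (rule eq_vecI)
    fix i assume "i < dim_vec x"
    then have i: "i < n" using that by simp
    have "inner (f i) (of_co x) = (\<Sum>j<n. if j = i then vec_index x i else 0)"
      unfolding of_co_def inner_sum_right using f i by (intro sum.cong) (auto simp: free_basis_def)
    then show "vec_index (co (of_co x)) i = vec_index x i" using i by (simp add: co_def)
  qed (use that in \<open>auto simp: co_def\<close>)
  have of_co: "of_co (co v) = v" if "v \<in> free_sym" for v
  proof -
    have "of_co (co v) = (\<Sum>i<n. inner (f i) v *\<^sub>R f i)" by (simp add: of_co_def co_def)
    then show ?thesis using f that by (simp add: free_basis_def)
  qed
  have of_in: "of_co x \<in> free_sym" for x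
    unfolding of_co_def using free_basisD(1)[OF f] subspace_free_sym by (intro subspace_sum subspace_scale) auto
  have Dco: "Matrix.mat n n (\<lambda>(i, j). inner (f i) (phess r (f j))) *\<^sub>v x = co (phess r (of_co x))" if "x \<in> carrier_vec n" for r x
  proof (rule eq_vecI)
    fix i assume "i < dim_vec (co (phess r (of_co x)))"
    then show "vec_index (Matrix.mat n n (\<lambda>(i, j). inner (f i) (phess r (f j))) *\<^sub>v x) i = vec_index (co (phess r (of_co x))) i"
      using that by (simp add: co_def of_co_def scalar_prod_def atLeast0LessThan linear_sum[OF linear_phess]
          linear_scale[OF linear_phess] inner_sum_right mult.commute)
  qed (simp add: co_def)
  have zero_of_co: "v = 0" if "v \<in> free_sym" "co v = 0\<^sub>v n" for v
    using of_co[OF that(1)] that(2) by (simp add: of_co_def)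
  define e where "e = of_co c"
  have e: "e \<in> free_sym" unfolding e_def by (rule of_in)
  have Pe: "phess p e = 0"
    using Dco[OF c(1), of p] c(3) phess_preserves(3)[OF e] zero_of_co by (simp add: D0_def e_def)
  have e0: "e \<noteq> 0"
  proof
    assume "e = 0"
    then have "c = co 0" using co_of[OF c(1)] by (simp add: e_def)
    then have "c = 0\<^sub>v n" by (auto simp: co_def)
    then show False using c(2) by simp
  qed
  define V where "V = {v. Ref v = v}"
  show ?thesis
  proof (rule branch_BIF[OF p, of V e])
    show "subspace V" unfolding V_def by (rule subspace_Ref_fixed)
    show "phess r v \<in> V" if "v \<in> V" for r v using that by (simp add: V_def phess_Ref[symmetric])
    show "pforce r (rosette p + v) \<in> V" if "v \<in> V" for r v
      using that by (simp add: V_def pforce_Ref[symmetric] Ref_linear Ref_rosette)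
    show "e \<in> V" using e by (simp add: V_def free_sym_def)
    fix \<eta> s assume eta: "\<eta> \<in> V" "inner e \<eta> = 0" "phess p \<eta> + s *\<^sub>R phess (1, 0) e = 0"
    obtain u v where uv: "u \<in> triple_sym" "v \<in> triple_free" "\<eta> = u + v" using sym_free_decomposition by blast
    have split: "x = 0 \<and> y = 0" if "x \<in> triple_sym" "y \<in> triple_free" "x + y = 0" for x y
    proof -
      have "inner x x + inner x y = 0" using that(3) by (metis inner_add_right inner_zero_right)
      then have "inner x x = 0" using inner_sym_free[OF that(1,2)] by simp
      then show ?thesis using that(3) by simp
    qed
    have Ru: "Ref u \<in> triple_sym" using uv(1) by (simp add: triple_sym_def Ref_Rot[symmetric]) (metis Ref_Rot Rot_6)
    have "(Ref u - u) + (Ref v - v) = 0" using eta(1) uv(3) by (simp add: V_def Ref_linear algebra_simps)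
    moreover have "Ref u - u \<in> triple_sym" using Ru uv(1) subspace_triple_sym by (simp add: subspace_diff)
    moreover have "Ref v - v \<in> triple_free" using Ref_triple_free[OF uv(2)] uv(2) subspace_triple_free by (simp add: subspace_diff)
    ultimately have R: "Ref u = u" "Ref v = v" using split by fastforce+
    have v: "v \<in> free_sym" using uv(2) R(2) by (simp add: free_sym_def)
    have ef: "e \<in> triple_free" using e by (simp add: free_sym_def)
    have "phess p u + (phess p v + s *\<^sub>R phess (1, 0) e) = 0"
      using eta(3) uv(3) by (simp add: linear_add[OF linear_phess] add.assoc)
    moreover have "phess p v + s *\<^sub>R phess (1, 0) e \<in> triple_free"
      using phess_preserves(2)[OF uv(2)] phess_preserves(2)[OF ef] subspace_triple_free
      by (intro subspace_add subspace_scale) auto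
    ultimately have Pu: "phess p u = 0" and Pv: "phess p v + s *\<^sub>R phess (1, 0) e = 0"
      using split phess_preserves(1)[OF uv(1)] by blast+
    have u0: "u = 0"
    proof -
      obtain x z x' t' where u: "u = upos x 0 z 0 + uneg x' 0 0 t'"
        using triple_sym_Ref_decomposition[OF uv(1) R(1)] by blast
      note eq = upos_uneg_zero[OF Pu[unfolded u linear_add[OF linear_phess] phess_upos phess_uneg]]
      have "x = 0 \<and> z = 0"
        by (rule det2_zero[OF _ conjunct1[OF eq] conjunct1[OF conjunct2[OF conjunct2[OF eq]]]])
          (use a1_det_pos[OF p] in \<open>simp add: a1_det_def\<close>)
      moreover have "x' = 0 \<and> t' = 0"
        by (rule det2_zero[OF _ eq[THEN conjunct2, THEN conjunct2, THEN conjunct2, THEN conjunct2, THEN conjunct1]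
              eq[THEN conjunct2, THEN conjunct2, THEN conjunct2, THEN conjunct2, THEN conjunct2, THEN conjunct2, THEN conjunct2]])
          (use b1 in \<open>simp add: b1_det_def\<close>)
      ultimately show ?thesis using u upos_scale[of 0 0 0 0 0] uneg_scale[of 0 0 0 0 0] by simp
    qed
    have "D0 *\<^sub>v co v + s \<cdot>\<^sub>v (D1 *\<^sub>v c) = 0\<^sub>v n"
    proof -
      have cv: "co v \<in> carrier_vec n" by (simp add: co_def)
      have "D0 *\<^sub>v co v + s \<cdot>\<^sub>v (D1 *\<^sub>v c) = co (phess p v) + s \<cdot>\<^sub>v co (phess (1, 0) e)"
        unfolding D0_def D1_def Dco[OF cv] Dco[OF c(1)] of_co[OF v] e_def[symmetric] ..
      also have "\<dots> = co (phess p v + s *\<^sub>R phess (1, 0) e)"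
        by (rule eq_vecI) (auto simp: co_def inner_add_right)
      also have "\<dots> = 0\<^sub>v n" unfolding Pv by (rule eq_vecI) (auto simp: co_def)
      finally show ?thesis .
    qed
    from pencil_simple_zero[OF D _ g(1,2) c(1,3,2) _ this] det
    obtain k where k: "s = 0" "co v = k \<cdot>\<^sub>v c" by (auto simp: co_def)
    have "v = k *\<^sub>R e"
    proof -
      have "v = of_co (k \<cdot>\<^sub>v c)" using of_co[OF v] k(2) by simp
      also have "\<dots> = k *\<^sub>R e" using c(1) by (simp add: of_co_def e_def scaleR_sum_right)
      finally show ?thesis .
    qed
    moreover have "inner e v = 0" using eta(2) uv(3) u0 by simp
    ultimately have "v = 0" using e0 by simp
    then show "\<eta> = 0 \<and> s = 0" using k(1) uv(3) u0 by simp
  qed (use e0 Pe in \<open>auto simp: V_def\<close>)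
qed


text \<open>The configurations invariant under the dihedral group of order 6. By
  \<open>triple_sym_Ref_decomposition\<close> their coordinates are the two radial ones of
  \<open>upos\<close> and the two symmetric ones of \<open>uneg\<close>, so the problem reduces to
  the blocks of \<open>a1_det\<close> and \<open>b1_det\<close>.\<close>

definition tri_ref :: "config set" where "tri_ref = triple_sym \<inter> {v. Ref v = v}"

lemma neg_rad_shift:
  "neg_rad11 (snd (p + (t, 0))) (m2 (p + (t, 0))) (fst (p + (t, 0))) (lamf (p + (t, 0))) =
    entry neg_rad11 p + t * neg_rad11 0 (m2 (1, 0)) 1 (lamf (1, 0))" (is ?t1)
  "neg_rad22 (snd (p + (t, 0))) (m2 (p + (t, 0))) (fst (p + (t, 0))) (lamf (p + (t, 0))) =
    entry neg_rad22 p + t * neg_rad22 0 (m2 (1, 0)) 1 (lamf (1, 0))" (is ?t2)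
  "neg_rad12 (snd (p + (t, 0))) (m2 (p + (t, 0))) (fst (p + (t, 0))) (lamf (p + (t, 0))) =
    entry neg_rad12 p + t * neg_rad12 0 (m2 (1, 0)) 1 (lamf (1, 0))" (is ?t3)
  "neg_rad21 (snd (p + (t, 0))) (m2 (p + (t, 0))) (fst (p + (t, 0))) (lamf (p + (t, 0))) =
    entry neg_rad21 p + t * neg_rad21 0 (m2 (1, 0)) 1 (lamf (1, 0))" (is ?t4)
proof -
  have m: "m2 (p + (t, 0)) = m2 p + t * m2 (1, 0)"
    using m2_linear[of "p + (t, 0)"] m2_linear[of p] by (simp add: algebra_simps)
  have l: "lamf (p + (t, 0)) = lamf p + t * lamf (1, 0)"
    using lamf_linear[of "p + (t, 0)"] lamf_linear[of p] by (simp add: algebra_simps)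
  show ?t1 ?t2 ?t3 ?t4
    unfolding neg_rad11_def neg_rad12_def neg_rad21_def neg_rad22_def m l
    by (simp_all add: algebra_simps add_divide_distrib diff_divide_distrib)
qed

text \<open>A zero of the two by two determinant with nonzero off-diagonal entries has a kernel
  spanned by (1, y) with y = - n11 / n12. Transversality in m0 follows from the simple zero of the
  quadratic form \<open>b1_det\<close>.\<close>

lemma b1_kernel:
  assumes p: "p \<in> quadrant" and b1: "b1_det p = 0"
  obtains y where
    "entry neg_rad11 p + entry neg_rad12 p * y = 0"
    "phess p (uneg 1 0 0 y) = 0" "uneg 1 0 0 y \<in> tri_ref" "uneg 1 0 0 y \<noteq> 0"
    "\<And>\<eta> s. \<eta> \<in> tri_ref \<Longrightarrow> inner (uneg 1 0 0 y) \<eta> = 0 \<Longrightarrow>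
      phess p \<eta> + s *\<^sub>R phess (1, 0) (uneg 1 0 0 y) = 0 \<Longrightarrow> \<eta> = 0 \<and> s = 0"
proof -
  define n11 n12 n21 n22 where n: "n11 = entry neg_rad11 p"
    "n12 = entry neg_rad12 p"
    "n21 = entry neg_rad21 p" "n22 = entry neg_rad22 p"
  define k11 k12 k21 k22 where k: "k11 = neg_rad11 0 (m2 (1, 0)) 1 (lamf (1, 0))"
    "k12 = neg_rad12 0 (m2 (1, 0)) 1 (lamf (1, 0))"
    "k21 = neg_rad21 0 (m2 (1, 0)) 1 (lamf (1, 0))" "k22 = neg_rad22 0 (m2 (1, 0)) 1 (lamf (1, 0))"
  have det: "n11 * n22 = n12 * n21" using b1 by (simp add: b1_det_def n)
  have pp: "fst p > 0" "snd p > 0" "m2 p > 0"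
    using p mass_pos[OF p, of 7] by (auto simp: quadrant_def mass_def ring_mass_nth)
  have "(- 13377 + 8 * sqrt 7) / 686 < 0" using sqrt_bounds by simp
  then have neg: "n12 < 0" "n21 < 0"
    using pp unfolding n off_diagonal by (simp_all add: mult_neg_pos)
  then have "n11 * n22 > 0" using det by (simp add: mult_neg_neg)
  then have n11: "n11 \<noteq> 0" by auto
  define y where "y = - n11 / n12"
  have y: "n12 * y = - n11" using neg by (simp add: y_def)
  have y2: "n21 + n22 * y = 0"
  proof -
    have "n12 * (n21 + n22 * y) = n12 * n21 + n22 * (n12 * y)" by (simp add: algebra_simps)
    also have "\<dots> = 0" using det by (simp add: y algebra_simps)
    finally show ?thesis using neg by simp
  qed
  \<comment> \<open>The derivative of \<open>b1_det\<close> in direction m0. For a quadratic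
    function the symmetric difference with step 1 computes it exactly.\<close>
  define d where "d = n11 * k22 + k11 * n22 - n12 * k21 - k12 * n21"
  have d0: "d \<noteq> 0"
  proof -
    obtain \<alpha> \<beta> \<gamma> where abc: "\<alpha> > 0" "\<gamma> < 0"
      and Q: "\<And>p. b1_det p = \<alpha> * (fst p)\<^sup>2 + \<beta> * (fst p * snd p) + \<gamma> * (snd p)\<^sup>2"
      using b1_det_quadratic by metis
    have exp: "b1_det (p + (t, 0)) = (n11 + t * k11) * (n22 + t * k22) - (n12 + t * k12) * (n21 + t * k21)" for t
      unfolding b1_det_def neg_rad_shift n k ..
    have "2 * d = b1_det (p + (1, 0)) - b1_det (p + (- 1, 0))"
      unfolding exp d_def by (simp add: algebra_simps)
    also have "\<dots> = 2 * (2 * \<alpha> * fst p + \<beta> * snd p)"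
      unfolding Q by (simp add: algebra_simps power2_eq_square)
    finally have d: "d = 2 * \<alpha> * fst p + \<beta> * snd p" by simp
    have "fst p * d = \<alpha> * (fst p)\<^sup>2 - \<gamma> * (snd p)\<^sup>2 + b1_det p"
      unfolding Q d by (simp add: algebra_simps power2_eq_square)
    moreover have "\<alpha> * (fst p)\<^sup>2 > 0" "\<gamma> * (snd p)\<^sup>2 < 0" using abc pp by (simp_all add: mult_neg_pos)
    ultimately show ?thesis using b1 by auto
  qed
  show thesis
  proof (rule that[of y])
    show "entry neg_rad11 p + entry neg_rad12 p * y = 0"
      using y by (simp add: n)
    have z: "uneg 0 0 0 0 = 0" using uneg_scale[of 0 0 0 0 0] by simp
    show "phess p (uneg 1 0 0 y) = 0"
      unfolding phess_uneg n[symmetric] using y y2 by (simp add: z)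
    show "uneg 1 0 0 y \<in> tri_ref"
      by (simp add: tri_ref_def triple_sym_def Ref_uneg Rot_uneg Rot_linear)
    show "uneg 1 0 0 y \<noteq> 0"
      using upos_uneg_zero[of 0 0 0 0 1 0 0 y] upos_scale[of 0 0 0 0 0] by auto
    fix \<eta> s assume eta: "\<eta> \<in> tri_ref" "inner (uneg 1 0 0 y) \<eta> = 0"
      "phess p \<eta> + s *\<^sub>R phess (1, 0) (uneg 1 0 0 y) = 0"
    obtain a b c t where abct: "\<eta> = upos a 0 b 0 + uneg c 0 0 t"
      using triple_sym_Ref_decomposition[of \<eta>] eta(1) by (auto simp: tri_ref_def)
    have ct: "c = - (y * t)"
      using eta(2) unfolding abct inner_add_right inner_uneg inner_uneg_upos by simp
    define P where "P = phess p (upos a 0 b 0)"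
    have "P + (phess p (uneg c 0 0 t) + s *\<^sub>R phess (1, 0) (uneg 1 0 0 y)) = 0"
      using eta(3) by (simp add: abct P_def linear_add[OF linear_phess] add.assoc)
    note eq = upos_uneg_zero[OF this[unfolded P_def phess_upos phess_uneg uneg_scale uneg_add fst_conv snd_conv]]
    have ab: "a = 0 \<and> b = 0"
      by (rule det2_zero[OF _ conjunct1[OF eq] conjunct1[OF conjunct2[OF conjunct2[OF eq]]]])
        (use a1_det_pos[OF p] in \<open>simp add: a1_det_def\<close>)
    have e1: "n11 * c + n12 * t + s * (k11 + k12 * y) = 0" and e2: "n21 * c + n22 * t + s * (k21 + k22 * y) = 0"
      using eq by (simp_all add: n k)
    \<comment> \<open>The combination of the two rows that eliminates c and, because the determinant
      vanishes, t as well; what remains is s times n11 d.\<close>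
    have "n12 * (n21 * (n11 * c + n12 * t + s * (k11 + k12 * y)) - n11 * (n21 * c + n22 * t + s * (k21 + k22 * y)))
        = n12 * t * (n12 * n21 - n11 * n22) + s * (n12 * n21 * k11 + n21 * k12 * (n12 * y) - n11 * k21 * n12 - n11 * k22 * (n12 * y))"
      by (simp add: algebra_simps)
    also have "\<dots> = s * n11 * d"
      unfolding y det[symmetric] d_def by (simp add: algebra_simps)
    finally have s: "s = 0" unfolding e1 e2 using n11 d0 by simp
    have "n12 * (t * (1 + y * y)) = 0"
    proof -
      have "n11 * c = n12 * y * (y * t)" unfolding ct using y by simp
      then show ?thesis using e1 s by (simp add: algebra_simps)
    qed
    moreover have "1 + y * y > 0" by (simp add: add_pos_nonneg)
    ultimately have "t = 0" using neg by auto
    then show "\<eta> = 0 \<and> s = 0"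
      using s ct abct ab upos_scale[of 0 0 0 0 0] z by simp
  qed
qed

lemma tri_ref_invariant:
  "subspace tri_ref" "v \<in> tri_ref \<Longrightarrow> Ref v = v" "v \<in> tri_ref \<Longrightarrow> phess r v \<in> tri_ref"
  "v \<in> tri_ref \<Longrightarrow> pforce r (rosette p + v) \<in> tri_ref"
proof -
  show "subspace tri_ref" unfolding tri_ref_def
    by (intro subspace_inter subspace_triple_sym subspace_Ref_fixed)
  assume "v \<in> tri_ref"
  then have v: "Rot (Rot v) = v" "Ref v = v" by (auto simp: tri_ref_def triple_sym_def)
  show "Ref v = v" by (rule v)
  show "phess r v \<in> tri_ref"
    using v by (simp add: tri_ref_def triple_sym_def phess_Rot[symmetric] phess_Ref[symmetric])
  show "pforce r (rosette p + v) \<in> tri_ref"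
    using v by (simp add: tri_ref_def triple_sym_def pforce_Rot[symmetric] pforce_Ref[symmetric] Ref_linear Rot_linear
        Rot_rosette Ref_rosette)
qed

lemma b1_kernel_BIF:
  assumes p: "p \<in> quadrant" and b1: "b1_det p = 0"
  shows "p \<in> BIF"
proof -
  obtain y where y: "phess p (uneg 1 0 0 y) = 0" "uneg 1 0 0 y \<in> tri_ref" "uneg 1 0 0 y \<noteq> 0"
    "\<And>\<eta> s. \<eta> \<in> tri_ref \<Longrightarrow> inner (uneg 1 0 0 y) \<eta> = 0 \<Longrightarrow>
      phess p \<eta> + s *\<^sub>R phess (1, 0) (uneg 1 0 0 y) = 0 \<Longrightarrow> \<eta> = 0 \<and> s = 0"
    using b1_kernel[OF assms] by metis
  show ?thesis
    by (rule branch_BIF[OF p tri_ref_invariant y(2,3,1,4)])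
qed

section \<open>Taylor expansion of the force\<close>

text \<open>With s for \<open>acc_slope z v\<close> and n for \<open>acc_ratio z v\<close>, |z + x
  v|^2 = |z|^2 (1 + 2 s x + n x^2).\<close>

definition acc_slope :: "real^2 \<Rightarrow> real^2 \<Rightarrow> real" where "acc_slope z v = inner z v / (norm z)\<^sup>2"

definition acc_ratio :: "real^2 \<Rightarrow> real^2 \<Rightarrow> real" where "acc_ratio z v = inner v v / (norm z)\<^sup>2"

text \<open>With \<open>acc3\<close>, the coefficients of x^2 and x^3 in the expansion of
  \<open>acc (z + x v)\<close>, factorials included.\<close>

definition acc2 :: "real^2 \<Rightarrow> real^2 \<Rightarrow> real^2" where
  "acc2 z v = (1 / norm z ^ 3) *\<^sub>R
    ((15/2 * (acc_slope z v)\<^sup>2 - 3/2 * acc_ratio z v) *\<^sub>R z - (3 * acc_slope z v) *\<^sub>R v)"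

definition acc3 :: "real^2 \<Rightarrow> real^2 \<Rightarrow> real^2" where
  "acc3 z v = (1 / norm z ^ 3) *\<^sub>R
    ((15/2 * acc_slope z v * acc_ratio z v - 35/2 * acc_slope z v ^ 3) *\<^sub>R z +
      (15/2 * (acc_slope z v)\<^sup>2 - 3/2 * acc_ratio z v) *\<^sub>R v)"

text \<open>The cubic Taylor polynomial of (1 + u)^(-3/2) composed with u = 2 s x + n x^2.\<close>

lemma powr_jet:
  fixes s n :: real
  obtains \<epsilon> where "(\<epsilon> \<longlongrightarrow> 0) (at 0)" "\<And>x. (1 + (2 * s * x + n * x\<^sup>2)) powr (- 3/2) =
    1 - 3 * s * x + (15/2 * s\<^sup>2 - 3/2 * n) * x\<^sup>2 + (15/2 * s * n - 35/2 * s ^ 3) * x ^ 3 + x ^ 3 * \<epsilon> x"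
proof -
  define E :: "real \<Rightarrow> real" where
    "E u = ((1 + u) powr (- 3/2) - (1 - 3/2 * u + 15/8 * u\<^sup>2 - 35/16 * u ^ 3)) / u ^ 3" for u
  have E: "(E \<longlongrightarrow> 0) (at 0)" unfolding E_def by real_asymp
  have E0: "E 0 = 0" by (simp add: E_def)
  have contE: "isCont E 0" unfolding isCont_def E0 by (rule E)
  define g where "g x = 2 * s + n * x" for x
  \<comment> \<open>The first summand collects the terms of degree at least four produced by
    substituting u, the second is the Taylor remainder in u; both are divided by x^3.\<close>
  define \<epsilon> where "\<epsilon> x = x * (15/8 * n\<^sup>2 - 35/16 * (12 * s\<^sup>2 * n + 6 * s * n\<^sup>2 * x + n ^ 3 * x\<^sup>2)) + g x ^ 3 * E (x * g x)" for x
  show thesis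
  proof (rule that[of \<epsilon>])
    have "isCont (\<lambda>x. E (x * g x)) 0"
      by (rule isCont_o2[of 0 "\<lambda>x. x * g x" E]) (use contE in \<open>auto simp: g_def intro!: continuous_intros\<close>)
    then have "isCont \<epsilon> 0" unfolding \<epsilon>_def g_def by (intro continuous_intros)
    then show "(\<epsilon> \<longlongrightarrow> 0) (at 0)" by (simp add: isCont_def \<epsilon>_def E_def)
    fix x
    define u where "u = x * g x"
    have u: "2 * s * x + n * x\<^sup>2 = u" by (simp add: u_def g_def algebra_simps power2_eq_square)
    have "(1 + u) powr (- 3/2) = 1 - 3/2 * u + 15/8 * u\<^sup>2 - 35/16 * u ^ 3 + u ^ 3 * E u"
      by (cases "u = 0") (simp_all add: E_def)
    also have "u ^ 3 * E u = x ^ 3 * (g x ^ 3 * E (x * g x))" by (simp add: u_def power_mult_distrib)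
    also have "1 - 3/2 * u + 15/8 * u\<^sup>2 - 35/16 * u ^ 3 =
        1 - 3 * s * x + (15/2 * s\<^sup>2 - 3/2 * n) * x\<^sup>2 + (15/2 * s * n - 35/2 * s ^ 3) * x ^ 3 +
        x ^ 3 * (x * (15/8 * n\<^sup>2 - 35/16 * (12 * s\<^sup>2 * n + 6 * s * n\<^sup>2 * x + n ^ 3 * x\<^sup>2)))"
      unfolding u_def g_def by (simp add: algebra_simps power2_eq_square power3_eq_cube)
    finally show "(1 + (2 * s * x + n * x\<^sup>2)) powr (- 3/2) =
        1 - 3 * s * x + (15/2 * s\<^sup>2 - 3/2 * n) * x\<^sup>2 + (15/2 * s * n - 35/2 * s ^ 3) * x ^ 3 + x ^ 3 * \<epsilon> x"
      unfolding u \<epsilon>_def by (simp add: algebra_simps)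
  qed
qed

text \<open>The premise admits \<open>z = 0\<close> only together with \<open>v = 0\<close>, which
  is the situation of a body paired with itself in the force.\<close>

lemma acc_jet:
  "((\<lambda>x. (1 / x ^ 3) *\<^sub>R (acc (z + x *\<^sub>R v) - (acc z + x *\<^sub>R acc_deriv z v + x\<^sup>2 *\<^sub>R acc2 z v + x ^ 3 *\<^sub>R acc3 z v)))
    \<longlongrightarrow> 0) (at 0)" if "z = 0 \<Longrightarrow> v = 0"
proof (cases "z = 0")
  case True
  then show ?thesis using that by (simp add: acc2_def acc3_def)
next
  case False
  define s n where "s = acc_slope z v" and "n = acc_ratio z v"
  define d where "d = norm z"
  have d: "d > 0" using False by (simp add: d_def)
  obtain \<epsilon> where \<epsilon>: "(\<epsilon> \<longlongrightarrow> 0) (at 0)" and jet: "\<And>x. (1 + (2 * s * x + n * x\<^sup>2)) powr (- 3/2) =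
    1 - 3 * s * x + (15/2 * s\<^sup>2 - 3/2 * n) * x\<^sup>2 + (15/2 * s * n - 35/2 * s ^ 3) * x ^ 3 + x ^ 3 * \<epsilon> x"
    using powr_jet by blast
  define c3 where "c3 = 15/2 * s * n - 35/2 * s ^ 3"
  define c2 where "c2 = 15/2 * s\<^sup>2 - 3/2 * n"
  have norm: "1 / norm (z + x *\<^sub>R v) ^ 3 = (1 / d ^ 3) * (1 + (2 * s * x + n * x\<^sup>2)) powr (- 3/2)" for x
  proof -
    define N where "N = norm (z + x *\<^sub>R v)"
    have "N\<^sup>2 = inner z z + 2 * x * inner z v + x\<^sup>2 * inner v v"
      unfolding N_def power2_norm_eq_inner inner_add_left inner_add_right inner_scaleR_left inner_scaleR_right
        inner_commute[of v z] by (simp add: power2_eq_square algebra_simps)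
    moreover have "inner z z = d\<^sup>2" by (simp add: d_def power2_norm_eq_inner)
    moreover have "inner z v = s * d\<^sup>2" "inner v v = n * d\<^sup>2"
      using d by (simp_all add: s_def n_def acc_slope_def acc_ratio_def d_def[symmetric])
    ultimately have "N\<^sup>2 = d\<^sup>2 * (1 + (2 * s * x + n * x\<^sup>2))" by (simp add: algebra_simps)
    then have e: "1 + (2 * s * x + n * x\<^sup>2) = (N / d)\<^sup>2" using d by (simp add: field_simps)
    show ?thesis
    proof (cases "N = 0")
      case True
      then show ?thesis unfolding e by (simp add: N_def[symmetric])
    next
      case False
      then have N: "N > 0" by (simp add: N_def)
      then have "(N / d)\<^sup>2 = (N / d) powr 2" using d by simp
      then have "((N / d)\<^sup>2) powr (- 3/2) = (N / d) powr (2 * (- 3/2))" by (simp only: powr_powr)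
      also have "\<dots> = (N / d) powr (- 3)" by simp
      also have "\<dots> = 1 / (N / d) ^ 3" using N d by (simp add: powr_minus_divide powr_numeral)
      finally show ?thesis unfolding e N_def[symmetric] using d N by (simp add: field_simps power_divide)
    qed
  qed
  have a1: "acc_deriv z v = (1 / d ^ 3) *\<^sub>R (v - (3 * s) *\<^sub>R z)"
    using d unfolding acc_deriv_def d_def s_def acc_slope_def
    by (simp add: scaleR_diff_right field_simps power_eq_if)
  have "(1 / x ^ 3) *\<^sub>R (acc (z + x *\<^sub>R v) - (acc z + x *\<^sub>R acc_deriv z v + x\<^sup>2 *\<^sub>R acc2 z v + x ^ 3 *\<^sub>R acc3 z v))
      = (1 / d ^ 3) *\<^sub>R (\<epsilon> x *\<^sub>R (z + x *\<^sub>R v) + (x * c3) *\<^sub>R v)" if x: "x \<noteq> 0" for x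
  proof -
    have "acc (z + x *\<^sub>R v) - (acc z + x *\<^sub>R acc_deriv z v + x\<^sup>2 *\<^sub>R acc2 z v + x ^ 3 *\<^sub>R acc3 z v)
        = (1 / d ^ 3) *\<^sub>R ((1 - 3 * s * x + c2 * x\<^sup>2 + c3 * x ^ 3 + x ^ 3 * \<epsilon> x) *\<^sub>R (z + x *\<^sub>R v)
          - (z + x *\<^sub>R (v - (3 * s) *\<^sub>R z) + x\<^sup>2 *\<^sub>R (c2 *\<^sub>R z - (3 * s) *\<^sub>R v) + x ^ 3 *\<^sub>R (c3 *\<^sub>R z + c2 *\<^sub>R v)))"
      unfolding acc_def[of "z + x *\<^sub>R v"] norm jet c2_def[symmetric] c3_def[symmetric] a1
      unfolding acc_def acc2_def acc3_def d_def[symmetric] s_def[symmetric] n_def[symmetric] c2_def[symmetric] c3_def[symmetric]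
      by (simp add: scaleR_diff_right scaleR_add_right)
    also have "(1 - 3 * s * x + c2 * x\<^sup>2 + c3 * x ^ 3 + x ^ 3 * \<epsilon> x) *\<^sub>R (z + x *\<^sub>R v)
          - (z + x *\<^sub>R (v - (3 * s) *\<^sub>R z) + x\<^sup>2 *\<^sub>R (c2 *\<^sub>R z - (3 * s) *\<^sub>R v) + x ^ 3 *\<^sub>R (c3 *\<^sub>R z + c2 *\<^sub>R v))
        = x ^ 3 *\<^sub>R (\<epsilon> x *\<^sub>R (z + x *\<^sub>R v) + (x * c3) *\<^sub>R v)"
      by (simp add: vec2_eq_iff algebra_simps power2_eq_square power3_eq_cube)
    finally show ?thesis using x by simp
  qed
  then have ev: "\<forall>\<^sub>F x in at 0. (1 / d ^ 3) *\<^sub>R (\<epsilon> x *\<^sub>R (z + x *\<^sub>R v) + (x * c3) *\<^sub>R v) =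
      (1 / x ^ 3) *\<^sub>R (acc (z + x *\<^sub>R v) - (acc z + x *\<^sub>R acc_deriv z v + x\<^sup>2 *\<^sub>R acc2 z v + x ^ 3 *\<^sub>R acc3 z v))"
    by (simp add: eventually_at_filter)
  have "((\<lambda>x. (1 / d ^ 3) *\<^sub>R (\<epsilon> x *\<^sub>R (z + x *\<^sub>R v) + (x * c3) *\<^sub>R v)) \<longlongrightarrow>
      (1 / d ^ 3) *\<^sub>R (0 *\<^sub>R (z + 0 *\<^sub>R v) + (0 * c3) *\<^sub>R v)) (at 0)"
    by (intro tendsto_intros \<epsilon>)
  then show ?thesis by (simp add: Lim_transform_eventually[OF _ ev])
qed

text \<open>The multiplier is absent here and in \<open>force3\<close> because its term is linear in
  the configuration.\<close>

definition force2 :: "real^13 \<Rightarrow> config \<Rightarrow> config \<Rightarrow> config" where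
  "force2 \<mu> q v = (\<chi> i. - (\<Sum>j\<in>UNIV. \<mu> $ j *\<^sub>R acc2 (q $ i - q $ j) (v $ i - v $ j)))"

definition force3 :: "real^13 \<Rightarrow> config \<Rightarrow> config \<Rightarrow> config" where
  "force3 \<mu> q v = (\<chi> i. - (\<Sum>j\<in>UNIV. \<mu> $ j *\<^sub>R acc3 (q $ i - q $ j) (v $ i - v $ j)))"

lemma force_jet:
  assumes "q \<in> Omega"
  shows "((\<lambda>x. (1 / x ^ 3) *\<^sub>R (force \<mu> l (q + x *\<^sub>R v) -
    (force \<mu> l q + x *\<^sub>R force_deriv \<mu> l q v + x\<^sup>2 *\<^sub>R force2 \<mu> q v + x ^ 3 *\<^sub>R force3 \<mu> q v))) \<longlongrightarrow> 0) (at 0)"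
proof -
  define D where "D x z v = (1 / x ^ 3) *\<^sub>R
    (acc (z + x *\<^sub>R v) - (acc z + x *\<^sub>R acc_deriv z v + x\<^sup>2 *\<^sub>R acc2 z v + x ^ 3 *\<^sub>R acc3 z v))" for x :: real and z v
  have "((\<lambda>x. \<chi> i. - (\<Sum>j\<in>UNIV. \<mu> $ j *\<^sub>R D x (q $ i - q $ j) (v $ i - v $ j))) \<longlongrightarrow>
      (\<chi> i. - (\<Sum>j\<in>UNIV. \<mu> $ j *\<^sub>R 0))) (at 0)"
    unfolding D_def
  proof (intro tendsto_vec_lambda tendsto_minus tendsto_sum tendsto_scaleR tendsto_const acc_jet)
    fix i j assume "q $ i - q $ j = 0"
    then have "i = j" using assms unfolding Omega_def by force
    then show "v $ i - v $ j = 0" by simp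
  qed
  moreover have "(\<chi> i. - (\<Sum>j\<in>UNIV. \<mu> $ j *\<^sub>R D x (q $ i - q $ j) (v $ i - v $ j))) =
      (1 / x ^ 3) *\<^sub>R (force \<mu> l (q + x *\<^sub>R v) -
    (force \<mu> l q + x *\<^sub>R force_deriv \<mu> l q v + x\<^sup>2 *\<^sub>R force2 \<mu> q v + x ^ 3 *\<^sub>R force3 \<mu> q v))" for x
  proof -
    have e: "q $ i + x *\<^sub>R v $ i - (q $ j + x *\<^sub>R v $ j) = (q $ i - q $ j) + x *\<^sub>R (v $ i - v $ j)" for i j
      by (simp add: algebra_simps)
    show ?thesis
      unfolding config_eq_iff
      by (simp add: force_def force_deriv_def force2_def force3_def D_def e scaleR_diff_right scaleR_add_right
        sum.distrib sum_subtractf scaleR_sum_right mult.commute)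
  qed
  moreover have "(\<chi> i. - (\<Sum>j\<in>UNIV. \<mu> $ j *\<^sub>R 0)) = (0 :: config)" by (simp add: config_eq_iff)
  ultimately show ?thesis by simp
qed

section \<open>Second derivative and self-adjointness of the force\<close>

lemma has_derivative_acc_deriv:
  assumes "z \<noteq> 0"
  shows "((\<lambda>z. acc_deriv z v) has_derivative
    (\<lambda>h. - (3 * inner z h / norm z ^ 5) *\<^sub>R v - ((3 * inner h v / norm z ^ 5 - 15 * inner z v * inner z h / norm z ^ 7) *\<^sub>R z
      + (3 * inner z v / norm z ^ 5) *\<^sub>R h))) (at z)"
proof -
  define d where "d = norm z"
  have d: "d > 0" "z \<noteq> 0" using assms by (auto simp: d_def)
  have N: "(norm has_derivative (\<lambda>h. inner z h / d)) (at z)"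
    using has_derivative_norm[OF assms] by (simp add: sgn_div_norm d_def inner_commute divide_inverse mult.commute)
  have P: "((\<lambda>z::real^2. 1 / norm z ^ k) has_derivative (\<lambda>h. - real k * inner z h / d ^ (k + 2))) (at z)" for k
  proof -
    have "((\<lambda>z::real^2. 1 / norm z ^ k) has_derivative
        (\<lambda>h. (0 * norm z ^ k - 1 * (real k * (inner z h / d) * norm z ^ (k - 1))) / (norm z ^ k * norm z ^ k))) (at z)"
      by (rule has_derivative_divide'[OF has_derivative_const has_derivative_power[OF N]]) (use d in auto)
    moreover have "(0 * norm z ^ k - 1 * (real k * (inner z h / d) * norm z ^ (k - 1))) / (norm z ^ k * norm z ^ k)
        = - real k * inner z h / d ^ (k + 2)" for h
      using d unfolding d_def[symmetric] by (cases k) (simp_all add: field_simps)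
    ultimately show ?thesis by simp
  qed
  have I: "((\<lambda>z. inner z v) has_derivative (\<lambda>h. inner h v)) (at z)"
    by (intro bounded_linear_imp_has_derivative bounded_linear_inner_left)
  have "((\<lambda>z. (1 / norm z ^ 3) *\<^sub>R v - (3 * (inner z v * (1 / norm z ^ 5))) *\<^sub>R z) has_derivative
      (\<lambda>h. (- real 3 * inner z h / d ^ (3 + 2)) *\<^sub>R v -
        ((3 * (inner z v * (1 / norm z ^ 5))) *\<^sub>R h + (3 * (inner z v * (- real 5 * inner z h / d ^ (5 + 2)) + inner h v * (1 / norm z ^ 5))) *\<^sub>R z))) (at z)"
    by (intro has_derivative_diff has_derivative_scaleR has_derivative_scaleR_left has_derivative_mult_right
        has_derivative_mult P I has_derivative_ident)
  then show ?thesis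
    unfolding acc_deriv_def d_def by (simp add: algebra_simps diff_divide_distrib add_divide_distrib)
qed

lemma acc_deriv_second:
  assumes "z \<noteq> 0"
  shows "- (3 * inner z v / norm z ^ 5) *\<^sub>R v - ((3 * inner v v / norm z ^ 5 - 15 * inner z v * inner z v / norm z ^ 7) *\<^sub>R z
      + (3 * inner z v / norm z ^ 5) *\<^sub>R v) = 2 *\<^sub>R acc2 z v"
  using assms unfolding acc2_def acc_slope_def acc_ratio_def vec2_eq_iff
  by (simp add: divide_simps) (simp add: algebra_simps power_eq_if)

text \<open>Differentiation in the base point with the direction v held fixed; on the diagonal the
  second derivative is twice the Taylor coefficient.\<close>

lemma force_deriv_second:
  assumes "q \<in> Omega"
  obtains G where "((\<lambda>q. force_deriv \<mu> l q v) has_derivative G) (at q)" "G v = 2 *\<^sub>R force2 \<mu> q v"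
proof -
  define A where "A i j h = (let z = q $ i - q $ j; u = v $ i - v $ j in
    if i = j then 0 else
    - (3 * inner z h / norm z ^ 5) *\<^sub>R u - ((3 * inner h u / norm z ^ 5 - 15 * inner z u * inner z h / norm z ^ 7) *\<^sub>R z
      + (3 * inner z u / norm z ^ 5) *\<^sub>R h))" for i j :: 13 and h
  define G where "G h = (\<chi> i. 0 - (\<Sum>j\<in>UNIV. \<mu> $ j *\<^sub>R A i j (h $ i - h $ j)))" for h
  have nth: "((\<lambda>q. q $ i - q $ j) has_derivative (\<lambda>h. h $ i - h $ j)) (at q)" for i j :: 13
    by (intro has_derivative_diff bounded_linear_imp_has_derivative bounded_linear_vec_nth)
  have 1: "((\<lambda>q. acc_deriv (q $ i - q $ j) (v $ i - v $ j)) has_derivative (\<lambda>h. A i j (h $ i - h $ j))) (at q)" for i j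
  proof (cases "i = j")
    case True
    then show ?thesis by (simp add: A_def)
  next
    case False
    then have "q $ i - q $ j \<noteq> 0" using assms by (auto simp: Omega_def)
    from has_derivative_compose[OF nth has_derivative_acc_deriv[OF this]] show ?thesis
      using False by (simp add: A_def Let_def)
  qed
  have "((\<lambda>q. force_deriv \<mu> l q v) has_derivative G) (at q)"
    unfolding force_deriv_def G_def
    by (intro has_derivative_vec_lambda has_derivative_diff has_derivative_const has_derivative_sum has_derivative_scaleR_right 1)
  moreover have "A i j (v $ i - v $ j) = 2 *\<^sub>R acc2 (q $ i - q $ j) (v $ i - v $ j)" for i j
  proof (cases "i = j")
    case True
    then show ?thesis by (simp add: A_def acc2_def)
  next
    case False
    then have "q $ i - q $ j \<noteq> 0" using assms by (auto simp: Omega_def)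
    from acc_deriv_second[OF this, of "v $ i - v $ j"] show ?thesis using False by (simp only: A_def Let_def if_False)
  qed
  then have "G v = 2 *\<^sub>R force2 \<mu> q v"
    by (simp add: G_def force2_def config_eq_iff scaleR_sum_right mult.commute)
  ultimately show thesis by (rule that)
qed

lemma acc_deriv_sym: "inner (acc_deriv z u) v = inner (acc_deriv z v) u"
  unfolding acc_deriv_def inner_diff_left inner_scaleR_left inner_commute[of v u] by simp

text \<open>The force is a gradient divided by the masses, so its derivative is self-adjoint for the
  mass-weighted inner product. Symmetrising the pair sum reduces this to the symmetry of
  \<open>acc_deriv z\<close>.\<close>

lemma force_deriv_sym:
  "(\<Sum>i\<in>UNIV. \<mu> $ i * inner (force_deriv \<mu> l q u $ i) (v $ i)) = (\<Sum>i\<in>UNIV. \<mu> $ i * inner (force_deriv \<mu> l q v $ i) (u $ i))"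
proof -
  define B where "B u v i j = inner (acc_deriv (q $ i - q $ j) (u $ i - u $ j)) (v $ i - v $ j)" for u v :: config and i j
  have neg: "acc_deriv (- z) (- x) = - acc_deriv z x" for z x by (simp add: acc_deriv_def)
  have S: "(\<Sum>i\<in>UNIV. \<mu> $ i * inner (force_deriv \<mu> l q u $ i) (v $ i)) =
      l * (\<Sum>i\<in>UNIV. \<mu> $ i * inner (u $ i) (v $ i)) - 1/2 * (\<Sum>i\<in>UNIV. \<Sum>j\<in>UNIV. \<mu> $ i * \<mu> $ j * B u v i j)" for u v :: config
  proof -
    define A where "A i j = \<mu> $ i * \<mu> $ j * inner (acc_deriv (q $ i - q $ j) (u $ i - u $ j)) (v $ i)" for i j
    have sw: "A j i = - (\<mu> $ i * \<mu> $ j * inner (acc_deriv (q $ i - q $ j) (u $ i - u $ j)) (v $ j))" for i j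
      using neg[of "q $ i - q $ j" "u $ i - u $ j"] by (simp add: A_def)
    have "\<mu> $ i * \<mu> $ j * B u v i j = A i j + A j i" for i j
    proof -
      have "\<mu> $ i * \<mu> $ j * B u v i j = A i j - \<mu> $ i * \<mu> $ j * inner (acc_deriv (q $ i - q $ j) (u $ i - u $ j)) (v $ j)"
        by (simp add: B_def A_def inner_diff_right algebra_simps)
      then show ?thesis using sw[of j i] by simp
    qed
    then have "(\<Sum>i\<in>UNIV. \<Sum>j\<in>UNIV. \<mu> $ i * \<mu> $ j * B u v i j) = (\<Sum>i\<in>UNIV. \<Sum>j\<in>UNIV. A i j + A j i)" by simp
    also have "\<dots> = (\<Sum>i\<in>UNIV. \<Sum>j\<in>UNIV. A i j) + (\<Sum>i\<in>UNIV. \<Sum>j\<in>UNIV. A j i)" by (simp add: sum.distrib)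
    also have "(\<Sum>i\<in>UNIV. \<Sum>j\<in>UNIV. A j i) = (\<Sum>i\<in>UNIV. \<Sum>j\<in>UNIV. A i j)" by (rule sum.swap)
    finally have "(\<Sum>i\<in>UNIV. \<Sum>j\<in>UNIV. A i j) = 1/2 * (\<Sum>i\<in>UNIV. \<Sum>j\<in>UNIV. \<mu> $ i * \<mu> $ j * B u v i j)" by simp
    moreover have "(\<Sum>i\<in>UNIV. \<mu> $ i * inner (force_deriv \<mu> l q u $ i) (v $ i)) =
      l * (\<Sum>i\<in>UNIV. \<mu> $ i * inner (u $ i) (v $ i)) - (\<Sum>i\<in>UNIV. \<Sum>j\<in>UNIV. A i j)"
      by (simp add: force_deriv_def A_def inner_diff_left inner_sum_left sum_distrib_left sum_subtractf algebra_simps)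
    ultimately show ?thesis by simp
  qed
  have "B u v i j = B v u i j" for i j unfolding B_def by (rule acc_deriv_sym)
  then show ?thesis unfolding S by (simp add: inner_commute)
qed

section \<open>Second and third order terms along the kernel\<close>

lemma acc2_acc3_eval:
  assumes "x * x + y * y = d * d" "d > 0" "k * (d * d * d) = 1"
    "s * (d * d) = x * u + y * v" "n * (d * d) = u * u + v * v"
  shows "acc2 (vector [x, y]) (vector [u, v]) =
      vector [k * ((15/2 * (s * s) - 3/2 * n) * x - 3 * s * u), k * ((15/2 * (s * s) - 3/2 * n) * y - 3 * s * v)]"
    "acc3 (vector [x, y]) (vector [u, v]) =
      vector [k * ((15/2 * (s * n) - 35/2 * (s * (s * s))) * x + (15/2 * (s * s) - 3/2 * n) * u),
        k * ((15/2 * (s * n) - 35/2 * (s * (s * s))) * y + (15/2 * (s * s) - 3/2 * n) * v)]"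
proof -
  have nn: "norm (vector [x, y] :: real^2) = d" using assms by (intro norm_vec2_eqI) auto
  have k: "1 / d ^ 3 = k" using assms(2,3) by (simp add: field_simps power3_eq_cube)
  have s: "acc_slope (vector [x, y]) (vector [u, v]) = s"
    using assms(2,4) unfolding acc_slope_def nn inner_vec2 vector_2 by (simp add: field_simps power2_eq_square)
  have n: "acc_ratio (vector [x, y]) (vector [u, v]) = n"
    using assms(2,5) unfolding acc_ratio_def nn inner_vec2 vector_2 by (simp add: field_simps power2_eq_square)
  show "acc2 (vector [x, y]) (vector [u, v]) =
      vector [k * ((15/2 * (s * s) - 3/2 * n) * x - 3 * s * u), k * ((15/2 * (s * s) - 3/2 * n) * y - 3 * s * v)]"
    unfolding acc2_def nn k s n by (simp add: power2_eq_square algebra_simps)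
  show "acc3 (vector [x, y]) (vector [u, v]) =
      vector [k * ((15/2 * (s * n) - 35/2 * (s * (s * s))) * x + (15/2 * (s * s) - 3/2 * n) * u),
        k * ((15/2 * (s * n) - 35/2 * (s * (s * s))) * y + (15/2 * (s * s) - 3/2 * n) * v)]"
    unfolding acc3_def nn k s n by (simp add: power2_eq_square power3_eq_cube algebra_simps)
qed

lemma acc2_fst:
  assumes "x * x + y * y = d * d" "d > 0" "k * (d * d * d) = 1"
    "s * (d * d) = x * u + y * v" "n * (d * d) = u * u + v * v"
    "r = k * ((15/2 * (s * s) - 3/2 * n) * x - 3 * s * u)"
  shows "acc2 (vector [x, y]) (vector [u, v]) $ 1 = r"
  by (simp only: acc2_acc3_eval(1)[OF assms(1-5)] vector_2 assms(6))

lemma acc3_fst: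
  assumes "x * x + y * y = d * d" "d > 0" "k * (d * d * d) = 1"
    "s * (d * d) = x * u + y * v" "n * (d * d) = u * u + v * v"
    "r = k * ((15/2 * (s * n) - 35/2 * (s * (s * s))) * x + (15/2 * (s * s) - 3/2 * n) * u)"
  shows "acc3 (vector [x, y]) (vector [u, v]) $ 1 = r"
  by (simp only: acc2_acc3_eval(2)[OF assms(1-5)] vector_2 assms(6))

lemma acc2_rad7:
  assumes "x * x + y * y = d * d" "d > 0" "k * (d * d * d) = 1"
    "s * (d * d) = x * u + y * v" "n * (d * d) = u * u + v * v"
    "r = sqrt 3 / 2 * (k * ((15/2 * (s * s) - 3/2 * n) * x - 3 * s * u)) +
      1/2 * (k * ((15/2 * (s * s) - 3/2 * n) * y - 3 * s * v))"
  shows "rad7 (acc2 (vector [x, y]) (vector [u, v])) = r"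
  by (simp only: acc2_acc3_eval(1)[OF assms(1-5)] rad7_def vector_2 assms(6))

lemma acc3_tan7:
  assumes "x * x + y * y = d * d" "d > 0" "k * (d * d * d) = 1"
    "s * (d * d) = x * u + y * v" "n * (d * d) = u * u + v * v"
    "r = - 1/2 * (k * ((15/2 * (s * n) - 35/2 * (s * (s * s))) * x + (15/2 * (s * s) - 3/2 * n) * u)) +
      sqrt 3 / 2 * (k * ((15/2 * (s * n) - 35/2 * (s * (s * s))) * y + (15/2 * (s * s) - 3/2 * n) * v))"
  shows "tan7 (acc3 (vector [x, y]) (vector [u, v])) = r"
  by (simp only: acc2_acc3_eval(2)[OF assms(1-5)] tan7_def vector_2 assms(6))

lemma acc2_0 [simp]: "acc2 z 0 = 0" and acc3_0 [simp]: "acc3 z 0 = 0"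
  by (simp_all add: acc2_def acc3_def acc_slope_def acc_ratio_def)

lemma rad7_linear: "rad7 (u + v) = rad7 u + rad7 v" "rad7 (- u) = - rad7 u" "rad7 (k *\<^sub>R u) = k * rad7 u" "rad7 0 = 0"
  by (simp_all add: rad7_def algebra_simps)

lemma tan7_linear: "tan7 (u + v) = tan7 u + tan7 v" "tan7 (- u) = - tan7 u" "tan7 (k *\<^sub>R u) = k * tan7 u" "tan7 0 = 0"
  by (simp_all add: tan7_def algebra_simps)

text \<open>Four tables follow for the kernel vector \<open>uneg 1 0 0 y\<close> with y left as a
  variable. Symmetry decides which components are needed: the second order force is an
  \<open>upos\<close> with radial entries, and the third order force is paired with the kernel
  vector, which sees the radial entry at body 1 and the tangential one at body 7. The instantiations
  supply the distance d, k = 1/d^3, the slope s and the ratio n.\<close>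

lemma acc2_fst_rosette:
  "acc2 (rosette p $ 1 - rosette p $ 2) (uneg 1 0 0 y $ 1 - uneg 1 0 0 y $ 2) $ 1 = (- 36)"
  "acc2 (rosette p $ 1 - rosette p $ 3) (uneg 1 0 0 y $ 1 - uneg 1 0 0 y $ 3) $ 1 = (8 * sqrt 3)"
  "acc2 (rosette p $ 1 - rosette p $ 4) (uneg 1 0 0 y $ 1 - uneg 1 0 0 y $ 4) $ 1 = 0"
  "acc2 (rosette p $ 1 - rosette p $ 5) (uneg 1 0 0 y $ 1 - uneg 1 0 0 y $ 5) $ 1 = (8 * sqrt 3)"
  "acc2 (rosette p $ 1 - rosette p $ 6) (uneg 1 0 0 y $ 1 - uneg 1 0 0 y $ 6) $ 1 = (- 36)"
  "acc2 (rosette p $ 1 - rosette p $ 7) (uneg 1 0 0 y $ 1 - uneg 1 0 0 y $ 7) $ 1 = (21) + (30) * y + (- 15) * y * y"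
  "acc2 (rosette p $ 1 - rosette p $ 8) (uneg 1 0 0 y $ 1 - uneg 1 0 0 y $ 8) $ 1 = ((- 21) / 16) + ((21) / 8) * y + ((- 21) / 16) * y * y"
  "acc2 (rosette p $ 1 - rosette p $ 9) (uneg 1 0 0 y $ 1 - uneg 1 0 0 y $ 9) $ 1 = ((615 * sqrt 7) / 2401) + ((- 258 * sqrt 7) / 2401) * y + ((- 429 * sqrt 7) / 2401) * y * y"
  "acc2 (rosette p $ 1 - rosette p $ 10) (uneg 1 0 0 y $ 1 - uneg 1 0 0 y $ 10) $ 1 = ((615 * sqrt 7) / 2401) + ((- 258 * sqrt 7) / 2401) * y + ((- 429 * sqrt 7) / 2401) * y * y"
  "acc2 (rosette p $ 1 - rosette p $ 11) (uneg 1 0 0 y $ 1 - uneg 1 0 0 y $ 11) $ 1 = ((- 21) / 16) + ((21) / 8) * y + ((- 21) / 16) * y * y"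
  "acc2 (rosette p $ 1 - rosette p $ 12) (uneg 1 0 0 y $ 1 - uneg 1 0 0 y $ 12) $ 1 = (21) + (30) * y + (- 15) * y * y"
  "acc2 (rosette p $ 1 - rosette p $ 13) (uneg 1 0 0 y $ 1 - uneg 1 0 0 y $ 13) $ 1 = (48)"
  unfolding rosette_nth uneg_nth zero_vec2 vec2_simps
  apply (rule acc2_fst[where d = "1/2" and k = "(8)" and s = "0" and n = "(12)"]; ((simp add: algebra_simps sqrt3_cancel; fail) | simp add: field_simps sqrt3_cancel))
  apply (rule acc2_fst[where d = "sqrt 3 / 2" and k = "((8 * sqrt 3) / 9)" and s = "(2)" and n = "(4)"]; ((simp add: algebra_simps sqrt3_cancel; fail) | simp add: field_simps sqrt3_cancel))
  apply (rule acc2_fst[where d = "1" and k = "(1)" and s = "0" and n = "0"]; ((simp add: algebra_simps sqrt3_cancel; fail) | simp add: field_simps sqrt3_cancel))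
  apply (rule acc2_fst[where d = "sqrt 3 / 2" and k = "((8 * sqrt 3) / 9)" and s = "(2)" and n = "(4)"]; ((simp add: algebra_simps sqrt3_cancel; fail) | simp add: field_simps sqrt3_cancel))
  apply (rule acc2_fst[where d = "1/2" and k = "(8)" and s = "0" and n = "(12)"]; ((simp add: algebra_simps sqrt3_cancel; fail) | simp add: field_simps sqrt3_cancel))
  apply (rule acc2_fst[where d = "1/2" and k = "(8)" and s = "(- 1) + (1) * y" and n = "(4) + (4) * y + (4) * y * y"]; ((simp add: algebra_simps sqrt3_cancel; fail) | simp add: field_simps sqrt3_cancel))
  apply (rule acc2_fst[where d = "1" and k = "(1)" and s = "((1) / 2) + ((- 1) / 2) * y" and n = "(1) + (- 2) * y + (1) * y * y"]; ((simp add: algebra_simps sqrt3_cancel; fail) | simp add: field_simps sqrt3_cancel))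
  apply (rule acc2_fst[where d = "sqrt 7 / 2" and k = "((8 * sqrt 7) / 49)" and s = "((5) / 7) + ((1) / 7) * y" and n = "((4) / 7) + ((4) / 7) * y + ((4) / 7) * y * y"]; ((simp add: algebra_simps sqrt3_cancel; fail) | simp add: field_simps sqrt3_cancel))
  apply (rule acc2_fst[where d = "sqrt 7 / 2" and k = "((8 * sqrt 7) / 49)" and s = "((5) / 7) + ((1) / 7) * y" and n = "((4) / 7) + ((4) / 7) * y + ((4) / 7) * y * y"]; ((simp add: algebra_simps sqrt3_cancel; fail) | simp add: field_simps sqrt3_cancel))
  apply (rule acc2_fst[where d = "1" and k = "(1)" and s = "((1) / 2) + ((- 1) / 2) * y" and n = "(1) + (- 2) * y + (1) * y * y"]; ((simp add: algebra_simps sqrt3_cancel; fail) | simp add: field_simps sqrt3_cancel))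
  apply (rule acc2_fst[where d = "1/2" and k = "(8)" and s = "(- 1) + (1) * y" and n = "(4) + (4) * y + (4) * y * y"]; ((simp add: algebra_simps sqrt3_cancel; fail) | simp add: field_simps sqrt3_cancel))
  apply (rule acc2_fst[where d = "1/2" and k = "(8)" and s = "(2)" and n = "(4)"]; ((simp add: algebra_simps sqrt3_cancel; fail) | simp add: field_simps sqrt3_cancel))
  done

lemma acc3_fst_rosette:
  "acc3 (rosette p $ 1 - rosette p $ 2) (uneg 1 0 0 y $ 1 - uneg 1 0 0 y $ 2) $ 1 = (- 216)"
  "acc3 (rosette p $ 1 - rosette p $ 3) (uneg 1 0 0 y $ 1 - uneg 1 0 0 y $ 3) $ 1 = ((- 64 * sqrt 3) / 3)"
  "acc3 (rosette p $ 1 - rosette p $ 4) (uneg 1 0 0 y $ 1 - uneg 1 0 0 y $ 4) $ 1 = 0"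
  "acc3 (rosette p $ 1 - rosette p $ 5) (uneg 1 0 0 y $ 1 - uneg 1 0 0 y $ 5) $ 1 = ((- 64 * sqrt 3) / 3)"
  "acc3 (rosette p $ 1 - rosette p $ 6) (uneg 1 0 0 y $ 1 - uneg 1 0 0 y $ 6) $ 1 = (- 216)"
  "acc3 (rosette p $ 1 - rosette p $ 7) (uneg 1 0 0 y $ 1 - uneg 1 0 0 y $ 7) $ 1 = (37) + (- 57) * y + (- 177) * y * y + (- 19) * y * y * y"
  "acc3 (rosette p $ 1 - rosette p $ 8) (uneg 1 0 0 y $ 1 - uneg 1 0 0 y $ 8) $ 1 = ((37) / 32) + ((- 111) / 32) * y + ((111) / 32) * y * y + ((- 37) / 32) * y * y * y"
  "acc3 (rosette p $ 1 - rosette p $ 9) (uneg 1 0 0 y $ 1 - uneg 1 0 0 y $ 9) $ 1 = ((- 461 * sqrt 7) / 2401) + ((771 * sqrt 7) / 2401) * y + ((183 * sqrt 7) / 343) * y * y + ((137 * sqrt 7) / 2401) * y * y * y"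
  "acc3 (rosette p $ 1 - rosette p $ 10) (uneg 1 0 0 y $ 1 - uneg 1 0 0 y $ 10) $ 1 = ((- 461 * sqrt 7) / 2401) + ((771 * sqrt 7) / 2401) * y + ((183 * sqrt 7) / 343) * y * y + ((137 * sqrt 7) / 2401) * y * y * y"
  "acc3 (rosette p $ 1 - rosette p $ 11) (uneg 1 0 0 y $ 1 - uneg 1 0 0 y $ 11) $ 1 = ((37) / 32) + ((- 111) / 32) * y + ((111) / 32) * y * y + ((- 37) / 32) * y * y * y"
  "acc3 (rosette p $ 1 - rosette p $ 12) (uneg 1 0 0 y $ 1 - uneg 1 0 0 y $ 12) $ 1 = (37) + (- 57) * y + (- 177) * y * y + (- 19) * y * y * y"
  "acc3 (rosette p $ 1 - rosette p $ 13) (uneg 1 0 0 y $ 1 - uneg 1 0 0 y $ 13) $ 1 = (- 128)"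
  unfolding rosette_nth uneg_nth zero_vec2 vec2_simps
  apply (rule acc3_fst[where d = "1/2" and k = "(8)" and s = "0" and n = "(12)"]; ((simp add: algebra_simps sqrt3_cancel; fail) | simp add: field_simps sqrt3_cancel))
  apply (rule acc3_fst[where d = "sqrt 3 / 2" and k = "((8 * sqrt 3) / 9)" and s = "(2)" and n = "(4)"]; ((simp add: algebra_simps sqrt3_cancel; fail) | simp add: field_simps sqrt3_cancel))
  apply (rule acc3_fst[where d = "1" and k = "(1)" and s = "0" and n = "0"]; ((simp add: algebra_simps sqrt3_cancel; fail) | simp add: field_simps sqrt3_cancel))
  apply (rule acc3_fst[where d = "sqrt 3 / 2" and k = "((8 * sqrt 3) / 9)" and s = "(2)" and n = "(4)"]; ((simp add: algebra_simps sqrt3_cancel; fail) | simp add: field_simps sqrt3_cancel))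
  apply (rule acc3_fst[where d = "1/2" and k = "(8)" and s = "0" and n = "(12)"]; ((simp add: algebra_simps sqrt3_cancel; fail) | simp add: field_simps sqrt3_cancel))
  apply (rule acc3_fst[where d = "1/2" and k = "(8)" and s = "(- 1) + (1) * y" and n = "(4) + (4) * y + (4) * y * y"]; ((simp add: algebra_simps sqrt3_cancel; fail) | simp add: field_simps sqrt3_cancel))
  apply (rule acc3_fst[where d = "1" and k = "(1)" and s = "((1) / 2) + ((- 1) / 2) * y" and n = "(1) + (- 2) * y + (1) * y * y"]; ((simp add: algebra_simps sqrt3_cancel; fail) | simp add: field_simps sqrt3_cancel))
  apply (rule acc3_fst[where d = "sqrt 7 / 2" and k = "((8 * sqrt 7) / 49)" and s = "((5) / 7) + ((1) / 7) * y" and n = "((4) / 7) + ((4) / 7) * y + ((4) / 7) * y * y"]; ((simp add: algebra_simps sqrt3_cancel; fail) | simp add: field_simps sqrt3_cancel))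
  apply (rule acc3_fst[where d = "sqrt 7 / 2" and k = "((8 * sqrt 7) / 49)" and s = "((5) / 7) + ((1) / 7) * y" and n = "((4) / 7) + ((4) / 7) * y + ((4) / 7) * y * y"]; ((simp add: algebra_simps sqrt3_cancel; fail) | simp add: field_simps sqrt3_cancel))
  apply (rule acc3_fst[where d = "1" and k = "(1)" and s = "((1) / 2) + ((- 1) / 2) * y" and n = "(1) + (- 2) * y + (1) * y * y"]; ((simp add: algebra_simps sqrt3_cancel; fail) | simp add: field_simps sqrt3_cancel))
  apply (rule acc3_fst[where d = "1/2" and k = "(8)" and s = "(- 1) + (1) * y" and n = "(4) + (4) * y + (4) * y * y"]; ((simp add: algebra_simps sqrt3_cancel; fail) | simp add: field_simps sqrt3_cancel))
  apply (rule acc3_fst[where d = "1/2" and k = "(8)" and s = "(2)" and n = "(4)"]; ((simp add: algebra_simps sqrt3_cancel; fail) | simp add: field_simps sqrt3_cancel))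
  done

lemma acc2_rad7_rosette:
  "rad7 (acc2 (rosette p $ 7 - rosette p $ 1) (uneg 1 0 0 y $ 7 - uneg 1 0 0 y $ 1)) = (- 9 * sqrt 3) + (- 30 * sqrt 3) * y + (3 * sqrt 3) * y * y"
  "rad7 (acc2 (rosette p $ 7 - rosette p $ 2) (uneg 1 0 0 y $ 7 - uneg 1 0 0 y $ 2)) = (- 9 * sqrt 3) + (- 30 * sqrt 3) * y + (3 * sqrt 3) * y * y"
  "rad7 (acc2 (rosette p $ 7 - rosette p $ 3) (uneg 1 0 0 y $ 7 - uneg 1 0 0 y $ 3)) = ((3 * sqrt 3) / 16) + ((- 3 * sqrt 3) / 8) * y + ((3 * sqrt 3) / 16) * y * y"
  "rad7 (acc2 (rosette p $ 7 - rosette p $ 4) (uneg 1 0 0 y $ 7 - uneg 1 0 0 y $ 4)) = ((453 * (sqrt 3 * sqrt 7)) / 2401) + ((114 * (sqrt 3 * sqrt 7)) / 2401) * y + ((- 207 * (sqrt 3 * sqrt 7)) / 2401) * y * y"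
  "rad7 (acc2 (rosette p $ 7 - rosette p $ 5) (uneg 1 0 0 y $ 7 - uneg 1 0 0 y $ 5)) = ((453 * (sqrt 3 * sqrt 7)) / 2401) + ((114 * (sqrt 3 * sqrt 7)) / 2401) * y + ((- 207 * (sqrt 3 * sqrt 7)) / 2401) * y * y"
  "rad7 (acc2 (rosette p $ 7 - rosette p $ 6) (uneg 1 0 0 y $ 7 - uneg 1 0 0 y $ 6)) = ((3 * sqrt 3) / 16) + ((- 3 * sqrt 3) / 8) * y + ((3 * sqrt 3) / 16) * y * y"
  "rad7 (acc2 (rosette p $ 7 - rosette p $ 8) (uneg 1 0 0 y $ 7 - uneg 1 0 0 y $ 8)) = (8) * y * y"
  "rad7 (acc2 (rosette p $ 7 - rosette p $ 9) (uneg 1 0 0 y $ 7 - uneg 1 0 0 y $ 9)) = ((- 4 * sqrt 3) / 9) * y * y"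
  "rad7 (acc2 (rosette p $ 7 - rosette p $ 10) (uneg 1 0 0 y $ 7 - uneg 1 0 0 y $ 10)) = 0"
  "rad7 (acc2 (rosette p $ 7 - rosette p $ 11) (uneg 1 0 0 y $ 7 - uneg 1 0 0 y $ 11)) = ((- 4 * sqrt 3) / 9) * y * y"
  "rad7 (acc2 (rosette p $ 7 - rosette p $ 12) (uneg 1 0 0 y $ 7 - uneg 1 0 0 y $ 12)) = (8) * y * y"
  "rad7 (acc2 (rosette p $ 7 - rosette p $ 13) (uneg 1 0 0 y $ 7 - uneg 1 0 0 y $ 13)) = ((- 8) / 3) * y * y"
  unfolding rosette_nth uneg_nth zero_vec2 vec2_simps
  apply (rule acc2_rad7[where d = "1/2" and k = "(8)" and s = "(- 1) + (1) * y" and n = "(4) + (4) * y + (4) * y * y"]; ((simp add: algebra_simps sqrt3_cancel; fail) | simp add: field_simps sqrt3_cancel))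
  apply (rule acc2_rad7[where d = "1/2" and k = "(8)" and s = "(1) + (- 1) * y" and n = "(4) + (4) * y + (4) * y * y"]; ((simp add: algebra_simps sqrt3_cancel; fail) | simp add: field_simps sqrt3_cancel))
  apply (rule acc2_rad7[where d = "1" and k = "(1)" and s = "((1) / 2) + ((- 1) / 2) * y" and n = "(1) + (- 2) * y + (1) * y * y"]; ((simp add: algebra_simps sqrt3_cancel; fail) | simp add: field_simps sqrt3_cancel))
  apply (rule acc2_rad7[where d = "sqrt 7 / 2" and k = "((8 * sqrt 7) / 49)" and s = "((- 5) / 7) + ((- 1) / 7) * y" and n = "((4) / 7) + ((4) / 7) * y + ((4) / 7) * y * y"]; ((simp add: algebra_simps sqrt3_cancel; fail) | simp add: field_simps sqrt3_cancel))
  apply (rule acc2_rad7[where d = "sqrt 7 / 2" and k = "((8 * sqrt 7) / 49)" and s = "((5) / 7) + ((1) / 7) * y" and n = "((4) / 7) + ((4) / 7) * y + ((4) / 7) * y * y"]; ((simp add: algebra_simps sqrt3_cancel; fail) | simp add: field_simps sqrt3_cancel))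
  apply (rule acc2_rad7[where d = "1" and k = "(1)" and s = "((- 1) / 2) + ((1) / 2) * y" and n = "(1) + (- 2) * y + (1) * y * y"]; ((simp add: algebra_simps sqrt3_cancel; fail) | simp add: field_simps sqrt3_cancel))
  apply (rule acc2_rad7[where d = "sqrt 3 / 2" and k = "((8 * sqrt 3) / 9)" and s = "(- 2) * y" and n = "(4) * y * y"]; ((simp add: algebra_simps sqrt3_cancel; fail) | simp add: field_simps sqrt3_cancel))
  apply (rule acc2_rad7[where d = "3/2" and k = "((8) / 27)" and s = "0" and n = "((4) / 3) * y * y"]; ((simp add: algebra_simps sqrt3_cancel; fail) | simp add: field_simps sqrt3_cancel))
  apply (rule acc2_rad7[where d = "sqrt 3" and k = "((sqrt 3) / 9)" and s = "0" and n = "0"]; ((simp add: algebra_simps sqrt3_cancel; fail) | simp add: field_simps sqrt3_cancel))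
  apply (rule acc2_rad7[where d = "3/2" and k = "((8) / 27)" and s = "0" and n = "((4) / 3) * y * y"]; ((simp add: algebra_simps sqrt3_cancel; fail) | simp add: field_simps sqrt3_cancel))
  apply (rule acc2_rad7[where d = "sqrt 3 / 2" and k = "((8 * sqrt 3) / 9)" and s = "(2) * y" and n = "(4) * y * y"]; ((simp add: algebra_simps sqrt3_cancel; fail) | simp add: field_simps sqrt3_cancel))
  apply (rule acc2_rad7[where d = "sqrt 3 / 2" and k = "((8 * sqrt 3) / 9)" and s = "0" and n = "((4) / 3) * y * y"]; ((simp add: algebra_simps sqrt3_cancel; fail) | simp add: field_simps sqrt3_cancel))
  done

lemma acc3_tan7_rosette:
  "tan7 (acc3 (rosette p $ 7 - rosette p $ 1) (uneg 1 0 0 y $ 7 - uneg 1 0 0 y $ 1)) = (- 19) + (- 177) * y + (- 57) * y * y + (37) * y * y * y"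
  "tan7 (acc3 (rosette p $ 7 - rosette p $ 2) (uneg 1 0 0 y $ 7 - uneg 1 0 0 y $ 2)) = (- 19) + (- 177) * y + (- 57) * y * y + (37) * y * y * y"
  "tan7 (acc3 (rosette p $ 7 - rosette p $ 3) (uneg 1 0 0 y $ 7 - uneg 1 0 0 y $ 3)) = ((- 37) / 32) + ((111) / 32) * y + ((- 111) / 32) * y * y + ((37) / 32) * y * y * y"
  "tan7 (acc3 (rosette p $ 7 - rosette p $ 4) (uneg 1 0 0 y $ 7 - uneg 1 0 0 y $ 4)) = ((257 * sqrt 7) / 2401) + ((183 * sqrt 7) / 343) * y + ((411 * sqrt 7) / 2401) * y * y + ((- 221 * sqrt 7) / 2401) * y * y * y"
  "tan7 (acc3 (rosette p $ 7 - rosette p $ 5) (uneg 1 0 0 y $ 7 - uneg 1 0 0 y $ 5)) = ((257 * sqrt 7) / 2401) + ((183 * sqrt 7) / 343) * y + ((411 * sqrt 7) / 2401) * y * y + ((- 221 * sqrt 7) / 2401) * y * y * y"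
  "tan7 (acc3 (rosette p $ 7 - rosette p $ 6) (uneg 1 0 0 y $ 7 - uneg 1 0 0 y $ 6)) = ((- 37) / 32) + ((111) / 32) * y + ((- 111) / 32) * y * y + ((37) / 32) * y * y * y"
  "tan7 (acc3 (rosette p $ 7 - rosette p $ 8) (uneg 1 0 0 y $ 7 - uneg 1 0 0 y $ 8)) = ((- 64 * sqrt 3) / 3) * y * y * y"
  "tan7 (acc3 (rosette p $ 7 - rosette p $ 9) (uneg 1 0 0 y $ 7 - uneg 1 0 0 y $ 9)) = ((- 8) / 9) * y * y * y"
  "tan7 (acc3 (rosette p $ 7 - rosette p $ 10) (uneg 1 0 0 y $ 7 - uneg 1 0 0 y $ 10)) = 0"
  "tan7 (acc3 (rosette p $ 7 - rosette p $ 11) (uneg 1 0 0 y $ 7 - uneg 1 0 0 y $ 11)) = ((- 8) / 9) * y * y * y"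
  "tan7 (acc3 (rosette p $ 7 - rosette p $ 12) (uneg 1 0 0 y $ 7 - uneg 1 0 0 y $ 12)) = ((- 64 * sqrt 3) / 3) * y * y * y"
  "tan7 (acc3 (rosette p $ 7 - rosette p $ 13) (uneg 1 0 0 y $ 7 - uneg 1 0 0 y $ 13)) = ((- 16 * sqrt 3) / 9) * y * y * y"
  unfolding rosette_nth uneg_nth zero_vec2 vec2_simps
  apply (rule acc3_tan7[where d = "1/2" and k = "(8)" and s = "(- 1) + (1) * y" and n = "(4) + (4) * y + (4) * y * y"]; ((simp add: algebra_simps sqrt3_cancel; fail) | simp add: field_simps sqrt3_cancel))
  apply (rule acc3_tan7[where d = "1/2" and k = "(8)" and s = "(1) + (- 1) * y" and n = "(4) + (4) * y + (4) * y * y"]; ((simp add: algebra_simps sqrt3_cancel; fail) | simp add: field_simps sqrt3_cancel))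
  apply (rule acc3_tan7[where d = "1" and k = "(1)" and s = "((1) / 2) + ((- 1) / 2) * y" and n = "(1) + (- 2) * y + (1) * y * y"]; ((simp add: algebra_simps sqrt3_cancel; fail) | simp add: field_simps sqrt3_cancel))
  apply (rule acc3_tan7[where d = "sqrt 7 / 2" and k = "((8 * sqrt 7) / 49)" and s = "((- 5) / 7) + ((- 1) / 7) * y" and n = "((4) / 7) + ((4) / 7) * y + ((4) / 7) * y * y"]; ((simp add: algebra_simps sqrt3_cancel; fail) | simp add: field_simps sqrt3_cancel))
  apply (rule acc3_tan7[where d = "sqrt 7 / 2" and k = "((8 * sqrt 7) / 49)" and s = "((5) / 7) + ((1) / 7) * y" and n = "((4) / 7) + ((4) / 7) * y + ((4) / 7) * y * y"]; ((simp add: algebra_simps sqrt3_cancel; fail) | simp add: field_simps sqrt3_cancel))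
  apply (rule acc3_tan7[where d = "1" and k = "(1)" and s = "((- 1) / 2) + ((1) / 2) * y" and n = "(1) + (- 2) * y + (1) * y * y"]; ((simp add: algebra_simps sqrt3_cancel; fail) | simp add: field_simps sqrt3_cancel))
  apply (rule acc3_tan7[where d = "sqrt 3 / 2" and k = "((8 * sqrt 3) / 9)" and s = "(- 2) * y" and n = "(4) * y * y"]; ((simp add: algebra_simps sqrt3_cancel; fail) | simp add: field_simps sqrt3_cancel))
  apply (rule acc3_tan7[where d = "3/2" and k = "((8) / 27)" and s = "0" and n = "((4) / 3) * y * y"]; ((simp add: algebra_simps sqrt3_cancel; fail) | simp add: field_simps sqrt3_cancel))
  apply (rule acc3_tan7[where d = "sqrt 3" and k = "((sqrt 3) / 9)" and s = "0" and n = "0"]; ((simp add: algebra_simps sqrt3_cancel; fail) | simp add: field_simps sqrt3_cancel))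
  apply (rule acc3_tan7[where d = "3/2" and k = "((8) / 27)" and s = "0" and n = "((4) / 3) * y * y"]; ((simp add: algebra_simps sqrt3_cancel; fail) | simp add: field_simps sqrt3_cancel))
  apply (rule acc3_tan7[where d = "sqrt 3 / 2" and k = "((8 * sqrt 3) / 9)" and s = "(2) * y" and n = "(4) * y * y"]; ((simp add: algebra_simps sqrt3_cancel; fail) | simp add: field_simps sqrt3_cancel))
  apply (rule acc3_tan7[where d = "sqrt 3 / 2" and k = "((8 * sqrt 3) / 9)" and s = "0" and n = "((4) / 3) * y * y"]; ((simp add: algebra_simps sqrt3_cancel; fail) | simp add: field_simps sqrt3_cancel))
  done

lemma force2_fst:
  "force2 (ring_mass a b c) (rosette p) (uneg 1 0 0 y) $ 1 $ 1 =
    - (a * ((- 72 + 16 * sqrt 3)) + b * (((756315 + 9840 * sqrt 7) / 19208) + ((626661 - 2064 * sqrt 7) / 9604) * y + ((- 626661 - 6864 * sqrt 7) / 19208) * y * y) + c * ((48)))"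
  unfolding force2_def vec_lambda_beta sum_ring_mass vector_uminus_component vector_add_component vector_scaleR_component real_scaleR_def acc2_fst_rosette diff_self acc2_0 acc3_0 zero_index
  by (simp add: field_simps)

lemma force3_fst:
  "force3 (ring_mass a b c) (rosette p) (uneg 1 0 0 y) $ 1 $ 1 =
    - (a * (((- 1296 - 128 * sqrt 3) / 3)) + b * (((2931621 - 14752 * sqrt 7) / 38416) + ((- 4645935 + 24672 * sqrt 7) / 38416) * y + ((- 1904679 + 5856 * sqrt 7) / 5488) * y * y + ((- 1548645 + 4384 * sqrt 7) / 38416) * y * y * y) + c * ((- 128)))"
  unfolding force3_def vec_lambda_beta sum_ring_mass vector_uminus_component vector_add_component vector_scaleR_component real_scaleR_def acc3_fst_rosette diff_self acc2_0 acc3_0 zero_index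
  by (simp add: field_simps)

lemma force2_rad7:
  "rad7 (force2 (ring_mass a b c) (rosette p) (uneg 1 0 0 y) $ 7) =
    - (a * (((- 338541 * sqrt 3 + 7248 * (sqrt 3 * sqrt 7)) / 19208) + ((- 583443 * sqrt 3 + 912 * (sqrt 3 * sqrt 7)) / 9604) * y + ((122451 * sqrt 3 - 3312 * (sqrt 3 * sqrt 7)) / 19208) * y * y) + b * (((144 - 8 * sqrt 3) / 9) * y * y) + c * (((- 8) / 3) * y * y))"
  unfolding force2_def vec_lambda_beta sum_ring_mass rad7_linear acc2_rad7_rosette diff_self acc2_0 acc3_0 zero_index
  by (simp add: field_simps)

lemma force3_tan7:
  "tan7 (force3 (ring_mass a b c) (rosette p) (uneg 1 0 0 y) $ 7) =
    - (a * (((- 1548645 + 8224 * sqrt 7) / 38416) + ((- 1904679 + 5856 * sqrt 7) / 5488) * y + ((- 4645935 + 13152 * sqrt 7) / 38416) * y * y + ((2931621 - 7072 * sqrt 7) / 38416) * y * y * y) + b * (((- 16 - 384 * sqrt 3) / 9) * y * y * y) + c * (((- 16 * sqrt 3) / 9) * y * y * y))"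
  unfolding force3_def vec_lambda_beta sum_ring_mass tan7_linear acc3_tan7_rosette diff_self acc2_0 acc3_0 zero_index
  by (simp add: field_simps)

section \<open>Numerical bounds\<close>

text \<open>A bilinear function on a rectangle is extremal at the corners.\<close>

lemma ivl_mult:
  fixes a b l u l' u' :: real
  assumes "l \<le> a" "a \<le> u" "l' \<le> b" "b \<le> u'"
  shows "L \<le> l * l' \<Longrightarrow> L \<le> l * u' \<Longrightarrow> L \<le> u * l' \<Longrightarrow> L \<le> u * u' \<Longrightarrow> L \<le> a * b"
    "l * l' \<le> U \<Longrightarrow> l * u' \<le> U \<Longrightarrow> u * l' \<le> U \<Longrightarrow> u * u' \<le> U \<Longrightarrow> a * b \<le> U"
proof -
  have "min (l * b) (u * b) \<le> a * b \<and> a * b \<le> max (l * b) (u * b)"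
    using assms by (cases "b \<ge> 0") (auto simp: min_def max_def mult_right_mono mult_right_mono_neg)
  moreover have "min (c * l') (c * u') \<le> c * b \<and> c * b \<le> max (c * l') (c * u')" for c
    using assms by (cases "c \<ge> 0") (auto simp: min_def max_def mult_left_mono mult_left_mono_neg)
  note this[of l] this[of u]
  ultimately show "L \<le> l * l' \<Longrightarrow> L \<le> l * u' \<Longrightarrow> L \<le> u * l' \<Longrightarrow> L \<le> u * u' \<Longrightarrow> L \<le> a * b"
    "l * l' \<le> U \<Longrightarrow> l * u' \<le> U \<Longrightarrow> u * l' \<le> U \<Longrightarrow> u * u' \<le> U \<Longrightarrow> a * b \<le> U"
    by (auto simp: min_def max_def split: if_splits)
qed

text \<open>The quotient x is given only by the equation d x = n. The bounds are for positive d and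
  nonnegative bounds of x; a negative quantity is negated first.\<close>

lemma ivl_div:
  fixes d x n :: real
  assumes "d * x = n" "dl \<le> d" "d \<le> du" "nl \<le> n" "n \<le> nu"
  shows "0 < dl \<Longrightarrow> 0 \<le> L \<Longrightarrow> L * du \<le> nl \<Longrightarrow> L \<le> x" "0 < dl \<Longrightarrow> 0 \<le> U \<Longrightarrow> nu \<le> U * dl \<Longrightarrow> x \<le> U"
proof -
  assume "0 < dl"
  then have d: "d > 0" using assms by simp
  show "L \<le> x" if "0 \<le> L" "L * du \<le> nl"
  proof -
    have "L * d \<le> L * du" using assms that by (intro mult_left_mono) auto
    then have "d * L \<le> d * x" using assms that by (simp add: mult.commute)
    then show ?thesis using d by simp
  qed
  show "x \<le> U" if "0 \<le> U" "nu \<le> U * dl"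
  proof -
    have "U * dl \<le> U * d" using assms that by (intro mult_left_mono) auto
    then have "d * x \<le> d * U" using assms that by (simp add: mult.commute)
    then show ?thesis using d by simp
  qed
qed

text \<open>The facts F1, F2, ... enclose intermediate quantities between outward rounded decimals,
  each obtained from earlier ones. At the end \<open>nd\<close> is the product of the diagonal
  entries of the block and \<open>km\<close> that of the off-diagonal ones; they differ by about
  0.1.\<close>

lemma b1_det_lower: "b1_det (1787/1000, 1) < 0"
proof -
  define p :: "real \<times> real" where "p = (1787/1000, 1)"
  have p1: "snd p = 1" by (simp add: p_def)
  define t where "t = fst p"
  have F1: "1787/1000 \<le> t" "t \<le> 1787/1000" by (simp_all add: t_def p_def)
  define m where "m = m2 p"
  define l where "l = lamf p"
  define n11 where "n11 = entry neg_rad11 p"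
  define n22 where "n22 = entry neg_rad22 p"
  define r where "r = sqrt 3"
  have F2: "4330127/2500000 \<le> r" "r \<le> 17320509/10000000" using sqrt_bounds(1,2) by (simp_all add: r_def)
  define s where "s = sqrt 7"
  have F3: "26457513/10000000 \<le> s" "s \<le> 13228757/5000000" using sqrt_bounds(3,4) by (simp_all add: s_def)
  define u where "u = sqrt 3 * sqrt 7"
  have F4: "11456439/2500000 \<le> u" "u \<le> 45825757/10000000" using sqrt_bounds(5,6) by (simp_all add: u_def)
  define dd where "dd = (1862) * r + (- 810) * s + (- 90) * u + (7203)"
  have F5: "3936294071/500000 \<le> dd" "dd \<le> 7872588419/1000000" using dd_def F2 F3 F4 by linarith+
  define nn where "nn = (7644) * t + (- 486) * s + (2646) * r + (- 54) * u + (882)"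
  have F6: "4397885037/250000 \<le> nn" "nn \<le> 4397885117/250000" using nn_def F1 F3 F2 F4 by linarith+
  have dm: "dd * m = nn" using m2_mult_den[of p] by (simp add: dd_def nn_def m_def t_def p1 m2_den_def r_def s_def u_def algebra_simps)
  have F7: "223453/100000 \<le> m" "m \<le> 2234531/1000000" by (rule ivl_div[OF dm F5 F6]; simp)+
  define sm where "sm = s * m"
  have F8: "591201/100000 \<le> sm" "sm \<le> 2956007/500000" unfolding sm_def by (rule ivl_mult[OF F3 F7]; simp)+
  have l: "l = 8 * t + 10 + 8/3 * r + 40/49 * sm - 6 * m" by (simp add: l_def lamf_expand p1 t_def r_def sm_def s_def m_def)
  have F9: "10166873/500000 \<le> l" "l \<le> 20333757/1000000" using l F1 F2 F8 F7 by linarith+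
  have n11: "n11 = - 24 + 16/3 * r - 9/2 * m + 188/343 * sm + 16 * t + l" by (simp add: n11_def neg_rad11_expand p1 t_def r_def sm_def s_def m_def l_def)
  have F10: "13674181/500000 \<le> n11" "n11 \<le> 27348381/1000000" using n11 F2 F7 F8 F1 F9 by linarith+
  define k where "k = (- 4/343) * s + (39/2)"
  have F11: "3893829/200000 \<le> k" "k \<le> 9734573/500000" using k_def F3 by linarith+
  define rm where "rm = r * m"
  have F12: "3870319/1000000 \<le> rm" "rm \<le> 1935161/500000" unfolding rm_def by (rule ivl_mult[OF F2 F7]; simp)+
  define rt where "rt = r * t"
  have F13: "1547587/500000 \<le> rt" "rt \<le> 123807/40000" unfolding rt_def by (rule ivl_mult[OF F2 F1]; simp)+
  have n22: "n22 = - 3087/686 - 200/686 * s - 8/9 * m + 48/9 * rm - 8/9 * rt + l" by (simp add: n22_def neg_rad22_def p1 t_def r_def rm_def rt_def s_def m_def l_def field_simps)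
  have F14: "15483287/500000 \<le> n22" "n22 \<le> 7741651/250000" using n22 F3 F7 F12 F13 F9 by linarith+
  define nd where "nd = n11 * n22"
  have F15: "33875403/40000 \<le> nd" "nd \<le> 169377297/200000" unfolding nd_def by (rule ivl_mult[OF F10 F14]; simp)+
  define kk where "kk = k * k"
  have F16: "379047607/1000000 \<le> kk" "kk \<le> 189523823/500000" unfolding kk_def by (rule ivl_mult[OF F11 F11]; simp)+
  define km where "km = kk * m"
  have F17: "846993249/1000000 \<le> km" "km \<le> 211748429/250000" unfolding km_def by (rule ivl_mult[OF F16 F7]; simp)+
  have "b1_det p = nd - km"
    by (simp add: b1_det_def off_diagonal n11_def n22_def nd_def km_def kk_def k_def m_def p1 s_def field_simps)
  then show ?thesis using F15 F17 by (simp add: p_def)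
qed

lemma b1_det_upper: "b1_det (143/80, 1) > 0"
proof -
  define p :: "real \<times> real" where "p = (143/80, 1)"
  have p1: "snd p = 1" by (simp add: p_def)
  define t where "t = fst p"
  have F1: "143/80 \<le> t" "t \<le> 143/80" by (simp_all add: t_def p_def)
  define m where "m = m2 p"
  define l where "l = lamf p"
  define n11 where "n11 = entry neg_rad11 p"
  define n22 where "n22 = entry neg_rad22 p"
  define r where "r = sqrt 3"
  have F2: "4330127/2500000 \<le> r" "r \<le> 17320509/10000000" using sqrt_bounds(1,2) by (simp_all add: r_def)
  define s where "s = sqrt 7"
  have F3: "26457513/10000000 \<le> s" "s \<le> 13228757/5000000" using sqrt_bounds(3,4) by (simp_all add: s_def)
  define u where "u = sqrt 3 * sqrt 7"
  have F4: "11456439/2500000 \<le> u" "u \<le> 45825757/10000000" using sqrt_bounds(5,6) by (simp_all add: u_def)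
  define dd where "dd = (1862) * r + (- 810) * s + (- 90) * u + (7203)"
  have F5: "3936294071/500000 \<le> dd" "dd \<le> 7872588419/1000000" using dd_def F2 F3 F4 by linarith+
  define nn where "nn = (7644) * t + (- 486) * s + (2646) * r + (- 54) * u + (882)"
  have F6: "4398840537/250000 \<le> nn" "nn \<le> 4398840617/250000" using nn_def F1 F3 F2 F4 by linarith+
  have dm: "dd * m = nn" using m2_mult_den[of p] by (simp add: dd_def nn_def m_def t_def p1 m2_den_def r_def s_def u_def algebra_simps)
  have F7: "279377/125000 \<le> m" "m \<le> 2235017/1000000" by (rule ivl_div[OF dm F5 F6]; simp)+
  define sm where "sm = s * m"
  have F8: "369581/62500 \<le> sm" "sm \<le> 59133/10000" unfolding sm_def by (rule ivl_mult[OF F3 F7]; simp)+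
  have l: "l = 8 * t + 10 + 8/3 * r + 40/49 * sm - 6 * m" by (simp add: l_def lamf_expand p1 t_def r_def sm_def s_def m_def)
  have F9: "508397/25000 \<le> l" "l \<le> 20335891/1000000" using l F1 F2 F8 F7 by linarith+
  have n11: "n11 = - 24 + 16/3 * r - 9/2 * m + 188/343 * sm + 16 * t + l" by (simp add: n11_def neg_rad11_expand p1 t_def r_def sm_def s_def m_def l_def)
  have F10: "13678507/500000 \<le> n11" "n11 \<le> 27357033/1000000" using n11 F2 F7 F8 F1 F9 by linarith+
  define k where "k = (- 4/343) * s + (39/2)"
  have F11: "3893829/200000 \<le> k" "k \<le> 9734573/500000" using k_def F3 by linarith+
  define rm where "rm = r * m"
  have F12: "3871161/1000000 \<le> rm" "rm \<le> 967791/250000" unfolding rm_def by (rule ivl_mult[OF F2 F7]; simp)+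
  define rt where "rt = r * t"
  have F13: "77401/25000 \<le> rt" "rt \<le> 3096041/1000000" unfolding rt_def by (rule ivl_mult[OF F2 F1]; simp)+
  have n22: "n22 = - 3087/686 - 200/686 * s - 8/9 * m + 48/9 * rm - 8/9 * rt + l" by (simp add: n22_def neg_rad22_def p1 t_def r_def rm_def rt_def s_def m_def l_def field_simps)
  have F14: "30971997/1000000 \<le> n22" "n22 \<le> 30972027/1000000" using n22 F3 F7 F12 F13 F9 by linarith+
  define nd where "nd = n11 * n22"
  have F15: "169460271/200000 \<le> nd" "nd \<le> 169460553/200000" unfolding nd_def by (rule ivl_mult[OF F10 F14]; simp)+
  define kk where "kk = k * k"
  have F16: "379047607/1000000 \<le> kk" "kk \<le> 189523823/500000" unfolding kk_def by (rule ivl_mult[OF F11 F11]; simp)+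
  define km where "km = kk * m"
  have F17: "423588733/500000 \<le> km" "km \<le> 847177933/1000000" unfolding km_def by (rule ivl_mult[OF F16 F7]; simp)+
  have "b1_det p = nd - km"
    by (simp add: b1_det_def off_diagonal n11_def n22_def nd_def km_def kk_def k_def m_def p1 s_def field_simps)
  then show ?thesis using F15 F17 by (simp add: p_def)
qed

text \<open>With a known root t the quadratic factors: t times its value at t' is (t' - t) (\<alpha>
  t t' - \<gamma>), and the second factor is positive. The sign at a test point thus tells on which
  side of it the root lies.\<close>

lemma b1_det_root:
  assumes "b1_det (t, 1) = 0" "t > 0"
  shows "1787/1000 < t" "t < 143/80"
proof -
  obtain \<alpha> \<beta> \<gamma> where abc: "\<alpha> > 0" "\<gamma> < 0"
    and Q: "\<And>p. b1_det p = \<alpha> * (fst p)\<^sup>2 + \<beta> * (fst p * snd p) + \<gamma> * (snd p)\<^sup>2"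
    using b1_det_quadratic by metis
  have key: "t * b1_det (t', 1) = (t' - t) * (\<alpha> * t * t' - \<gamma>)" for t'
  proof -
    have "t * b1_det (t', 1) = (t' - t) * (\<alpha> * t * t' - \<gamma>) + t' * b1_det (t, 1)"
      unfolding Q by (simp add: algebra_simps power2_eq_square)
    then show ?thesis using assms(1) by simp
  qed
  have pos: "\<alpha> * t * t' - \<gamma> > 0" if "t' > 0" for t'
  proof -
    have "\<alpha> * t * t' > 0" using abc assms(2) that by simp
    then show ?thesis using abc by linarith
  qed
  have "(1787/1000 - t) * (\<alpha> * t * (1787/1000) - \<gamma>) < 0"
    using key[of "1787/1000"] b1_det_lower assms(2) by (metis mult_pos_neg)
  then show "1787/1000 < t" using pos[of "1787/1000"] by (simp add: mult_less_0_iff)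
  have "(143/80 - t) * (\<alpha> * t * (143/80) - \<gamma>) > 0"
    using key[of "143/80"] b1_det_upper assms(2) by (metis mult_pos_pos)
  then show "t < 143/80" using pos[of "143/80"] by (simp add: zero_less_mult_iff)
qed

text \<open>Up to a positive factor the expression shown to be positive is the third order coefficient of the reduced
  bifurcation equation; \<open>(a, b)\<close> is the second order correction of
  the branch in the directions \<open>upos 1 0 0 0\<close> and \<open>upos 0 0 1 0\<close>.\<close>

lemma quartic_positive:
  assumes "snd p = 1" "1787/1000 < fst p" "fst p < 143/80"
    "entry neg_rad11 p + entry neg_rad12 p * y = 0"
    "entry pos_rad11 p * a + entry pos_rad12 p * b =
      - force2 (mass p) (rosette p) (uneg 1 0 0 y) $ 1 $ 1"
    "entry pos_rad21 p * a + entry pos_rad22 p * b =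
      - rad7 (force2 (mass p) (rosette p) (uneg 1 0 0 y) $ 7)"
  shows "0 < force3 (mass p) (rosette p) (uneg 1 0 0 y) $ 1 $ 1 + m2 p * (y * tan7 (force3 (mass p) (rosette p) (uneg 1 0 0 y) $ 7)) +
    2 * (a * force2 (mass p) (rosette p) (uneg 1 0 0 y) $ 1 $ 1 + m2 p * (b * rad7 (force2 (mass p) (rosette p) (uneg 1 0 0 y) $ 7)))"
proof -
  note p1 = assms(1)
  define t where "t = fst p"
  define m where "m = m2 p"
  define l where "l = lamf p"
  define n11 where "n11 = entry neg_rad11 p"
  define q1 where "q1 = force2 (mass p) (rosette p) (uneg 1 0 0 y) $ 1 $ 1"
  define q2 where "q2 = rad7 (force2 (mass p) (rosette p) (uneg 1 0 0 y) $ 7)"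
  define r1 where "r1 = force3 (mass p) (rosette p) (uneg 1 0 0 y) $ 1 $ 1"
  define r3 where "r3 = tan7 (force3 (mass p) (rosette p) (uneg 1 0 0 y) $ 7)"
  define a11 where "a11 = entry pos_rad11 p"
  define a12 where "a12 = entry pos_rad12 p"
  define a21 where "a21 = entry pos_rad21 p"
  define a22 where "a22 = entry pos_rad22 p"
  have F1: "1787/1000 \<le> t" "t \<le> 143/80" using assms(2,3) by (simp_all add: t_def)
  define r where "r = sqrt 3"
  have F2: "4330127/2500000 \<le> r" "r \<le> 17320509/10000000" using sqrt_bounds(1,2) by (simp_all add: r_def)
  define s where "s = sqrt 7"
  have F3: "26457513/10000000 \<le> s" "s \<le> 13228757/5000000" using sqrt_bounds(3,4) by (simp_all add: s_def)
  define u where "u = sqrt 3 * sqrt 7"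
  have F4: "11456439/2500000 \<le> u" "u \<le> 45825757/10000000" using sqrt_bounds(5,6) by (simp_all add: u_def)
  define dd where "dd = (1862) * r + (- 810) * s + (- 90) * u + (7203)"
  have F5: "3936294071/500000 \<le> dd" "dd \<le> 7872588419/1000000" using dd_def F2 F3 F4 by linarith+
  define nn where "nn = (7644) * t + (- 486) * s + (2646) * r + (- 54) * u + (882)"
  have F6: "4397885037/250000 \<le> nn" "nn \<le> 4398840617/250000" using nn_def F1 F3 F2 F4 by linarith+
  have dm: "dd * m = nn" using m2_mult_den[of p] by (simp add: dd_def nn_def m_def t_def p1 m2_den_def r_def s_def u_def algebra_simps)
  have F7: "223453/100000 \<le> m" "m \<le> 2235017/1000000" by (rule ivl_div[OF dm F5 F6]; simp)+
  define sm where "sm = s * m"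
  have F8: "591201/100000 \<le> sm" "sm \<le> 59133/10000" unfolding sm_def by (rule ivl_mult[OF F3 F7]; simp)+
  have l: "l = 8 * t + 10 + 8/3 * r + 40/49 * sm - 6 * m" by (simp add: l_def lamf_expand p1 t_def r_def sm_def s_def m_def)
  have F9: "2033083/100000 \<le> l" "l \<le> 20338807/1000000" using l F1 F2 F8 F7 by linarith+
  have n11: "n11 = - 24 + 16/3 * r - 9/2 * m + 188/343 * sm + 16 * t + l" by (simp add: n11_def neg_rad11_expand p1 t_def r_def sm_def s_def m_def l_def)
  have F10: "27343259/1000000 \<le> n11" "n11 \<le> 3420267/125000" using n11 F2 F7 F8 F1 F9 by linarith+
  define k where "k = (- 4/343) * s + (39/2)"
  have F11: "3893829/200000 \<le> k" "k \<le> 9734573/500000" using k_def F3 by linarith+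
  define rm where "rm = r * m"
  have F12: "3870319/1000000 \<le> rm" "rm \<le> 967791/250000" unfolding rm_def by (rule ivl_mult[OF F2 F7]; simp)+
  define rt where "rt = r * t"
  have F13: "1547587/500000 \<le> rt" "rt \<le> 3096041/1000000" unfolding rt_def by (rule ivl_mult[OF F2 F1]; simp)+
  define km where "km = k * m"
  have F14: "10876097/250000 \<le> km" "km \<le> 43513873/1000000" unfolding km_def by (rule ivl_mult[OF F11 F7]; simp)+
  \<comment> \<open>The kernel equation solved for y: the upper off-diagonal entry is - k m, so y is
    the quotient of n11 by k m, close to 0.629.\<close>
  have ky: "km * y = n11" using assms(4) by (simp add: n11_def off_diagonal km_def k_def m_def p1 s_def field_simps)
  have F15: "31419/50000 \<le> y" "y \<le> 78619/125000" by (rule ivl_div[OF ky F14 F10]; simp)+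
  define y2 where "y2 = y * y"
  have F16: "394861/1000000 \<le> y2" "y2 \<le> 395581/1000000" unfolding y2_def by (rule ivl_mult[OF F15 F15]; simp)+
  define y3 where "y3 = y2 * y"
  have F17: "124061/500000 \<le> y3" "y3 \<le> 124401/500000" unfolding y3_def by (rule ivl_mult[OF F16 F15]; simp)+
  define c1 where "c1 = (16) * r + (- 72)"
  have F18: "- 11071797/250000 \<le> c1" "c1 \<le> - 8857437/200000" using c1_def F2 by linarith+
  define q1a where "q1a = (1) * c1"
  have F19: "- 11071797/250000 \<le> q1a" "q1a \<le> - 8857437/200000" using q1a_def F18 by linarith+
  define c2 where "c2 = (1230/2401) * s + (315/8)"
  have F20: "20365191/500000 \<le> c2" "c2 \<le> 40730383/1000000" using c2_def F3 by linarith+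
  define c3 where "c3 = (- 516/2401) * s + (261/4)"
  have F21: "323407/5000 \<le> c3" "c3 \<le> 64681401/1000000" using c3_def F3 by linarith+
  define q1b_1 where "q1b_1 = c3 * y"
  have F22: "20322249/500000 \<le> q1b_1" "q1b_1 \<le> 40681497/1000000" unfolding q1b_1_def by (rule ivl_mult[OF F21 F15]; simp)+
  define c4 where "c4 = (- 858/2401) * s + (- 261/8)"
  have F23: "- 33570463/1000000 \<le> c4" "c4 \<le> - 16785231/500000" using c4_def F3 by linarith+
  define q1b_2 where "q1b_2 = c4 * y2"
  have F24: "- 6639919/500000 \<le> q1b_2" "q1b_2 \<le> - 6627833/500000" unfolding q1b_2_def by (rule ivl_mult[OF F23 F16]; simp)+
  define q1b where "q1b = (1) * c2 + (1) * q1b_1 + (1) * q1b_2"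
  have F25: "34047521/500000 \<le> q1b" "q1b \<le> 34078107/500000" using q1b_def F20 F22 F24 by linarith+
  define c5 :: real where "c5 = 48"
  have F26: "48 \<le> c5" "c5 \<le> 48" by (simp_all add: c5_def)
  define q1c where "q1c = (1) * c5"
  have F27: "48 \<le> q1c" "q1c \<le> 48" using q1c_def F26 by linarith+
  define q1mb where "q1mb = m * q1b"
  have F28: "76080207/500000 \<le> q1mb" "q1mb \<le> 152330297/1000000" unfolding q1mb_def by (rule ivl_mult[OF F7 F25]; simp)+
  define q1tc where "q1tc = t * q1c"
  have F29: "10722/125 \<le> q1tc" "q1tc \<le> 429/5" unfolding q1tc_def by (rule ivl_mult[OF F1 F27]; simp)+
  have q1: "q1 = - (q1a + q1mb + q1tc)"
    unfolding q1_def mass_def force2_fst q1mb_def q1tc_def p1 m_def t_def q1c_def c5_def q1b_def q1b_2_def c4_def q1b_1_def c3_def c2_def q1a_def c1_def y3_def y2_def r_def s_def u_def by (simp add: field_simps)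
  have F30: "- 24230389/125000 \<le> q1" "q1 \<le> - 96824613/500000" using q1 F19 F28 F29 by linarith+
  define c6 where "c6 = (- 141/8) * r + (906/2401) * u"
  have F31: "- 7199549/250000 \<le> c6" "c6 \<le> - 28798193/1000000" using c6_def F2 F4 by linarith+
  define c7 where "c7 = (- 243/4) * r + (228/2401) * u"
  have F32: "- 104786929/1000000 \<le> c7" "c7 \<le> - 52393461/500000" using c7_def F2 F4 by linarith+
  define q2a_1 where "q2a_1 = c7 * y"
  have F33: "- 65905949/1000000 \<le> q2a_1" "q2a_1 \<le> - 32923003/500000" unfolding q2a_1_def by (rule ivl_mult[OF F32 F15]; simp)+
  define c8 where "c8 = (51/8) * r + (- 414/2401) * u"
  have F34: "5125829/500000 \<le> c8" "c8 \<le> 512583/50000" using c8_def F2 F4 by linarith+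
  define q2a_2 where "q2a_2 = c8 * y2"
  have F35: "4047979/1000000 \<le> q2a_2" "q2a_2 \<le> 2027681/500000" unfolding q2a_2_def by (rule ivl_mult[OF F34 F16]; simp)+
  define q2a where "q2a = (1) * c6 + (1) * q2a_1 + (1) * q2a_2"
  have F36: "- 45328083/500000 \<le> q2a" "q2a \<le> - 90588837/1000000" using q2a_def F31 F33 F35 by linarith+
  define c9 where "c9 = (- 8/9) * r + (16)"
  have F37: "14460399/1000000 \<le> c9" "c9 \<le> 36151/2500" using c9_def F2 by linarith+
  define q2b_2 where "q2b_2 = c9 * y2"
  have F38: "5709847/1000000 \<le> q2b_2" "q2b_2 \<le> 286013/50000" unfolding q2b_2_def by (rule ivl_mult[OF F37 F16]; simp)+
  define q2b where "q2b = (1) * q2b_2"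
  have F39: "5709847/1000000 \<le> q2b" "q2b \<le> 286013/50000" using q2b_def F38 by linarith+
  define c10 :: real where "c10 = - 8/3"
  have F40: "- 8/3 \<le> c10" "c10 \<le> - 8/3" by (simp_all add: c10_def)
  define q2c_2 where "q2c_2 = c10 * y2"
  have F41: "- 1054883/1000000 \<le> q2c_2" "q2c_2 \<le> - 526481/500000" unfolding q2c_2_def by (rule ivl_mult[OF F40 F16]; simp)+
  define q2c where "q2c = (1) * q2c_2"
  have F42: "- 1054883/1000000 \<le> q2c" "q2c \<le> - 526481/500000" using q2c_def F41 by linarith+
  define q2mb where "q2mb = m * q2b"
  have F43: "1594853/125000 \<le> q2mb" "q2mb \<le> 12784879/1000000" unfolding q2mb_def by (rule ivl_mult[OF F7 F39]; simp)+
  define q2tc where "q2tc = t * q2c"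
  have F44: "- 471401/250000 \<le> q2tc" "q2tc \<le> - 1881643/1000000" unfolding q2tc_def by (rule ivl_mult[OF F1 F42]; simp)+
  have q2: "q2 = - (q2a + q2mb + q2tc)"
    unfolding q2_def mass_def force2_rad7 q2mb_def q2tc_def p1 m_def t_def q2c_def q2c_2_def c10_def q2b_def q2b_2_def c9_def q2a_def q2a_2_def c8_def q2a_1_def c7_def c6_def y3_def y2_def r_def s_def u_def by (simp add: field_simps)
  have F45: "79685601/1000000 \<le> q2" "q2 \<le> 39891473/500000" using q2 F36 F43 F44 by linarith+
  define c11 where "c11 = (- 128/3) * r + (- 432)"
  have F46: "- 505900839/1000000 \<le> c11" "c11 \<le> - 252950417/500000" using c11_def F2 by linarith+
  define r1a where "r1a = (1) * c11"
  have F47: "- 505900839/1000000 \<le> r1a" "r1a \<le> - 252950417/500000" using r1a_def F46 by linarith+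
  define c12 where "c12 = (- 922/2401) * s + (1221/16)"
  have F48: "75296513/1000000 \<le> c12" "c12 \<le> 37648257/500000" using c12_def F3 by linarith+
  define c13 where "c13 = (1542/2401) * s + (- 1935/16)"
  have F49: "- 119238313/1000000 \<le> c13" "c13 \<le> - 14904789/125000" using c13_def F3 by linarith+
  define r1b_1 where "r1b_1 = c13 * y"
  have F50: "- 9374397/125000 \<le> r1b_1" "r1b_1 \<le> - 7492697/100000" unfolding r1b_1_def by (rule ivl_mult[OF F49 F15]; simp)+
  define c14 where "c14 = (366/343) * s + (- 5553/16)"
  have F51: "- 344239337/1000000 \<le> c14" "c14 \<le> - 43029917/125000" using c14_def F3 by linarith+
  define r1b_2 where "r1b_2 = c14 * y2"
  have F52: "- 68087271/500000 \<le> r1b_2" "r1b_2 \<le> - 4247709/31250" unfolding r1b_2_def by (rule ivl_mult[OF F51 F16]; simp)+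
  define c15 where "c15 = (274/2401) * s + (- 645/16)"
  have F53: "- 4001057/100000 \<le> c15" "c15 \<le> - 40010569/1000000" using c15_def F3 by linarith+
  define r1b_3 where "r1b_3 = c15 * y3"
  have F54: "- 995471/100000 \<le> r1b_3" "r1b_3 \<le> - 4963751/500000" unfolding r1b_3_def by (rule ivl_mult[OF F53 F17]; simp)+
  define r1b where "r1b = (1) * c12 + (1) * r1b_1 + (1) * r1b_2 + (1) * r1b_3"
  have F55: "- 29165583/200000 \<le> r1b" "r1b \<le> - 72742323/500000" using r1b_def F48 F50 F52 F54 by linarith+
  define c16 :: real where "c16 = - 128"
  have F56: "- 128 \<le> c16" "c16 \<le> - 128" by (simp_all add: c16_def)
  define r1c where "r1c = (1) * c16"
  have F57: "- 128 \<le> r1c" "r1c \<le> - 128" using r1c_def F56 by linarith+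
  define r1mb where "r1mb = m * r1b"
  have F58: "- 32592787/100000 \<le> r1mb" "r1mb \<le> - 162544903/500000" unfolding r1mb_def by (rule ivl_mult[OF F7 F55]; simp)+
  define r1tc where "r1tc = t * r1c"
  have F59: "- 1144/5 \<le> r1tc" "r1tc \<le> - 28592/125" unfolding r1tc_def by (rule ivl_mult[OF F1 F57]; simp)+
  have r1: "r1 = - (r1a + r1mb + r1tc)"
    unfolding r1_def mass_def force3_fst r1mb_def r1tc_def p1 m_def t_def r1c_def c16_def r1b_def r1b_3_def c15_def r1b_2_def c14_def r1b_1_def c13_def c12_def r1a_def c11_def y3_def y2_def r_def s_def u_def by (simp add: field_simps)
  have F60: "13246583/12500 \<le> r1" "r1 \<le> 1060628709/1000000" using r1 F47 F58 F59 by linarith+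
  define c17 where "c17 = (514/2401) * s + (- 645/16)"
  have F61: "- 7949221/200000 \<le> c17" "c17 \<le> - 4968263/125000" using c17_def F3 by linarith+
  define c18 where "c18 = (366/343) * s + (- 5553/16)"
  have F62: "- 344239337/1000000 \<le> c18" "c18 \<le> - 43029917/125000" using c18_def F3 by linarith+
  define r3a_1 where "r3a_1 = c18 * y"
  have F63: "- 10825501/50000 \<le> r3a_1" "r3a_1 \<le> - 216313113/1000000" unfolding r3a_1_def by (rule ivl_mult[OF F62 F15]; simp)+
  define c19 where "c19 = (822/2401) * s + (- 1935/16)"
  have F64: "- 30007927/250000 \<le> c19" "c19 \<le> - 120031707/1000000" using c19_def F3 by linarith+
  define r3a_2 where "r3a_2 = c19 * y2"
  have F65: "- 5935283/125000 \<le> r3a_2" "r3a_2 \<le> - 47395839/1000000" unfolding r3a_2_def by (rule ivl_mult[OF F64 F16]; simp)+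
  define c20 where "c20 = (- 442/2401) * s + (1221/16)"
  have F66: "75825443/1000000 \<le> c20" "c20 \<le> 18956361/250000" using c20_def F3 by linarith+
  define r3a_3 where "r3a_3 = c20 * y3"
  have F67: "470349/25000 \<le> r3a_3" "r3a_3 \<le> 18865523/1000000" unfolding r3a_3_def by (rule ivl_mult[OF F66 F17]; simp)+
  define r3a where "r3a = (1) * c17 + (1) * r3a_1 + (1) * r3a_2 + (1) * r3a_3"
  have F68: "- 284924429/1000000 \<le> r3a" "r3a \<le> - 284589533/1000000" using r3a_def F61 F63 F65 F67 by linarith+
  define c21 where "c21 = (- 128/3) * r + (- 16/9)"
  have F69: "- 75678617/1000000 \<le> c21" "c21 \<le> - 75678611/1000000" using c21_def F2 by linarith+
  define r3b_3 where "r3b_3 = c21 * y3"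
  have F70: "- 294203/15625 \<le> r3b_3" "r3b_3 \<le> - 2347191/125000" unfolding r3b_3_def by (rule ivl_mult[OF F69 F17]; simp)+
  define r3b where "r3b = (1) * r3b_3"
  have F71: "- 294203/15625 \<le> r3b" "r3b \<le> - 2347191/125000" using r3b_def F70 by linarith+
  define c22 where "c22 = (- 16/9) * r"
  have F72: "- 1539601/500000 \<le> c22" "c22 \<le> - 3079201/1000000" using c22_def F2 by linarith+
  define r3c_3 where "r3c_3 = c22 * y3"
  have F73: "- 23941/31250 \<le> r3c_3" "r3c_3 \<le> - 764017/1000000" unfolding r3c_3_def by (rule ivl_mult[OF F72 F17]; simp)+
  define r3c where "r3c = (1) * r3c_3"
  have F74: "- 23941/31250 \<le> r3c" "r3c \<le> - 764017/1000000" using r3c_def F73 by linarith+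
  define r3mb where "r3mb = m * r3b"
  have F75: "- 21041559/500000 \<le> r3mb" "r3mb \<le> - 41958949/1000000" unfolding r3mb_def by (rule ivl_mult[OF F7 F71]; simp)+
  define r3tc where "r3tc = t * r3c"
  have F76: "- 684713/500000 \<le> r3tc" "r3tc \<le> - 682649/500000" unfolding r3tc_def by (rule ivl_mult[OF F1 F74]; simp)+
  have r3: "r3 = - (r3a + r3mb + r3tc)"
    unfolding r3_def mass_def force3_tan7 r3mb_def r3tc_def p1 m_def t_def r3c_def r3c_3_def c22_def r3b_def r3b_3_def c21_def r3a_def r3a_3_def c20_def r3a_2_def c19_def r3a_1_def c18_def c17_def y3_def y2_def r_def s_def u_def by (simp add: field_simps)
  have F77: "16395689/50000 \<le> r3" "r3 \<le> 328376973/1000000" using r3 F68 F75 F76 by linarith+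
  have a11: "a11 = l + 20 + 16/3 * r - 3087/686 * m + 376/686 * sm + 16 * t" by (simp add: a11_def pos_rad11_def p1 l_def m_def t_def r_def s_def sm_def field_simps)
  have F78: "71343259/1000000 \<le> a11" "a11 \<le> 8920267/125000" using a11 F9 F2 F7 F8 F1 by linarith+
  have a22: "a22 = l + 15435/686 + 424/686 * s + 16/9 * m + 20/9 * rm + 16/9 * rt" by (simp add: a22_def pos_rad22_def p1 l_def m_def t_def r_def s_def rm_def rt_def field_simps)
  have F79: "62541843/1000000 \<le> a22" "a22 \<le> 31277053/500000" using a22 F9 F3 F7 F12 F13 by linarith+
  have a21: "a21 = - 1715/686 * r + 248/686 * u" by (simp add: a21_def off_diagonal p1 r_def u_def field_simps)
  have F80: "- 2673453/1000000 \<le> a21" "a21 \<le> - 668363/250000" using a21 F2 F4 by linarith+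
  define ma21 where "ma21 = m * a21"
  have F81: "- 5975213/1000000 \<le> ma21" "ma21 \<le> - 1493477/250000" unfolding ma21_def by (rule ivl_mult[OF F7 F80]; simp)+
  have a12: "a12 = ma21" unfolding ma21_def a12_def a21_def off_diagonal by (simp add: p1 m_def)
  define d1 where "d1 = a11 * a22"
  have F82: "4461938903/1000000 \<le> d1" "d1 \<le> 223199731/50000" unfolding d1_def by (rule ivl_mult[OF F78 F79]; simp)+
  define d2 where "d2 = ma21 * a21"
  have F83: "3992739/250000 \<le> d2" "d2 \<le> 3993613/250000" unfolding d2_def by (rule ivl_mult[OF F81 F80]; simp)+
  define d where "d = (1) * d1 + (- 1) * d2"
  have F84: "4445964451/1000000 \<le> d" "d \<le> 278001479/62500" using d_def F82 F83 by linarith+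
  define x1 where "x1 = q1 * a22"
  have F85: "- 757855161/62500 \<le> x1" "x1 \<le> - 12111179489/1000000" unfolding x1_def by (rule ivl_mult[OF F30 F79]; simp)+
  define x2 where "x2 = q2 * ma21"
  have F86: "- 476720097/1000000 \<le> x2" "x2 \<le> - 476034449/1000000" unfolding x2_def by (rule ivl_mult[OF F45 F81]; simp)+
  define na where "na = (- 1) * x1 + (1) * x2"
  have F87: "181788428/15625 \<le> na" "na \<le> 11649648127/1000000" using na_def F85 F86 by linarith+
  define z1 where "z1 = q2 * a11"
  have F88: "568503047/100000 \<le> z1" "z1 \<le> 5693481443/1000000" unfolding z1_def by (rule ivl_mult[OF F45 F78]; simp)+
  define z2 where "z2 = q1 * a21"
  have F89: "51771191/100000 \<le> z2" "z2 \<le> 10364609/20000" unfolding z2_def by (rule ivl_mult[OF F30 F80]; simp)+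
  define nb where "nb = (1) * z1 + (- 1) * z2"
  have F90: "258340001/50000 \<le> nb" "nb \<le> 5175769533/1000000" using nb_def F88 F89 by linarith+
  have e: "a11 * a + a12 * b = - q1" "a21 * a + a22 * b = - q2" using assms(5,6) by (simp_all add: a11_def a12_def a21_def a22_def q1_def q2_def)
  \<comment> \<open>Cramer's rule, with d the determinant of the block; \<open>a12 = m a21\<close>
    is used because the two off-diagonal entries differ only in the mass.\<close>
  have da: "d * a = na"
  proof -
    have "d * a = a22 * (a11 * a + a12 * b) - a12 * (a21 * a + a22 * b)" by (simp add: d_def d1_def d2_def a12 algebra_simps)
    also have "\<dots> = na" unfolding e by (simp add: na_def x1_def x2_def a12 algebra_simps)
    finally show ?thesis .
  qed
  \<comment> \<open>The correction b is negative, and \<open>ivl_div\<close> is for nonnegative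
    bounds.\<close>
  define b' where "b' = - b"
  have db: "d * b' = nb"
  proof -
    have "d * b' = a21 * (a11 * a + a12 * b) - a11 * (a21 * a + a22 * b)" by (simp add: b'_def d_def d1_def d2_def a12 algebra_simps)
    also have "\<dots> = nb" unfolding e by (simp add: nb_def z1_def z2_def algebra_simps)
    finally show ?thesis .
  qed
  have F91: "1307823/500000 \<le> a" "a \<le> 104811/40000" by (rule ivl_div[OF da F84 F87]; simp)+
  have F92: "580797/500000 \<le> b'" "b' \<le> 1164151/1000000" by (rule ivl_div[OF db F84 F90]; simp)+
  define yr where "yr = y * r3"
  have F93: "206054461/1000000 \<le> yr" "yr \<le> 103266677/500000" unfolding yr_def by (rule ivl_mult[OF F15 F77]; simp)+
  define myr where "myr = m * yr"
  have F94: "230217437/500000 \<le> myr" "myr \<le> 230802779/500000" unfolding myr_def by (rule ivl_mult[OF F7 F93]; simp)+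
  define aq where "aq = a * q1"
  have F95: "- 507922261/1000000 \<le> aq" "aq \<le> - 506517823/1000000" unfolding aq_def by (rule ivl_mult[OF F91 F30]; simp)+
  define bq where "bq = b' * q2"
  have F96: "23140579/250000 \<le> bq" "bq \<le> 92879397/1000000" unfolding bq_def by (rule ivl_mult[OF F92 F45]; simp)+
  define mbq where "mbq = m * bq"
  have F97: "206833271/1000000 \<le> mbq" "mbq \<le> 25948379/125000" unfolding mbq_def by (rule ivl_mult[OF F7 F96]; simp)+
  \<comment> \<open>The lower bounds add up to about 89.\<close>
  have "r1 + myr + 2 * aq - 2 * mbq > 0" using F60 F94 F95 F97 by linarith
  then show ?thesis by (simp add: r1_def r3_def myr_def yr_def aq_def bq_def mbq_def q1_def q2_def b'_def m_def algebra_simps)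
qed

section \<open>The branch of symmetric configurations is not vertical\<close>

lemma pair_sum_gact:
  assumes f: "orthogonal_transformation f" and \<pi>: "bij \<pi>" "\<And>j. \<mu> $ \<pi> j = \<mu> $ j"
    and A: "\<And>z v. A (f z) (f v) = f (A z v)"
  shows "(\<chi> i. - (\<Sum>j\<in>UNIV. \<mu> $ j *\<^sub>R A (gact f \<pi> q $ i - gact f \<pi> q $ j) (gact f \<pi> v $ i - gact f \<pi> v $ j))) =
    gact f \<pi> (\<chi> i. - (\<Sum>j\<in>UNIV. \<mu> $ j *\<^sub>R A (q $ i - q $ j) (v $ i - v $ j)))"
proof -
  have l: "linear f" using f by (rule orthogonal_transformation_linear)
  have "(\<Sum>j\<in>UNIV. \<mu> $ j *\<^sub>R A (f (q $ \<pi> i) - f (q $ \<pi> j)) (f (v $ \<pi> i) - f (v $ \<pi> j))) =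
      f (\<Sum>j\<in>UNIV. \<mu> $ j *\<^sub>R A (q $ \<pi> i - q $ j) (v $ \<pi> i - v $ j))" for i
  proof -
    have "(\<Sum>j\<in>UNIV. \<mu> $ j *\<^sub>R A (f (q $ \<pi> i) - f (q $ \<pi> j)) (f (v $ \<pi> i) - f (v $ \<pi> j))) =
        (\<Sum>j\<in>UNIV. \<mu> $ \<pi> j *\<^sub>R f (A (q $ \<pi> i - q $ \<pi> j) (v $ \<pi> i - v $ \<pi> j)))"
      by (simp add: \<pi>(2) linear_diff[OF l, symmetric] A)
    also have "\<dots> = (\<Sum>j\<in>UNIV. \<mu> $ j *\<^sub>R f (A (q $ \<pi> i - q $ j) (v $ \<pi> i - v $ j)))"
      using sum_reindex_bij[OF \<pi>(1), of "\<lambda>j. \<mu> $ j *\<^sub>R f (A (q $ \<pi> i - q $ j) (v $ \<pi> i - v $ j))"] .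
    finally show ?thesis by (simp add: linear_sum[OF l] linear_scale[OF l])
  qed
  then show ?thesis by (simp add: config_eq_iff linear_neg[OF l])
qed

lemma acc23_orthogonal:
  assumes "orthogonal_transformation f"
  shows "acc2 (f z) (f v) = f (acc2 z v)" "acc3 (f z) (f v) = f (acc3 z v)"
proof -
  have l: "linear f" and i: "\<And>x y. inner (f x) (f y) = inner x y"
    using assms by (auto simp: orthogonal_transformation_def)
  show "acc2 (f z) (f v) = f (acc2 z v)" "acc3 (f z) (f v) = f (acc3 z v)"
    by (simp_all add: acc2_def acc3_def acc_slope_def acc_ratio_def orthogonal_norm[OF assms] linear_diff[OF l]
        linear_add[OF l] linear_scale[OF l] i)
qed

lemma force23_Rot:
  "force2 (mass p) (Rot q) (Rot v) = Rot (force2 (mass p) q v)"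
  "force3 (mass p) (Rot q) (Rot v) = Rot (force3 (mass p) q v)"
  unfolding force2_def force3_def Rot_def mass_def
  by (rule pair_sum_gact acc23_orthogonal orthogonal_Phi bij_rot_perm ring_mass_rot)+

lemma force2_Ref: "force2 (mass p) (Ref q) (Ref v) = Ref (force2 (mass p) q v)"
  unfolding force2_def Ref_def mass_def
  by (rule pair_sum_gact acc23_orthogonal orthogonal_mirror bij_ref_perm ring_mass_ref)+

lemma force23_minus: "force2 \<mu> q (- v) = force2 \<mu> q v" "force3 \<mu> q (- v) = - force3 \<mu> q v"
proof -
  have n: "acc2 z (- x) = acc2 z x" "acc3 z (- x) = - acc3 z x" for z x
    by (simp_all add: acc2_def acc3_def acc_slope_def acc_ratio_def vec2_eq_iff algebra_simps)
  have "(- v) $ i - (- v) $ j = - (v $ i - v $ j)" for i j by simp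
  then show "force2 \<mu> q (- v) = force2 \<mu> q v" "force3 \<mu> q (- v) = - force3 \<mu> q v"
    by (simp_all only: force2_def force3_def n) (simp add: config_eq_iff sum_negf)
qed

text \<open>\<open>Rot\<close> maps the kernel vector to its negative and \<open>force2\<close> is
  even, so its value is fixed by \<open>Rot\<close>; it is fixed by \<open>Ref\<close> as the kernel
  vector is. Such vectors are \<open>upos\<close> with radial entries only.\<close>

lemma force2_kernel:
  obtains a b where "force2 (mass p) (rosette p) (uneg 1 0 0 y) = upos a 0 b 0"
    "a = force2 (mass p) (rosette p) (uneg 1 0 0 y) $ 1 $ 1"
    "b = rad7 (force2 (mass p) (rosette p) (uneg 1 0 0 y) $ 7)"
proof -
  define F where "F = force2 (mass p) (rosette p) (uneg 1 0 0 y)"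
  have "Rot F = F"
    using force23_Rot(1)[of p "rosette p" "uneg 1 0 0 y"] by (simp add: F_def Rot_rosette Rot_uneg force23_minus)
  then have F: "F = upos (F $ 1 $ 1) (F $ 1 $ 2) (rad7 (F $ 7)) (tan7 (F $ 7))" by (rule Rot_fixed_eq_upos)
  have "Ref F = F"
    using force2_Ref[of p "rosette p" "uneg 1 0 0 y"] by (simp add: F_def Ref_rosette Ref_uneg)
  then have "Ref (upos (F $ 1 $ 1) (F $ 1 $ 2) (rad7 (F $ 7)) (tan7 (F $ 7))) =
      upos (F $ 1 $ 1) (F $ 1 $ 2) (rad7 (F $ 7)) (tan7 (F $ 7))" using F by simp
  then have "upos (F $ 1 $ 1) (F $ 1 $ 2) (rad7 (F $ 7)) (tan7 (F $ 7)) +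
      (- 1) *\<^sub>R upos (F $ 1 $ 1) (- (F $ 1 $ 2)) (rad7 (F $ 7)) (- tan7 (F $ 7)) + uneg 0 0 0 0 = 0"
    using uneg_scale[of 0 0 0 0 0] by (simp add: Ref_upos)
  then have "F $ 1 $ 2 = 0" "tan7 (F $ 7) = 0"
    unfolding upos_scale upos_add by (auto dest!: upos_uneg_zero)
  then show thesis using F that unfolding F_def by simp
qed

text \<open>\<open>force3\<close> is odd, so its value along the kernel vector lies in the same
  eigenspace of \<open>Rot\<close> and is a \<open>uneg\<close>; the pairing then reads off two of
  its entries.\<close>

lemma inner_weight_force3:
  "inner (weight p (force3 (mass p) (rosette p) (uneg 1 0 0 y))) (uneg 1 0 0 y) =
    6 * (snd p * force3 (mass p) (rosette p) (uneg 1 0 0 y) $ 1 $ 1 +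
      m2 p * (y * tan7 (force3 (mass p) (rosette p) (uneg 1 0 0 y) $ 7)))"
proof -
  define F where "F = force3 (mass p) (rosette p) (uneg 1 0 0 y)"
  have "Rot F = - F"
    using force23_Rot(2)[of p "rosette p" "uneg 1 0 0 y"] by (simp add: F_def Rot_rosette Rot_uneg force23_minus)
  then have F: "F = uneg (F $ 1 $ 1) (F $ 1 $ 2) (rad7 (F $ 7)) (tan7 (F $ 7))" by (rule Rot_neg_eq_uneg)
  have "inner (weight p F) (uneg 1 0 0 y) = 6 * (snd p * F $ 1 $ 1 + m2 p * (y * tan7 (F $ 7)))"
    by (subst F) (simp add: weight_uneg inner_uneg)
  then show ?thesis by (simp add: F_def)
qed

text \<open>Difference quotients along a curve whose direction converges to e. The remainder E is
  continuous at 0 with value 0, which also covers k x = 0.\<close>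

lemma directional_limit:
  assumes f: "(f has_derivative G) (at w)" and k: "(k \<longlongrightarrow> e) (at_right 0)"
  shows "((\<lambda>x. (1 / x) *\<^sub>R (f (w + x *\<^sub>R k x) - f w)) \<longlongrightarrow> G e) (at_right (0::real))"
proof -
  have bl: "bounded_linear G" using f has_derivative_bounded_linear by blast
  define E where "E v = (1 / norm v) *\<^sub>R (f (w + v) - f w - G v)" for v
  have "((\<lambda>v. norm (f (w + v) - f w - G v) / norm v) \<longlongrightarrow> 0) (at 0)" using f by (simp add: has_derivative_at)
  then have "((\<lambda>v. norm (E v)) \<longlongrightarrow> 0) (at 0)" by (simp add: E_def)
  then have "(E \<longlongrightarrow> 0) (at 0)" by (rule tendsto_norm_zero_cancel)
  then have cE: "isCont E 0" by (simp add: isCont_def E_def)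
  have x: "((\<lambda>x::real. x) \<longlongrightarrow> 0) (at_right 0)" by (rule tendsto_ident_at)
  have "((\<lambda>x. x *\<^sub>R k x) \<longlongrightarrow> 0 *\<^sub>R e) (at_right 0)" by (intro tendsto_scaleR x k)
  then have "((\<lambda>x. E (x *\<^sub>R k x)) \<longlongrightarrow> E 0) (at_right 0)"
    using isCont_tendsto_compose[OF cE] by simp
  then have "((\<lambda>x. norm (k x) *\<^sub>R E (x *\<^sub>R k x) + G (k x)) \<longlongrightarrow> norm e *\<^sub>R E 0 + G e) (at_right 0)"
    by (intro tendsto_add tendsto_scaleR tendsto_norm k bounded_linear.tendsto[OF bl])
  moreover have "\<forall>\<^sub>F x in at_right 0. norm (k x) *\<^sub>R E (x *\<^sub>R k x) + G (k x) = (1 / x) *\<^sub>R (f (w + x *\<^sub>R k x) - f w)"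
    unfolding eventually_at_right_field
  proof (intro exI[of _ 1] conjI allI impI)
    fix x :: real assume "0 < x" "x < 1"
    have G: "G (x *\<^sub>R k x) = x *\<^sub>R G (k x)" using bl by (simp add: linear_scale bounded_linear.linear)
    have G0: "G 0 = 0" using bl by (simp add: linear_0 bounded_linear.linear)
    show "norm (k x) *\<^sub>R E (x *\<^sub>R k x) + G (k x) = (1 / x) *\<^sub>R (f (w + x *\<^sub>R k x) - f w)"
      using \<open>0 < x\<close> by (cases "k x = 0") (simp_all add: E_def G G0 scaleR_diff_right)
  qed simp
  ultimately show ?thesis using Lim_transform_eventually by (fastforce simp: E_def)
qed

text \<open>The mean value theorem for the weighted component along e, followed by
  \<open>force_deriv_sym\<close>, which moves the derivative from v to e. Near w the derivative
  applied to the kernel vector is small, and this gains one power of x.\<close>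

lemma weighted_mvt:
  assumes "\<And>\<theta>. \<theta> \<in> {0..1} \<Longrightarrow> q + \<theta> *\<^sub>R v \<in> Omega"
  obtains \<theta> where "\<theta> \<in> {0..1}" "inner (weight p (pforce p (q + v))) e = inner (weight p (pforce p q)) e +
    inner (weight p (force_deriv (mass p) (lamf p) (q + \<theta> *\<^sub>R v) e)) v"
proof -
  define g where "g \<theta> = inner (weight p (pforce p (q + \<theta> *\<^sub>R v))) e" for \<theta>
  define g' where "g' \<theta> = inner (weight p (force_deriv (mass p) (lamf p) (q + \<theta> *\<^sub>R v) v)) e" for \<theta>
  have "(g has_derivative (\<lambda>h. inner (weight p (force_deriv (mass p) (lamf p) (q + \<theta> *\<^sub>R v) (h *\<^sub>R v))) e)) (at \<theta>)"
    if "\<theta> \<in> {0..1}" for \<theta>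
  proof -
    have 1: "((\<lambda>\<theta>. q + \<theta> *\<^sub>R v) has_derivative (\<lambda>h. h *\<^sub>R v)) (at \<theta>)"
      by (auto intro!: derivative_eq_intros)
    have 2: "(pforce p has_derivative force_deriv (mass p) (lamf p) (q + \<theta> *\<^sub>R v)) (at (q + \<theta> *\<^sub>R v))"
      unfolding pforce_def by (rule has_derivative_force[OF assms[OF that]])
    have 3: "bounded_linear (\<lambda>u. inner (weight p u) e)"
      using linear_weight[of p] by (intro bounded_linear_compose[OF bounded_linear_inner_left]) (simp add: linear_conv_bounded_linear)
    show ?thesis unfolding g_def
      using has_derivative_compose[OF has_derivative_compose[OF 1 2] bounded_linear_imp_has_derivative[OF 3]] by simp
  qed
  moreover have "inner (weight p (force_deriv (mass p) (lamf p) (q + \<theta> *\<^sub>R v) (h *\<^sub>R v))) e = h * g' \<theta>" if "\<theta> \<in> {0..1}" for \<theta> h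
  proof -
    have "linear (force_deriv (mass p) (lamf p) (q + \<theta> *\<^sub>R v))"
      using has_derivative_force[OF assms[OF that]] has_derivative_linear by blast
    then show ?thesis unfolding g'_def using linear_weight[of p] by (simp add: linear_scale)
  qed
  ultimately have g: "(g has_derivative (\<lambda>h. h * g' \<theta>)) (at \<theta>)" if "\<theta> \<in> {0..1}" for \<theta>
    using that by (metis (no_types, lifting) ext)
  have "\<exists>\<theta>\<in>{0<..<1}. g 1 - g 0 = (1 - 0) * g' \<theta>"
    by (rule mvt_simple) (use g in \<open>auto intro: has_derivative_at_withinI\<close>)
  then obtain \<theta> where \<theta>: "\<theta> \<in> {0<..<1}" "g 1 = g 0 + g' \<theta>" by auto
  have "inner (weight p u) v = (\<Sum>i\<in>UNIV. mass p $ i * inner (u $ i) (v $ i))" for u v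
    by (simp add: weight_def inner_vec_def[where 'b = 13])
  then have "g' \<theta> = inner (weight p (force_deriv (mass p) (lamf p) (q + \<theta> *\<^sub>R v) e)) v"
    unfolding g'_def by (simp only: force_deriv_sym[of "mass p" "lamf p" "q + \<theta> *\<^sub>R v" v e])
  then show thesis using that[of \<theta>] \<theta> by (simp add: g_def)
qed

text \<open>Lyapunov-Schmidt reduction to third order. If the parameter stayed at p, order x^2 would
  force h x / x to converge to the solution \<eta> of \<open>phess p \<eta> = - F2\<close>. At order
  x^3 the weighted component along e would give F3 . e + 2 F2 . \<eta> = 0, against
  \<open>quartic_positive\<close>.\<close>

lemma branch_not_vertical_normalized:
  assumes p: "p \<in> quadrant" "snd p = 1" and b1: "b1_det p = 0"
    and y: "entry neg_rad11 p + entry neg_rad12 p * y = 0"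
    and e: "e = uneg 1 0 0 y" "phess p e = 0"
    and inj: "\<And>\<eta>. \<eta> \<in> tri_ref \<Longrightarrow> inner e \<eta> = 0 \<Longrightarrow> phess p \<eta> = 0 \<Longrightarrow> \<eta> = 0"
    and h: "(h \<longlongrightarrow> 0) (at_right 0)" and hV: "\<forall>\<^sub>F x in at_right 0. h x \<in> tri_ref \<and> inner e (h x) = 0"
    and sol: "\<forall>\<^sub>F x in at_right 0. pforce p (rosette p + x *\<^sub>R (e + h x)) = 0"
  shows False
proof -
  define w where "w = rosette p"
  define F2 where "F2 = force2 (mass p) w e"
  define F3 where "F3 = force3 (mass p) w e"
  define R where "R = at_right (0::real)"
  have R: "R \<noteq> bot" by (simp add: R_def)
  have x0: "((\<lambda>x::real. x) \<longlongrightarrow> 0) R" unfolding R_def by (rule tendsto_ident_at)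
  have pos: "\<forall>\<^sub>F x::real in R. x > 0" unfolding R_def by (rule eventually_at_right_less)
  have wO: "w \<in> Omega" by (simp add: w_def rosette_in_Omega)
  have Pw: "phess p = force_deriv (mass p) (lamf p) w" unfolding phess_eq w_def rosette_const[of p "(1, 1)"] ..
  have lP: "linear (phess p)" by (rule linear_phess)
  \<comment> \<open>The remainder of the cubic expansion along the straight line w + x e; the terms
    of order 0 and 1 vanish because w is central and e is in the kernel.\<close>
  define J where "J x = (1 / x ^ 3) *\<^sub>R (pforce p (w + x *\<^sub>R e) - (x\<^sup>2 *\<^sub>R F2 + x ^ 3 *\<^sub>R F3))" for x :: real
  have J: "(J \<longlongrightarrow> 0) R"
  proof -
    have "(J \<longlongrightarrow> 0) (at 0)"
      unfolding J_def F2_def F3_def pforce_def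
      using force_jet[OF wO, of "mass p" "lamf p" e] central_configuration[of p p, unfolded pforce_def] e(2)
      by (simp add: w_def[symmetric] Pw)
    then show ?thesis unfolding R_def by (rule tendsto_within_subset) simp
  qed
  have line: "pforce p (w + x *\<^sub>R e) = x\<^sup>2 *\<^sub>R F2 + x ^ 3 *\<^sub>R (F3 + J x)" if "x > 0" for x
    using that by (simp add: J_def scaleR_add_right)
  define L where "L x = F2 + x *\<^sub>R (F3 + J x)" for x
  have L: "(L \<longlongrightarrow> F2) R"
  proof -
    have "(L \<longlongrightarrow> F2 + 0 *\<^sub>R (F3 + 0)) R" unfolding L_def by (intro tendsto_intros x0 J)
    then show ?thesis by simp
  qed
  obtain a2 b2 where F2: "F2 = upos a2 0 b2 0" "a2 = F2 $ 1 $ 1" "b2 = rad7 (F2 $ 7)"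
    using force2_kernel unfolding F2_def e(1) w_def by blast
  define A11 A12 A21 A22 where A: "A11 = entry pos_rad11 p" "A12 = entry pos_rad12 p"
    "A21 = entry pos_rad21 p" "A22 = entry pos_rad22 p"
  define dt where "dt = A11 * A22 - A12 * A21"
  have dt: "dt \<noteq> 0" using a1_det_pos[OF p(1)] by (simp add: dt_def A a1_det_def)
  \<comment> \<open>Cramer's rule for \<open>phess p \<eta> = - F2\<close> within the radial block,
    whose determinant \<open>a1_det\<close> is positive.\<close>
  define a where "a = (A12 * b2 - A22 * a2) / dt"
  define b where "b = (A21 * a2 - A11 * b2) / dt"
  have ab: "A11 * a + A12 * b = - a2" "A21 * a + A22 * b = - b2"
  proof -
    have "dt * (A11 * a + A12 * b) = A11 * (dt * a) + A12 * (dt * b)" by (simp add: algebra_simps)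
    also have "\<dots> = dt * (- a2)" using dt by (simp add: a_def b_def) (simp add: dt_def algebra_simps)
    finally show "A11 * a + A12 * b = - a2" using dt by (simp only: mult_cancel_left) simp
    have "dt * (A21 * a + A22 * b) = A21 * (dt * a) + A22 * (dt * b)" by (simp add: algebra_simps)
    also have "\<dots> = dt * (- b2)" using dt by (simp add: a_def b_def) (simp add: dt_def algebra_simps)
    finally show "A21 * a + A22 * b = - b2" using dt by (simp only: mult_cancel_left) simp
  qed
  define \<eta> where "\<eta> = upos a 0 b 0"
  have P\<eta>: "phess p \<eta> = - F2"
    using upos_scale[of "- 1" a2 0 b2 0] ab by (simp add: \<eta>_def phess_upos F2(1) A)
  define S where "S = tri_ref \<inter> {v. inner e v = 0}"
  have S: "subspace S" unfolding S_def
    by (intro subspace_inter tri_ref_invariant(1)) (simp add: subspace_def inner_add_right)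
  have \<eta>S: "\<eta> \<in> S"
    by (simp add: S_def \<eta>_def e(1) tri_ref_def triple_sym_def Rot_upos Ref_upos inner_uneg_upos)
  obtain \<kappa> where \<kappa>: "\<kappa> > 0" "\<And>v. v \<in> S \<Longrightarrow> \<kappa> * norm v \<le> norm (phess p v)"
    using injective_imp_isometric[OF closed_subspace[OF S] S, of "phess p"] inj lP
    by (auto simp: S_def linear_conv_bounded_linear mult.commute)
  define k where "k x = (1 / x) *\<^sub>R h x" for x
  have hk: "h x = x *\<^sub>R k x" if "x > 0" for x using that by (simp add: k_def)
  have kS: "\<forall>\<^sub>F x in R. k x \<in> S"
    using hV[folded R_def]
  proof (rule eventually_mono)
    fix x assume "h x \<in> tri_ref \<and> inner e (h x) = 0"
    then have "h x \<in> S" by (simp add: S_def)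
    then show "k x \<in> S" unfolding k_def by (rule subspace_scale[OF S])
  qed
  have near: "((\<lambda>x. w + x *\<^sub>R (e + h x)) \<longlongrightarrow> w) R" "((\<lambda>x. w + x *\<^sub>R e) \<longlongrightarrow> w) R"
  proof -
    have "((\<lambda>x. w + x *\<^sub>R (e + h x)) \<longlongrightarrow> w + 0 *\<^sub>R (e + 0)) R" "((\<lambda>x. w + x *\<^sub>R e) \<longlongrightarrow> w + 0 *\<^sub>R e) R"
      using h unfolding R_def by (intro tendsto_intros tendsto_ident_at; simp)+
    then show "((\<lambda>x. w + x *\<^sub>R (e + h x)) \<longlongrightarrow> w) R" "((\<lambda>x. w + x *\<^sub>R e) \<longlongrightarrow> w) R" by simp_all
  qed
  \<comment> \<open>Strict differentiability between the branch and the straight line: the two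
    points differ by x^2 k x and the force on the line is x^2 L x, so x^2 divides out.\<close>
  have approx: "\<forall>\<^sub>F x in R. norm (phess p (k x) + L x) \<le> \<epsilon> * norm (k x)" if \<epsilon>: "\<epsilon> > 0" for \<epsilon>
  proof -
    obtain \<delta> where \<delta>: "\<delta> > 0" "\<And>x y. x \<in> ball w \<delta> \<Longrightarrow> y \<in> ball w \<delta> \<Longrightarrow>
        norm (pforce p x - pforce p y - phess p (x - y)) \<le> \<epsilon> * norm (x - y)"
      by (rule strict_derivD[OF strict_deriv_pforce[of p p] \<epsilon>]) (auto simp: w_def)
    have ev: "\<forall>\<^sub>F x in R. w + x *\<^sub>R (e + h x) \<in> ball w \<delta>" "\<forall>\<^sub>F x in R. w + x *\<^sub>R e \<in> ball w \<delta>"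
      using near[THEN tendstoD[OF _ \<delta>(1)]] by (simp_all add: dist_commute)
    show ?thesis using ev pos sol[folded R_def w_def]
    proof eventually_elim
      case (elim x)
      have d: "(w + x *\<^sub>R (e + h x)) - (w + x *\<^sub>R e) = x\<^sup>2 *\<^sub>R k x"
        using hk[OF elim(3)] by (simp add: scaleR_add_right power2_eq_square)
      have l: "pforce p (w + x *\<^sub>R e) = x\<^sup>2 *\<^sub>R L x"
        unfolding line[OF elim(3)] L_def by (simp add: scaleR_add_right power2_eq_square power3_eq_cube algebra_simps)
      have "norm (0 - x\<^sup>2 *\<^sub>R L x - phess p (x\<^sup>2 *\<^sub>R k x)) \<le> \<epsilon> * norm (x\<^sup>2 *\<^sub>R k x)"
        using \<delta>(2)[OF elim(1,2)] unfolding d l elim(4) .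
      moreover have "0 - x\<^sup>2 *\<^sub>R L x - phess p (x\<^sup>2 *\<^sub>R k x) = - (x\<^sup>2 *\<^sub>R (phess p (k x) + L x))"
        by (simp add: linear_scale[OF lP] scaleR_add_right)
      ultimately have "norm (- (x\<^sup>2 *\<^sub>R (phess p (k x) + L x))) \<le> \<epsilon> * norm (x\<^sup>2 *\<^sub>R k x)"
        by (simp only:)
      then have "x\<^sup>2 * norm (phess p (k x) + L x) \<le> x\<^sup>2 * (\<epsilon> * norm (k x))"
        unfolding norm_minus_cancel norm_scaleR by (simp add: mult.left_commute mult.commute)
      then show ?case using elim(3) by simp
    qed
  qed
  \<comment> \<open>Taking \<epsilon> = \<kappa>/2 lets the lower bound \<kappa> of
    \<open>phess p\<close> on S absorb the error term; only then does the error in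
    \<open>approx\<close> tend to 0.\<close>
  have bounded: "\<forall>\<^sub>F x in R. norm (k x) \<le> 2 / \<kappa> * (norm F2 + 1)"
  proof -
    have "\<forall>\<^sub>F x in R. norm (L x) < norm F2 + 1"
      by (rule order_tendstoD(2)[OF tendsto_norm[OF L]]) simp
    then show ?thesis using approx[OF half_gt_zero[OF \<kappa>(1)]] kS
    proof eventually_elim
      case (elim x)
      have "\<kappa> * norm (k x) \<le> norm (phess p (k x))" by (rule \<kappa>(2)[OF elim(3)])
      also have "\<dots> \<le> norm (phess p (k x) + L x) + norm (L x)"
        using norm_triangle_ineq4[of "phess p (k x) + L x" "L x"] by simp
      finally have "\<kappa> * norm (k x) \<le> 2 * (norm F2 + 1)" using elim(1,2) by simp
      then show ?case using \<kappa>(1) by (simp add: field_simps)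
    qed
  qed
  have Pk: "((\<lambda>x. phess p (k x) + L x) \<longlongrightarrow> 0) R"
    unfolding tendsto_iff
  proof (intro allI impI)
    fix \<epsilon> :: real assume \<epsilon>: "\<epsilon> > 0"
    define M where "M = 2 / \<kappa> * (norm F2 + 1)"
    have M: "M > 0" using \<kappa>(1) by (simp add: M_def add_nonneg_pos)
    have eM: "\<epsilon> / (2 * M) > 0" using \<epsilon> M by simp
    from approx[OF eM] bounded show "\<forall>\<^sub>F x in R. dist (phess p (k x) + L x) 0 < \<epsilon>"
    proof eventually_elim
      case (elim x)
      have "\<epsilon> / (2 * M) * norm (k x) \<le> \<epsilon> / (2 * M) * M"
        by (rule mult_left_mono[OF elim(2)[folded M_def] less_imp_le[OF eM]])
      also have "\<dots> < \<epsilon>" using M \<epsilon> by simp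
      finally show ?case using elim(1) by simp
    qed
  qed
  have k: "(k \<longlongrightarrow> \<eta>) R"
  proof -
    have lim: "((\<lambda>x. (1 / \<kappa>) * norm ((phess p (k x) + L x) - (L x - F2))) \<longlongrightarrow> (1 / \<kappa>) * norm ((0::config) - (F2 - F2))) R"
      by (intro tendsto_intros Pk L)
    have "\<forall>\<^sub>F x in R. norm (k x - \<eta>) \<le> (1 / \<kappa>) * norm ((phess p (k x) + L x) - (L x - F2))"
      using kS
    proof eventually_elim
      case (elim x)
      have "\<kappa> * norm (k x - \<eta>) \<le> norm (phess p (k x - \<eta>))"
        using elim \<eta>S S by (intro \<kappa>(2) subspace_diff)
      then show ?case using \<kappa>(1) by (simp add: linear_diff[OF lP] P\<eta> field_simps)
    qed
    then have "((\<lambda>x. k x - \<eta>) \<longlongrightarrow> 0) R"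
      by (rule Lim_null_comparison) (use lim in simp)
    then show ?thesis by (simp only: Lim_null[of k])
  qed
  obtain r where r: "r > 0" "ball w r \<subseteq> Omega" using openE[OF open_Omega wO] by blast
  obtain G where G: "((\<lambda>q. force_deriv (mass p) (lamf p) q e) has_derivative G) (at w)" "G e = 2 *\<^sub>R F2"
    using force_deriv_second[OF wO, of "mass p" "lamf p" e] unfolding F2_def by metis
  \<comment> \<open>The intermediate point of the mean value theorem depends on x; naming the
    property allows it to be selected as a function of x.\<close>
  define good where "good x \<theta> \<longleftrightarrow> \<theta> \<in> {0..1} \<and> inner (weight p (pforce p ((w + x *\<^sub>R e) + x *\<^sub>R h x))) e =
      inner (weight p (pforce p (w + x *\<^sub>R e))) e +
      inner (weight p (force_deriv (mass p) (lamf p) ((w + x *\<^sub>R e) + \<theta> *\<^sub>R (x *\<^sub>R h x)) e)) (x *\<^sub>R h x)" for x \<theta>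
  have good: "\<forall>\<^sub>F x in R. good x (SOME \<theta>. good x \<theta>)"
  proof -
    have "\<forall>\<^sub>F x in R. w + x *\<^sub>R (e + h x) \<in> ball w r" "\<forall>\<^sub>F x in R. w + x *\<^sub>R e \<in> ball w r"
      using near[THEN tendstoD[OF _ r(1)]] by (simp_all add: dist_commute)
    then show ?thesis
    proof eventually_elim
      case (elim x)
      have "(w + x *\<^sub>R e) + \<theta> *\<^sub>R (x *\<^sub>R h x) \<in> Omega" if "\<theta> \<in> {0..1}" for \<theta>
      proof -
        have "(1 - \<theta>) *\<^sub>R (w + x *\<^sub>R e) + \<theta> *\<^sub>R (w + x *\<^sub>R (e + h x)) \<in> ball w r"
          by (rule convexD[OF convex_ball elim(2,1)]) (use that in auto)
        moreover have "(1 - \<theta>) *\<^sub>R (w + x *\<^sub>R e) + \<theta> *\<^sub>R (w + x *\<^sub>R (e + h x)) = (w + x *\<^sub>R e) + \<theta> *\<^sub>R (x *\<^sub>R h x)"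
          by (simp add: algebra_simps)
        ultimately show ?thesis using r(2) by auto
      qed
      then have "\<exists>\<theta>. good x \<theta>" unfolding good_def using weighted_mvt[of "w + x *\<^sub>R e" "x *\<^sub>R h x" p e] by metis
      then show ?case by (rule someI_ex)
    qed
  qed
  define \<theta> where "\<theta> x = (SOME \<theta>. good x \<theta>)" for x
  have good': "\<forall>\<^sub>F x in R. good x (\<theta> x)" unfolding \<theta>_def by (rule good)
  have "((\<lambda>x. e + \<theta> x *\<^sub>R h x) \<longlongrightarrow> e + 0) R"
  proof (intro tendsto_add tendsto_const)
    have "\<forall>\<^sub>F x in R. norm (\<theta> x *\<^sub>R h x) \<le> norm (h x)"
      using good'
    proof eventually_elim
      case (elim x)
      then have "\<bar>\<theta> x\<bar> \<le> 1" by (auto simp: good_def)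
      then show ?case using mult_right_mono[of "\<bar>\<theta> x\<bar>" 1 "norm (h x)"] by simp
    qed
    moreover have "((\<lambda>x. norm (h x)) \<longlongrightarrow> 0) R" using h unfolding R_def by (rule tendsto_norm_zero)
    ultimately show "((\<lambda>x. \<theta> x *\<^sub>R h x) \<longlongrightarrow> 0) R"
      by (rule Lim_null_comparison)
  qed
  then have kk: "((\<lambda>x. e + \<theta> x *\<^sub>R h x) \<longlongrightarrow> e) (at_right 0)" by (simp add: R_def)
  \<comment> \<open>The derivative applied to e, divided by x. It is a difference quotient since
    \<open>phess p e = 0\<close>, and its limit is the second derivative 2 F2.\<close>
  define D where "D x = (1 / x) *\<^sub>R (force_deriv (mass p) (lamf p) (w + x *\<^sub>R (e + \<theta> x *\<^sub>R h x)) e - force_deriv (mass p) (lamf p) w e)" for x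
  have D: "(D \<longlongrightarrow> 2 *\<^sub>R F2) R"
    unfolding D_def R_def G(2)[symmetric] by (rule directional_limit[OF G(1) kk])
  have bl: "bounded_linear (weight p)" using linear_weight[of p] by (simp add: linear_conv_bounded_linear)
  have F2e: "inner (weight p F2) e = 0"
    by (simp add: F2(1) e(1) weight_upos inner_upos_uneg)
  \<comment> \<open>The identity at order x^3: F2 is orthogonal to e in the weighted product, and x
    D x paired with x h x = x^2 k x supplies the second term.\<close>
  have ev: "\<forall>\<^sub>F x in R. inner (weight p (F3 + J x)) e + inner (weight p (D x)) (k x) = 0"
    using good' pos sol[folded R_def w_def]
  proof eventually_elim
    case (elim x)
    have lw: "linear (weight p)" by (rule linear_weight)
    have D': "force_deriv (mass p) (lamf p) ((w + x *\<^sub>R e) + \<theta> x *\<^sub>R (x *\<^sub>R h x)) e = x *\<^sub>R D x"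
      using elim(2) e(2) by (simp add: D_def Pw algebra_simps)
    have q: "(w + x *\<^sub>R e) + x *\<^sub>R h x = w + x *\<^sub>R (e + h x)" by (simp add: algebra_simps)
    have "0 = inner (weight p (pforce p (w + x *\<^sub>R e))) e + inner (weight p (x *\<^sub>R D x)) (x *\<^sub>R h x)"
      using elim(1) unfolding good_def D' q elim(3) by (simp add: linear_0[OF lw])
    also have "\<dots> = x ^ 3 * (inner (weight p (F3 + J x)) e + inner (weight p (D x)) (k x))"
      unfolding line[OF elim(2)] hk[OF elim(2)] linear_add[OF lw, of "x\<^sup>2 *\<^sub>R F2"] linear_scale[OF lw]
      using F2e by (simp add: inner_add_left power3_eq_cube algebra_simps)
    finally show ?case using elim(2) by simp
  qed
  have "((\<lambda>x. inner (weight p (F3 + J x)) e + inner (weight p (D x)) (k x)) \<longlongrightarrow>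
      inner (weight p (F3 + 0)) e + inner (weight p (2 *\<^sub>R F2)) \<eta>) R"
    by (intro tendsto_intros bounded_linear.tendsto[OF bl] J D k)
  moreover have "((\<lambda>x. inner (weight p (F3 + J x)) e + inner (weight p (D x)) (k x)) \<longlongrightarrow> 0) R"
    using tendsto_eventually[OF ev] .
  ultimately have "inner (weight p F3) e + inner (weight p (2 *\<^sub>R F2)) \<eta> = 0"
    using tendsto_unique[OF R] by (metis (no_types, lifting) add_0_right)
  moreover have "inner (weight p (2 *\<^sub>R F2)) \<eta> = 12 * (snd p * (a * a2) + m2 p * (b * b2))"
    by (simp add: F2(1) upos_scale weight_upos \<eta>_def inner_upos algebra_simps)
  moreover have "0 < F3 $ 1 $ 1 + m2 p * (y * tan7 (F3 $ 7)) + 2 * (a * a2 + m2 p * (b * b2))"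
  proof -
    have t: "b1_det (fst p, 1) = 0" "fst p > 0" using b1 p by (cases p, simp add: quadrant_def)+
    show ?thesis
      using quartic_positive[OF p(2) b1_det_root[OF t] y, of a b] ab F2(2,3)
      unfolding A F3_def F2_def e(1) w_def by simp
  qed
  ultimately show False using inner_weight_force3[of p y] p(2) unfolding F3_def e(1) w_def by simp
qed

section \<open>Global bifurcation\<close>

text \<open>Force and Hessian are linear in the parameter, so dividing by m1 changes neither their
  zeros nor the kernel slope y.\<close>

lemma branch_not_vertical:
  assumes p: "p \<in> quadrant" and b1: "b1_det p = 0"
    and y: "entry neg_rad11 p + entry neg_rad12 p * y = 0"
    and e: "e = uneg 1 0 0 y" "phess p e = 0"
    and inj: "\<And>\<eta>. \<eta> \<in> tri_ref \<Longrightarrow> inner e \<eta> = 0 \<Longrightarrow> phess p \<eta> = 0 \<Longrightarrow> \<eta> = 0"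
    and h: "(h \<longlongrightarrow> 0) (at_right 0)" and hV: "\<forall>\<^sub>F x in at_right 0. h x \<in> tri_ref \<and> inner e (h x) = 0"
    and sol: "\<forall>\<^sub>F x in at_right 0. pforce p (rosette p + x *\<^sub>R (e + h x)) = 0"
  shows False
proof -
  define s where "s = 1 / snd p"
  define p' where "p' = s *\<^sub>R p"
  have s: "s > 0" using p by (auto simp: s_def quadrant_def)
  have p': "p' \<in> quadrant" "snd p' = 1"
    using p s by (auto simp: p'_def s_def quadrant_def)
  have m: "m2 p' = s * m2 p" "lamf p' = s * lamf p"
    using m2_linear[of p'] m2_linear[of p] lamf_linear[of p'] lamf_linear[of p] by (simp_all add: p'_def algebra_simps)
  have F: "pforce p' q = s *\<^sub>R pforce p q" for q
    using pforce_linear[of p' q] pforce_linear[of p q] by (simp add: p'_def scaleR_add_right)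
  have H: "phess p' v = s *\<^sub>R phess p v" for v unfolding p'_def by (rule phess_scale)
  have y': "entry neg_rad11 p' + entry neg_rad12 p' * y = 0"
  proof -
    have "entry neg_rad11 p' + entry neg_rad12 p' * y =
      s * (entry neg_rad11 p + entry neg_rad12 p * y)"
      unfolding m neg_rad11_def neg_rad12_def by (simp add: p'_def algebra_simps)
    then show ?thesis using y by simp
  qed
  show False
  proof (rule branch_not_vertical_normalized[OF p' _ y' e(1) _ _ h hV])
    show "b1_det p' = 0" unfolding p'_def b1_det_scale using b1 by simp
    show "phess p' e = 0" using e(2) by (simp add: H)
    show "\<eta> = 0" if "\<eta> \<in> tri_ref" "inner e \<eta> = 0" "phess p' \<eta> = 0" for \<eta>
      using inj[OF that(1,2)] that(3) s by (simp add: H)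
    show "\<forall>\<^sub>F x in at_right 0. pforce p' (rosette p' + x *\<^sub>R (e + h x)) = 0"
      using sol by (simp add: F rosette_const[of p' p])
  qed
qed

text \<open>The zero of \<open>b1_det\<close> is simple and \<open>free_det\<close> stays nonzero
  nearby, so on a short segment in direction m0 only the point p is degenerate.\<close>

lemma cp_coeff_near:
  assumes p: "p \<in> quadrant" and f: "free_basis n f" and b1: "b1_det p = 0" and fd: "free_det n f p \<noteq> 0"
  obtains \<delta> where "\<delta> > 0" "\<delta> \<le> fst p" "\<And>t. t \<noteq> 0 \<Longrightarrow> \<bar>t\<bar> < \<delta> \<Longrightarrow> cp_coeff 25 (p + (t, 0)) \<noteq> 0"
proof -
  obtain \<alpha> \<beta> \<gamma> where abc: "\<alpha> > 0" "\<gamma> < 0"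
    and Q: "\<And>p. b1_det p = \<alpha> * (fst p)\<^sup>2 + \<beta> * (fst p * snd p) + \<gamma> * (snd p)\<^sup>2"
    using b1_det_quadratic by metis
  have pp: "fst p > 0" "snd p > 0" using p by (auto simp: quadrant_def)
  define c where "c = 2 * \<alpha> * fst p + \<beta> * snd p"
  have "fst p * c = \<alpha> * (fst p)\<^sup>2 - \<gamma> * (snd p)\<^sup>2 + b1_det p"
    unfolding Q c_def by (simp add: algebra_simps power2_eq_square)
  moreover have "\<alpha> * (fst p)\<^sup>2 > 0" "\<gamma> * (snd p)\<^sup>2 < 0" using abc pp by (simp_all add: mult_neg_pos)
  ultimately have "fst p * c > 0" using b1 by linarith
  then have c: "c > 0" using pp by (simp add: zero_less_mult_iff)
  have b1t: "b1_det (p + (t, 0)) = t * (c + \<alpha> * t)" for t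
  proof -
    have "b1_det (p + (t, 0)) = b1_det p + t * (c + \<alpha> * t)"
      unfolding Q c_def by (simp add: algebra_simps power2_eq_square)
    then show ?thesis using b1 by simp
  qed
  obtain P where P: "\<And>t. free_det n f (p + (t, 0)) = poly P t" using free_det_poly by blast
  have "poly P 0 \<noteq> 0" using P[of 0] fd by (simp add: zero_prod_def[symmetric])
  moreover have "isCont (poly P) 0" by simp
  ultimately obtain r where r: "r > 0" "\<And>t. \<bar>t\<bar> < r \<Longrightarrow> poly P t \<noteq> 0"
    using continuous_at_avoid[of 0 "poly P" 0] by (auto simp: dist_real_def)
  define \<delta> where "\<delta> = min r (min (fst p) (c / \<alpha>))"
  show thesis
  proof (rule that[of \<delta>])
    show "\<delta> > 0" "\<delta> \<le> fst p" using r c abc pp by (auto simp: \<delta>_def)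
    fix t assume t: "t \<noteq> 0" "\<bar>t\<bar> < \<delta>"
    then have "\<bar>t\<bar> < c / \<alpha>" "\<bar>t\<bar> < r" "\<bar>t\<bar> < fst p" by (auto simp: \<delta>_def)
    then have "\<alpha> * \<bar>t\<bar> < c" using abc by (simp add: field_simps)
    moreover have "- (\<alpha> * t) \<le> \<alpha> * \<bar>t\<bar>" using abc mult_left_mono[of "- t" "\<bar>t\<bar>" \<alpha>] by simp
    ultimately have "c + \<alpha> * t > 0" by linarith
    then have "b1_det (p + (t, 0)) \<noteq> 0" using t by (simp add: b1t)
    moreover have "p + (t, 0) \<in> quadrant" using p \<open>\<bar>t\<bar> < fst p\<close> by (cases p) (auto simp: quadrant_def)
    moreover have "free_det n f (p + (t, 0)) \<noteq> 0" using r(2) \<open>\<bar>t\<bar> < r\<close> by (simp add: P)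
    ultimately show "cp_coeff 25 (p + (t, 0)) \<noteq> 0"
      using cp_unit_nonzero[OF f] by (simp add: cp_coeff_cp_unit[OF f])
  qed
qed

lemma connected_SO2_orbit: "connected (SO2_orbit q)"
proof -
  have "SO2_orbit q = (\<lambda>t. cos t *\<^sub>R q + sin t *\<^sub>R Jrot q) ` UNIV"
  proof (intro equalityI subsetI)
    fix x assume "x \<in> SO2_orbit q"
    then obtain c s where x: "x = c *\<^sub>R q + s *\<^sub>R Jrot q" "c\<^sup>2 + s\<^sup>2 = 1"
      unfolding SO2_orbit_eq turn_def by blast
    obtain t where "c = cos t" "s = sin t" using sincos_total_2pi[OF x(2)] by metis
    then show "x \<in> (\<lambda>t. cos t *\<^sub>R q + sin t *\<^sub>R Jrot q) ` UNIV" using x(1) by blast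
  next
    fix x assume "x \<in> (\<lambda>t. cos t *\<^sub>R q + sin t *\<^sub>R Jrot q) ` UNIV"
    then obtain t where "x = cos t *\<^sub>R q + sin t *\<^sub>R Jrot q" by blast
    moreover have "(cos t)\<^sup>2 + (sin t)\<^sup>2 = 1" by simp
    ultimately show "x \<in> SO2_orbit q" unfolding SO2_orbit_eq turn_def by blast
  qed
  moreover have "connected ((\<lambda>t. cos t *\<^sub>R q + sin t *\<^sub>R Jrot q) ` UNIV)"
    by (intro connected_continuous_image continuous_intros connected_UNIV)
  ultimately show ?thesis by simp
qed

text \<open>The minimum of the compact set where the modulus equals b; the intermediate value
  theorem excludes larger values before it.\<close>

lemma first_hitting:
  fixes \<tau> :: "real \<Rightarrow> real"
  assumes c: "continuous_on {0..a} \<tau>" and a: "a > 0" and 0: "\<tau> 0 = 0" and b: "b > 0" "\<bar>\<tau> a\<bar> = b"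
  obtains x1 where "0 < x1" "x1 \<le> a" "\<bar>\<tau> x1\<bar> = b" "\<And>x. x \<in> {0..<x1} \<Longrightarrow> \<bar>\<tau> x\<bar> < b"
proof -
  define S where "S = {x \<in> {0..a}. \<bar>\<tau> x\<bar> = b}"
  have abs: "continuous_on {0..a} (\<lambda>x. \<bar>\<tau> x\<bar>)" using c by (intro continuous_intros)
  have "closed S" unfolding S_def
    using continuous_closed_preimage[OF abs closed_atLeastAtMost, of "{b}"] by (simp add: vimage_def Int_def)
  moreover have "bounded S" by (rule bounded_subset[OF bounded_closed_interval[of 0 a]]) (auto simp: S_def)
  ultimately have "compact S" by (simp add: compact_eq_bounded_closed)
  moreover have "a \<in> S" using a b by (simp add: S_def)
  ultimately obtain x1 where x1: "x1 \<in> S" "\<And>x. x \<in> S \<Longrightarrow> x1 \<le> x"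
    using compact_attains_inf[of S] by blast
  show thesis
  proof (rule that[of x1])
    have "x1 \<noteq> 0" using x1(1) 0 b by (auto simp: S_def)
    then show "0 < x1" using x1(1) by (simp add: S_def)
    show "x1 \<le> a" "\<bar>\<tau> x1\<bar> = b" using x1(1) by (auto simp: S_def)
    fix x assume x: "x \<in> {0..<x1}"
    show "\<bar>\<tau> x\<bar> < b"
    proof (rule ccontr)
      assume "\<not> \<bar>\<tau> x\<bar> < b"
      then have "b \<le> \<bar>\<tau> x\<bar>" by simp
      have xa: "x \<le> a" using x \<open>x1 \<le> a\<close> by simp
      have "continuous_on {0..x} (\<lambda>x. \<bar>\<tau> x\<bar>)" using abs by (rule continuous_on_subset) (use xa in auto)
      then obtain z where "0 \<le> z" "z \<le> x" "\<bar>\<tau> z\<bar> = b"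
        using IVT'[of "\<lambda>x. \<bar>\<tau> x\<bar>" 0 b x] 0 b(1) \<open>b \<le> \<bar>\<tau> x\<bar>\<close> x by auto
      then have "z \<in> S" using xa by (simp add: S_def)
      from x1(2)[OF this] show False using \<open>z \<le> x\<close> x by simp
    qed
  qed
qed

lemma b1_kernel_GLOB:
  assumes p: "p \<in> quadrant" and f: "free_basis n f" and b1: "b1_det p = 0" and fd: "free_det n f p \<noteq> 0"
  shows "p \<in> GLOB"
proof -
  obtain y where y: "entry neg_rad11 p + entry neg_rad12 p * y = 0"
    and e: "phess p (uneg 1 0 0 y) = 0" "uneg 1 0 0 y \<in> tri_ref" "uneg 1 0 0 y \<noteq> 0"
    and inj: "\<And>\<eta> s. \<eta> \<in> tri_ref \<Longrightarrow> inner (uneg 1 0 0 y) \<eta> = 0 \<Longrightarrow>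
      phess p \<eta> + s *\<^sub>R phess (1, 0) (uneg 1 0 0 y) = 0 \<Longrightarrow> \<eta> = 0 \<and> s = 0"
    using b1_kernel[OF p b1] by metis
  define v where "v = uneg 1 0 0 y"
  obtain a :: real and h \<tau> where a: "a > 0" "continuous_on {0..a} h" "continuous_on {0..a} \<tau>"
    "h 0 = 0" "\<tau> 0 = (0::real)"
    and hV: "\<And>x. x \<in> {0..a} \<Longrightarrow> h x \<in> tri_ref \<and> inner v (h x) = 0"
    and br: "\<And>x. x \<in> {0..a} \<Longrightarrow> p + (\<tau> x, 0) \<in> quadrant"
    "\<And>x. x \<in> {0..a} \<Longrightarrow> rosette p + x *\<^sub>R (v + h x) \<in> Omega"
    "\<And>x. x \<in> {0..a} \<Longrightarrow> pforce (p + (\<tau> x, 0)) (rosette p + x *\<^sub>R (v + h x)) = 0"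
    "\<And>x. x \<in> {0<..a} \<Longrightarrow> rosette p + x *\<^sub>R (v + h x) \<notin> SO2_orbit (rosette p)"
    unfolding v_def by (rule bifurcation_branch[OF p tri_ref_invariant e(2,3,1) inj]) blast+
  obtain \<delta> where \<delta>: "\<delta> > 0" "\<delta> \<le> fst p" "\<And>t. t \<noteq> 0 \<Longrightarrow> \<bar>t\<bar> < \<delta> \<Longrightarrow> cp_coeff 25 (p + (t, 0)) \<noteq> 0"
    using cp_coeff_near[OF p f b1 fd] by blast
  obtain r where r: "r > 0" "\<And>x. x \<in> {0..a} \<Longrightarrow> \<bar>x\<bar> < r \<Longrightarrow> \<bar>\<tau> x\<bar> < \<delta>"
  proof -
    have "0 \<in> {0..a}" using a(1) by simp
    then obtain r where "r > 0" "\<And>x. x \<in> {0..a} \<Longrightarrow> dist x 0 < r \<Longrightarrow> dist (\<tau> x) (\<tau> 0) < \<delta>"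
      using a(3) \<delta>(1) unfolding continuous_on_iff by metis
    then show thesis using that[of r] by (simp add: a(5) dist_real_def)
  qed
  \<comment> \<open>Were \<tau> zero throughout a right neighbourhood of 0, the branch would solve
    the equation at the fixed parameter p, which \<open>branch_not_vertical\<close>
    excludes.\<close>
  obtain x0 where x0: "0 < x0" "x0 < a" "x0 < r" "\<tau> x0 \<noteq> 0"
  proof (rule ccontr)
    assume "\<not> thesis"
    then have vert: "\<tau> x = 0" if "0 < x" "x < a" "x < r" for x using that \<open>\<And>x0. \<lbrakk>0 < x0; x0 < a; x0 < r; \<tau> x0 \<noteq> 0\<rbrakk> \<Longrightarrow> thesis\<close> by blast
    have ev: "\<forall>\<^sub>F x in at_right 0. 0 < x \<and> x < a \<and> x < r"
      unfolding eventually_at_right_field using a(1) r(1) by (intro exI[of _ "min a r"]) auto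
    show False
    proof (rule branch_not_vertical[OF p b1 y v_def])
      show "phess p v = 0" using e(1) by (simp add: v_def)
      show "\<eta> = 0" if "\<eta> \<in> tri_ref" "inner v \<eta> = 0" "phess p \<eta> = 0" for \<eta>
        using inj[of \<eta> 0] that by (simp add: v_def)
      have "(h \<longlongrightarrow> h 0) (at 0 within {0..a})" using a(1,2) by (simp add: continuous_on_def)
      then show "(h \<longlongrightarrow> 0) (at_right 0)" using a(1,4) by (simp add: at_within_Icc_at_right)
      show "\<forall>\<^sub>F x in at_right 0. h x \<in> tri_ref \<and> inner v (h x) = 0"
        using ev by (rule eventually_mono) (use hV in auto)
      show "\<forall>\<^sub>F x in at_right 0. pforce p (rosette p + x *\<^sub>R (v + h x)) = 0"
        using ev
      proof (rule eventually_mono)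
        fix x assume x: "0 < x \<and> x < a \<and> x < r"
        then have "\<tau> x = 0" using vert by blast
        then show "pforce p (rosette p + x *\<^sub>R (v + h x)) = 0"
          using br(3)[of x] x by (simp add: zero_prod_def[symmetric])
      qed
    qed
  qed
  \<comment> \<open>The open interval J will end exactly at a value reached by the modulus of
    \<tau>: before the first hitting time x1 the branch stays over J, and at x1 it is over an
    endpoint.\<close>
  define b where "b = \<bar>\<tau> x0\<bar>"
  have b: "b > 0" "b < \<delta>" using x0 r(2)[of x0] by (auto simp: b_def)
  have sub: "{0..x0} \<subseteq> {0..a}" using x0 by auto
  obtain x1 where x1: "0 < x1" "x1 \<le> x0" "\<bar>\<tau> x1\<bar> = b" "\<And>x. x \<in> {0..<x1} \<Longrightarrow> \<bar>\<tau> x\<bar> < b"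
    using first_hitting[OF continuous_on_subset[OF a(3) sub] x0(1) a(5) b(1)] b_def by metis
  define J where "J = {- b<..<b}"
  define \<sigma> where "\<sigma> = shift_segment p"
  have seg: "segment_family \<sigma> J"
    unfolding \<sigma>_def J_def using p by (rule shift_segment_family) (use b \<delta> in simp)
  have \<sigma>0: "\<sigma> 0 = p" by (simp add: \<sigma>_def shift_segment_eq zero_prod_def[symmetric])
  define w where "w = rosette p"
  define c where "c x = (w + x *\<^sub>R (v + h x), \<tau> x)" for x
  have cc: "continuous_on {0..x1} c"
    unfolding c_def using x0 x1 by (intro continuous_intros continuous_on_subset[OF a(2)] continuous_on_subset[OF a(3)]) auto
  define T where "T = trivial_set \<sigma> {0}"
  have T: "T = SO2_orbit w \<times> {0}" by (simp add: T_def trivial_set_def \<sigma>0 w_def)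
  define X where "X = closure (nontrivial_set \<sigma> J) \<inter> (Omega \<times> J) \<union> T"
  have XJ: "snd z \<in> J" if "z \<in> X" for z using that b by (auto simp: X_def T J_def)
  have wT: "(w, 0) \<in> T" by (simp add: T w_def rosette_orbit_refl)
  define K where "K = connected_component_set X (w, 0)"
  have KX: "K \<subseteq> X" unfolding K_def by (rule connected_component_subset)
  have K: "K \<in> components X" using wT by (auto simp: K_def X_def components_def)
  \<comment> \<open>The orbit is connected, so the component of one of its points contains all of
    it.\<close>
  have TK: "T \<subseteq> K"
    unfolding K_def by (rule connected_component_maximal[OF wT])
      (auto simp: T X_def intro!: connected_Times connected_SO2_orbit)
  have cX: "c x \<in> X" if x: "x \<in> {0..<x1}" for x
  proof (cases "x = 0")
    case True
    then show ?thesis using wT by (simp add: c_def a X_def)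
  next
    case False
    then have x': "x \<in> {0..a}" "x \<in> {0<..a}" using x x1 x0 by auto
    have tJ: "\<tau> x \<in> J" using x1(4)[OF x] by (auto simp: J_def)
    have "c x \<in> nontrivial_set \<sigma> J"
      unfolding c_def \<sigma>_def w_def
      by (rule branch_nontrivial[OF br(1)[OF x'(1)] br(2)[OF x'(1)] br(3)[OF x'(1)] br(4)[OF x'(2)] tJ])
    moreover have "c x \<in> Omega \<times> J" using br(2)[OF x'(1)] tJ by (simp add: c_def w_def)
    ultimately show ?thesis using closure_subset by (auto simp: X_def)
  qed
  have cK: "c ` {0..<x1} \<subseteq> K"
    unfolding K_def
  proof (rule connected_component_maximal)
    have "c 0 = (w, 0)" by (simp add: c_def a)
    then show "(w, 0) \<in> c ` {0..<x1}" using x1(1) by (metis atLeastLessThan_iff imageI order_refl)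
    show "connected (c ` {0..<x1})"
      by (rule connected_continuous_image) (auto intro: continuous_on_subset[OF cc])
    show "c ` {0..<x1} \<subseteq> X" using cX by blast
  qed
  \<comment> \<open>A compact K would contain the limit c x1 of the branch, whose parameter is b or
    -b and hence outside J.\<close>
  have "\<not> compact K"
  proof
    assume "compact K"
    then have cl: "closed K" by (rule compact_imp_closed)
    have "closure {0..<x1} = {0..x1}" using x1(1) by (simp add: closure_atLeastLessThan)
    then have "c ` {0..x1} \<subseteq> K"
      using continuous_image_closure_subset[of "{0..<x1}" c] cc image_closure_subset[of "{0..<x1}" c K] cl cK by metis
    moreover have "x1 \<in> {0..x1}" using x1(1) by simp
    ultimately have "c x1 \<in> X" using KX by blast
    from XJ[OF this] show False using x1(3) by (auto simp: c_def J_def)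
  qed
  \<comment> \<open>Since b < \<delta>, the parameter 0 is the only degenerate one in J, so -b/2 and
    b/2 may serve as the ends of the reference segment.\<close>
  have nl: "\<not> local_bif \<sigma> J t" if "t \<noteq> 0" "\<bar>t\<bar> < b" for t
  proof (rule not_local_bif[of \<sigma> p "(1, 0)"])
    show "\<sigma> \<rho> = p + \<rho> *\<^sub>R (1, 0)" for \<rho> by (simp add: \<sigma>_def shift_segment_def)
    show "\<sigma> ` J \<subseteq> quadrant" using seg by (simp add: segment_family_def)
    show "t \<in> J" using that by (auto simp: J_def)
    show "cp_coeff 25 (\<sigma> t) \<noteq> 0" using \<delta>(3)[of t] that b by (simp add: \<sigma>_def shift_segment_eq)
  qed
  have "global_bif \<sigma> J (- b / 2) (b / 2) 0"
    unfolding global_bif_def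
  proof (intro conjI bexI[of _ K])
    show "\<not> local_bif \<sigma> J (- b / 2)" "\<not> local_bif \<sigma> J (b / 2)" using b by (intro nl; simp)+
    show "{- b / 2..b / 2} \<subseteq> J" using b by (auto simp: J_def)
    show "trivial_set \<sigma> {0} \<subseteq> K" using TK by (simp add: T_def)
    show "K \<in> components (closure (nontrivial_set \<sigma> J) \<inter> (Omega \<times> J) \<union> trivial_set \<sigma> {0})"
      using K by (simp add: X_def T_def)
  qed (use b \<open>\<not> compact K\<close> in auto)
  then show ?thesis unfolding GLOB_def using p seg \<sigma>0 by (metis (mono_tags, lifting) mem_Collect_eq)
qed

theorem theorem4p2:
  fixes C0 :: "real poly poly" and C :: "nat \<Rightarrow> real poly poly" and m0 m1 :: real
  assumes "a25_factorization C0 C"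
    and "(m0, m1) \<in> quadrant"
  shows "(\<forall>i\<in>{1, 2, 3}. bipoly (C i) (m0, m1) = 0 \<longrightarrow> (m0, m1) \<in> BIF) \<and>
    (bipoly (C 2) (m0, m1) = 0 \<longrightarrow> (m0, m1) \<in> GLOB)"
proof -
  obtain n f where f: "free_basis n f" using free_basis_exists by blast
  define p where "p = (m0, m1)"
  have p: "p \<in> quadrant" using assms(2) by (simp add: p_def)
  have zero: "cp_coeff 25 p = 0" if "i \<in> {1, 2, 3}" "bipoly (C i) p = 0" for i
  proof -
    have "cp_coeff 25 p = bipoly C0 p * (bipoly (C 1) p)\<^sup>2 * bipoly (C 2) p * (bipoly (C 3) p)\<^sup>2"
      using assms(1) p unfolding a25_factorization_def by blast
    then show ?thesis using that by auto
  qed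
  have dich: "b1_det p = 0 \<and> free_det n f p \<noteq> 0 \<or> b1_det p \<noteq> 0 \<and> simple_free n f p \<and> bipoly (C 2) p \<noteq> 0"
    if "cp_coeff 25 p = 0" using order_dichotomy[OF assms(1) p f that] .
  have "p \<in> BIF" if "i \<in> {1, 2, 3}" "bipoly (C i) p = 0" for i
    using dich[OF zero[OF that]] b1_kernel_BIF[OF p] free_kernel_BIF[OF f p] by blast
  moreover have "p \<in> GLOB" if "bipoly (C 2) p = 0"
    using dich[OF zero[of 2]] that b1_kernel_GLOB[OF p f] by auto
  ultimately show ?thesis unfolding p_def by blast
qed

end
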